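(* Let $\mathcal{A}\subset\mathbb{R}_{>0}$ be a discrete set (i.e. a set with no accumulation point in $\mathbb{R}$) such that \[ \limsup_{x\to\infty} \frac{1}{\log x} \sum_{\alpha\in\mathcal{A}\cap[1,x]} \frac{1}{\alpha}>0 . \] Then, for every $\varepsilon>0$, there exists a pair $(\alpha, \beta)\in \mathcal{A}^2$ such that $\alpha\neq \beta$ and $|n\alpha-\beta| <\varepsilon$ for some positive integer $n$. *)

theory Defs
  imports "HOL-Analysis.Analysis"
begin

end

(*
  Suppose that, after rescaling, |n \<alpha> - \<beta>| >= 1 for all distinct \<alpha>, \<beta> in A and all n > 0. Take a finite
  part S of A, made of many blocks lying in widely spaced ranges, and put an interval of length c around
  every multiple n \<alpha> <= X with \<alpha> in S and n free of primes up to z(\<alpha>), where z(\<alpha>) is about the square of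
  the right end of the block. They avoid the unit intervals centred at the elements of A - S, which are
  disjoint, so they live on a set of measure about X - |(A - S) \<inter> [1, X]|. If their pairwise overlaps add up to
  at most (1 + O(\<eta>)) times the value for independent positions, Cauchy-Schwarz gives
  |(A - S) \<inter> [1, X]| <= O(\<eta>) X + O(1), against the assumed logarithmic density of A.

  The overlap of the multiples of \<alpha> and of \<beta> is computed pair by pair. If \<alpha> / \<beta> is irrational, the
  positions are independent. If \<alpha> = q a and \<beta> = q b with a, b coprime, then n \<alpha> - m \<beta> = q h for an integer
  h; the sieve kills h = 0, and the sum over h <> 0 has the expected size unless either q lies in a band
  just below c (a "band pair"), or a b is divisible by many primes exceeding log (c / q) (a "bad pair").

  Bad pairs are rare in the sense of logarithmic density. This is an anatomy statement about pairs with
  large gcd, proved with the compression argument of GCD graphs (Koukoulopoulos and Maynard): as long as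
  fixing the exponent of some prime on both sides increases a weighted quality, do so; when no prime
  improves the quality, each prime has one dominating exponent and the pairs can be counted directly.

  Band pairs are handled by the choice of c: among scales c_0 > c_1 > ... with disjoint bands, band k
  costs a factor ln (y_k) with y_k = 2^k y_0, and since the sum of 1 / ln (y_k) diverges, some scale
  carries few band pairs.
*)

theory Submission
  imports Defs "HOL-Computational_Algebra.Primes" "HOL-Real_Asymp.Real_Asymp"
begin

section \<open>Primes and Mertens products\<close>

text \<open>The obstacle is the size of the unit q of a commensurable pair relative to c. For q >= c
  two intervals overlap only if n \<alpha> = m \<beta>. For q far below c there are so many
  differences h that the residues modulo small primes average out. In between only a bound exceeding
  the expected value by a logarithmic factor is used, and it has to be paid for by rarity. Bad pairs
  at level H cost ln (H + 1) but have proportion O(exp (- H)), so the sum over H converges and its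
  tail is small; for the band there is no such decay, which is why many scales compete.

  Sieving serves twice. Besides removing the coincidences n \<alpha> = m \<beta>, by Mertens it
  costs a factor of order 1 / ln x on a block ending at x, which is what the reciprocals in the
  block gain. So every block has weight bounded below, and enough blocks make the total weight \<mu>
  so large that the diagonal term c \<mu> is negligible against (c \<mu>)^2. The additive errors may
  depend on S in any way, because S is fixed before X grows.\<close>

definition primes_le :: "nat \<Rightarrow> nat set" where
  "primes_le n = {p. prime p \<and> p \<le> n}"

definition mertens_prod :: "nat \<Rightarrow> real" where
  "mertens_prod n = (\<Prod>p\<in>primes_le n. 1 - 1 / real p)"

lemma finite_primes_le [simp]: "finite (primes_le n)"
  unfolding primes_le_def by (rule finite_subset[of _ "{..n}"]) auto

lemma prime_of_primes_le [dest]: "p \<in> primes_le n \<Longrightarrow> prime p"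
  by (simp add: primes_le_def)

lemma primes_le_mono: "m \<le> n \<Longrightarrow> primes_le m \<subseteq> primes_le n"
  by (auto simp: primes_le_def)

section \<open>Chebyshev's bound for the primorial and one-sided Mertens estimates\<close>

lemma prod_primes_dvd:
  fixes n :: nat
  assumes "finite S" "\<And>p. p \<in> S \<Longrightarrow> prime p" "\<And>p. p \<in> S \<Longrightarrow> p dvd n"
  shows "\<Prod>S dvd n"
  using assms
proof (induction S)
  case (insert p S)
  have "coprime p (\<Prod>S)"
    using insert.prems insert.hyps
    by (intro prod_coprime_right) (metis insertCI primes_coprime)
  then show ?case
    using insert by (simp add: divides_mult)
qed simp

text \<open>The two equal middle entries of an odd row of Pascal's triangle add up to at most the
  row sum 2 * 4^m.\<close>

lemma binomial_odd_middle_le: "(2 * m + 1) choose m \<le> 4 ^ m"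
proof -
  have "2 * ((2 * m + 1) choose m) = ((2 * m + 1) choose m) + ((2 * m + 1) choose (m + 1))"
    using binomial_symmetric[of m "2 * m + 1"] by simp
  also have "\<dots> = (\<Sum>k\<in>{m, m + 1}. (2 * m + 1) choose k)" by simp
  also have "\<dots> \<le> (\<Sum>k\<le>2 * m + 1. (2 * m + 1) choose k)"
    by (rule sum_mono2) auto
  also have "\<dots> = 2 * 4 ^ m"
    by (simp only: choose_row_sum power_add power_mult) simp
  finally show ?thesis by simp
qed

text \<open>Erdos' argument: for n = 2 m + 1 the primes in (m + 1, n] all divide one binomial
  coefficient, which is at most 4^m, and the smaller primes are covered by induction; an even n > 2
  adds no prime.\<close>

lemma primorial_le: "\<Prod>(primes_le n) \<le> 4 ^ n"
proof (induction n rule: less_induct)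
  case (less n)
  consider "n \<le> 2" | "n > 2" "even n" | "n > 2" "odd n" by linarith
  then show ?case
  proof cases
    case 1
    have "primes_le 0 = {}" "primes_le 1 = {}" "primes_le 2 = {2}"
      by (auto simp: primes_le_def dest: prime_ge_2_nat intro: antisym)
    moreover have "n \<in> {0, 1, 2}" using 1 by auto
    ultimately show ?thesis by auto
  next
    case 2
    then have "\<not> prime n" using primes_dvd_imp_eq two_is_prime_nat by blast
    then have "prime p \<and> p \<le> n \<longleftrightarrow> prime p \<and> p \<le> n - 1" for p by (cases "p = n") auto
    then have "primes_le n = primes_le (n - 1)" by (simp add: primes_le_def)
    then have "\<Prod>(primes_le n) = \<Prod>(primes_le (n - 1))" by (rule arg_cong)
    also have "\<dots> \<le> 4 ^ (n - 1)" using 2 less by simp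
    also have "(4::nat) ^ (n - 1) \<le> 4 ^ n" by (rule power_increasing) auto
    finally show ?thesis .
  next
    case 3
    then obtain m where m: "n = 2 * m + 1" by (elim oddE) 
    have m1: "m \<ge> 1" using 3 m by simp
    define T where "T = {p. prime p \<and> m + 1 < p \<and> p \<le> n}"
    have fT: "finite T" unfolding T_def by (rule finite_subset[of _ "{..n}"]) auto
    have split: "primes_le n = primes_le (m + 1) \<union> T" "primes_le (m + 1) \<inter> T = {}"
      using m by (auto simp: primes_le_def T_def)
    have "\<Prod>T dvd (n choose m)"
    proof (rule prod_primes_dvd[OF fT])
      fix p assume p: "p \<in> T"
      then show "prime p" by (simp add: T_def)
      have "fact n = fact m * fact (n - m) * (n choose m)"
        using binomial_fact_lemma[of m n] m by simp
      moreover have "p dvd fact n" using p by (simp add: T_def prime_dvd_fact_iff)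
      moreover have "\<not> p dvd fact m" "\<not> p dvd fact (n - m)"
        unfolding prime_dvd_fact_iff[OF \<open>prime p\<close>] using p m by (auto simp: T_def)
      ultimately show "p dvd (n choose m)"
        using \<open>prime p\<close> by (metis prime_dvd_mult_iff)
    qed
    then have "\<Prod>T \<le> n choose m"
      by (rule dvd_imp_le) (use m in simp)
    also have "\<dots> \<le> 4 ^ m" using binomial_odd_middle_le[of m] m by simp
    finally have T: "\<Prod>T \<le> 4 ^ m" .
    have "\<Prod>(primes_le n) = \<Prod>(primes_le (m + 1)) * \<Prod>T"
      using split fT by (simp add: prod.union_disjoint)
    also have "\<dots> \<le> 4 ^ (m + 1) * 4 ^ m"
      using T less[of "m + 1"] m m1 by (intro mult_mono) auto
    also have "\<dots> = 4 ^ n" using m by (simp flip: power_add)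
    finally show ?thesis .
  qed
qed

lemma sum_ln_primes_le: "(\<Sum>p\<in>primes_le n. ln (real p)) \<le> real n * ln 4"
proof -
  have "(\<Sum>p\<in>primes_le n. ln (real p)) = ln (\<Prod>p\<in>primes_le n. real p)"
    by (rule ln_prod[symmetric]) (auto dest!: prime_of_primes_le prime_gt_0_nat)
  also have "\<dots> = ln (real (\<Prod>(primes_le n)))" by simp
  also have "\<dots> \<le> ln (real (4 ^ n))"
  proof (rule ln_mono)
    show "real (\<Prod>(primes_le n)) \<le> real (4 ^ n)" using primorial_le of_nat_le_iff by blast
    show "0 < real (\<Prod>(primes_le n))"
      by (auto intro!: prod_pos dest!: prime_of_primes_le prime_gt_0_nat)
  qed 
  also have "\<dots> = real n * ln 4" by (simp add: ln_realpow)
  finally show ?thesis .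
qed

lemma sum_ln_prime_divisors_le:
  fixes m :: nat
  assumes "m > 0"
  shows "(\<Sum>p | prime p \<and> p dvd m. ln (real p)) \<le> ln (real m)"
proof -
  let ?S = "{p. prime p \<and> p dvd m}"
  have fin: "finite ?S" using assms by (intro finite_subset[of ?S "{..m}"]) (auto intro: dvd_imp_le)
  have "(\<Sum>p\<in>?S. ln (real p)) = ln (\<Prod>p\<in>?S. real p)"
    by (rule ln_prod[symmetric]) (use fin in \<open>auto dest!: prime_of_primes_le prime_gt_0_nat\<close>)
  also have "\<dots> = ln (real (\<Prod>?S))" by simp
  also have "\<dots> \<le> ln (real m)"
  proof (rule ln_mono)
    have "\<Prod>?S dvd m" by (rule prod_primes_dvd[OF fin]) auto
    then show "real (\<Prod>?S) \<le> real m" using assms dvd_imp_le of_nat_le_iff by blast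
    show "0 < real (\<Prod>?S)" by (auto intro!: prod_pos dest!: prime_of_primes_le prime_gt_0_nat)
  qed
  finally show ?thesis .
qed

text \<open>Upper half of Mertens' first theorem. Summing ln p over the primes dividing m, for all m
  <= n, counts each prime n div p times and gives at most ln m for each m; replacing n div p by n /
  p costs the sum of ln p, which Chebyshev's bound controls.\<close>

lemma sum_ln_div_primes_le:
  assumes "n \<ge> 1"
  shows "(\<Sum>p\<in>primes_le n. ln (real p) / real p) \<le> ln (real n) + ln 4"
proof -
  have "(\<Sum>p\<in>primes_le n. ln (real p) * (real n / real p - 1))
      \<le> (\<Sum>p\<in>primes_le n. ln (real p) * real (n div p))"
  proof (rule sum_mono)
    fix p assume "p \<in> primes_le n"
    then have p: "prime p" by auto
    have "real n / real p - 1 \<le> real (n div p)"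
    proof -
      have "real n = real p * real (n div p) + real (n mod p)"
        by (metis mult_div_mod_eq of_nat_add of_nat_mult)
      moreover have "real (n mod p) \<le> real p"
        using prime_gt_0_nat[OF p] by (simp add: less_imp_le)
      ultimately have "real n \<le> (real (n div p) + 1) * real p" by (simp add: algebra_simps)
      then show ?thesis using prime_gt_0_nat[OF p] by (simp add: pos_divide_le_eq diff_le_eq)
    qed
    then show "ln (real p) * (real n / real p - 1) \<le> ln (real p) * real (n div p)"
      using prime_ge_1_nat[OF p] by (intro mult_left_mono) auto
  qed
  also have "\<dots> = (\<Sum>p\<in>primes_le n. \<Sum>m | m \<in> {1..n} \<and> p dvd m. ln (real p))"
  proof (rule sum.cong[OF refl])
    fix p assume "p \<in> primes_le n"
    then have p: "p > 0" using prime_gt_0_nat by blast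
    have "{m. m \<in> {1..n} \<and> p dvd m} = (\<lambda>k. p * k) ` {1..n div p}"
    proof (intro equalityI subsetI)
      fix m assume "m \<in> {m. m \<in> {1..n} \<and> p dvd m}"
      then obtain k where k: "m = p * k" "1 \<le> m" "m \<le> n" by auto
      then have "k > 0" "k \<le> n div p"
        using p div_le_mono[of "p * k" n p] by (auto intro: Nat.gr0I)
      with k show "m \<in> (\<lambda>k. p * k) ` {1..n div p}" by auto
    next
      fix m assume "m \<in> (\<lambda>k. p * k) ` {1..n div p}"
      then obtain k where "m = p * k" "k \<in> {1..n div p}" by (rule imageE)
      then have k: "m = p * k" "1 \<le> k" "k \<le> n div p" by simp_all
      have "p * k \<le> p * (n div p)" using k by simp
      also have "\<dots> \<le> n" by simp
      finally show "m \<in> {m. m \<in> {1..n} \<and> p dvd m}" using p k by simp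
    qed
    then have "card {m. m \<in> {1..n} \<and> p dvd m} = n div p"
      using p by (simp add: card_image inj_on_def)
    then show "ln (real p) * real (n div p) = (\<Sum>m | m \<in> {1..n} \<and> p dvd m. ln (real p))"
      by simp
  qed
  also have "\<dots> = (\<Sum>m\<in>{1..n}. \<Sum>p | p \<in> primes_le n \<and> p dvd m. ln (real p))"
    by (rule sum.swap_restrict) auto
  also have "\<dots> \<le> (\<Sum>m\<in>{1..n}. ln (real n))"
  proof (rule sum_mono)
    fix m assume m: "m \<in> {1..n}"
    have "{p. p \<in> primes_le n \<and> p dvd m} = {p. prime p \<and> p dvd m}"
      using m dvd_imp_le[of _ m] by (auto simp: primes_le_def intro: order_trans)
    then have "(\<Sum>p | p \<in> primes_le n \<and> p dvd m. ln (real p)) \<le> ln (real m)"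
      using sum_ln_prime_divisors_le[of m] m by simp
    also have "\<dots> \<le> ln (real n)" using m by simp
    finally show "(\<Sum>p | p \<in> primes_le n \<and> p dvd m. ln (real p)) \<le> ln (real n)" .
  qed
  also have "\<dots> = real n * ln (real n)" by simp
  finally have "(\<Sum>p\<in>primes_le n. ln (real p) * (real n / real p - 1)) \<le> real n * ln (real n)" .
  moreover have "(\<Sum>p\<in>primes_le n. ln (real p) * (real n / real p - 1))
     = real n * (\<Sum>p\<in>primes_le n. ln (real p) / real p) - (\<Sum>p\<in>primes_le n. ln (real p))"
    by (simp add: right_diff_distrib sum_subtractf sum_distrib_left mult.commute)
  ultimately have "real n * (\<Sum>p\<in>primes_le n. ln (real p) / real p) \<le> real n * (ln (real n) + ln 4)"
    using sum_ln_primes_le[of n] by (simp add: distrib_left)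
  then show ?thesis using assms by simp
qed

text \<open>Abel summation: for a decreasing nonnegative weight both sides are nonnegative
  combinations of partial sums. It serves twice, for reciprocals of primes and for reciprocals of a
  set with a bounded counting function.\<close>

lemma weighted_sum_mono_of_partial_sums:
  fixes a b w :: "nat \<Rightarrow> real"
  assumes part: "\<And>n. m \<le> n \<Longrightarrow> (\<Sum>k=m..n. a k) \<le> (\<Sum>k=m..n. b k)"
    and dec: "\<And>k. m \<le> k \<Longrightarrow> w (Suc k) \<le> w k" and pos: "\<And>k. m \<le> k \<Longrightarrow> 0 \<le> w k"
    and "m \<le> n"
  shows "(\<Sum>k=m..n. a k * w k) \<le> (\<Sum>k=m..n. b k * w k)"
proof -
  have abel: "(\<Sum>k=m..n. c k * w k) = (\<Sum>k=m..n. c k) * w n + (\<Sum>j=m..<n. (\<Sum>k=m..j. c k) * (w j - w (Suc j)))"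
    for c :: "nat \<Rightarrow> real"
    using \<open>m \<le> n\<close>
  proof (induction n rule: dec_induct)
    case (step n)
    then show ?case by (simp add: algebra_simps)
  qed simp
  show ?thesis unfolding abel
    by (intro add_mono sum_mono mult_right_mono part pos) (use dec \<open>m \<le> n\<close> in auto)
qed

text \<open>Mertens' second theorem from above: ln p / p is compared with the increments of ln k
  under the weight 1 / ln k.\<close>

lemma sum_inverse_primes_le:
  obtains C where "\<And>n. n \<ge> 2 \<Longrightarrow> (\<Sum>p\<in>primes_le n. 1 / real p) \<le> ln (ln (real n)) + C"
proof -
  define a where "a = (\<lambda>k::nat. if prime k then ln (real k) / real k else 0)"
  \<comment> \<open>The partial sums of \<open>b\<close> are exactly ln n + ln 4, the bound known
    for those of \<open>a\<close>; the first term absorbs the constant.\<close>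
  define b where "b = (\<lambda>k::nat. if k = 2 then ln 2 + ln 4 else ln (real k) - ln (real (k - 1)))"
  have set_eq: "primes_le n = {k \<in> {2..n}. prime k}" for n
    by (auto simp: primes_le_def dest: prime_ge_2_nat)
  have sum_a: "(\<Sum>k=2..n. a k * f k) = (\<Sum>p\<in>primes_le n. ln (real p) / real p * f p)" for n f
    unfolding set_eq by (subst sum.inter_filter) (auto simp: a_def intro!: sum.cong)
  have sum_b: "(\<Sum>k=2..n. b k) = ln (real n) + ln 4" if "n \<ge> 2" for n
    using that
  proof (induction n rule: dec_induct)
    case (step n)
    then show ?case by (simp add: b_def)
  qed (simp add: b_def)
  have "(\<Sum>p\<in>primes_le n. 1 / real p) \<le> ln (ln (real n)) + (3 - ln (ln 2))" if n: "n \<ge> 2" for n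
  proof -
    have "(\<Sum>p\<in>primes_le n. 1 / real p) = (\<Sum>p\<in>primes_le n. ln (real p) / real p * (1 / ln (real p)))"
    proof (rule sum.cong[OF refl])
      fix p assume "p \<in> primes_le n"
      then have "ln (real p) > 0" by (auto dest!: prime_of_primes_le prime_gt_1_nat)
      then show "1 / real p = ln (real p) / real p * (1 / ln (real p))" by simp
    qed
    also have "\<dots> = (\<Sum>k=2..n. a k * (1 / ln (real k)))" by (rule sum_a[symmetric])
    also have "\<dots> \<le> (\<Sum>k=2..n. b k * (1 / ln (real k)))"
    proof (rule weighted_sum_mono_of_partial_sums)
      fix n :: nat assume n: "2 \<le> n"
      show "(\<Sum>k=2..n. a k) \<le> (\<Sum>k=2..n. b k)"
        using sum_a[of "\<lambda>_. 1" n] sum_b[OF n] sum_ln_div_primes_le[of n] n by simp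
    next
      fix k :: nat assume k: "2 \<le> k"
      then show "1 / ln (real (Suc k)) \<le> 1 / ln (real k)"
        by (intro divide_left_mono) auto
      show "0 \<le> 1 / ln (real k)" using k by simp
    qed (use n in auto)
    also have "\<dots> \<le> ln (ln (real n)) + (3 - ln (ln 2))"
      using n
    proof (induction n rule: dec_induct)
      case base
      have "ln (4::real) = 2 * ln 2" using ln_realpow[of 2 2] by simp
      then have "(ln 2 + ln 4) / ln (2::real) = 3" by simp
      then show ?case by (simp add: b_def)
    next
      case (step n)
      define x y where "x = ln (real n)" and "y = ln (real (Suc n))"
      have xy: "0 < x" "x < y" using step by (auto simp: x_def y_def)
      have "ln (x / y) \<le> x / y - 1" by (rule ln_le_minus_one) (use xy in auto)
      then have "ln x - ln y \<le> x / y - 1" using xy by (simp add: ln_div)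
      moreover have "(y - x) / y = 1 - x / y" using xy by (simp add: field_simps)
      ultimately have "(y - x) / y \<le> ln y - ln x" by simp
      moreover have "b (Suc n) = y - x" using step by (simp add: b_def x_def y_def)
      ultimately show ?case using step unfolding x_def y_def by simp
    qed
    finally show ?thesis .
  qed
  then show ?thesis by (rule that)
qed

lemma sum_inverse_squares_le: "(\<Sum>k=2..n. 1 / (real k)\<^sup>2) \<le> 1"
proof -
  have "n \<ge> 1 \<Longrightarrow> (\<Sum>k=2..n. 1 / (real k)\<^sup>2) \<le> 1 - 1 / real n"
  proof (induction n rule: dec_induct)
    case (step n)
    have "1 / (real (Suc n))\<^sup>2 \<le> 1 / real n - 1 / real (Suc n)"
    proof -
      have "1 / real n - 1 / real (Suc n) = 1 / (real n * real (Suc n))" using step by (simp add: field_simps)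
      moreover have "real n * real (Suc n) \<le> (real (Suc n))\<^sup>2" by (simp add: power2_eq_square)
      ultimately show ?thesis using step by (simp add: frac_le)
    qed
    then show ?case using step by simp
  qed simp
  then show ?thesis by (cases "n = 0") (auto intro: order_trans)
qed

lemma mertens_prod_pos: "mertens_prod n > 0"
  unfolding mertens_prod_def by (intro prod_pos) (auto dest!: prime_of_primes_le prime_gt_1_nat)

lemma mertens_prod_le_1: "mertens_prod n \<le> 1"
  unfolding mertens_prod_def by (intro prod_le_1) (auto dest!: prime_of_primes_le prime_gt_1_nat)

text \<open>From 1 - t >= exp (- t - 2 t^2) for 0 <= t <= 1 / 2: the linear part is the sum of 1 /
  p, and the quadratic part contributes only a constant.\<close>

lemma mertens_prod_ge:
  obtains c where "c > 0" "\<And>n. n \<ge> 2 \<Longrightarrow> mertens_prod n \<ge> c / ln (real n)"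
proof -
  obtain C where C: "\<And>n. n \<ge> 2 \<Longrightarrow> (\<Sum>p\<in>primes_le n. 1 / real p) \<le> ln (ln (real n)) + C"
    using sum_inverse_primes_le by blast
  have "mertens_prod n \<ge> exp (- C - 2) / ln (real n)" if n: "n \<ge> 2" for n
  proof -
    have "exp (- (ln (ln (real n)) + C) - 2) \<le> exp (\<Sum>p\<in>primes_le n. - 1 / real p - 2 * (1 / (real p)\<^sup>2))"
    proof -
      have "(\<Sum>p\<in>primes_le n. 1 / (real p)\<^sup>2) \<le> (\<Sum>k=2..n. 1 / (real k)\<^sup>2)"
        by (rule sum_mono2) (auto simp: primes_le_def dest: prime_ge_2_nat)
      then have "(\<Sum>p\<in>primes_le n. 1 / (real p)\<^sup>2) \<le> 1" using sum_inverse_squares_le[of n] by linarith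
      moreover have "(\<Sum>p\<in>primes_le n. - 1 / real p - 2 * (1 / (real p)\<^sup>2))
        = - (\<Sum>p\<in>primes_le n. 1 / real p) - 2 * (\<Sum>p\<in>primes_le n. 1 / (real p)\<^sup>2)"
        by (simp add: sum_subtractf sum_negf sum_distrib_left)
      ultimately show ?thesis using C[OF n] by simp
    qed
    also have "\<dots> = (\<Prod>p\<in>primes_le n. exp (- 1 / real p - 2 * (1 / (real p)\<^sup>2)))"
      by (rule exp_sum) simp
    also have "\<dots> \<le> mertens_prod n"
      unfolding mertens_prod_def
    proof (rule prod_mono, intro conjI)
      fix p assume "p \<in> primes_le n"
      then have p: "real p \<ge> 2" by (auto dest!: prime_of_primes_le prime_ge_2_nat)
      have "- (1 / real p) - 2 * (1 / real p)\<^sup>2 \<le> ln (1 - 1 / real p)"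
        by (rule ln_one_minus_pos_lower_bound) (use p in \<open>auto simp: field_simps\<close>)
      then have "exp (- (1 / real p) - 2 * (1 / real p)\<^sup>2) \<le> exp (ln (1 - 1 / real p))"
        by (simp only: exp_le_cancel_iff)
      also have "\<dots> = 1 - 1 / real p" using p by (subst exp_ln) auto
      finally show "exp (- 1 / real p - 2 * (1 / (real p)\<^sup>2)) \<le> 1 - 1 / real p"
        by (simp add: power_one_over)
    qed simp
    finally have "exp (- (ln (ln (real n)) + C) - 2) \<le> mertens_prod n" .
    moreover have "exp (- (ln (ln (real n)) + C) - 2) = exp (- C - 2) / ln (real n)"
    proof -
      have "exp (- (ln (ln (real n)) + C) - 2) = exp (- C - 2 - ln (ln (real n)))"
        by (simp add: algebra_simps)
      also have "\<dots> = exp (- C - 2) / exp (ln (ln (real n)))" by (rule exp_diff)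
      also have "exp (ln (ln (real n))) = ln (real n)" using n by (intro exp_ln) auto
      finally show ?thesis .
    qed
    ultimately show ?thesis by simp
  qed
  then show ?thesis by (intro that[of "exp (- C - 2)"]) auto
qed

section \<open>The compression step for bipartite graphs\<close>

definition nat_dist :: "nat \<Rightarrow> nat \<Rightarrow> nat" where
  "nat_dist i j = (i - j) + (j - i)"

lemma nat_dist_commute: "nat_dist i j = nat_dist j i"
  by (simp add: nat_dist_def)

lemma nat_dist_self [simp]: "nat_dist i i = 0"
  by (simp add: nat_dist_def)

lemma nat_dist_pos: "i \<noteq> j \<Longrightarrow> nat_dist i j \<ge> 1"
  by (simp add: nat_dist_def)

section \<open>Schur-type bounds for kernels decaying geometrically off the diagonal\<close>

lemma sum_powers_le:
  fixes \<rho> :: real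
  assumes "finite K" "0 \<notin> K" "0 \<le> \<rho>" "\<rho> < 1"
  shows "(\<Sum>k\<in>K. \<rho> ^ k) \<le> \<rho> / (1 - \<rho>)"
proof -
  have "1 + (\<Sum>k\<in>K. \<rho> ^ k) = (\<Sum>k\<in>insert 0 K. \<rho> ^ k)"
    using assms by simp
  also have "\<dots> \<le> (\<Sum>k. \<rho> ^ k)"
    by (rule sum_le_suminf) (use assms in \<open>auto intro: summable_geometric\<close>)
  also have "\<dots> = 1 / (1 - \<rho>)" by (rule suminf_geometric) (use assms in auto)
  finally show ?thesis using assms by (simp add: field_simps)
qed

lemma sum_dist_powers_le:
  fixes \<rho> :: real
  assumes "finite I" "0 \<le> \<rho>" "\<rho> < 1"
  shows "(\<Sum>j\<in>I - {i}. \<rho> ^ nat_dist i j) \<le> 2 * \<rho> / (1 - \<rho>)"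
proof -
  let ?L = "{j \<in> I. j < i}" and ?G = "{j \<in> I. i < j}"
  have "I - {i} = ?L \<union> ?G" by auto
  then have "(\<Sum>j\<in>I - {i}. \<rho> ^ nat_dist i j) = (\<Sum>j\<in>?L. \<rho> ^ (i - j)) + (\<Sum>j\<in>?G. \<rho> ^ (j - i))"
    using assms(1) by (simp add: nat_dist_def sum.union_disjoint[of ?L ?G] disjoint_iff)
  moreover have "(\<Sum>j\<in>?L. \<rho> ^ (i - j)) = (\<Sum>k\<in>(\<lambda>j. i - j) ` ?L. \<rho> ^ k)"
    by (subst sum.reindex) (auto simp: inj_on_def)
  moreover have "\<dots> \<le> \<rho> / (1 - \<rho>)" by (rule sum_powers_le) (use assms in auto)
  moreover have "(\<Sum>j\<in>?G. \<rho> ^ (j - i)) = (\<Sum>k\<in>(\<lambda>j. j - i) ` ?G. \<rho> ^ k)"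
    by (subst sum.reindex) (auto simp: inj_on_def)
  moreover have "\<dots> \<le> \<rho> / (1 - \<rho>)" by (rule sum_powers_le) (use assms in auto)
  ultimately show ?thesis by simp
qed

text \<open>The Schur test in its simplest form: x y <= (x^2 + y^2) / 2, then summation along rows
  and columns.\<close>

lemma schur_bound:
  fixes x y :: "nat \<Rightarrow> real"
  assumes c: "\<And>i j. c i j \<ge> 0"
    and row: "\<And>i. i \<in> I \<Longrightarrow> (\<Sum>j\<in>I. c i j) \<le> s" and col: "\<And>j. j \<in> I \<Longrightarrow> (\<Sum>i\<in>I. c i j) \<le> s"
  shows "(\<Sum>i\<in>I. \<Sum>j\<in>I. x i * y j * c i j) \<le> s / 2 * ((\<Sum>i\<in>I. (x i)\<^sup>2) + (\<Sum>j\<in>I. (y j)\<^sup>2))"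
proof -
  have "(\<Sum>i\<in>I. \<Sum>j\<in>I. x i * y j * c i j)
      \<le> (\<Sum>i\<in>I. \<Sum>j\<in>I. (x i)\<^sup>2 / 2 * c i j + (y j)\<^sup>2 / 2 * c i j)"
  proof (intro sum_mono)
    fix i j
    have "x i * y j \<le> (x i)\<^sup>2 / 2 + (y j)\<^sup>2 / 2"
      using sum_squares_bound[of "x i" "y j"] by simp
    then show "x i * y j * c i j \<le> (x i)\<^sup>2 / 2 * c i j + (y j)\<^sup>2 / 2 * c i j"
      using c[of i j] by (metis distrib_right mult_right_mono)
  qed
  also have "\<dots> = (\<Sum>i\<in>I. (x i)\<^sup>2 / 2 * (\<Sum>j\<in>I. c i j)) + (\<Sum>j\<in>I. (y j)\<^sup>2 / 2 * (\<Sum>i\<in>I. c i j))"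
    by (simp add: sum.distrib sum_distrib_left) (rule sum.swap)
  also have "\<dots> \<le> (\<Sum>i\<in>I. (x i)\<^sup>2 / 2 * s) + (\<Sum>j\<in>I. (y j)\<^sup>2 / 2 * s)"
    by (intro add_mono sum_mono mult_left_mono row col) auto
  also have "\<dots> = s / 2 * ((\<Sum>i\<in>I. (x i)\<^sup>2) + (\<Sum>j\<in>I. (y j)\<^sup>2))"
    by (simp add: sum_distrib_left distrib_left mult.commute sum_divide_distrib)
  finally show ?thesis .
qed

lemma le_1_of_sum_power4:
  fixes F :: "nat \<Rightarrow> real"
  assumes "finite I" "(\<Sum>i\<in>I. F i ^ 4) \<le> 1" "\<And>i. F i \<ge> 0" "i \<in> I"
  shows "F i \<le> 1"
proof -
  have "F i ^ 4 \<le> (\<Sum>i\<in>I. F i ^ 4)"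
    by (rule member_le_sum) (use assms in auto)
  then have "F i ^ 4 \<le> 1 ^ 4" using assms by simp
  then show ?thesis by (rule power_le_imp_le_base[of _ 3, simplified]) simp
qed

text \<open>As \<open>F\<close> and \<open>G\<close> are at most 1, lowering the exponent from 3 to
  2 only increases the sum, and then F^2 and G^2 are unit vectors in l2, to which the Schur test
  applies.\<close>

lemma local_schur:
  fixes F G :: "nat \<Rightarrow> real"
  assumes fin: "finite I" and F: "\<And>i. F i \<ge> 0" "(\<Sum>i\<in>I. F i ^ 4) = 1"
    and G: "\<And>j. G j \<ge> 0" "(\<Sum>j\<in>I. G j ^ 4) = 1"
    and c: "\<And>i j. c i j \<ge> 0"
    and row: "\<And>i. i \<in> I \<Longrightarrow> (\<Sum>j\<in>I. c i j) \<le> s" and col: "\<And>j. j \<in> I \<Longrightarrow> (\<Sum>i\<in>I. c i j) \<le> s"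
  shows "(\<Sum>i\<in>I. \<Sum>j\<in>I. (F i * G j) ^ 3 * c i j) \<le> s"
proof -
  have "(\<Sum>i\<in>I. \<Sum>j\<in>I. (F i * G j) ^ 3 * c i j) \<le> (\<Sum>i\<in>I. \<Sum>j\<in>I. (F i)\<^sup>2 * (G j)\<^sup>2 * c i j)"
  proof (intro sum_mono mult_right_mono c)
    fix i j assume ij: "i \<in> I" "j \<in> I"
    have "F i * G j \<le> 1" using le_1_of_sum_power4[OF fin] F G ij by (simp add: mult_le_one)
    then have "(F i * G j) ^ 3 \<le> (F i * G j) ^ 2"
      using F G by (intro power_decreasing) auto
    then show "(F i * G j) ^ 3 \<le> (F i)\<^sup>2 * (G j)\<^sup>2" by (simp add: power_mult_distrib)
  qed
  also have "\<dots> \<le> s / 2 * ((\<Sum>i\<in>I. ((F i)\<^sup>2)\<^sup>2) + (\<Sum>j\<in>I. ((G j)\<^sup>2)\<^sup>2))"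
    by (rule schur_bound) (use c row col in auto)
  also have "\<dots> = s" using F G by (simp flip: power_mult)
  finally show ?thesis .
qed

text \<open>Here $e$ is the edge density between two fibres and $F^4$, $G^4$ are the densities of the fibres, so \<open>le\<close>
  says that restricting to a pair of fibres does not increase the quality. The exponents 4 and 6 matter only
  because \<open>\<rho>\<close> will be \<open>p powr (- 1 / 5)\<close>: then \<open>\<rho> ^ 6\<close> is summable over the primes.\<close>

lemma local_domination:
  fixes F G :: "nat \<Rightarrow> real" and e :: "nat \<Rightarrow> nat \<Rightarrow> real"
  assumes fin: "finite I" and F: "\<And>i. F i \<ge> 0" "(\<Sum>i\<in>I. F i ^ 4) = 1"
    and G: "\<And>j. G j \<ge> 0" "(\<Sum>j\<in>I. G j ^ 4) = 1"
    and e: "\<And>i j. e i j \<ge> 0" "(\<Sum>i\<in>I. \<Sum>j\<in>I. e i j) = 1"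
    and \<rho>: "0 \<le> \<rho>" "\<rho> \<le> 1 / 768"
    and le: "\<And>i j. i \<in> I \<Longrightarrow> j \<in> I \<Longrightarrow> e i j \<le> (F i * G j) ^ 3 * \<rho> ^ nat_dist i j"
  obtains k where "(\<Sum>i\<in>I. \<Sum>j\<in>I. if i \<noteq> j then e i j else 0) \<le> 10 ^ 5 * \<rho> ^ 4"
    "(\<Sum>i\<in>I. \<Sum>j\<in>I. if i \<noteq> k \<and> j \<noteq> k then e i j else 0) \<le> 10 ^ 8 * \<rho> ^ 6"
proof -
  have geo: "(\<Sum>j\<in>J - {i}. \<rho> ^ nat_dist i j) \<le> 3 * \<rho>" if "finite J" for i J
  proof -
    have "(\<Sum>j\<in>J - {i}. \<rho> ^ nat_dist i j) \<le> 2 * \<rho> / (1 - \<rho>)"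
      by (rule sum_dist_powers_le) (use that \<rho> in auto)
    also have "\<dots> \<le> 3 * \<rho>"
    proof -
      have "2 * \<rho> \<le> 3 * \<rho> * (1 - \<rho>)" using \<rho> mult_mono[of \<rho> "1/3" \<rho> \<rho>] by (simp add: algebra_simps)
      then show ?thesis using \<rho> by (simp add: pos_divide_le_eq)
    qed
    finally show ?thesis .
  qed
  have F1: "F i \<le> 1" and G1: "G i \<le> 1" if "i \<in> I" for i
    using le_1_of_sum_power4[OF fin] F G that by auto
  define offw where "offw = (\<lambda>i j. if i \<noteq> j then \<rho> ^ nat_dist i j else 0)"
  have offsum: "(\<Sum>j\<in>I. offw i j) \<le> 3 * \<rho>" "(\<Sum>j\<in>I. offw j i) \<le> 3 * \<rho>" for i
  proof -
    have "(\<Sum>j\<in>I. offw i j) = (\<Sum>j\<in>I - {i}. \<rho> ^ nat_dist i j)"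
      by (rule sum.mono_neutral_cong_right) (use fin in \<open>auto simp: offw_def\<close>)
    then show "(\<Sum>j\<in>I. offw i j) \<le> 3 * \<rho>" using geo[OF fin, of i] by simp
    moreover have "offw j i = offw i j" for j by (simp add: offw_def nat_dist_commute)
    ultimately show "(\<Sum>j\<in>I. offw j i) \<le> 3 * \<rho>" by simp
  qed
  have "(\<Sum>i\<in>I. \<Sum>j\<in>I. if i \<noteq> j then e i j else 0) \<le> (\<Sum>i\<in>I. \<Sum>j\<in>I. (F i * G j) ^ 3 * offw i j)"
    by (intro sum_mono) (use le in \<open>auto simp: offw_def\<close>)
  also have "\<dots> \<le> 3 * \<rho>"
    by (rule local_schur) (use fin F G offsum \<rho> in \<open>auto simp: offw_def\<close>)
  finally have off: "(\<Sum>i\<in>I. \<Sum>j\<in>I. if i \<noteq> j then e i j else 0) \<le> 3 * \<rho>" .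
  have "(\<Sum>i\<in>I. \<Sum>j\<in>I. e i j) = (\<Sum>i\<in>I. e i i + (\<Sum>j\<in>I. if i \<noteq> j then e i j else 0))"
  proof (rule sum.cong[OF refl])
    fix i assume i: "i \<in> I"
    have "(\<Sum>j\<in>I. e i j) = e i i + (\<Sum>j\<in>I - {i}. e i j)" using fin i by (rule sum.remove)
    also have "(\<Sum>j\<in>I - {i}. e i j) = (\<Sum>j\<in>I. if i \<noteq> j then e i j else 0)"
      by (rule sum.mono_neutral_cong_left) (use fin in auto)
    finally show "(\<Sum>j\<in>I. e i j) = e i i + (\<Sum>j\<in>I. if i \<noteq> j then e i j else 0)" .
  qed
  then have diag: "(\<Sum>i\<in>I. e i i) \<ge> 1 - 3 * \<rho>" using off e(2) by (simp add: sum.distrib)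
  \<comment> \<open>The dominating value \<open>k\<close> maximises F i G i. The diagonal carries
    almost all edges and its total is at most F k G k times the sum of F^2 G^2, which is at most 1;
    so F k and G k are both close to 1.\<close>
  have "I \<noteq> {}" using F(2) by auto
  then have "Max ((\<lambda>i. F i * G i) ` I) \<in> (\<lambda>i. F i * G i) ` I" using fin by (intro Max_in) auto
  then obtain k where "Max ((\<lambda>i. F i * G i) ` I) = F k * G k" "k \<in> I" by (rule imageE)
  then have k: "k \<in> I" "\<And>i. i \<in> I \<Longrightarrow> F i * G i \<le> F k * G k"
    using Max_ge[of "(\<lambda>i. F i * G i) ` I"] fin by auto
  have "1 - 3 * \<rho> \<le> (\<Sum>i\<in>I. (F k * G k) * ((F i)\<^sup>2 * (G i)\<^sup>2))"
  proof (rule order_trans[OF diag], rule sum_mono)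
    fix i assume i: "i \<in> I"
    have "e i i \<le> (F i * G i) ^ 3" using le[OF i i] by simp
    also have "\<dots> = (F i * G i) * (F i * G i)\<^sup>2" by (simp add: power3_eq_cube power2_eq_square)
    also have "\<dots> \<le> (F k * G k) * (F i * G i)\<^sup>2" by (rule mult_right_mono) (use k i in auto)
    finally show "e i i \<le> (F k * G k) * ((F i)\<^sup>2 * (G i)\<^sup>2)" by (simp add: power_mult_distrib)
  qed
  also have "\<dots> = (F k * G k) * (\<Sum>i\<in>I. (F i)\<^sup>2 * (G i)\<^sup>2)" by (simp add: sum_distrib_left)
  also have "\<dots> \<le> (F k * G k) * 1"
  proof (rule mult_left_mono)
    have "(\<Sum>i\<in>I. (F i)\<^sup>2 * (G i)\<^sup>2) \<le> (\<Sum>i\<in>I. F i ^ 4 / 2 + G i ^ 4 / 2)"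
    proof (rule sum_mono)
      fix i show "(F i)\<^sup>2 * (G i)\<^sup>2 \<le> F i ^ 4 / 2 + G i ^ 4 / 2"
        using sum_squares_bound[of "(F i)\<^sup>2" "(G i)\<^sup>2"] by (simp flip: power_mult)
    qed
    also have "\<dots> = 1" using F G by (simp add: sum.distrib flip: sum_divide_distrib)
    finally show "(\<Sum>i\<in>I. (F i)\<^sup>2 * (G i)\<^sup>2) \<le> 1" .
  qed (use F G in simp)
  finally have FG: "1 - 3 * \<rho> \<le> F k * G k" by simp
  have Fk: "1 - 3 * \<rho> \<le> F k" "1 - 3 * \<rho> \<le> G k"
    using FG mult_left_le[OF G1[OF k(1)] F(1)[of k]] mult_left_le_one_le[OF G(1)[of k] F(1)[of k] F1[OF k(1)]] by auto
  define I' where "I' = I - {k}"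
  \<comment> \<open>U^4 and W^4 are the masses of the two sides outside the fibre \<open>k\<close>.
    The first estimate U^4 <= 12 \<rho> is bootstrapped below to U = O(\<rho>), and only this yields
    the powers \<rho>^4 and \<rho>^6.\<close>
  define U W where "U = root 4 (\<Sum>i\<in>I'. F i ^ 4)" and "W = root 4 (\<Sum>i\<in>I'. G i ^ 4)"
  have fin': "finite I'" using fin by (simp add: I'_def)
  have UW0: "U \<ge> 0" "W \<ge> 0" by (auto simp: U_def W_def intro!: sum_nonneg F G)
  have U4: "U ^ 4 = (\<Sum>i\<in>I'. F i ^ 4)" and W4: "W ^ 4 = (\<Sum>i\<in>I'. G i ^ 4)"
    by (auto simp: U_def W_def sum_nonneg)
  have Uk: "U ^ 4 = 1 - F k ^ 4" and Wk: "W ^ 4 = 1 - G k ^ 4"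
    using sum.remove[OF fin k(1), of "\<lambda>i. F i ^ 4"] sum.remove[OF fin k(1), of "\<lambda>i. G i ^ 4"]
    by (simp_all add: U4 W4 I'_def F G)
  have bern: "1 - x ^ 4 \<le> 12 * \<rho>" if "1 - 3 * \<rho> \<le> x" for x
  proof -
    have "1 + real 4 * (- 3 * \<rho>) \<le> (1 + - 3 * \<rho>) ^ 4"
      by (rule Bernoulli_inequality) (use \<rho> in auto)
    also have "\<dots> \<le> x ^ 4" by (rule power_mono) (use that \<rho> in auto)
    finally show ?thesis by simp
  qed
  \<comment> \<open>Here 1 / 768 enters: 12 / 768 = (1 / 8)^2.\<close>
  have sq: "x\<^sup>2 \<le> 1 / 8" if "x ^ 4 \<le> 12 * \<rho>" for x :: real
  proof -
    have "(x\<^sup>2)\<^sup>2 \<le> (1 / 8)\<^sup>2" using that \<rho> by (simp add: power_divide flip: power_mult)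
    then show ?thesis by (rule power2_le_imp_le) simp
  qed
  have U2: "U\<^sup>2 \<le> 1 / 8" and W2: "W\<^sup>2 \<le> 1 / 8"
    using sq[of U] sq[of W] bern[OF Fk(1)] bern[OF Fk(2)] Uk Wk by auto
  have FU: "F i \<le> U" and GW: "G i \<le> W" if "i \<in> I'" for i
  proof -
    have "F i ^ 4 \<le> U ^ 4" unfolding U4 by (rule member_le_sum) (use that fin' F in auto)
    then show "F i \<le> U" by (rule power_le_imp_le_base[of _ 3, simplified]) (rule UW0)
    have "G i ^ 4 \<le> W ^ 4" unfolding W4 by (rule member_le_sum) (use that fin' G in auto)
    then show "G i \<le> W" by (rule power_le_imp_le_base[of _ 3, simplified]) (rule UW0)
  qed
  have Isub: "i \<in> I' \<Longrightarrow> i \<in> I" for i by (simp add: I'_def)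
  define O1 O2 B where "O1 = (\<Sum>j\<in>I'. e k j)" and "O2 = (\<Sum>i\<in>I'. e i k)" and "B = (\<Sum>i\<in>I'. \<Sum>j\<in>I'. e i j)"
  have O1: "O1 \<le> 3 * \<rho> * W ^ 3"
  proof -
    have "O1 \<le> (\<Sum>j\<in>I'. W ^ 3 * \<rho> ^ nat_dist k j)" unfolding O1_def
    proof (rule sum_mono)
      fix j assume j: "j \<in> I'"
      have "e k j \<le> (F k * G j) ^ 3 * \<rho> ^ nat_dist k j" using le k Isub[OF j] by simp
      also have "\<dots> \<le> W ^ 3 * \<rho> ^ nat_dist k j"
      proof (intro mult_right_mono power_mono)
        show "F k * G j \<le> W"
          using mult_left_le_one_le[OF G(1)[of j] F(1)[of k] F1[OF k(1)]] GW[OF j] by linarith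
      qed (use F G \<rho> in auto)
      finally show "e k j \<le> W ^ 3 * \<rho> ^ nat_dist k j" .
    qed
    also have "\<dots> = W ^ 3 * (\<Sum>j\<in>I'. \<rho> ^ nat_dist k j)" by (simp add: sum_distrib_left)
    also have "\<dots> \<le> W ^ 3 * (3 * \<rho>)"
      unfolding I'_def by (intro mult_left_mono geo) (use fin UW0 in auto)
    finally show ?thesis by (simp add: mult_ac)
  qed
  have O2: "O2 \<le> 3 * \<rho> * U ^ 3"
  proof -
    have "O2 \<le> (\<Sum>j\<in>I'. U ^ 3 * \<rho> ^ nat_dist k j)" unfolding O2_def
    proof (rule sum_mono)
      fix j assume j: "j \<in> I'"
      have "e j k \<le> (F j * G k) ^ 3 * \<rho> ^ nat_dist k j" using le k Isub[OF j] nat_dist_commute by metis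
      also have "\<dots> \<le> U ^ 3 * \<rho> ^ nat_dist k j"
      proof (intro mult_right_mono power_mono)
        show "F j * G k \<le> U"
          using mult_left_le[OF G1[OF k(1)] F(1)[of j]] FU[OF j] by linarith
      qed (use F G \<rho> in auto)
      finally show "e j k \<le> U ^ 3 * \<rho> ^ nat_dist k j" .
    qed
    also have "\<dots> = U ^ 3 * (\<Sum>j\<in>I'. \<rho> ^ nat_dist k j)" by (simp add: sum_distrib_left)
    also have "\<dots> \<le> U ^ 3 * (3 * \<rho>)"
      unfolding I'_def by (intro mult_left_mono geo) (use fin UW0 in auto)
    finally show ?thesis by (simp add: mult_ac)
  qed
  have row: "(\<Sum>j\<in>I'. \<rho> ^ nat_dist i j) \<le> 2" for i
  proof (cases "i \<in> I'")
    case True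
    then show ?thesis using sum.remove[OF fin' True, of "\<lambda>j. \<rho> ^ nat_dist i j"] geo[OF fin', of i] \<rho> by simp
  next
    case False
    then have "I' - {i} = I'" by auto
    then show ?thesis using geo[OF fin', of i] \<rho> by simp
  qed
  have six: "(\<Sum>i\<in>I'. (x i ^ 3)\<^sup>2) \<le> V ^ 6"
    if "\<And>i. x i \<ge> 0" "\<And>i. i \<in> I' \<Longrightarrow> x i \<le> V" "V ^ 4 = (\<Sum>i\<in>I'. x i ^ 4)" for x :: "nat \<Rightarrow> real" and V
  proof -
    have "(\<Sum>i\<in>I'. (x i ^ 3)\<^sup>2) \<le> (\<Sum>i\<in>I'. V\<^sup>2 * x i ^ 4)"
    proof (rule sum_mono)
      fix i assume i: "i \<in> I'"
      have "(x i ^ 3)\<^sup>2 = (x i)\<^sup>2 * x i ^ 4" by (simp flip: power_mult power_add)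
      also have "\<dots> \<le> V\<^sup>2 * x i ^ 4" by (intro mult_right_mono power_mono) (use that i in auto)
      finally show "(x i ^ 3)\<^sup>2 \<le> V\<^sup>2 * x i ^ 4" .
    qed
    also have "\<dots> = V\<^sup>2 * V ^ 4" by (simp add: sum_distrib_left that(3))
    also have "\<dots> = V ^ 6" by (simp flip: power_add)
    finally show ?thesis .
  qed
  have B: "B \<le> U ^ 6 + W ^ 6"
  proof -
    have "B \<le> (\<Sum>i\<in>I'. \<Sum>j\<in>I'. F i ^ 3 * G j ^ 3 * \<rho> ^ nat_dist i j)"
      unfolding B_def by (intro sum_mono) (use le Isub in \<open>simp flip: power_mult_distrib\<close>)
    also have "\<dots> \<le> 2 / 2 * ((\<Sum>i\<in>I'. (F i ^ 3)\<^sup>2) + (\<Sum>j\<in>I'. (G j ^ 3)\<^sup>2))"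
    proof (rule schur_bound)
      show "(\<Sum>i\<in>I'. \<rho> ^ nat_dist i j) \<le> 2" for j
        using row[of j] by (simp add: nat_dist_commute[of _ j])
    qed (use row \<rho> in auto)
    also have "\<dots> \<le> U ^ 6 + W ^ 6"
      using six[of F U] six[of G W] F G FU GW U4 W4 by auto
    finally show ?thesis .
  qed
  have decomp: "(\<Sum>i\<in>I. \<Sum>j\<in>I. h i j) = h k k + (\<Sum>j\<in>I'. h k j) + (\<Sum>i\<in>I'. h i k) + (\<Sum>i\<in>I'. \<Sum>j\<in>I'. h i j)"
    for h :: "nat \<Rightarrow> nat \<Rightarrow> real"
    unfolding I'_def by (simp add: sum.remove[OF fin k(1)] sum.distrib)
  have total: "1 = e k k + O1 + O2 + B" using decomp[of e] e(2) by (simp add: O1_def O2_def B_def)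
  have ekk: "e k k \<le> 1 - (U ^ 4 + W ^ 4) / 2"
  proof -
    have "e k k \<le> F k ^ 3 * G k ^ 3" using le[OF k(1) k(1)] by (simp add: power_mult_distrib)
    also have "\<dots> \<le> F k ^ 6 / 2 + G k ^ 6 / 2"
      using sum_squares_bound[of "F k ^ 3" "G k ^ 3"] by (simp flip: power_mult)
    also have "\<dots> \<le> F k ^ 4 / 2 + G k ^ 4 / 2"
      using power_decreasing[of 4 6 "F k"] power_decreasing[of 4 6 "G k"] F G F1[OF k(1)] G1[OF k(1)] by simp
    finally show ?thesis unfolding Uk Wk by (simp add: field_simps)
  qed
  have shrink: "x ^ 6 \<le> x ^ 4 / 8" if "x\<^sup>2 \<le> 1 / 8" for x :: real
  proof -
    have "x ^ 6 = x\<^sup>2 * x ^ 4" by (simp flip: power_add)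
    also have "\<dots> \<le> 1 / 8 * x ^ 4" by (rule mult_right_mono) (use that in auto)
    finally show ?thesis by simp
  qed
  \<comment> \<open>In the total 1 = e k k + O1 + O2 + B the first term falls short of 1 by (U^4 +
    W^4) / 2, and \<open>B\<close> makes up for at most a quarter of that. The rest must come from
    \<open>O1\<close> and \<open>O2\<close>, which are only O(\<rho> W^3) and O(\<rho> U^3); for the
    larger of U and W this forces O(\<rho>).\<close>
  have key: "3 / 8 * (U ^ 4 + W ^ 4) \<le> 3 * \<rho> * U ^ 3 + 3 * \<rho> * W ^ 3"
  proof -
    have lin: "3 / 8 * (x + y) \<le> a + b"
      if "1 = e0 + o1 + o2 + b0" "e0 \<le> 1 - (x + y) / 2" "o1 \<le> b" "o2 \<le> a" "b0 \<le> u + t" "u \<le> x / 8" "t \<le> y / 8"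
      for x y a b e0 o1 o2 b0 u t :: real
      using that by (simp add: field_simps)
    show ?thesis by (rule lin[OF total ekk O1 O2 B shrink[OF U2] shrink[OF W2]])
  qed
  define Z where "Z = max U W"
  have Z0: "Z \<ge> 0" using UW0 by (simp add: Z_def)
  have UZ: "U ^ n \<le> Z ^ n" "W ^ n \<le> Z ^ n" for n
    using UW0 by (auto simp: Z_def intro!: power_mono)
  have "Z \<le> 16 * \<rho>"
  proof (cases "Z = 0")
    case False
    have "3 / 8 * Z ^ 4 \<le> 3 / 8 * (U ^ 4 + W ^ 4)" by (simp add: Z_def max_def)
    also have "\<dots> \<le> 3 * \<rho> * Z ^ 3 + 3 * \<rho> * Z ^ 3"
      using key UZ[of 3] mult_left_mono[OF UZ(1)[of 3], of "3 * \<rho>"] mult_left_mono[OF UZ(2)[of 3], of "3 * \<rho>"] \<rho> by simp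
    finally have "3 / 8 * Z ^ 4 \<le> 3 * \<rho> * Z ^ 3 + 3 * \<rho> * Z ^ 3" .
    moreover have "Z ^ 4 = Z * Z ^ 3" by (simp add: eval_nat_numeral)
    moreover have "3 * \<rho> * Z ^ 3 + 3 * \<rho> * Z ^ 3 = 6 * (\<rho> * Z ^ 3)" by simp
    ultimately have "Z * Z ^ 3 \<le> 16 * (\<rho> * Z ^ 3)" by linarith
    then have "Z * Z ^ 3 \<le> (16 * \<rho>) * Z ^ 3" by (simp only: mult.assoc)
    then show ?thesis using Z0 False by (simp add: mult_le_cancel_right)
  qed (use \<rho> in simp)
  then have Zn: "Z ^ n \<le> (16 * \<rho>) ^ n" for n using Z0 by (intro power_mono)
  have U3: "U ^ 3 \<le> 4096 * \<rho> ^ 3" "W ^ 3 \<le> 4096 * \<rho> ^ 3"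
    using UZ[of 3] Zn[of 3] by (simp_all add: power_mult_distrib)
  have U6: "U ^ 6 \<le> 16777216 * \<rho> ^ 6" "W ^ 6 \<le> 16777216 * \<rho> ^ 6"
    using UZ[of 6] Zn[of 6] by (simp_all add: power_mult_distrib)
  have both: "B \<le> 10 ^ 8 * \<rho> ^ 6"
  proof -
    have "B \<le> 33554432 * \<rho> ^ 6" using B U6 by simp
    also have "\<dots> \<le> 10 ^ 8 * \<rho> ^ 6" by (rule mult_right_mono) (use \<rho> in auto)
    finally show ?thesis .
  qed
  have O12: "O1 + O2 \<le> 24576 * \<rho> ^ 4"
  proof -
    have "3 * \<rho> * U ^ 3 \<le> 3 * \<rho> * (4096 * \<rho> ^ 3)" "3 * \<rho> * W ^ 3 \<le> 3 * \<rho> * (4096 * \<rho> ^ 3)"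
      by (intro mult_left_mono U3; use \<rho> in simp)+
    moreover have "3 * \<rho> * (4096 * \<rho> ^ 3) = 12288 * \<rho> ^ 4" by (simp add: eval_nat_numeral)
    ultimately show ?thesis using O1 O2 by linarith
  qed
  have "33554432 * \<rho>\<^sup>2 * \<rho> ^ 4 = 33554432 * \<rho> ^ 6" by (simp flip: power_add)
  then have "B \<le> 33554432 * \<rho>\<^sup>2 * \<rho> ^ 4" using B U6 by linarith
  also have "\<dots> \<le> 60 * \<rho> ^ 4"
  proof (rule mult_right_mono)
    have "\<rho>\<^sup>2 \<le> (1 / 768)\<^sup>2" using \<rho> by (intro power_mono) auto
    then show "33554432 * \<rho>\<^sup>2 \<le> 60" by (simp add: power2_eq_square)
  qed simp
  finally have B4: "B \<le> 60 * \<rho> ^ 4" .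
  show ?thesis
  proof (rule that[of k])
    have "(\<Sum>i\<in>I. \<Sum>j\<in>I. if i \<noteq> j then e i j else 0) \<le> O1 + O2 + B"
      unfolding decomp O1_def O2_def B_def
      using e(1) by (intro add_mono sum_mono) (auto intro!: sum_mono)
    also have "\<dots> \<le> 100000 * \<rho> ^ 4"
      using O12 B4 zero_le_power[OF \<rho>(1), of 4] by linarith
    also have "\<dots> = 10 ^ 5 * \<rho> ^ 4" by simp
    finally show "(\<Sum>i\<in>I. \<Sum>j\<in>I. if i \<noteq> j then e i j else 0) \<le> 10 ^ 5 * \<rho> ^ 4" .
    have "(\<Sum>i\<in>I. \<Sum>j\<in>I. if i \<noteq> k \<and> j \<noteq> k then e i j else 0) = B"
      unfolding decomp B_def by (auto simp: I'_def intro!: sum.cong)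
    then show "(\<Sum>i\<in>I. \<Sum>j\<in>I. if i \<noteq> k \<and> j \<noteq> k then e i j else 0) \<le> 10 ^ 8 * \<rho> ^ 6"
      using both by simp
  qed
qed

section \<open>Graphs whose two sides are split into fibres\<close>

lemma sum_card_fibres:
  assumes "finite A" "finite I" "f ` A \<subseteq> I"
  shows "(\<Sum>i\<in>I. real (card {x \<in> A. f x = i \<and> P x})) = real (card {x \<in> A. P x})"
proof -
  have "(\<Sum>i\<in>I. \<Sum>x\<in>{x \<in> {x \<in> A. P x}. f x = i}. 1) = (\<Sum>x\<in>{x \<in> A. P x}. 1::nat)"
    by (rule sum.group) (use assms in auto)
  moreover have "{x \<in> {x \<in> A. P x}. f x = i} = {x \<in> A. f x = i \<and> P x}" for i by auto
  ultimately show ?thesis by (simp flip: of_nat_sum)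
qed

lemma sum_card_fibres2:
  assumes "finite E" "finite I" "\<And>x. x \<in> E \<Longrightarrow> f x \<in> I" "\<And>x. x \<in> E \<Longrightarrow> g x \<in> I"
  shows "(\<Sum>i\<in>I. \<Sum>j\<in>I. if Q i j then real (card {x \<in> E. f x = i \<and> g x = j}) else 0) = real (card {x \<in> E. Q (f x) (g x)})"
proof -
  have "(\<Sum>i\<in>I. \<Sum>j\<in>I. if Q i j then real (card {x \<in> E. f x = i \<and> g x = j}) else 0)
     = (\<Sum>i\<in>I. \<Sum>j\<in>I. real (card {x \<in> E. g x = j \<and> f x = i \<and> Q (f x) (g x)}))"
  proof (intro sum.cong refl)
    fix i j
    show "(if Q i j then real (card {x \<in> E. f x = i \<and> g x = j}) else 0) = real (card {x \<in> E. g x = j \<and> f x = i \<and> Q (f x) (g x)})"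
    proof -
      have "{x \<in> E. g x = j \<and> f x = i \<and> Q (f x) (g x)} = (if Q i j then {x \<in> E. f x = i \<and> g x = j} else {})"
        by auto
      then show ?thesis by simp
    qed
  qed
  also have "\<dots> = (\<Sum>i\<in>I. real (card {x \<in> E. f x = i \<and> Q (f x) (g x)}))"
    by (intro sum.cong refl sum_card_fibres) (use assms in auto)
  also have "\<dots> = real (card {x \<in> E. Q (f x) (g x)})"
    by (intro sum_card_fibres) (use assms in auto)
  finally show ?thesis .
qed

text \<open>The assumption \<open>stable\<close> says that no pair of fibres has larger quality $e^4 w / (|A| |B|)^3$ than the
  whole graph, where $e$ counts edges.\<close>

locale fibred_graph =
  fixes A :: "'a set" and B :: "'b set" and E :: "('a \<times> 'b) set"
    and \<phi> :: "'a \<Rightarrow> nat" and \<psi> :: "'b \<Rightarrow> nat" and I :: "nat set" and w :: "nat \<Rightarrow> nat \<Rightarrow> real"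
  assumes finA: "finite A" and finB: "finite B" and EAB: "E \<subseteq> A \<times> B" and E0: "E \<noteq> {}" and finI: "finite I"
    and \<phi>I: "\<And>n. n \<in> A \<Longrightarrow> \<phi> n \<in> I" and \<psi>I: "\<And>m. m \<in> B \<Longrightarrow> \<psi> m \<in> I"
    and stable: "\<And>i j. i \<in> I \<Longrightarrow> j \<in> I \<Longrightarrow>
      real (card {x \<in> E. \<phi> (fst x) = i \<and> \<psi> (snd x) = j}) ^ 4 * w i j * (real (card A) * real (card B)) ^ 3
        \<le> real (card E) ^ 4 * (real (card {n \<in> A. \<phi> n = i}) * real (card {m \<in> B. \<psi> m = j})) ^ 3"
begin

text \<open>Fourth roots of the fibre densities, so that the fourth root of \<open>stable\<close>
  reads e i j <= (F i G j)^3 up to the weight, the shape required by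
  \<open>local_domination\<close>.\<close>

definition F where "F i = root 4 (real (card {n \<in> A. \<phi> n = i}) / real (card A))"
definition G where "G j = root 4 (real (card {m \<in> B. \<psi> m = j}) / real (card B))"
definition e where "e i j = real (card {x \<in> E. \<phi> (fst x) = i \<and> \<psi> (snd x) = j}) / real (card E)"

lemma finE: "finite E" using EAB finA finB by (meson finite_SigmaI finite_subset)

lemma card_pos: "card A > 0" "card B > 0" "card E > 0"
  using E0 EAB finA finB finE by (auto simp: card_gt_0_iff)

lemma F_nonneg: "F i \<ge> 0" and G_nonneg: "G i \<ge> 0" and e_nonneg: "e i j \<ge> 0"
  by (auto simp: F_def G_def e_def)

lemma F4: "F i ^ 4 = real (card {n \<in> A. \<phi> n = i}) / real (card A)"
  and G4: "G i ^ 4 = real (card {m \<in> B. \<psi> m = i}) / real (card B)"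
  by (auto simp: F_def G_def)

lemma sum_F: "(\<Sum>i\<in>I. F i ^ 4) = 1" and sum_G: "(\<Sum>i\<in>I. G i ^ 4) = 1"
  using sum_card_fibres[OF finA finI, of \<phi> "\<lambda>_. True"] sum_card_fibres[OF finB finI, of \<psi> "\<lambda>_. True"] \<phi>I \<psi>I card_pos
  by (auto simp: F4 G4 image_subset_iff simp flip: sum_divide_distrib)

lemma sum_e: "(\<Sum>i\<in>I. \<Sum>j\<in>I. if Q i j then e i j else 0)
    = real (card {x \<in> E. Q (\<phi> (fst x)) (\<psi> (snd x))}) / real (card E)"
proof -
  have "(\<Sum>i\<in>I. \<Sum>j\<in>I. if Q i j then real (card {x \<in> E. \<phi> (fst x) = i \<and> \<psi> (snd x) = j}) else 0)
    = real (card {x \<in> E. Q (\<phi> (fst x)) (\<psi> (snd x))})"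
    by (rule sum_card_fibres2) (use finE finI EAB \<phi>I \<psi>I in auto)
  moreover have "(\<Sum>i\<in>I. \<Sum>j\<in>I. if Q i j then e i j else 0)
    = (\<Sum>i\<in>I. \<Sum>j\<in>I. if Q i j then real (card {x \<in> E. \<phi> (fst x) = i \<and> \<psi> (snd x) = j}) else 0) / real (card E)"
    unfolding sum_divide_distrib e_def by (intro sum.cong refl) simp
  ultimately show ?thesis by simp
qed

text \<open>The fourth root of \<open>stable\<close>. The constant c covers two uses: c = 1 for
  large primes, and c = 14 for small primes with their bonus in the weight.\<close>

lemma e_le:
  assumes ij: "i \<in> I" "j \<in> I" and \<rho>: "\<rho> \<ge> 0" "c > 0" and w: "w i j * \<rho> ^ (4 * d) \<ge> c ^ 4"
  shows "c * e i j \<le> (F i * G j) ^ 3 * \<rho> ^ d"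
proof -
  have "e i j ^ 4 * w i j \<le> (F i ^ 4 * G j ^ 4) ^ 3"
  proof -
    have "e i j ^ 4 * w i j = real (card {x \<in> E. \<phi> (fst x) = i \<and> \<psi> (snd x) = j}) ^ 4 * w i j / real (card E) ^ 4"
      by (simp add: e_def power_divide)
    also have "\<dots> \<le> (real (card {n \<in> A. \<phi> n = i}) * real (card {m \<in> B. \<psi> m = j})) ^ 3 / (real (card A) * real (card B)) ^ 3"
    proof -
      have "x / E' \<le> y / AB" if "x * AB \<le> E' * y" "E' > 0" "AB > 0" for x y E' AB :: real
        using that by (simp add: field_simps)
      from this[OF stable[OF ij]] show ?thesis using card_pos by simp
    qed
    also have "\<dots> = (F i ^ 4 * G j ^ 4) ^ 3" by (simp add: F4 G4 flip: power_divide)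
    finally show ?thesis .
  qed
  then have "e i j ^ 4 * w i j * \<rho> ^ (4 * d) \<le> (F i ^ 4 * G j ^ 4) ^ 3 * \<rho> ^ (4 * d)"
    using \<rho> by (intro mult_right_mono) auto
  moreover have "c ^ 4 * e i j ^ 4 \<le> (w i j * \<rho> ^ (4 * d)) * e i j ^ 4"
    by (rule mult_right_mono[OF w]) (simp add: e_nonneg)
  ultimately have "(c * e i j) ^ 4 \<le> (F i ^ 4 * G j ^ 4) ^ 3 * \<rho> ^ (4 * d)"
    by (simp add: power_mult_distrib mult_ac)
  also have "\<dots> = ((F i * G j) ^ 3 * \<rho> ^ d) ^ 4"
    by (simp add: power_mult_distrib flip: power_mult) (simp add: mult.commute)
  finally show ?thesis
    by (rule power_le_imp_le_base[of _ 3, simplified]) (use \<rho> F_nonneg G_nonneg in auto)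
qed

lemma prime_dominated:
  assumes \<rho>: "0 \<le> \<rho>" "\<rho> \<le> 1 / 768"
    and w: "\<And>i j. w i j * \<rho> ^ (4 * nat_dist i j) \<ge> 1"
  obtains k where "real (card {x \<in> E. \<phi> (fst x) \<noteq> \<psi> (snd x)}) \<le> 10 ^ 5 * \<rho> ^ 4 * real (card E)"
    "real (card {x \<in> E. \<phi> (fst x) \<noteq> k \<and> \<psi> (snd x) \<noteq> k}) \<le> 10 ^ 8 * \<rho> ^ 6 * real (card E)"
proof -
  have le: "e i j \<le> (F i * G j) ^ 3 * \<rho> ^ nat_dist i j" if "i \<in> I" "j \<in> I" for i j
    using e_le[OF that \<rho>(1), of 1 "nat_dist i j"] w by simp
  have tot: "(\<Sum>i\<in>I. \<Sum>j\<in>I. e i j) = 1"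
    using sum_e[of "\<lambda>_ _. True"] card_pos by simp
  obtain k where k: "(\<Sum>i\<in>I. \<Sum>j\<in>I. if i \<noteq> j then e i j else 0) \<le> 10 ^ 5 * \<rho> ^ 4"
    "(\<Sum>i\<in>I. \<Sum>j\<in>I. if i \<noteq> k \<and> j \<noteq> k then e i j else 0) \<le> 10 ^ 8 * \<rho> ^ 6"
    using local_domination[OF finI F_nonneg sum_F G_nonneg sum_G e_nonneg tot \<rho> le] by blast
  show ?thesis
    using k that[of k] card_pos unfolding sum_e by (simp add: pos_divide_le_eq)
qed

text \<open>For small primes the ratio is too large for the domination argument. A bonus 14^4 in
  their weight makes stability impossible instead: with ratio 17 / 20 the rows of the kernel sum to
  at most 13, whereas the total edge mass 1 would have to be at most 13 / 14. So compression fixes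
  every small prime. The ratio 17 / 20 suits even p = 2, since 2 (17 / 20)^4 >= 1.\<close>

lemma small_prime_unstable:
  assumes w: "\<And>i j. w i j * (17 / 20) ^ (4 * nat_dist i j) \<ge> 14 ^ 4"
  shows False
proof -
  define \<rho> :: real where "\<rho> = 17 / 20"
  have le: "14 * e i j \<le> (F i * G j) ^ 3 * \<rho> ^ nat_dist i j" if "i \<in> I" "j \<in> I" for i j
    unfolding \<rho>_def by (rule e_le[OF that _ _ w]) auto
  have row: "(\<Sum>j\<in>I. \<rho> ^ nat_dist i j) \<le> 13" for i
  proof -
    have "(\<Sum>j\<in>I. \<rho> ^ nat_dist i j) \<le> (\<Sum>j\<in>insert i I. \<rho> ^ nat_dist i j)"
      by (rule sum_mono2) (use finI in \<open>auto simp: \<rho>_def\<close>)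
    also have "\<dots> = 1 + (\<Sum>j\<in>I - {i}. \<rho> ^ nat_dist i j)" by (simp add: sum.insert_remove finI)
    also have "\<dots> \<le> 1 + 2 * \<rho> / (1 - \<rho>)"
      by (intro add_left_mono sum_dist_powers_le finI) (auto simp: \<rho>_def)
    finally show ?thesis by (simp add: \<rho>_def)
  qed
  have "14 * (\<Sum>i\<in>I. \<Sum>j\<in>I. e i j) \<le> (\<Sum>i\<in>I. \<Sum>j\<in>I. (F i * G j) ^ 3 * \<rho> ^ nat_dist i j)"
    unfolding sum_distrib_left by (intro sum_mono le)
  also have "\<dots> \<le> 13"
  proof (rule local_schur[OF finI F_nonneg sum_F G_nonneg sum_G])
    show "(\<Sum>i\<in>I. \<rho> ^ nat_dist i j) \<le> 13" for j using row[of j] by (simp add: nat_dist_commute[of _ j])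
  qed (use row in \<open>auto simp: \<rho>_def\<close>)
  finally show False using sum_e[of "\<lambda>_ _. True"] card_pos by simp
qed

end

text \<open>Compression as an induction on the number of primes with free exponents: an unstable
  prime provides a pair of fibres of strictly larger weighted quality, to which the induction
  hypothesis applies, and the weights of the chosen exponents are collected in the product over
  \<open>S\<close>. The terminal case, in which every free prime is stable, is the hypothesis
  \<open>stable\<close>.\<close>

lemma exponent_induction:
  fixes w :: "nat \<Rightarrow> nat \<Rightarrow> nat \<Rightarrow> real" and v :: "nat \<Rightarrow> nat \<Rightarrow> nat"
  assumes fin: "finite Pr" "finite I" "finite A0" "finite B0" and E0: "E0 \<subseteq> A0 \<times> B0"
    and vI: "\<And>p n. p \<in> Pr \<Longrightarrow> n \<in> A0 \<union> B0 \<Longrightarrow> v p n \<in> I"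
    and w: "\<And>p i j. w p i j > 0" and K: "K \<ge> 0"
    and stable: "\<And>S ii jj A B E. S \<subseteq> Pr \<Longrightarrow> A \<subseteq> A0 \<Longrightarrow> B \<subseteq> B0 \<Longrightarrow> E \<subseteq> E0 \<Longrightarrow> E \<subseteq> A \<times> B \<Longrightarrow> E \<noteq> {} \<Longrightarrow>
        (\<And>p n. p \<in> S \<Longrightarrow> n \<in> A \<Longrightarrow> v p n = ii p) \<Longrightarrow> (\<And>p n. p \<in> S \<Longrightarrow> n \<in> B \<Longrightarrow> v p n = jj p) \<Longrightarrow>
        (\<And>p. p \<in> Pr - S \<Longrightarrow> fibred_graph A B E (v p) (v p) I (w p)) \<Longrightarrow>
        real (card E) ^ 4 * (\<Prod>p\<in>S. w p (ii p) (jj p)) \<le> K * (real (card A) * real (card B)) ^ 3"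
    and "S \<subseteq> Pr" "A \<subseteq> A0" "B \<subseteq> B0" "E \<subseteq> E0" "E \<subseteq> A \<times> B"
        "\<And>p n. p \<in> S \<Longrightarrow> n \<in> A \<Longrightarrow> v p n = ii p" "\<And>p n. p \<in> S \<Longrightarrow> n \<in> B \<Longrightarrow> v p n = jj p"
  shows "real (card E) ^ 4 * (\<Prod>p\<in>S. w p (ii p) (jj p)) \<le> K * (real (card A) * real (card B)) ^ 3"
  using assms(10-16)
proof (induction "card (Pr - S)" arbitrary: S A B E ii jj rule: less_induct)
  case less
  note S = \<open>S \<subseteq> Pr\<close> and A = \<open>A \<subseteq> A0\<close> and B = \<open>B \<subseteq> B0\<close> and E = \<open>E \<subseteq> E0\<close> \<open>E \<subseteq> A \<times> B\<close>
  have finAB: "finite A" "finite B" using A B fin finite_subset by blast+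
  then have finE: "finite E" using E(2) finite_subset by blast
  show ?case
  proof (cases "E = {} \<or> (\<forall>p\<in>Pr - S. fibred_graph A B E (v p) (v p) I (w p))")
    case True
    then show ?thesis
    proof
      assume "E = {}" then show ?thesis using K by simp
    next
      assume *: "\<forall>p\<in>Pr - S. fibred_graph A B E (v p) (v p) I (w p)"
      show ?thesis
      proof (cases "E = {}")
        case False
        then show ?thesis by (intro stable S A B E less.prems(6,7)) (use * in auto)
      qed (use K in simp)
    qed
  next
    case False
    then obtain p where p: "p \<in> Pr - S" "\<not> fibred_graph A B E (v p) (v p) I (w p)" by blast
    have "\<exists>i\<in>I. \<exists>j\<in>I. real (card E) ^ 4 * (real (card {n \<in> A. v p n = i}) * real (card {m \<in> B. v p m = j})) ^ 3
       < real (card {x \<in> E. v p (fst x) = i \<and> v p (snd x) = j}) ^ 4 * w p i j * (real (card A) * real (card B)) ^ 3"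
    proof (rule ccontr)
      assume "\<not> ?thesis"
      then have "fibred_graph A B E (v p) (v p) I (w p)"
        using p False finAB fin E vI A B
        by unfold_locales (auto simp: not_less subset_iff)
      with p show False by blast
    qed
    then obtain i j where ij: "real (card E) ^ 4 * (real (card {n \<in> A. v p n = i}) * real (card {m \<in> B. v p m = j})) ^ 3
       < real (card {x \<in> E. v p (fst x) = i \<and> v p (snd x) = j}) ^ 4 * w p i j * (real (card A) * real (card B)) ^ 3"
      by blast
    define A1 B1 E1 where "A1 = {n \<in> A. v p n = i}" and "B1 = {m \<in> B. v p m = j}"
      and "E1 = {x \<in> E. v p (fst x) = i \<and> v p (snd x) = j}"
    define S1 ii1 jj1 where "S1 = insert p S" and "ii1 = ii(p := i)" and "jj1 = jj(p := j)"
    have E1: "E1 \<subseteq> A1 \<times> B1" using E(2) by (auto simp: A1_def B1_def E1_def)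
    have "E1 \<noteq> {}"
    proof
      assume "E1 = {}"
      with ij have "real (card E) ^ 4 * (real (card A1) * real (card B1)) ^ 3 < 0"
        unfolding A1_def[symmetric] B1_def[symmetric] E1_def[symmetric] by simp
      moreover have "0 \<le> real (card E) ^ 4 * (real (card A1) * real (card B1)) ^ 3" by simp
      ultimately show False by linarith
    qed
    then have "A1 \<noteq> {}" "B1 \<noteq> {}" using E1 by auto
    moreover have "finite A1" "finite B1" using finAB by (auto simp: A1_def B1_def)
    ultimately have pos: "real (card A1) * real (card B1) > 0" by (simp add: card_gt_0_iff)
    have prodS: "(\<Prod>q\<in>S1. w q (ii1 q) (jj1 q)) = w p i j * (\<Prod>q\<in>S. w q (ii q) (jj q))"
    proof -
      have "finite S" "p \<notin> S" using S fin p finite_subset by auto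
      moreover have "(\<Prod>q\<in>S. w q (ii1 q) (jj1 q)) = (\<Prod>q\<in>S. w q (ii q) (jj q))"
        using p by (intro prod.cong) (auto simp: ii1_def jj1_def)
      ultimately show ?thesis by (simp add: S1_def) (simp add: ii1_def jj1_def)
    qed
    have IH: "real (card E1) ^ 4 * (\<Prod>q\<in>S1. w q (ii1 q) (jj1 q)) \<le> K * (real (card A1) * real (card B1)) ^ 3"
    proof (rule less.hyps)
      show "card (Pr - S1) < card (Pr - S)"
        unfolding S1_def using p fin by (intro psubset_card_mono) auto
    qed (use S p A B E E1 less.prems(6,7) in \<open>auto simp: S1_def ii1_def jj1_def A1_def B1_def E1_def\<close>)
    define P where "P = (\<Prod>q\<in>S. w q (ii q) (jj q))"
    have P: "P > 0" unfolding P_def by (intro prod_pos) (use w in auto)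
    define c where "c = real (card A1) * real (card B1)"
    define ab where "ab = real (card A) * real (card B)"
    \<comment> \<open>The gain in quality at \<open>p\<close> is combined with the bound for the
      fibres; the positive factor c^3 belonging to the fibres then cancels.\<close>
    have "real (card E) ^ 4 * P * c ^ 3 = real (card E) ^ 4 * c ^ 3 * P" by simp
    also have "\<dots> \<le> real (card E1) ^ 4 * w p i j * ab ^ 3 * P"
      using ij P by (intro mult_right_mono) (auto simp: c_def ab_def A1_def B1_def E1_def)
    also have "\<dots> = real (card E1) ^ 4 * (w p i j * P) * ab ^ 3" by simp
    also have "\<dots> \<le> K * c ^ 3 * ab ^ 3"
      using IH unfolding prodS P_def c_def by (intro mult_right_mono) (auto simp: ab_def)
    finally have "(real (card E) ^ 4 * P) * c ^ 3 \<le> (K * ab ^ 3) * c ^ 3" by (simp add: mult_ac)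
    then show ?thesis using pos unfolding c_def[symmetric] P_def ab_def by (simp add: mult_le_cancel_right)
  qed
qed

text \<open>Meant for integers encoded by their excess \<open>f1\<close> and their deficit
  \<open>f2\<close> relative to a fixed integer: an upper bound on the integer bounds f1 / f2,
  leaving at most K f2 choices of f1 for each f2 <= R.\<close>

lemma card_le_of_ratio_bound:
  fixes f1 f2 :: "nat \<Rightarrow> nat"
  assumes inj: "\<And>x y. x \<in> X \<Longrightarrow> y \<in> X \<Longrightarrow> f1 x = f1 y \<Longrightarrow> f2 x = f2 y \<Longrightarrow> x = y"
    and f1: "\<And>x. x \<in> X \<Longrightarrow> 1 \<le> f1 x \<and> real (f1 x) \<le> K * real (f2 x)"
    and f2: "\<And>x. x \<in> X \<Longrightarrow> 1 \<le> f2 x \<and> real (f2 x) \<le> R"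
    and "K \<ge> 0" "R \<ge> 0"
  shows "real (card X) \<le> K * R\<^sup>2"
proof -
  define T where "T = Sigma {1..nat \<lfloor>R\<rfloor>} (\<lambda>v. {1..nat \<lfloor>K * real v\<rfloor>})"
  have "(\<lambda>x. (f2 x, f1 x)) ` X \<subseteq> T"
    using f1 f2 by (auto simp: T_def le_nat_floor)
  moreover have "inj_on (\<lambda>x. (f2 x, f1 x)) X" using inj by (auto simp: inj_on_def)
  moreover have "finite T" by (simp add: T_def)
  ultimately have "card X \<le> card T" by (metis card_inj_on_le)
  also have "card T = (\<Sum>v\<in>{1..nat \<lfloor>R\<rfloor>}. nat \<lfloor>K * real v\<rfloor>)"
    unfolding T_def by simp
  finally have "real (card X) \<le> (\<Sum>v\<in>{1..nat \<lfloor>R\<rfloor>}. real (nat \<lfloor>K * real v\<rfloor>))"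
    by (simp flip: of_nat_sum)
  also have "\<dots> \<le> (\<Sum>v\<in>{1..nat \<lfloor>R\<rfloor>}. K * R)"
  proof (rule sum_mono)
    fix v assume v: "v \<in> {1..nat \<lfloor>R\<rfloor>}"
    then have "real v \<le> R" using assms(5) by (auto simp: le_nat_iff le_floor_iff)
    then have "K * real v \<le> K * R" using assms(4) by (rule mult_left_mono)
    moreover have "real (nat \<lfloor>K * real v\<rfloor>) \<le> K * real v" using assms(4) by simp
    ultimately show "real (nat \<lfloor>K * real v\<rfloor>) \<le> K * R" by linarith
  qed
  also have "\<dots> = real (nat \<lfloor>R\<rfloor>) * (K * R)" by simp
  also have "\<dots> \<le> R * (K * R)" by (rule mult_right_mono) (use assms(4,5) in auto)
  finally show ?thesis by (simp add: power2_eq_square mult_ac)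
qed

lemma prod_prime_powers_eq:
  fixes n :: nat
  assumes "finite Pr" "\<And>p. p \<in> Pr \<Longrightarrow> prime p" "n > 0" "prime_factors n \<subseteq> Pr"
  shows "(\<Prod>p\<in>Pr. p ^ multiplicity p n) = n"
proof -
  have "(\<Prod>p\<in>Pr. p ^ multiplicity p n) = (\<Prod>p\<in>prime_factors n. p ^ multiplicity p n)"
  proof (rule prod.mono_neutral_right)
    show "\<forall>p\<in>Pr - prime_factors n. p ^ multiplicity p n = 1"
    proof
      fix p assume p: "p \<in> Pr - prime_factors n"
      then have "\<not> p dvd n" using assms by (auto simp: prime_factors_dvd)
      then show "p ^ multiplicity p n = 1" by (simp add: not_dvd_imp_multiplicity_0)
    qed
  qed (use assms in auto)
  also have "\<dots> = n" using assms(3) prod_prime_factors[of n] by simp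
  finally show ?thesis .
qed

section \<open>Few pairs with large gcd and many unequal prime exponents\<close>

text \<open>Outside \<open>S\<close> a vertex differs from the common integer prod p^(k p) by an
  excess \<open>n1\<close> and a deficit \<open>n2\<close>. At each such p one endpoint of an edge
  has exponent k p exactly, so the gcd is at most g c divided by both deficits, and a large gcd
  makes the product of the deficits small. The deficit of one extremal vertex bounds one side
  directly and the other side inversely, so that it cancels.\<close>

lemma structured_count:
  fixes A B :: "nat set" and G :: "(nat \<times> nat) set" and M N D :: real and ii jj k :: "nat \<Rightarrow> nat"
  assumes Pr: "finite Pr" "\<And>p. p \<in> Pr \<Longrightarrow> prime p" and S: "S \<subseteq> Pr"
    and fin: "finite A" "finite B" and G: "G \<subseteq> A \<times> B" "G \<noteq> {}"
    and A: "\<And>n. n \<in> A \<Longrightarrow> n > 0 \<and> real n \<le> M \<and> prime_factors n \<subseteq> Pr"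
    and B: "\<And>n. n \<in> B \<Longrightarrow> n > 0 \<and> real n \<le> N \<and> prime_factors n \<subseteq> Pr"
    and ii: "\<And>p n. p \<in> S \<Longrightarrow> n \<in> A \<Longrightarrow> multiplicity p n = ii p"
    and jj: "\<And>p n. p \<in> S \<Longrightarrow> n \<in> B \<Longrightarrow> multiplicity p n = jj p"
    and k: "\<And>n m p. (n, m) \<in> G \<Longrightarrow> p \<in> Pr - S \<Longrightarrow> multiplicity p n = k p \<or> multiplicity p m = k p"
    and D: "\<And>n m. (n, m) \<in> G \<Longrightarrow> D \<le> real (gcd n m)" and "D > 0"
  shows "real (card G) ^ 2 * (\<Prod>p\<in>S. real p ^ nat_dist (ii p) (jj p)) * D\<^sup>2
      \<le> 4 * (real (card A) * real (card B)) * (M * N)"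
proof -
  define R where "R = Pr - S"
  have finSR: "finite S" "finite R" and PrSR: "Pr = S \<union> R" "S \<inter> R = {}"
    using Pr(1) S finite_subset by (auto simp: R_def)
  have p0: "p \<in> S \<union> R \<Longrightarrow> p > 0" for p using Pr(2) prime_gt_0_nat PrSR by blast
  define n1 n2 :: "nat \<Rightarrow> nat" where "n1 n = (\<Prod>p\<in>R. p ^ (multiplicity p n - k p))"
    and "n2 n = (\<Prod>p\<in>R. p ^ (k p - multiplicity p n))" for n
  define c sA sB g where "c = (\<Prod>p\<in>R. p ^ k p)" and "sA = (\<Prod>p\<in>S. p ^ ii p)" and "sB = (\<Prod>p\<in>S. p ^ jj p)"
    and "g = (\<Prod>p\<in>S. p ^ min (ii p) (jj p))"
  have pos: "n1 n > 0" "n2 n > 0" "c > 0" "sA > 0" "sB > 0" "g > 0" for n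
    using p0 by (auto simp: n1_def n2_def c_def sA_def sB_def g_def intro!: prod_pos)
  have split: "n * n2 n = (\<Prod>p\<in>S. p ^ multiplicity p n) * (c * n1 n)" if "n > 0" "prime_factors n \<subseteq> Pr" for n
  proof -
    have "n = (\<Prod>p\<in>S. p ^ multiplicity p n) * (\<Prod>p\<in>R. p ^ multiplicity p n)"
      using prod_prime_powers_eq[OF Pr that] finSR PrSR by (metis prod.union_disjoint)
    moreover have "(\<Prod>p\<in>R. p ^ multiplicity p n) * n2 n = c * n1 n"
      unfolding n1_def n2_def c_def prod.distrib[symmetric] power_add[symmetric]
      by (intro prod.cong refl arg_cong2[where f = power]) auto
    ultimately show ?thesis by (metis mult.assoc)
  qed
  have eqA: "n * n2 n = sA * (c * n1 n)" if "n \<in> A" for n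
    using split[of n] A[OF that] ii that by (simp add: sA_def)
  have eqB: "n * n2 n = sB * (c * n1 n)" if "n \<in> B" for n
    using split[of n] B[OF that] jj that by (simp add: sB_def)
  have gcd_le: "gcd n m * (n2 n * n2 m) \<le> g * c" if nm: "(n, m) \<in> G" for n m
  proof -
    have n: "n \<in> A" "m \<in> B" using nm G by auto
    have "gcd n m > 0" using A[OF n(1)] by simp
    moreover have "prime_factors (gcd n m) \<subseteq> Pr" using A[OF n(1)] by (auto simp: prime_factors_dvd)
    ultimately have "gcd n m = (\<Prod>p\<in>Pr. p ^ multiplicity p (gcd n m))"
      using prod_prime_powers_eq[OF Pr] by metis
    also have "\<dots> \<le> (\<Prod>p\<in>Pr. p ^ min (multiplicity p n) (multiplicity p m))"
    proof (intro prod_mono conjI power_increasing)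
      fix p assume p: "p \<in> Pr"
      show "multiplicity p (gcd n m) \<le> min (multiplicity p n) (multiplicity p m)"
        using A[OF n(1)] B[OF n(2)] by (auto intro: dvd_imp_multiplicity_le)
      show "1 \<le> p" using p p0 PrSR by (simp add: Suc_le_eq)
    qed auto
    also have "\<dots> = g * (\<Prod>p\<in>R. p ^ min (multiplicity p n) (multiplicity p m))"
      unfolding PrSR(1) using finSR PrSR(2) ii jj n by (simp add: prod.union_disjoint g_def)
    finally have "gcd n m * (n2 n * n2 m) \<le> g * (\<Prod>p\<in>R. p ^ min (multiplicity p n) (multiplicity p m)) * (n2 n * n2 m)"
      by (rule mult_right_mono) simp
    also have "\<dots> = g * ((\<Prod>p\<in>R. p ^ min (multiplicity p n) (multiplicity p m)) * (n2 n * n2 m))" by simp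
    also have "(\<Prod>p\<in>R. p ^ min (multiplicity p n) (multiplicity p m)) * (n2 n * n2 m) = c"
      unfolding n2_def c_def prod.distrib[symmetric] power_add[symmetric]
    proof (intro prod.cong refl arg_cong2[where f = power])
      fix p assume "p \<in> R"
      then have "multiplicity p n = k p \<or> multiplicity p m = k p" using k[OF nm] by (simp add: R_def)
      then show "min (multiplicity p n) (multiplicity p m) + (k p - multiplicity p n + (k p - multiplicity p m)) = k p"
        by auto
    qed
    finally show ?thesis .
  qed
  define a b e where "a = real (card A)" and "b = real (card B)" and "e = real (card G)"
  have finG: "finite G" using G fin finite_subset by blast
  have abe: "a > 0" "b > 0" "e > 0"
    using G fin finG by (auto simp: a_def b_def e_def card_gt_0_iff)
  define nb where "nb n = {m \<in> B. (n, m) \<in> G}" for n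
  have nb: "finite (nb n)" "nb n \<subseteq> B" for n using fin by (auto simp: nb_def)
  \<comment> \<open>At least half of the edges start at vertices of at least half the average
    degree. Among these \<open>n0\<close> has the largest deficit, which bounds all deficits in
    \<open>A2\<close>, while the gcd condition at \<open>n0\<close> bounds those of its neighbours
    by a constant over n2 n0.\<close>
  define A2 where "A2 = {n \<in> A. real (card (nb n)) \<ge> e / (2 * a)}"
  have A2: "finite A2" "A2 \<subseteq> A" using fin by (auto simp: A2_def)
  have "e = (\<Sum>n\<in>A. real (card (nb n)))"
  proof -
    have "G = Sigma A nb" using G by (auto simp: nb_def)
    then show ?thesis using fin nb by (simp add: e_def)
  qed
  also have "\<dots> = (\<Sum>n\<in>A2. real (card (nb n))) + (\<Sum>n\<in>A - A2. real (card (nb n)))"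
    using A2 fin by (metis add.commute sum.subset_diff)
  also have "\<dots> \<le> (\<Sum>n\<in>A2. b) + (\<Sum>n\<in>A - A2. e / (2 * a))"
    by (intro add_mono sum_mono) (use nb fin in \<open>auto simp: A2_def b_def card_mono\<close>)
  also have "(\<Sum>n\<in>A - A2. e / (2 * a)) \<le> (\<Sum>n\<in>A. e / (2 * a))"
    by (rule sum_mono2) (use fin abe in auto)
  also have "(\<Sum>n\<in>A. e / (2 * a)) = e / 2" using abe by (simp add: a_def)
  finally have A2card: "e / 2 \<le> real (card A2) * b" by simp
  then have "A2 \<noteq> {}" using abe by auto
  then have "Max (n2 ` A2) \<in> n2 ` A2" using A2 by (intro Max_in) auto
  then obtain n0 where n0: "n0 \<in> A2" "n2 n0 = Max (n2 ` A2)" by auto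
  have max: "n2 n \<le> n2 n0" if "n \<in> A2" for n using n0 A2 that by simp
  have n0A: "n0 \<in> A" using n0 A2 by auto
  have M0: "M > 0" using A[OF n0A] by auto
  have N0: "N > 0" using G B by fastforce
  have c1: "real (card A2) \<le> M / (sA * c) * (real (n2 n0))\<^sup>2"
  proof (rule card_le_of_ratio_bound)
    fix x y assume xy: "x \<in> A2" "y \<in> A2" "n1 x = n1 y" "n2 x = n2 y"
    then have "x * n2 x = y * n2 x" using eqA A2 by (metis subsetD)
    then show "x = y" using pos(2)[of x] by simp
  next
    fix x assume x: "x \<in> A2"
    then have xA: "x \<in> A" using A2 by auto
    have "real sA * real c * real (n1 x) = real x * real (n2 x)"
      using eqA[OF xA] by (metis mult.assoc of_nat_mult)
    also have "\<dots> \<le> M * real (n2 x)" using A[OF xA] by (intro mult_right_mono) auto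
    finally show "1 \<le> n1 x \<and> real (n1 x) \<le> M / (sA * c) * real (n2 x)"
      using pos by (simp add: field_simps Suc_le_eq)
    show "1 \<le> n2 x \<and> real (n2 x) \<le> real (n2 n0)" using pos max[OF x] by (simp add: Suc_le_eq)
  qed (use M0 in auto)
  define Q where "Q = real g * real c / (D * real (n2 n0))"
  have Q0: "Q \<ge> 0" using \<open>D > 0\<close> by (simp add: Q_def)
  have c2: "real (card (nb n0)) \<le> N / (sB * c) * Q\<^sup>2"
  proof (rule card_le_of_ratio_bound)
    fix x y assume xy: "x \<in> nb n0" "y \<in> nb n0" "n1 x = n1 y" "n2 x = n2 y"
    then have "x * n2 x = y * n2 x" using eqB nb by (metis subsetD)
    then show "x = y" using pos(2)[of x] by simp
  next
    fix x assume x: "x \<in> nb n0"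
    then have xB: "x \<in> B" using nb by auto
    have "real sB * real c * real (n1 x) = real x * real (n2 x)"
      using eqB[OF xB] by (metis mult.assoc of_nat_mult)
    also have "\<dots> \<le> N * real (n2 x)" using B[OF xB] by (intro mult_right_mono) auto
    finally show "1 \<le> n1 x \<and> real (n1 x) \<le> N / (sB * c) * real (n2 x)"
      using pos by (simp add: field_simps Suc_le_eq)
    have xG: "(n0, x) \<in> G" using x by (simp add: nb_def)
    have "D * (real (n2 n0) * real (n2 x)) \<le> real (gcd n0 x) * (real (n2 n0) * real (n2 x))"
      by (intro mult_right_mono D xG) auto
    also have "\<dots> \<le> real g * real c" using gcd_le[OF xG] by (metis of_nat_le_iff of_nat_mult)
    finally show "1 \<le> n2 x \<and> real (n2 x) \<le> Q"
      using pos \<open>D > 0\<close> by (simp add: Q_def field_simps Suc_le_eq)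
  qed (use N0 Q0 in auto)
  have deg: "e / (2 * a) \<le> real (card (nb n0))" using n0 by (simp add: A2_def)
  define s where "s = (\<Prod>p\<in>S. real p ^ nat_dist (ii p) (jj p))"
  \<comment> \<open>At each fixed prime 2 min (i, j) + |i - j| = i + j; this is how the gain
    \<open>s\<close> enters.\<close>
  have gs: "real g ^ 2 * s = real sA * real sB"
  proof -
    have "(real g)\<^sup>2 * s = (\<Prod>p\<in>S. (real p ^ min (ii p) (jj p))\<^sup>2 * real p ^ nat_dist (ii p) (jj p))"
      by (simp add: g_def s_def prod.distrib prod_power_distrib)
    also have "\<dots> = (\<Prod>p\<in>S. real p ^ ii p * real p ^ jj p)"
      by (intro prod.cong refl) (simp add: nat_dist_def min_def add.commute flip: power_mult power_add)
    finally show ?thesis by (simp add: sA_def sB_def prod.distrib)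
  qed
  have "e / 2 * (e / (2 * a)) \<le> (real (card A2) * b) * real (card (nb n0))"
    by (intro mult_mono A2card deg) (use abe in auto)
  also have "\<dots> \<le> (M / (sA * c) * (real (n2 n0))\<^sup>2 * b) * (N / (sB * c) * Q\<^sup>2)"
    by (intro mult_mono c1 c2) (use abe M0 in auto)
  also have "\<dots> = b * (M * N) * (real g)\<^sup>2 / (D\<^sup>2 * (real sA * real sB))"
    using pos(2)[of n0] pos(3-6) \<open>D > 0\<close> by (simp add: Q_def power_divide power_mult_distrib field_simps power2_eq_square)
  finally have "e\<^sup>2 * (D\<^sup>2 * (real sA * real sB)) \<le> 4 * a * (b * (M * N) * (real g)\<^sup>2)"
    using abe pos \<open>D > 0\<close> by (simp add: field_simps power2_eq_square)
  then have "(real g)\<^sup>2 * (e\<^sup>2 * s * D\<^sup>2) \<le> (real g)\<^sup>2 * (4 * (a * b) * (M * N))"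
    by (simp add: mult_ac flip: gs)
  then have "e\<^sup>2 * s * D\<^sup>2 \<le> 4 * (a * b) * (M * N)"
    using pos by (simp add: mult_le_cancel_left)
  then show ?thesis by (simp add: e_def a_def b_def s_def)
qed

section \<open>Weighted compression of the gcd graph\<close>

lemma summable_tail:
  fixes f :: "nat \<Rightarrow> real"
  assumes "summable f" "\<And>n. f n \<ge> 0" "r > 0"
  obtains n0 where "\<And>T. finite T \<Longrightarrow> (\<And>p. p \<in> T \<Longrightarrow> n0 < p) \<Longrightarrow> sum f T \<le> r"
proof -
  have "(\<lambda>n. \<Sum>i<n. f i) \<longlonglongrightarrow> suminf f" by (rule summable_LIMSEQ) fact
  then have "eventually (\<lambda>n. dist (\<Sum>i<n. f i) (suminf f) < r) sequentially"
    using assms(3) by (rule tendstoD)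
  then obtain n0 where n0: "dist (\<Sum>i<n0. f i) (suminf f) < r"
    by (auto simp: eventually_sequentially)
  show ?thesis
  proof (rule that[of n0])
    fix T assume T: "finite T" "\<And>p. p \<in> T \<Longrightarrow> n0 < p"
    have "{..<n0} \<inter> T = {}" by (auto dest!: T(2))
    then have "(\<Sum>i<n0. f i) + sum f T = sum f ({..<n0} \<union> T)"
      using T(1) by (simp add: sum.union_disjoint)
    also have "\<dots> \<le> suminf f" by (rule sum_le_suminf) (use assms T in auto)
    finally show "sum f T \<le> r" using n0 by (simp add: dist_real_def)
  qed
qed

lemma multiplicity_le_self:
  fixes p n :: nat
  assumes "prime p" "n > 0"
  shows "multiplicity p n \<le> n"
proof -
  have "p ^ multiplicity p n \<le> n" using assms multiplicity_dvd dvd_imp_le by blast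
  moreover have "multiplicity p n < p ^ multiplicity p n"
    using prime_gt_1_nat[OF assms(1)] by (simp add: power_gt_expt)
  ultimately show ?thesis by linarith
qed

text \<open>The primes above \<open>H\<close> dividing n m / gcd (n, m)^2, weighted by 1 / p;
  expressed through exponents because compression fixes exponents.\<close>

definition prime_tail :: "nat \<Rightarrow> nat \<Rightarrow> nat \<Rightarrow> real" where
  "prime_tail H n m = (\<Sum>p | prime p \<and> H < p \<and> multiplicity p n \<noteq> multiplicity p m. 1 / real p)"

text \<open>Every fixed prime p > H with different exponents is charged exp (- lam / p). Compression
  never lowers the charged quality, yet at its end the fixed primes alone account for \<eta> / 2 of
  the prime tail of some edge, so the final bound contains exp (- lam \<eta> / 2). As lam is of
  order H ln H, this beats exp (- \<Lambda> H) for any given \<Lambda>.\<close>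

theorem gcd_graph_bound:
  fixes \<eta> \<Lambda> :: real
  assumes "\<eta> > 0"
  obtains H0 where "\<And>H A B E M N D. H \<ge> H0 \<Longrightarrow> finite A \<Longrightarrow> finite B \<Longrightarrow> E \<subseteq> A \<times> B \<Longrightarrow> D > 0 \<Longrightarrow>
      (\<And>n. n \<in> A \<Longrightarrow> n > 0 \<and> real n \<le> M) \<Longrightarrow> (\<And>n. n \<in> B \<Longrightarrow> n > 0 \<and> real n \<le> N) \<Longrightarrow>
      (\<And>n m. (n, m) \<in> E \<Longrightarrow> D \<le> real (gcd n m) \<and> prime_tail H n m > \<eta>) \<Longrightarrow>
      real (card E) ^ 4 * D\<^sup>2 \<le> exp (- \<Lambda> * real H) * (real (card A) * real (card B)) ^ 3 * (M * N)"
proof -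
  \<comment> \<open>With \<rho> = p^(-1/5) the weight p^d leaves p^(d/5) after the loss \<rho>^(4
    d), and for d >= 1 one factor p^(1/5) pays the charge exp (- lam / p). The exceptional
    proportions are then of order p^(-6/5), and of order p^(-9/5) after weighting by 1 / p; both are
    summable.\<close>
  define r where "r = (\<lambda>p::nat. real p powr (- 1 / 5))"
  have r6: "r p ^ 6 = real p powr (- 6 / 5)" and r4: "r p ^ 4 / real p = real p powr (- 9 / 5)"
    and r4': "r p ^ 4 = real p powr (- 4 / 5)" if "p > 0" for p
  proof -
    show 1: "r p ^ 6 = real p powr (- 6 / 5)" "r p ^ 4 = real p powr (- 4 / 5)"
      using that by (auto simp: r_def powr_realpow[symmetric] powr_powr)
    have "real p powr (- 4 / 5) / real p = real p powr (- 4 / 5 - 1)" using that by (subst powr_diff) auto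
    then show "r p ^ 4 / real p = real p powr (- 9 / 5)" unfolding 1 by simp
  qed
  have "summable (\<lambda>p. 10 ^ 8 * real p powr (- 6 / 5))"
    by (intro summable_mult) (simp add: summable_real_powr_iff)
  then obtain n1 where n1: "\<And>T. finite T \<Longrightarrow> (\<And>p. p \<in> T \<Longrightarrow> n1 < p) \<Longrightarrow> (\<Sum>p\<in>T. 10 ^ 8 * real p powr (- 6 / 5)) \<le> 1 / 8"
    by (rule summable_tail[where r = "1/8"]) auto
  have "summable (\<lambda>p. 10 ^ 5 * real p powr (- 9 / 5))"
    by (intro summable_mult) (simp add: summable_real_powr_iff)
  then obtain n2 where n2: "\<And>T. finite T \<Longrightarrow> (\<And>p. p \<in> T \<Longrightarrow> n2 < p) \<Longrightarrow> (\<Sum>p\<in>T. 10 ^ 5 * real p powr (- 9 / 5)) \<le> \<eta> / 8"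
    by (rule summable_tail[where r = "\<eta>/8"]) (use assms in auto)
  \<comment> \<open>Beyond 768^5 the ratio p^(-1/5) is at most 1 / 768, as domination requires;
    beyond \<open>n1\<close> the exceptional edges amount to at most an eighth of all.\<close>
  define P0 where "P0 = max n1 (768 ^ 5)"
  define C where "C = (16::real) * (14 ^ 4) ^ Suc P0"
  \<comment> \<open>lam \<eta> / 2 = \<eta> H ln H / 10 has to reach (\<Lambda> + 1) H; the
    additional H absorbs ln C.\<close>
  define H0 where "H0 = max (max n2 P0) (max (nat \<lceil>exp (10 * (\<Lambda> + 1) / \<eta>)\<rceil>) (max 3 (nat \<lceil>ln C\<rceil>)))"
  show ?thesis
  proof (rule that[of H0])
    fix H A B and E :: "(nat \<times> nat) set" and M N D :: real
    assume H: "H \<ge> H0" and fin: "finite A" "finite B" and EAB: "E \<subseteq> A \<times> B" and D0: "D > 0"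
      and A: "\<And>n. n \<in> A \<Longrightarrow> n > 0 \<and> real n \<le> M" and B: "\<And>n. n \<in> B \<Longrightarrow> n > 0 \<and> real n \<le> N"
      and E: "\<And>n m. (n, m) \<in> E \<Longrightarrow> D \<le> real (gcd n m) \<and> prime_tail H n m > \<eta>"
    have H': "n2 \<le> H" "P0 \<le> H" "H \<ge> 3" "exp (10 * (\<Lambda> + 1) / \<eta>) \<le> real H" "ln C \<le> real H"
      using H by (auto simp: H0_def nat_le_iff ceiling_le_iff)
    \<comment> \<open>Chosen so that exp (- lam / p) >= p^(-1/5) for every p > H, as t ln t is
      increasing.\<close>
    define lam where "lam = real H * ln (real H) / 5"
    have lam0: "lam \<ge> 0" using H' by (simp add: lam_def)
    define Bd where "Bd = Max (A \<union> B \<union> {0})"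
    have Bd: "n \<le> Bd" if "n \<in> A \<union> B" for n unfolding Bd_def by (rule Max_ge) (use fin that in auto)
    define Pr where "Pr = primes_le Bd"
    \<comment> \<open>Bonus for small primes, gain in the structured count, charge for large primes.
      The correction at p = 0 keeps the weight positive for all natural p, as the induction
      demands.\<close>
    define w where "w = (\<lambda>p i j. (if p \<le> P0 then 14 ^ 4 else 1) * real (p + (if p = 0 then 1 else 0)) ^ nat_dist i j
        * (if H < p \<and> i \<noteq> j then exp (- lam / real p) else 1))"
    define K where "K = C * exp (- lam * \<eta> / 2) * (M * N) / D\<^sup>2"
    have Prprime: "prime p" if "p \<in> Pr" for p using that by (auto simp: Pr_def)
    have pf: "prime_factors n \<subseteq> Pr" if "n \<in> A \<union> B" "n > 0" for n
    proof
      fix p assume p: "p \<in> prime_factors n"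
      then have "p \<le> n" using that by (auto simp: prime_factors_dvd intro: dvd_imp_le)
      with p Bd[OF that(1)] show "p \<in> Pr" by (auto simp: Pr_def primes_le_def prime_factors_dvd)
    qed
    have main: "real (card E) ^ 4 * (\<Prod>p\<in>{}. w p 0 0) \<le> K * (real (card A) * real (card B)) ^ 3"
      if E0: "E \<noteq> {}"
    proof (rule exponent_induction[where w = w and v = multiplicity and A0 = A and B0 = B and E0 = E and I = "{..Bd}" and Pr = Pr and ii = "\<lambda>_. 0" and jj = "\<lambda>_. 0"])
      show "finite Pr" by (simp add: Pr_def)
      show "multiplicity p n \<in> {..Bd}" if "p \<in> Pr" "n \<in> A \<union> B" for p n
        using multiplicity_le_self[OF Prprime[OF that(1)], of n] A B Bd[OF that(2)] that(2) by fastforce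
      show "w p i j > 0" for p i j by (auto simp: w_def)
      obtain n m where nm: "(n, m) \<in> E" using E0 by auto
      have "M \<ge> 0" "N \<ge> 0" using nm EAB A[of n] B[of m] by auto
      then show "K \<ge> 0" by (simp add: K_def C_def)
    next
      fix S ii jj A' B' E'
      assume S: "S \<subseteq> Pr" and sub: "A' \<subseteq> A" "B' \<subseteq> B" "E' \<subseteq> E" "E' \<subseteq> A' \<times> B'" "E' \<noteq> {}"
        and ii: "\<And>p n. p \<in> S \<Longrightarrow> n \<in> A' \<Longrightarrow> multiplicity p n = ii p"
        and jj: "\<And>p n. p \<in> S \<Longrightarrow> n \<in> B' \<Longrightarrow> multiplicity p n = jj p"
        and fg: "\<And>p. p \<in> Pr - S \<Longrightarrow> fibred_graph A' B' E' (multiplicity p) (multiplicity p) {..Bd} (w p)"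
      define R where "R = Pr - S"
      have finR: "finite R" and finS: "finite S" using S finite_subset[of S Pr] by (auto simp: R_def Pr_def)
      have fin': "finite A'" "finite B'" using sub fin finite_subset by blast+
      have finE: "finite E'" using sub(4) fin' finite_subset by blast
      define e where e_eq: "e = real (card E')"
      have e0: "e > 0" using finE sub by (simp add: e_eq card_gt_0_iff)
      have RP0: "p > P0" if p: "p \<in> R" for p
      proof (rule ccontr)
        assume np: "\<not> p > P0"
        have p2: "p \<ge> 2" using Prprime p prime_ge_2_nat by (auto simp: R_def)
        interpret fibred_graph A' B' E' "multiplicity p" "multiplicity p" "{..Bd}" "w p"
          using fg p by (simp add: R_def)
        have "w p i j * (17 / 20) ^ (4 * nat_dist i j) \<ge> 14 ^ 4" for i j
        proof -
          have "(1::real) \<le> (real p * (17 / 20) ^ 4) ^ nat_dist i j"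
          proof (rule one_le_power)
            have "(1::real) \<le> 2 * (17 / 20) ^ 4" by (simp add: power_divide)
            also have "\<dots> \<le> real p * (17 / 20) ^ 4" using p2 by (intro mult_right_mono) auto
            finally show "1 \<le> real p * (17 / 20) ^ 4" .
          qed
          then show ?thesis using np p2 H'(2)
            by (simp add: w_def power_mult_distrib power_mult)
        qed
        then show False by (rule small_prime_unstable)
      qed
      have "\<exists>k. real (card {x \<in> E'. multiplicity p (fst x) \<noteq> multiplicity p (snd x)}) \<le> 10 ^ 5 * r p ^ 4 * e \<and>
          real (card {x \<in> E'. multiplicity p (fst x) \<noteq> k \<and> multiplicity p (snd x) \<noteq> k}) \<le> 10 ^ 8 * r p ^ 6 * e"
        if p: "p \<in> R" for p
      proof -
        have pP0: "p > P0" by (rule RP0) fact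
        then have p1: "real p \<ge> 768 ^ 5" by (simp add: P0_def)
        interpret fibred_graph A' B' E' "multiplicity p" "multiplicity p" "{..Bd}" "w p"
          using fg p by (simp add: R_def)
        have "r p \<le> (768 ^ 5) powr (- 1 / 5)" unfolding r_def by (rule powr_mono2') (use p1 in auto)
        also have "(768 ^ 5 :: real) = 768 powr (real 5)" by (rule powr_realpow[symmetric]) simp
        also have "(768 powr (real 5)) powr (- 1 / 5) = (768 powr (- 1) :: real)"
          unfolding powr_powr by (rule arg_cong) simp
        also have "(768 powr (- 1) :: real) = 1 / 768" by (simp only: powr_minus_divide) simp
        finally have r768: "r p \<le> 1 / 768" .
        have w1: "w p i j * r p ^ (4 * nat_dist i j) \<ge> 1" for i j
        proof (cases "i = j")
          case True
          then show ?thesis using pP0 by (simp add: w_def)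
        next
          case False
          define d where "d = nat_dist i j"
          have d1: "d \<ge> 1" using nat_dist_pos[OF False] by (simp add: d_def)
          have pr: "real p * r p ^ 4 = real p powr (1 / 5)"
          proof -
            have "real p powr (1 / 5) = real p powr (1 + - 4 / 5)" by simp
            also have "\<dots> = real p * real p powr (- 4 / 5)" using p1 by (subst powr_add) auto
            finally show ?thesis using r4'[of p] pP0 by simp
          qed
          have "(if H < p \<and> i \<noteq> j then exp (- lam / real p) else 1) \<ge> real p powr (- 1 / 5)"
          proof (cases "H < p")
            case True
            have "real H * ln (real H) \<le> real p * ln (real p)"
              using True H' by (intro mult_mono) auto
            then have "lam / real p \<le> ln (real p) / 5" using p1 by (simp add: lam_def field_simps)
            then have "- 1 / 5 * ln (real p) \<le> - lam / real p" by simp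
            then show ?thesis using p1 True False by (simp add: powr_def)
          next
            case False
            then show ?thesis using p1 powr_mono[of "- 1 / 5" 0 "real p"] by auto
          qed
          then have "w p i j * r p ^ (4 * d) \<ge> real p ^ d * real p powr (- 1 / 5) * r p ^ (4 * d)"
            unfolding w_def d_def using pP0 by (intro mult_right_mono) (auto simp: r_def)
          also have "real p ^ d * real p powr (- 1 / 5) * r p ^ (4 * d) = (real p * r p ^ 4) ^ d * real p powr (- 1 / 5)"
            by (simp add: power_mult power_mult_distrib)
          also have "\<dots> = (real p powr (1 / 5)) ^ d * real p powr (- 1 / 5)" unfolding pr ..
          finally have "w p i j * r p ^ (4 * d) \<ge> (real p powr (1 / 5)) ^ d * real p powr (- 1 / 5)" .
          moreover have "(real p powr (1 / 5)) ^ d * real p powr (- 1 / 5) \<ge> (real p powr (1 / 5)) ^ 1 * real p powr (- 1 / 5)"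
            using p1 d1 by (intro mult_right_mono power_increasing) (auto intro: ge_one_powr_ge_zero)
          moreover have "(real p powr (1 / 5)) ^ 1 * real p powr (- 1 / 5) = 1"
            using p1 by (simp flip: powr_add)
          ultimately show ?thesis by (simp add: d_def)
        qed
        show ?thesis
          by (rule prime_dominated[OF _ r768 w1]) (auto simp: r_def e_eq)
      qed
      then have "\<forall>p\<in>R. \<exists>k. real (card {x \<in> E'. multiplicity p (fst x) \<noteq> multiplicity p (snd x)}) \<le> 10 ^ 5 * r p ^ 4 * e \<and>
          real (card {x \<in> E'. multiplicity p (fst x) \<noteq> k \<and> multiplicity p (snd x) \<noteq> k}) \<le> 10 ^ 8 * r p ^ 6 * e"
        by (rule ballI)
      from bchoice[OF this] obtain k where k: "\<forall>p\<in>R. real (card {x \<in> E'. multiplicity p (fst x) \<noteq> multiplicity p (snd x)}) \<le> 10 ^ 5 * r p ^ 4 * e \<and>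
          real (card {x \<in> E'. multiplicity p (fst x) \<noteq> k p \<and> multiplicity p (snd x) \<noteq> k p}) \<le> 10 ^ 8 * r p ^ 6 * e"
        by (elim exE)
      have k1: "real (card {x \<in> E'. multiplicity p (fst x) \<noteq> multiplicity p (snd x)}) \<le> 10 ^ 5 * r p ^ 4 * e" if "p \<in> R" for p
        using bspec[OF k that] by (rule conjunct1)
      have k2: "real (card {x \<in> E'. multiplicity p (fst x) \<noteq> k p \<and> multiplicity p (snd x) \<noteq> k p}) \<le> 10 ^ 8 * r p ^ 6 * e" if "p \<in> R" for p
        using bspec[OF k that] by (rule conjunct2)
      have Rpos: "p > 0" if "p \<in> R" for p using RP0[OF that] by simp
      \<comment> \<open>\<open>X\<close> collects the edges that miss the dominating exponent at
        both ends for some free prime, \<open>Y\<close> those for which the free primes carry more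
        than half of the required tail. On the remaining edges the structured count applies, and the
        fixed primes carry the other half of the tail.\<close>
      define X where "X = (\<Union>p\<in>R. {x \<in> E'. multiplicity p (fst x) \<noteq> k p \<and> multiplicity p (snd x) \<noteq> k p})"
      define Rx where "Rx = (\<lambda>x. {p \<in> R. H < p \<and> multiplicity p (fst x) \<noteq> multiplicity p (snd x)})"
      define Y where "Y = {x \<in> E'. (\<Sum>p\<in>Rx x. 1 / real p) > \<eta> / 2}"
      have X: "real (card X) \<le> e / 8"
      proof -
        have "card X \<le> (\<Sum>p\<in>R. card {x \<in> E'. multiplicity p (fst x) \<noteq> k p \<and> multiplicity p (snd x) \<noteq> k p})"
          unfolding X_def by (rule card_UN_le) (rule finR)
        then have "real (card X) \<le> (\<Sum>p\<in>R. real (card {x \<in> E'. multiplicity p (fst x) \<noteq> k p \<and> multiplicity p (snd x) \<noteq> k p}))"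
          by (simp flip: of_nat_sum)
        also have "\<dots> \<le> (\<Sum>p\<in>R. 10 ^ 8 * real p powr (- 6 / 5) * e)"
          using k2 r6 Rpos by (intro sum_mono) force
        also have "\<dots> = (\<Sum>p\<in>R. 10 ^ 8 * real p powr (- 6 / 5)) * e" by (simp add: sum_distrib_right)
        also have "\<dots> \<le> 1 / 8 * e"
          using e0 by (intro mult_right_mono n1 finR) (use RP0 in \<open>auto simp: P0_def\<close>)
        finally show ?thesis by simp
      qed
      have Y: "real (card Y) \<le> e / 4"
      proof -
        have "real (card Y) * (\<eta> / 2) = (\<Sum>x\<in>Y. \<eta> / 2)" by simp
        also have "\<dots> \<le> (\<Sum>x\<in>Y. \<Sum>p\<in>Rx x. 1 / real p)" by (rule sum_mono) (auto simp: Y_def)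
        also have "\<dots> \<le> (\<Sum>x\<in>E'. \<Sum>p\<in>Rx x. 1 / real p)"
          by (rule sum_mono2) (use finE in \<open>auto simp: Y_def intro: sum_nonneg\<close>)
        also have "\<dots> = (\<Sum>x\<in>E'. \<Sum>p | p \<in> {p \<in> R. H < p} \<and> multiplicity p (fst x) \<noteq> multiplicity p (snd x). 1 / real p)"
          by (intro sum.cong refl) (auto simp: Rx_def)
        also have "\<dots> = (\<Sum>p\<in>{p \<in> R. H < p}. \<Sum>x | x \<in> E' \<and> multiplicity p (fst x) \<noteq> multiplicity p (snd x). 1 / real p)"
          by (rule sum.swap_restrict) (use finE finR in auto)
        also have "\<dots> \<le> (\<Sum>p\<in>{p \<in> R. H < p}. 10 ^ 5 * real p powr (- 9 / 5) * e)"
        proof (rule sum_mono)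
          fix p assume p: "p \<in> {p \<in> R. H < p}"
          have "(\<Sum>x | x \<in> E' \<and> multiplicity p (fst x) \<noteq> multiplicity p (snd x). 1 / real p)
              = real (card {x \<in> E'. multiplicity p (fst x) \<noteq> multiplicity p (snd x)}) / real p" by simp
          also have "\<dots> \<le> 10 ^ 5 * r p ^ 4 * e / real p" using k1 p by (intro divide_right_mono) auto
          also have "\<dots> = 10 ^ 5 * (r p ^ 4 / real p) * e" by simp
          also have "r p ^ 4 / real p = real p powr (- 9 / 5)" by (rule r4) (use p in simp)
          finally show "(\<Sum>x | x \<in> E' \<and> multiplicity p (fst x) \<noteq> multiplicity p (snd x). 1 / real p) \<le> 10 ^ 5 * real p powr (- 9 / 5) * e" .
        qed
        also have "\<dots> = (\<Sum>p\<in>{p \<in> R. H < p}. 10 ^ 5 * real p powr (- 9 / 5)) * e" by (simp add: sum_distrib_right)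
        also have "\<dots> \<le> \<eta> / 8 * e"
          using e0 by (intro mult_right_mono n2) (use finR H' in auto)
        finally have "real (card Y) * (\<eta> / 2) \<le> (e / 4) * (\<eta> / 2)" by (simp add: mult.commute)
        then show ?thesis using assms by (simp add: mult_le_cancel_right)
      qed
      define G where "G = E' - (X \<union> Y)"
      have finXY: "finite (X \<union> Y)" "X \<union> Y \<subseteq> E'" using finE finR by (auto simp: X_def Y_def)
      have "real (card G) = e - real (card (X \<union> Y))"
        unfolding G_def e_eq using finXY finE by (simp add: card_Diff_subset card_mono of_nat_diff)
      moreover have "real (card (X \<union> Y)) \<le> real (card X) + real (card Y)"
        by (metis card_Un_le of_nat_add of_nat_le_iff)
      ultimately have Ghalf: "real (card G) \<ge> e / 2" using X Y e0 by linarith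
      then have Gne: "G \<noteq> {}" using e0 by auto
      have GE: "G \<subseteq> E'" by (auto simp: G_def)
      have count: "real (card G) ^ 2 * (\<Prod>p\<in>S. real p ^ nat_dist (ii p) (jj p)) * D\<^sup>2
          \<le> 4 * (real (card A') * real (card B')) * (M * N)"
      proof (rule structured_count[where Pr = Pr and k = k])
        show "G \<subseteq> A' \<times> B'" using GE sub by auto
        show "n > 0 \<and> real n \<le> M \<and> prime_factors n \<subseteq> Pr" if "n \<in> A'" for n
          using A[of n] pf[of n] sub(1) that by auto
        show "n > 0 \<and> real n \<le> N \<and> prime_factors n \<subseteq> Pr" if "n \<in> B'" for n
          using B[of n] pf[of n] sub(2) that by auto
        show "multiplicity p n = k p \<or> multiplicity p m = k p" if "(n, m) \<in> G" "p \<in> Pr - S" for n m p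
          using that by (auto simp: G_def X_def R_def)
        show "D \<le> real (gcd n m)" if "(n, m) \<in> G" for n m using that GE sub E by blast
      qed (use Prprime S fin' Gne ii jj D0 in \<open>auto simp: Pr_def\<close>)
      define SH where "SH = {p \<in> S. H < p \<and> ii p \<noteq> jj p}"
      have "(\<Sum>p\<in>SH. 1 / real p) \<ge> \<eta> / 2"
      proof -
        obtain n m where nm: "(n, m) \<in> G" using Gne by auto
        then have nm': "n \<in> A'" "m \<in> B'" "(n, m) \<in> E" "n \<in> A" "m \<in> B" using GE sub by auto
        have "{p. prime p \<and> H < p \<and> multiplicity p n \<noteq> multiplicity p m} = SH \<union> Rx (n, m)"
        proof -
          have "p \<in> Pr" if "prime p" "multiplicity p n \<noteq> multiplicity p m" for p
          proof -
            have "p dvd n \<or> p dvd m" using that by (metis not_dvd_imp_multiplicity_0)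
            then have "p \<in> prime_factors n \<or> p \<in> prime_factors m"
              using A[OF nm'(4)] B[OF nm'(5)] that by (auto simp: prime_factors_dvd)
            then show ?thesis using pf[of n] pf[of m] nm' A[OF nm'(4)] B[OF nm'(5)] by auto
          qed
          then show ?thesis using ii[OF _ nm'(1)] jj[OF _ nm'(2)] S Prprime
            by (auto simp: SH_def Rx_def R_def)
        qed
        moreover have "SH \<inter> Rx (n, m) = {}" by (auto simp: SH_def Rx_def R_def)
        moreover have "finite SH" "finite (Rx (n, m))" using finS finR by (auto simp: SH_def Rx_def)
        ultimately have "prime_tail H n m = (\<Sum>p\<in>SH. 1 / real p) + (\<Sum>p\<in>Rx (n, m). 1 / real p)"
          by (simp add: prime_tail_def sum.union_disjoint)
        moreover have "prime_tail H n m > \<eta>" using E nm' by blast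
        moreover have "(\<Sum>p\<in>Rx (n, m). 1 / real p) \<le> \<eta> / 2" using nm GE by (auto simp: G_def Y_def)
        ultimately show ?thesis by linarith
      qed
      note SHsum = this
      define s where "s = (\<Prod>p\<in>S. real p ^ nat_dist (ii p) (jj p))"
      have s0: "s \<ge> 0" by (auto simp: s_def intro: prod_nonneg)
      have "(\<Prod>p\<in>S. w p (ii p) (jj p)) = (\<Prod>p\<in>S. if p \<le> P0 then 14 ^ 4 else 1) * s * (\<Prod>p\<in>S. if H < p \<and> ii p \<noteq> jj p then exp (- lam / real p) else 1)"
      proof -
        have "p \<noteq> 0" if "p \<in> S" for p using Prprime S that by (metis not_prime_0 subsetD)
        then have "w p (ii p) (jj p) = (if p \<le> P0 then 14 ^ 4 else 1) * real p ^ nat_dist (ii p) (jj p)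
            * (if H < p \<and> ii p \<noteq> jj p then exp (- lam / real p) else 1)" if "p \<in> S" for p
          using that unfolding w_def by (cases "p = 0") auto
        then show ?thesis unfolding s_def prod.distrib[symmetric] by (rule prod.cong[OF refl])
      qed
      also have "\<dots> \<le> (14 ^ 4) ^ Suc P0 * s * exp (- lam * \<eta> / 2)"
      proof (intro mult_mono)
        have "(\<Prod>p\<in>S. if p \<le> P0 then 14 ^ 4 else (1::real)) = (\<Prod>p\<in>{p \<in> S. p \<le> P0}. 14 ^ 4)"
          by (rule prod.inter_filter[symmetric, OF finS])
        also have "\<dots> = (14 ^ 4) ^ card {p \<in> S. p \<le> P0}" by simp
        also have "\<dots> \<le> (14 ^ 4) ^ Suc P0"
        proof (rule power_increasing)
          have "card {p \<in> S. p \<le> P0} \<le> card {..P0}" by (rule card_mono) auto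
          then show "card {p \<in> S. p \<le> P0} \<le> Suc P0" by simp
        qed simp
        finally show "(\<Prod>p\<in>S. if p \<le> P0 then 14 ^ 4 else (1::real)) \<le> (14 ^ 4) ^ Suc P0" .
        have "(\<Prod>p\<in>S. if H < p \<and> ii p \<noteq> jj p then exp (- lam / real p) else 1) = (\<Prod>p\<in>SH. exp (- lam / real p))"
          unfolding SH_def by (rule prod.inter_filter[symmetric, OF finS])
        also have "\<dots> = exp (\<Sum>p\<in>SH. - lam / real p)"
          using finS by (simp add: exp_sum SH_def)
        also have "(\<Sum>p\<in>SH. - lam / real p) = - lam * (\<Sum>p\<in>SH. 1 / real p)"
          by (simp add: sum_distrib_left sum_negf)
        also have "exp (- lam * (\<Sum>p\<in>SH. 1 / real p)) \<le> exp (- lam * \<eta> / 2)"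
          using mult_left_mono[OF SHsum lam0] by simp
        finally show "(\<Prod>p\<in>S. if H < p \<and> ii p \<noteq> jj p then exp (- lam / real p) else 1) \<le> exp (- lam * \<eta> / 2)" .
      qed (use s0 in \<open>auto intro!: prod_nonneg mult_nonneg_nonneg\<close>)
      finally have wle: "(\<Prod>p\<in>S. w p (ii p) (jj p)) \<le> (14 ^ 4) ^ Suc P0 * s * exp (- lam * \<eta> / 2)" .
      define ab where "ab = real (card A') * real (card B')"
      have eab: "e \<le> ab"
      proof -
        have "card E' \<le> card (A' \<times> B')" by (rule card_mono) (use fin' sub in auto)
        then show ?thesis unfolding e_eq ab_def by (metis card_cartesian_product of_nat_le_iff of_nat_mult)
      qed
      define c where "c = (14 ^ 4) ^ Suc P0 * exp (- lam * \<eta> / 2)"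
      have c0: "c \<ge> 0" by (simp add: c_def)
      have "e\<^sup>2 \<le> (2 * real (card G))\<^sup>2" by (rule power_mono) (use Ghalf e0 in auto)
      then have e2: "e\<^sup>2 * s * D\<^sup>2 \<le> 16 * ab * (M * N)"
        using count mult_right_mono[of "e\<^sup>2" "(2 * real (card G))\<^sup>2" "s * D\<^sup>2"] s0
        by (simp add: s_def[symmetric] ab_def power_mult_distrib mult_ac)
      \<comment> \<open>Two of the four factors e go into the structured count, the other two are
        bounded trivially by e <= |A'| |B'|; this produces the exponents 4 and 3 of the
        quality.\<close>
      have "e ^ 4 * (\<Prod>p\<in>S. w p (ii p) (jj p)) \<le> e ^ 4 * ((14 ^ 4) ^ Suc P0 * s * exp (- lam * \<eta> / 2))"
        by (rule mult_left_mono[OF wle]) simp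
      also have "\<dots> = c / D\<^sup>2 * (e\<^sup>2 * (e\<^sup>2 * s * D\<^sup>2))"
        using D0 by (simp add: c_def eval_nat_numeral)
      also have "\<dots> \<le> c / D\<^sup>2 * (ab\<^sup>2 * (16 * ab * (M * N)))"
      proof -
        have sq: "e\<^sup>2 \<le> ab\<^sup>2" by (rule power_mono) (use eab e0 in auto)
        have "0 \<le> e\<^sup>2 * s * D\<^sup>2" using s0 by simp
        then show ?thesis using c0 by (intro mult_left_mono mult_mono[OF sq e2]) auto
      qed
      also have "\<dots> = K * ab ^ 3" by (simp add: K_def C_def c_def power3_eq_cube power2_eq_square)
      finally show "real (card E') ^ 4 * (\<Prod>p\<in>S. w p (ii p) (jj p)) \<le> K * (real (card A') * real (card B')) ^ 3"
        by (simp add: e_eq ab_def)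
    qed (use fin EAB in auto)
    show "real (card E) ^ 4 * D\<^sup>2 \<le> exp (- \<Lambda> * real H) * (real (card A) * real (card B)) ^ 3 * (M * N)"
    proof (cases "E = {}")
      case True
      have "0 \<le> (real (card A) * real (card B)) ^ 3 * (M * N)"
      proof (cases "A = {} \<or> B = {}")
        case False
        then obtain n m where "n \<in> A" "m \<in> B" by auto
        then have "M \<ge> 0" "N \<ge> 0" using A[of n] B[of m] by auto
        then show ?thesis by simp
      qed auto
      with True show ?thesis by (simp add: mult.assoc)
    next
      case False
      then obtain n m where "(n, m) \<in> E" by auto
      then have MN: "M * N \<ge> 0" using EAB A[of n] B[of m] by auto
      have "C * exp (- lam * \<eta> / 2) \<le> exp (- \<Lambda> * real H)"
      proof -
        have C0: "C > 0" by (simp add: C_def)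
        have "10 * (\<Lambda> + 1) / \<eta> \<le> ln (real H)" using H' by (simp add: ln_ge_iff)
        then have "\<Lambda> + 1 \<le> ln (real H) * \<eta> / 10" using assms by (simp add: field_simps)
        then have "real H * (\<Lambda> + 1) \<le> real H * (ln (real H) * \<eta> / 10)" by (rule mult_left_mono) simp
        then have "ln C + - lam * \<eta> / 2 \<le> - \<Lambda> * real H" using H'(5) by (simp add: lam_def algebra_simps)
        then have "exp (ln C + - lam * \<eta> / 2) \<le> exp (- \<Lambda> * real H)" by simp
        then show ?thesis by (simp only: exp_add exp_ln[OF C0])
      qed
      then have "K * D\<^sup>2 \<le> exp (- \<Lambda> * real H) * (M * N)"
        unfolding K_def using D0 MN mult_right_mono by fastforce
      moreover have "real (card E) ^ 4 * D\<^sup>2 \<le> K * (real (card A) * real (card B)) ^ 3 * D\<^sup>2"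
        using main[OF False] by (intro mult_right_mono) auto
      ultimately show ?thesis
        using mult_right_mono[of "K * D\<^sup>2" "exp (- \<Lambda> * real H) * (M * N)" "(real (card A) * real (card B)) ^ 3"]
        by (simp add: mult_ac)
    qed
  qed
qed

section \<open>Periodic functions and tents\<close>

definition periodic :: "int \<Rightarrow> (int \<Rightarrow> real) \<Rightarrow> bool" where
  "periodic P f \<longleftrightarrow> (\<forall>k. f (k + P) = f k)"

lemma periodic_mult_int:
  assumes "periodic P f"
  shows "f (k + P * int t) = f k"
proof (induction t)
  case (Suc t)
  have "f (k + P * int (Suc t)) = f ((k + P * int t) + P)" by (simp add: algebra_simps)
  also have "\<dots> = f (k + P * int t)" using assms by (simp add: periodic_def)
  finally show ?case using Suc by simp
qed simp

lemma periodic_add_mult: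
  assumes "periodic P f"
  shows "f (k + P * j) = f k"
proof (cases "j \<ge> 0")
  case True
  then show ?thesis using periodic_mult_int[OF assms, of k "nat j"] by simp
next
  case False
  then show ?thesis using periodic_mult_int[OF assms, of "k + P * j" "nat (- j)"] by simp
qed

lemma periodic_mod:
  assumes "periodic P f"
  shows "f (k mod P) = f k"
  using periodic_add_mult[OF assms, of "k mod P" "k div P"] by simp

lemma sum_period_shift:
  assumes "periodic P f" "P > 0"
  shows "(\<Sum>k\<in>{a..<a + P}. f k) = (\<Sum>k\<in>{0..<P}. f k)"
proof -
  have step: "(\<Sum>k\<in>{b + 1..<b + 1 + P}. f k) = (\<Sum>k\<in>{b..<b + P}. f k)" for b
  proof -
    have "{b..<b + P} = insert b {b + 1..<b + P}" "{b + 1..<b + 1 + P} = insert (b + P) {b + 1..<b + P}"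
      using assms(2) by auto
    then show ?thesis using assms by (simp add: periodic_def)
  qed
  show ?thesis
  proof (induction a rule: int_induct[where k = 0])
    case (step2 i)
    then show ?case using step[of "i - 1"] by simp
  qed (use step in simp_all)
qed

lemma sum_periods:
  assumes "periodic P f" "P > 0"
  shows "(\<Sum>k\<in>{a..<a + P * int t}. f k) = real t * (\<Sum>k\<in>{0..<P}. f k)"
proof (induction t)
  case (Suc t)
  have "0 \<le> P * int t" using assms(2) by simp
  then have "{a..<a + P * int (Suc t)} = {a..<a + P * int t} \<union> {a + P * int t..<a + P * int t + P}"
    using assms(2) by (subst ivl_disj_un_two(3)) (simp_all add: algebra_simps)
  moreover have "{a..<a + P * int t} \<inter> {a + P * int t..<a + P * int t + P} = {}" by auto
  ultimately have "(\<Sum>k\<in>{a..<a + P * int (Suc t)}. f k)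
     = (\<Sum>k\<in>{a..<a + P * int t}. f k) + (\<Sum>k\<in>{a + P * int t..<a + P * int t + P}. f k)"
    by (simp add: sum.union_disjoint)
  then show ?case using Suc sum_period_shift[OF assms, of "a + P * int t"] by (simp add: algebra_simps)
qed simp

lemma sum_periodic_le:
  assumes "periodic P f" "P > 0" "\<And>k. f k \<ge> 0" "L \<ge> 0"
  shows "(\<Sum>k\<in>{a..<a + L}. f k) \<le> (real_of_int L / real_of_int P + 1) * (\<Sum>k\<in>{0..<P}. f k)"
proof -
  define t where "t = nat (L div P + 1)"
  have t: "int t = L div P + 1" using assms by (simp add: t_def pos_imp_zdiv_nonneg_iff)
  have "L \<le> P * int t" unfolding t using assms(2)
    by (smt (verit) distrib_left mult_cancel_left1 mult_div_mod_eq pos_mod_bound)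
  then have "(\<Sum>k\<in>{a..<a + L}. f k) \<le> (\<Sum>k\<in>{a..<a + P * int t}. f k)"
    using assms(3) by (intro sum_mono2) auto
  also have "\<dots> = real t * (\<Sum>k\<in>{0..<P}. f k)" by (rule sum_periods) fact+
  also have "\<dots> \<le> (real_of_int L / real_of_int P + 1) * (\<Sum>k\<in>{0..<P}. f k)"
  proof (rule mult_right_mono)
    have "real t = real_of_int (L div P) + 1" using t by linarith
    also have "\<dots> \<le> real_of_int L / real_of_int P + 1" by (simp add: real_of_int_div4)
    finally show "real t \<le> real_of_int L / real_of_int P + 1" .
  qed (use assms(3) in \<open>auto intro: sum_nonneg\<close>)
  finally show ?thesis .
qed

lemma sum_periodic_ge:
  assumes "periodic P f" "P > 0" "\<And>k. f k \<ge> 0" "L \<ge> 0"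
  shows "(\<Sum>k\<in>{a..<a + L}. f k) \<ge> (real_of_int L / real_of_int P - 1) * (\<Sum>k\<in>{0..<P}. f k)"
proof -
  define t where "t = nat (L div P)"
  have t: "int t = L div P" using assms by (simp add: t_def pos_imp_zdiv_nonneg_iff)
  have "P * int t \<le> L" unfolding t using assms(2)
    by (smt (verit) mult_div_mod_eq pos_mod_sign)
  have "(real_of_int L / real_of_int P - 1) * (\<Sum>k\<in>{0..<P}. f k) \<le> real t * (\<Sum>k\<in>{0..<P}. f k)"
  proof (rule mult_right_mono)
    have "real t = real_of_int (L div P)" using t by linarith
    also have "\<dots> \<ge> real_of_int L / real_of_int P - 1"
      by (metis add_diff_cancel diff_mono floor_divide_of_int_eq less_eq_real_def order.refl real_of_int_floor_add_one_ge)
    finally show "real_of_int L / real_of_int P - 1 \<le> real t" .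
  qed (use assms(3) in \<open>auto intro: sum_nonneg\<close>)
  also have "\<dots> = (\<Sum>k\<in>{a..<a + P * int t}. f k)" by (rule sum_periods[symmetric]) fact+
  also have "\<dots> \<le> (\<Sum>k\<in>{a..<a + L}. f k)"
    using assms(3) \<open>P * int t \<le> L\<close> by (intro sum_mono2) auto
  finally show ?thesis .
qed

lemma periodic_prod:
  assumes "\<And>p. p \<in> S \<Longrightarrow> periodic p (\<phi> p)" "\<And>p. p \<in> S \<Longrightarrow> p dvd P"
  shows "periodic P (\<lambda>k. \<Prod>p\<in>S. \<phi> p k)"
  unfolding periodic_def
proof
  fix k
  have "\<phi> p (k + P) = \<phi> p k" if p: "p \<in> S" for p
  proof -
    obtain j where "P = p * j" using assms(2)[OF p] by (rule dvdE)
    then show ?thesis using periodic_add_mult[OF assms(1)[OF p]] by simp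
  qed
  then show "(\<Prod>p\<in>S. \<phi> p (k + P)) = (\<Prod>p\<in>S. \<phi> p k)" by (intro prod.cong) auto
qed

text \<open>The Chinese remainder theorem in the form k = i + P j: for fixed i the numbers i + P j
  run through all residues modulo p.\<close>

lemma sum_coprime_periods:
  fixes P p :: int
  assumes f: "periodic P f" and g: "periodic p g" and "coprime P p" "P > 0" "p > 0"
  shows "(\<Sum>k\<in>{0..<P * p}. f k * g k) = (\<Sum>k\<in>{0..<P}. f k) * (\<Sum>k\<in>{0..<p}. g k)"
proof -
  have bij: "bij_betw (\<lambda>(i, j). i + P * j) ({0..<P} \<times> {0..<p}) {0..<P * p}"
  proof (rule bij_betwI[where g = "\<lambda>k. (k mod P, k div P)"])
    show "(\<lambda>(i, j). i + P * j) \<in> {0..<P} \<times> {0..<p} \<rightarrow> {0..<P * p}"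
    proof
      fix x assume "x \<in> {0..<P} \<times> {0..<p}"
      then obtain i j where x: "x = (i, j)" "0 \<le> i" "i < P" "0 \<le> j" "j + 1 \<le> p" by auto
      have "P * (j + 1) \<le> P * p" using x assms by (intro mult_left_mono) auto
      then show "(case x of (i, j) \<Rightarrow> i + P * j) \<in> {0..<P * p}"
        using x assms by (simp add: algebra_simps)
    qed
    show "(\<lambda>k. (k mod P, k div P)) \<in> {0..<P * p} \<rightarrow> {0..<P} \<times> {0..<p}"
    proof
      fix k assume k: "k \<in> {0..<P * p}"
      have "k div P < p"
      proof (rule ccontr)
        assume "\<not> k div P < p"
        then have "P * p \<le> P * (k div P)" using assms by (intro mult_left_mono) auto
        also have "\<dots> = k - k mod P" by (simp add: minus_mod_eq_mult_div)
        also have "\<dots> \<le> k" using assms by simp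
        finally show False using k by simp
      qed
      then show "(k mod P, k div P) \<in> {0..<P} \<times> {0..<p}"
        using assms k by (simp add: pos_imp_zdiv_nonneg_iff)
    qed
  qed (use assms in auto)
  have inner: "(\<Sum>j\<in>{0..<p}. g (i + P * j)) = (\<Sum>k\<in>{0..<p}. g k)" for i
  proof -
    have "bij_betw (\<lambda>j. (i + P * j) mod p) {0..<p} {0..<p}"
    proof -
      have inj: "inj_on (\<lambda>j. (i + P * j) mod p) {0..<p}"
      proof (rule inj_onI)
        fix x y assume xy: "x \<in> {0..<p}" "y \<in> {0..<p}" "(i + P * x) mod p = (i + P * y) mod p"
        then have "p dvd (i + P * x) - (i + P * y)" by (simp only: mod_eq_dvd_iff)
        then have "p dvd P * (x - y)" by (simp add: algebra_simps)
        then have "p dvd x - y" using assms(3) by (simp add: coprime_dvd_mult_right_iff coprime_commute)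
        then have "x mod p = y mod p" by (simp only: mod_eq_dvd_iff)
        then show "x = y" using xy by simp
      qed
      moreover have "(\<lambda>j. (i + P * j) mod p) ` {0..<p} \<subseteq> {0..<p}" using assms by auto
      ultimately show ?thesis unfolding bij_betw_def by (simp add: endo_inj_surj)
    qed
    then have "(\<Sum>k\<in>{0..<p}. g k) = (\<Sum>j\<in>{0..<p}. g ((i + P * j) mod p))"
      by (rule sum.reindex_bij_betw[symmetric])
    then show ?thesis by (simp add: periodic_mod[OF g])
  qed
  have "(\<Sum>k\<in>{0..<P * p}. f k * g k) = (\<Sum>(i, j)\<in>{0..<P} \<times> {0..<p}. f (i + P * j) * g (i + P * j))"
    using sum.reindex_bij_betw[OF bij, of "\<lambda>k. f k * g k"] by (simp add: case_prod_unfold)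
  also have "\<dots> = (\<Sum>i\<in>{0..<P}. \<Sum>j\<in>{0..<p}. f i * g (i + P * j))"
    by (simp add: sum.cartesian_product periodic_add_mult[OF f])
  also have "\<dots> = (\<Sum>i\<in>{0..<P}. f i * (\<Sum>k\<in>{0..<p}. g k))"
    by (simp add: inner flip: sum_distrib_left)
  finally show ?thesis by (simp add: sum_distrib_right)
qed

lemma sum_prod_periodic:
  fixes \<phi> :: "nat \<Rightarrow> int \<Rightarrow> real"
  assumes "finite S" "\<And>p. p \<in> S \<Longrightarrow> prime p" "\<And>p. p \<in> S \<Longrightarrow> periodic (int p) (\<phi> p)"
  shows "(\<Sum>k\<in>{0..<int (\<Prod>S)}. \<Prod>p\<in>S. \<phi> p k) = (\<Prod>p\<in>S. \<Sum>k\<in>{0..<int p}. \<phi> p k)"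
  using assms
proof (induction S)
  case (insert p S)
  have "periodic (int (\<Prod>S)) (\<lambda>k. \<Prod>q\<in>S. \<phi> q k)"
    using insert.prems insert.hyps(1) unfolding periodic_def
  proof (intro allI prod.cong refl)
    fix k q assume q: "q \<in> S"
    then have "q dvd \<Prod>S" using insert.hyps using dvd_prodI[of S q "\<lambda>x. x"] by simp
    then obtain j where "\<Prod>S = q * j" by (rule dvdE)
    then show "\<phi> q (k + int (\<Prod>S)) = \<phi> q k"
      using periodic_add_mult[of "int q" "\<phi> q" k "int j"] insert.prems q by simp
  qed
  moreover have "coprime (int (\<Prod>S)) (int p)"
    unfolding coprime_int_iff
    by (intro prod_coprime_left) (metis insertCI insert.prems(1) insert.hyps(2) primes_coprime)
  moreover have "p > 0" "\<Prod>S > 0" using insert.prems prime_gt_0_nat by (auto intro!: prod_pos)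
  ultimately have "(\<Sum>k\<in>{0..<int (\<Prod>S) * int p}. (\<Prod>q\<in>S. \<phi> q k) * \<phi> p k)
    = (\<Sum>k\<in>{0..<int (\<Prod>S)}. \<Prod>q\<in>S. \<phi> q k) * (\<Sum>k\<in>{0..<int p}. \<phi> p k)"
    using insert.prems by (intro sum_coprime_periods) (auto simp del: of_nat_prod)
  then show ?case using insert by (simp add: mult.commute)
qed simp

text \<open>The length of the intersection of two intervals of length \<open>c\<close> whose centres differ by \<open>u\<close>.\<close>

definition tent :: "real \<Rightarrow> real \<Rightarrow> real" where
  "tent c u = max 0 (c - \<bar>u\<bar>)"

section \<open>Sums of tents over arithmetic progressions\<close>

lemma tent_nonneg: "tent c u \<ge> 0" by (simp add: tent_def)

lemma tent_perturb: "tent c (x + e) \<le> tent (c + \<bar>e\<bar>) x" by (simp add: tent_def)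

lemma tent_antimono: "\<bar>x\<bar> \<le> \<bar>y\<bar> \<Longrightarrow> tent c y \<le> tent c x" by (simp add: tent_def)

text \<open>A Riemann sum of a decreasing function, telescoped through the antiderivative - tent^2 /
  2; the term j = 0 contributes the extra c.\<close>

lemma sum_tent_progression_le:
  assumes "c \<ge> 0" "u > 0"
  shows "(\<Sum>j<n. tent c (u * real j)) \<le> c + c\<^sup>2 / (2 * u)"
proof -
  have step: "u * tent c (u * real (Suc j)) \<le> ((tent c (u * real j))\<^sup>2 - (tent c (u * real (Suc j)))\<^sup>2) / 2" for j
  proof (cases "c - u * real (Suc j) > 0")
    case True
    define a where "a = c - u * real (Suc j)"
    have pos: "u * real j \<ge> 0" "u * real (Suc j) \<ge> 0" using assms by auto
    have e: "tent c (u * real (Suc j)) = a" "tent c (u * real j) = a + u"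
      using True assms pos by (auto simp: tent_def a_def algebra_simps)
    show ?thesis unfolding e using assms by (simp add: power2_eq_square algebra_simps)
  next
    case False
    have "u * real (Suc j) \<ge> 0" using assms by auto
    then have "tent c (u * real (Suc j)) = 0" using False by (simp add: tent_def)
    then show ?thesis by simp
  qed
  have "u * (\<Sum>j<n. tent c (u * real (Suc j))) \<le> ((tent c 0)\<^sup>2 - (tent c (u * real n))\<^sup>2) / 2" for n
  proof (induction n)
    case (Suc n)
    then show ?case using step[of n] by (simp add: distrib_left diff_divide_distrib)
  qed simp
  note tele = this
  show ?thesis
  proof (cases n)
    case 0
    then show ?thesis using assms by simp
  next
    case (Suc k)
    have "(\<Sum>j<n. tent c (u * real j)) = tent c 0 + (\<Sum>j<k. tent c (u * real (Suc j)))"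
      unfolding Suc by (simp add: sum.lessThan_Suc_shift del: sum.lessThan_Suc)
    moreover have "u * (\<Sum>j<k. tent c (u * real (Suc j))) \<le> c\<^sup>2 / 2"
    proof -
      have t0: "tent c 0 = c" using assms by (simp add: tent_def)
      have "(c\<^sup>2 - (tent c (u * real k))\<^sup>2) / 2 \<le> c\<^sup>2 / 2" by simp
      then show ?thesis using tele[of k] unfolding t0 by linarith
    qed
    then have "(\<Sum>j<k. tent c (u * real (Suc j))) \<le> c\<^sup>2 / (2 * u)" using assms by (simp add: field_simps)
    moreover have "tent c 0 \<le> c" using assms by (simp add: tent_def)
    ultimately show ?thesis by linarith
  qed
qed

text \<open>Each half of the progression, on either side of 0, is moved towards 0 until it starts
  there, which only increases the tents.\<close>

lemma sum_tent_ints_le: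
  assumes "c \<ge> 0" "u > 0" "finite W"
  shows "(\<Sum>w\<in>W. tent c (z + u * real_of_int w)) \<le> c\<^sup>2 / u + 2 * c"
proof -
  have half: "(\<Sum>w\<in>V. tent c (z + u * real_of_int w)) \<le> c + c\<^sup>2 / (2 * u)"
    if V: "finite V" "\<And>w. w \<in> V \<Longrightarrow> z + u * real_of_int w \<ge> 0" for V z
  proof -
    define w0 where "w0 = \<lceil>- z / u\<rceil>"
    have ge: "w \<ge> w0" if "w \<in> V" for w
      unfolding w0_def ceiling_le_iff using V(2)[OF that] assms by (simp add: field_simps)
    have w0: "z + u * real_of_int w0 \<ge> 0"
    proof -
      have "- z / u \<le> real_of_int w0" by (simp add: w0_def)
      then show ?thesis using assms by (simp add: field_simps)
    qed
    define N where "N = Suc (Max (insert 0 ((\<lambda>w. nat (w - w0)) ` V)))"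
    have "(\<Sum>w\<in>V. tent c (z + u * real_of_int w)) \<le> (\<Sum>w\<in>V. tent c (u * real (nat (w - w0))))"
    proof (intro sum_mono tent_antimono)
      fix w assume w: "w \<in> V"
      have "real (nat (w - w0)) = real_of_int w - real_of_int w0" using ge[OF w] by simp
      then have "u * real (nat (w - w0)) = (z + u * real_of_int w) - (z + u * real_of_int w0)"
        by (simp add: algebra_simps)
      then have "u * real (nat (w - w0)) \<le> z + u * real_of_int w" using w0 by linarith
      moreover have "0 \<le> u * real (nat (w - w0))" using assms by simp
      ultimately show "\<bar>u * real (nat (w - w0))\<bar> \<le> \<bar>z + u * real_of_int w\<bar>" by linarith
    qed
    also have "\<dots> = (\<Sum>j\<in>(\<lambda>w. nat (w - w0)) ` V. tent c (u * real j))"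
      by (subst sum.reindex) (use ge in \<open>auto intro!: inj_onI dest!: ge\<close>)
    also have "\<dots> \<le> (\<Sum>j<N. tent c (u * real j))"
    proof (rule sum_mono2)
      show "(\<lambda>w. nat (w - w0)) ` V \<subseteq> {..<N}"
        using V(1) by (auto simp: N_def less_Suc_eq_le intro!: Max_ge)
    qed (auto simp: tent_nonneg)
    also have "\<dots> \<le> c + c\<^sup>2 / (2 * u)" by (rule sum_tent_progression_le) fact+
    finally show ?thesis .
  qed
  define V1 V2 where "V1 = {w \<in> W. z + u * real_of_int w \<ge> 0}" and "V2 = {w \<in> W. \<not> z + u * real_of_int w \<ge> 0}"
  have "W = V1 \<union> V2" "V1 \<inter> V2 = {}" "finite V1" "finite V2" using assms by (auto simp: V1_def V2_def)
  then have "(\<Sum>w\<in>W. tent c (z + u * real_of_int w)) = (\<Sum>w\<in>V1. tent c (z + u * real_of_int w)) + (\<Sum>w\<in>V2. tent c (z + u * real_of_int w))"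
    by (simp add: sum.union_disjoint)
  moreover have "(\<Sum>w\<in>V1. tent c (z + u * real_of_int w)) \<le> c + c\<^sup>2 / (2 * u)"
    by (rule half) (use assms in \<open>auto simp: V1_def\<close>)
  moreover have "(\<Sum>w\<in>V2. tent c (z + u * real_of_int w)) \<le> c + c\<^sup>2 / (2 * u)"
  proof -
    have "(\<Sum>w\<in>V2. tent c (z + u * real_of_int w)) = (\<Sum>w\<in>uminus ` V2. tent c (- z + u * real_of_int w))"
      by (subst sum.reindex) (auto simp: tent_def inj_on_def abs_minus_commute intro!: sum.cong)
    also have "\<dots> \<le> c + c\<^sup>2 / (2 * u)"
      by (rule half) (use assms in \<open>auto simp: V2_def\<close>)
    finally show ?thesis .
  qed
  moreover have "c\<^sup>2 / u = c\<^sup>2 / (2 * u) + c\<^sup>2 / (2 * u)" by simp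
  ultimately show ?thesis by linarith
qed

text \<open>On each period the tent is replaced by a constant upper bound, so that only the mean
  \<mu> of \<open>F\<close> enters, at the price of an error \<mu> R c on each side. The term h = 0
  is left out because it represents the coincidences n \<alpha> = m \<beta>, which are treated
  apart.\<close>

lemma sum_tent_periodic_le:
  assumes F: "periodic R F" "\<And>h. F h \<ge> 0" "R > 0" and mean: "(\<Sum>h\<in>{0..<R}. F h) = real_of_int R * \<mu>"
    and c: "c \<ge> 0" "u > 0"
  shows "(\<Sum>h\<in>{-N..N} - {0}. tent c (u * real_of_int h) * F h) \<le> \<mu> * (c\<^sup>2 / u + 2 * real_of_int R * c)"
proof -
  have half: "(\<Sum>h\<in>{1..int n}. tent c (u * real_of_int h) * F h) \<le> \<mu> * (c\<^sup>2 / (2 * u) + real_of_int R * c)"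
    if F: "periodic R F" "\<And>h. F h \<ge> 0" "(\<Sum>h\<in>{0..<R}. F h) = real_of_int R * \<mu>" for F n
  proof -
    have block: "(\<Sum>h\<in>{1..<1 + R * int t}. tent c (u * real_of_int h) * F h)
       \<le> (\<Sum>j<t. tent c (u * real_of_int R * real j)) * (real_of_int R * \<mu>)" for t
    proof (induction t)
      case (Suc t)
      have "0 \<le> R * int t" using assms(3) by simp
      then have "{1..<1 + R * int (Suc t)} = {1..<1 + R * int t} \<union> {1 + R * int t..<1 + R * int t + R}"
        using assms(3) by (subst ivl_disj_un_two(3)) (simp_all add: algebra_simps)
      moreover have "{1..<1 + R * int t} \<inter> {1 + R * int t..<1 + R * int t + R} = {}" by auto
      ultimately have "(\<Sum>h\<in>{1..<1 + R * int (Suc t)}. tent c (u * real_of_int h) * F h)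
        = (\<Sum>h\<in>{1..<1 + R * int t}. tent c (u * real_of_int h) * F h)
          + (\<Sum>h\<in>{1 + R * int t..<1 + R * int t + R}. tent c (u * real_of_int h) * F h)"
        by (simp add: sum.union_disjoint)
      moreover have "(\<Sum>h\<in>{1 + R * int t..<1 + R * int t + R}. tent c (u * real_of_int h) * F h)
        \<le> (\<Sum>h\<in>{1 + R * int t..<1 + R * int t + R}. tent c (u * real_of_int R * real t) * F h)"
      proof (intro sum_mono mult_right_mono tent_antimono F)
        fix h assume h: "h \<in> {1 + R * int t..<1 + R * int t + R}"
        then have "real_of_int (R * int t) \<le> real_of_int h" by (simp only: of_int_le_iff) auto
        then have "u * real_of_int (R * int t) \<le> u * real_of_int h" using c by (intro mult_left_mono) auto
        moreover have "0 \<le> u * real_of_int (R * int t)" using c assms(3) by simp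
        ultimately show "\<bar>u * real_of_int R * real t\<bar> \<le> \<bar>u * real_of_int h\<bar>" by (simp add: mult.assoc)
      qed
      moreover have "\<dots> = tent c (u * real_of_int R * real t) * (real_of_int R * \<mu>)"
        using sum_period_shift[OF F(1) assms(3)] F(3) by (simp flip: sum_distrib_left)
      ultimately show ?case using Suc by (simp add: distrib_right)
    qed simp
    have "(\<Sum>h\<in>{1..int n}. tent c (u * real_of_int h) * F h) \<le> (\<Sum>h\<in>{1..<1 + R * int n}. tent c (u * real_of_int h) * F h)"
    proof (rule sum_mono2)
      have "1 * int n \<le> R * int n" by (rule mult_right_mono) (use assms(3) in auto)
      then have "int n < 1 + R * int n" by linarith
      then show "{1..int n} \<subseteq> {1..<1 + R * int n}" by (meson atLeastAtMost_iff atLeastLessThan_iff order.strict_trans1 subsetI)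
    qed (auto simp: tent_nonneg F)
    also have "\<dots> \<le> (\<Sum>j<n. tent c (u * real_of_int R * real j)) * (real_of_int R * \<mu>)" by (rule block)
    also have "\<dots> \<le> (c + c\<^sup>2 / (2 * (u * real_of_int R))) * (real_of_int R * \<mu>)"
    proof (intro mult_right_mono sum_tent_progression_le)
      show "0 \<le> real_of_int R * \<mu>" unfolding F(3)[symmetric] by (intro sum_nonneg F)
    qed (use assms in auto)
    also have "\<dots> = \<mu> * (c\<^sup>2 / (2 * u) + real_of_int R * c)" using assms(3) by (simp add: field_simps)
    finally show ?thesis .
  qed
  define n where "n = nat N"
  define F' where "F' = (\<lambda>h. F (- h))"
  have F': "periodic R F'"
    unfolding periodic_def F'_def
  proof
    fix k show "F (- (k + R)) = F (- k)" using F(1)[unfolded periodic_def, rule_format, of "- k - R"] by simp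
  qed
  have mean': "(\<Sum>h\<in>{0..<R}. F' h) = real_of_int R * \<mu>"
  proof -
    have "(\<Sum>h\<in>{0..<R}. F' h) = (\<Sum>h\<in>uminus ` {0..<R}. F h)"
      by (subst sum.reindex) (auto simp: F'_def inj_on_def)
    also have "uminus ` {0..<R} = {1 - R..<1 - R + R}"
    proof
      show "{1 - R..<1 - R + R} \<subseteq> uminus ` {0..<R}"
      proof
        fix x assume "x \<in> {1 - R..<1 - R + R}"
        then have "- x \<in> {0..<R}" by auto
        then have "- (- x) \<in> uminus ` {0..<R}" by (rule imageI)
        then show "x \<in> uminus ` {0..<R}" by simp
      qed
    qed auto
    finally show ?thesis using sum_period_shift[OF F(1,3), of "1 - R"] mean by simp
  qed
  have "{-N..N} - {0} \<subseteq> {1..int n} \<union> uminus ` {1..int n}"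
  proof
    fix x assume "x \<in> {-N..N} - {0}"
    then have "x \<in> {1..int n} \<or> - x \<in> {1..int n}" by (auto simp: n_def)
    then show "x \<in> {1..int n} \<union> uminus ` {1..int n}" by (metis UnI1 UnI2 imageI minus_minus)
  qed
  then have "(\<Sum>h\<in>{-N..N} - {0}. tent c (u * real_of_int h) * F h)
    \<le> (\<Sum>h\<in>{1..int n} \<union> uminus ` {1..int n}. tent c (u * real_of_int h) * F h)"
    by (intro sum_mono2) (auto simp: tent_nonneg F)
  also have "\<dots> = (\<Sum>h\<in>{1..int n}. tent c (u * real_of_int h) * F h) + (\<Sum>h\<in>uminus ` {1..int n}. tent c (u * real_of_int h) * F h)"
    by (rule sum.union_disjoint) auto
  also have "(\<Sum>h\<in>uminus ` {1..int n}. tent c (u * real_of_int h) * F h) = (\<Sum>h\<in>{1..int n}. tent c (u * real_of_int h) * F' h)"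
    by (subst sum.reindex) (auto simp: F'_def inj_on_def tent_def)
  also have "(\<Sum>h\<in>{1..int n}. tent c (u * real_of_int h) * F h) + (\<Sum>h\<in>{1..int n}. tent c (u * real_of_int h) * F' h)
     \<le> \<mu> * (c\<^sup>2 / (2 * u) + real_of_int R * c) + \<mu> * (c\<^sup>2 / (2 * u) + real_of_int R * c)"
    by (intro add_mono half F F' mean mean') (auto simp: F'_def F)
  also have "\<dots> = \<mu> * (c\<^sup>2 / u + 2 * real_of_int R * c)" by (simp add: algebra_simps)
  finally show ?thesis .
qed

section \<open>Overlaps when the ratio is irrational\<close>

definition rough :: "nat \<Rightarrow> nat set" where
  "rough z = {n. n > 0 \<and> (\<forall>p\<in>primes_le z. \<not> p dvd n)}"

text \<open>The total overlap of the intervals of length \<open>c\<close> around the sieved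
  multiples of \<alpha> and of \<beta> up to \<open>X\<close>.\<close>

definition pair_sum :: "real \<Rightarrow> nat \<Rightarrow> nat \<Rightarrow> real \<Rightarrow> real \<Rightarrow> real \<Rightarrow> real" where
  "pair_sum c y z \<alpha> \<beta> X = (\<Sum>n | n \<in> rough y \<and> real n * \<alpha> \<le> X. \<Sum>m | m \<in> rough z \<and> real m * \<beta> \<le> X.
      tent c (real n * \<alpha> - real m * \<beta>))"

text \<open>Local factor of the indicator of \<open>rough\<close>. A prime above the level
  contributes 1, so that sieves of different levels can be multiplied over one common set of
  primes.\<close>

definition sieve :: "nat \<Rightarrow> nat \<Rightarrow> int \<Rightarrow> real" where
  "sieve z p k = (if p \<le> z \<and> int p dvd k then 0 else 1)"

lemma sieve_nonneg: "sieve z p k \<ge> 0" by (simp add: sieve_def)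

lemma periodic_sieve_affine: "periodic (int p) (\<lambda>k. sieve z p (a + b * k))"
proof -
  have "int p dvd a + b * (k + int p) \<longleftrightarrow> int p dvd a + b * k" for k
  proof -
    have "a + b * (k + int p) = (a + b * k) + int p * b" by (simp add: algebra_simps)
    then show ?thesis by (simp only: dvd_add_left_iff dvd_triv_left)
  qed
  then show ?thesis by (simp add: periodic_def sieve_def)
qed

lemma periodic_mult_fun: "periodic P f \<Longrightarrow> periodic P g \<Longrightarrow> periodic P (\<lambda>k. f k * g k)"
  by (simp add: periodic_def)

lemma prod_sieve_eq:
  assumes "z \<le> Z"
  shows "(\<Prod>p\<in>primes_le Z. sieve z p k) = (if \<forall>p\<in>primes_le z. \<not> int p dvd k then 1 else 0)"
proof (cases "\<forall>p\<in>primes_le z. \<not> int p dvd k")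
  case True
  then have "sieve z p k = 1" if "p \<in> primes_le Z" for p
    using that by (auto simp: sieve_def primes_le_def)
  then show ?thesis using True by simp
next
  case False
  then obtain p where p: "p \<in> primes_le z" "int p dvd k" by auto
  then have "p \<in> primes_le Z" "sieve z p k = 0" using assms by (auto simp: primes_le_def sieve_def)
  then have "(\<Prod>p\<in>primes_le Z. sieve z p k) = 0" by (intro prod_zero) auto
  then show ?thesis using False by (simp only: if_False)
qed

section \<open>Sieve densities over one period\<close>

lemma sum_sieve_prime:
  assumes "prime p"
  shows "(\<Sum>k\<in>{0..<int p}. sieve z p k) = real p * (if p \<le> z then 1 - 1 / real p else 1)"
proof (cases "p \<le> z")
  case True
  have p: "p > 0" using assms prime_gt_0_nat by blast
  have "(\<Sum>k\<in>{0..<int p}. sieve z p k) = (\<Sum>k\<in>{0..<int p}. if k = 0 then 0 else 1)"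
  proof (rule sum.cong[OF refl])
    fix k assume k: "k \<in> {0..<int p}"
    have "\<not> int p dvd k" if "k \<noteq> 0" using that k zdvd_not_zless[of k "int p"] by auto
    then have "int p dvd k \<longleftrightarrow> k = 0" by auto
    then show "sieve z p k = (if k = 0 then 0 else 1)" using True by (simp add: sieve_def)
  qed
  also have "\<dots> = real (card ({0..<int p} - {0}))"
    by (simp add: sum.If_cases Collect_neg_eq Diff_eq)
  also have "\<dots> = real p - 1" using p by (simp add: of_nat_diff)
  also have "\<dots> = real p * (if p \<le> z then 1 - 1 / real p else 1)"
    using True p by (simp add: right_diff_distrib)
  finally show ?thesis .
qed (simp add: sieve_def)

lemma mertens_prod_extend:
  assumes "z \<le> Z"
  shows "(\<Prod>p\<in>primes_le Z. if p \<le> z then 1 - 1 / real p else 1) = mertens_prod z"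
proof -
  have "{p \<in> primes_le Z. p \<le> z} = primes_le z" using assms by (auto simp: primes_le_def)
  then show ?thesis unfolding mertens_prod_def
    using prod.inter_filter[of "primes_le Z" "\<lambda>p. 1 - 1 / real p" "\<lambda>p. p \<le> z"] by simp
qed

lemma card_residues:
  assumes "z \<le> Z"
  shows "(\<Sum>k\<in>{0..<int (\<Prod>(primes_le Z))}. \<Prod>p\<in>primes_le Z. sieve z p k) = real (\<Prod>(primes_le Z)) * mertens_prod z"
proof -
  have "(\<Sum>k\<in>{0..<int (\<Prod>(primes_le Z))}. \<Prod>p\<in>primes_le Z. sieve z p k) = (\<Prod>p\<in>primes_le Z. \<Sum>k\<in>{0..<int p}. sieve z p k)"
    using periodic_sieve_affine[of _ z 0 1] by (intro sum_prod_periodic) auto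
  also have "\<dots> = (\<Prod>p\<in>primes_le Z. real p * (if p \<le> z then 1 - 1 / real p else 1))"
    by (intro prod.cong refl sum_sieve_prime) auto
  also have "\<dots> = real (\<Prod>(primes_le Z)) * mertens_prod z"
    by (simp add: prod.distrib mertens_prod_extend[OF assms])
  finally show ?thesis .
qed

lemma primorial_pos: "\<Prod>(primes_le Z) > 0"
  by (intro prod_pos) (auto dest: prime_gt_0_nat)

lemma rough_mod_iff:
  assumes "z \<le> Z" "n > 0"
  shows "n \<in> rough z \<longleftrightarrow> (\<forall>p\<in>primes_le z. \<not> p dvd n mod \<Prod>(primes_le Z))"
proof -
  have "p dvd n mod \<Prod>(primes_le Z) \<longleftrightarrow> p dvd n" if "p \<in> primes_le z" for p
  proof (rule dvd_mod_iff)
    show "p dvd \<Prod>(primes_le Z)"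
      using dvd_prodI[of "primes_le Z" p "\<lambda>x. x"] subsetD[OF primes_le_mono[OF assms(1)] that] by simp
  qed
  then show ?thesis using assms by (simp add: rough_def)
qed

definition residues :: "nat \<Rightarrow> nat \<Rightarrow> nat set" where
  "residues z Z = {c. c < \<Prod>(primes_le Z) \<and> (\<forall>p\<in>primes_le z. \<not> p dvd c)}"

lemma finite_residues [simp]: "finite (residues z Z)"
  by (rule finite_subset[of _ "{..<\<Prod>(primes_le Z)}"]) (auto simp: residues_def)

lemma card_residues_eq:
  assumes "z \<le> Z"
  shows "real (card (residues z Z)) = real (\<Prod>(primes_le Z)) * mertens_prod z"
proof -
  have "int ` residues z Z = {k \<in> {0..<int (\<Prod>(primes_le Z))}. \<forall>p\<in>primes_le z. \<not> int p dvd k}"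
  proof
    show "{k \<in> {0..<int (\<Prod>(primes_le Z))}. \<forall>p\<in>primes_le z. \<not> int p dvd k} \<subseteq> int ` residues z Z"
    proof
      fix k assume k: "k \<in> {k \<in> {0..<int (\<Prod>(primes_le Z))}. \<forall>p\<in>primes_le z. \<not> int p dvd k}"
      then have "k = int (nat k)" by simp
      moreover have "nat k \<in> residues z Z"
      proof -
        have "int p dvd k \<longleftrightarrow> p dvd nat k" for p using k by (simp flip: int_dvd_int_iff)
        then show ?thesis using k by (simp add: residues_def nat_less_iff del: of_nat_prod)
      qed
      ultimately show "k \<in> int ` residues z Z" by blast
    qed
  qed (auto simp: residues_def simp del: of_nat_prod)
  then have "card (residues z Z) = card {k \<in> {0..<int (\<Prod>(primes_le Z))}. \<forall>p\<in>primes_le z. \<not> int p dvd k}"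
    by (metis card_image inj_on_of_nat)
  also have "real \<dots> = (\<Sum>k\<in>{0..<int (\<Prod>(primes_le Z))}. if \<forall>p\<in>primes_le z. \<not> int p dvd k then 1 else 0)"
    by (simp add: sum.inter_filter[symmetric] del: of_nat_prod)
  also have "\<dots> = real (\<Prod>(primes_le Z)) * mertens_prod z"
    using card_residues[OF assms] by (simp only: prod_sieve_eq[OF assms])
  finally show ?thesis .
qed

lemma finite_bounded_multiples [simp]:
  assumes "\<alpha> > 0"
  shows "finite {n::nat. P n \<and> real n * \<alpha> \<le> X}"
proof (rule finite_subset)
  show "{n::nat. P n \<and> real n * \<alpha> \<le> X} \<subseteq> {..nat \<lceil>X / \<alpha>\<rceil>}"
  proof (rule subsetI)
    fix n :: nat assume "n \<in> {n. P n \<and> real n * \<alpha> \<le> X}"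
    then have "real n * \<alpha> \<le> X" by simp
    then have "real n \<le> X / \<alpha>" using assms by (simp add: field_simps)
    also have "\<dots> \<le> real (nat \<lceil>X / \<alpha>\<rceil>)" by (rule real_nat_ceiling_ge)
    finally show "n \<in> {..nat \<lceil>X / \<alpha>\<rceil>}" by simp
  qed
qed simp

text \<open>For q consecutive k the numbers k \<xi> - l are, after a common shift, within 1 / q of
  (k a - q l) / q, and k a - q l takes each integer at most once. So the positions lie on a grid of
  mesh u = P \<beta> / q, each point used at most once, if the tents are widened by u.\<close>

lemma irrational_block_le:
  fixes \<beta> \<xi> z c P :: real and q :: nat and a :: int
  assumes q: "q > 0" "coprime a (int q)" "\<bar>\<xi> - real_of_int a / real q\<bar> < 1 / (real q)\<^sup>2"
    and pos: "\<beta> > 0" "P > 0" "c \<ge> 0" and "finite L"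
  shows "(\<Sum>k\<in>{k0..<k0 + q}. \<Sum>l\<in>L. tent c (z + P * (real k * (\<xi> * \<beta>) - real l * \<beta>)))
    \<le> real q * (c + P * \<beta> / real q)\<^sup>2 / (P * \<beta>) + 2 * (c + P * \<beta> / real q)"
proof -
  define u where "u = P * \<beta> / real q"
  define z' where "z' = z + P * real k0 * \<xi> * \<beta>"
  have u: "u > 0" using q pos by (simp add: u_def)
  define W where "W = (\<lambda>(k, l). int k * a - int q * int l) ` ({..<q} \<times> L)"
  have inj: "inj_on (\<lambda>(k, l). int k * a - int q * int l) ({..<q} \<times> (L::nat set))"
  proof (rule inj_onI)
    fix x y assume xy: "x \<in> {..<q} \<times> L" "y \<in> {..<q} \<times> L"
      "(case x of (k, l) \<Rightarrow> int k * a - int q * int l) = (case y of (k, l) \<Rightarrow> int k * a - int q * int l)"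
    obtain k l k' l' where x: "x = (k, l)" "y = (k', l')" by (cases x, cases y)
    have k: "k < q" "k' < q" and eq: "int k * a - int q * int l = int k' * a - int q * int l'"
      using xy by (auto simp: x)
    from eq have "(int k - int k') * a = int q * (int l - int l')" by (simp add: algebra_simps)
    then have "int q dvd (int k - int k') * a" by simp
    then have dvd: "int q dvd int k - int k'" using q(2) by (simp add: coprime_dvd_mult_left_iff coprime_commute)
    then have "k = k'"
    proof -
      have "int k mod int q = int k' mod int q" using dvd by (simp only: mod_eq_dvd_iff)
      then show ?thesis using k by simp
    qed
    then show "x = y" using eq q by (simp add: x)
  qed
  have "(\<Sum>k\<in>{k0..<k0 + q}. \<Sum>l\<in>L. tent c (z + P * (real k * (\<xi> * \<beta>) - real l * \<beta>)))
    = (\<Sum>k\<in>{..<q}. \<Sum>l\<in>L. tent c (z + P * (real (k0 + k) * (\<xi> * \<beta>) - real l * \<beta>)))"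
    using sum.shift_bounds_nat_ivl[of "\<lambda>k. \<Sum>l\<in>L. tent c (z + P * (real k * (\<xi> * \<beta>) - real l * \<beta>))" 0 k0 q]
    by (simp add: add.commute atLeast0LessThan)
  also have "\<dots> \<le> (\<Sum>k\<in>{..<q}. \<Sum>l\<in>L. tent (c + u) (z' + u * real_of_int (int k * a - int q * int l)))"
  proof (intro sum_mono)
    fix k l assume k: "k \<in> {..<q}"
    define e where "e = P * \<beta> * (real k * (\<xi> - real_of_int a / real q))"
    have "real k * \<bar>\<xi> - real_of_int a / real q\<bar> \<le> real q * (1 / (real q)\<^sup>2)"
      using k q by (intro mult_mono) auto
    also have "\<dots> = 1 / real q" by (simp add: power2_eq_square)
    finally have "P * \<beta> * (real k * \<bar>\<xi> - real_of_int a / real q\<bar>) \<le> P * \<beta> * (1 / real q)"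
      using pos by (intro mult_left_mono) auto
    then have e: "\<bar>e\<bar> \<le> u" using pos by (simp add: e_def u_def abs_mult)
    have "z + P * (real (k0 + k) * (\<xi> * \<beta>) - real l * \<beta>) = (z' + u * real_of_int (int k * a - int q * int l)) + e"
      using q by (simp add: z'_def u_def e_def field_simps)
    then have "tent c (z + P * (real (k0 + k) * (\<xi> * \<beta>) - real l * \<beta>))
      \<le> tent (c + \<bar>e\<bar>) (z' + u * real_of_int (int k * a - int q * int l))"
      by (simp only: tent_perturb)
    also have "\<dots> \<le> tent (c + u) (z' + u * real_of_int (int k * a - int q * int l))"
      using e by (simp add: tent_def)
    finally show "tent c (z + P * (real (k0 + k) * (\<xi> * \<beta>) - real l * \<beta>))
      \<le> tent (c + u) (z' + u * real_of_int (int k * a - int q * int l))" .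
  qed
  also have "\<dots> = (\<Sum>w\<in>W. tent (c + u) (z' + u * real_of_int w))"
    unfolding W_def sum.reindex[OF inj] by (simp add: sum.cartesian_product case_prod_unfold)
  also have "\<dots> \<le> (c + u)\<^sup>2 / u + 2 * (c + u)"
    by (rule sum_tent_ints_le) (use u pos \<open>finite L\<close> in \<open>auto simp: W_def\<close>)
  also have "\<dots> = real q * (c + u)\<^sup>2 / (P * \<beta>) + 2 * (c + u)" using q pos by (simp add: u_def)
  finally show ?thesis by (simp add: u_def)
qed

lemma good_approximation:
  fixes \<xi> :: real
  assumes "\<xi> \<notin> \<rat>"
  obtains q :: nat and a :: int where "q > Q" "coprime a (int q)" "\<bar>\<xi> - real_of_int a / real q\<bar> < 1 / (real q)\<^sup>2"
proof -
  have inf: "infinite (approx_set \<xi>)" using assms rational_iff_finite_approx_set by blast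
  from infinite_approx_set[OF inf, of "int Q"] obtain r s where rs: "(r, s) \<in> approx_set \<xi>" "s > int Q"
    by blast
  show ?thesis
    by (rule that[of "nat s" r]) (use rs in \<open>auto simp: approx_set_def\<close>)
qed

text \<open>Modulo the primorial P^2 V pairs of residue classes survive the sieve, and within each
  pair the quotients k are cut into blocks of length q. As q grows, the bound per unit of X tends to
  the value for independent positions, so one sufficiently large q suffices; whatever does not grow
  with X goes into \<open>K\<close>.\<close>

lemma pair_sum_irrational_le:
  assumes irr: "\<alpha> / \<beta> \<notin> \<rat>" and pos: "\<alpha> > 0" "\<beta> > 0" "c \<ge> 0" "\<eta> > 0"
  obtains K where "\<And>X. X \<ge> 0 \<Longrightarrow> pair_sum c y z \<alpha> \<beta> X
    \<le> (c\<^sup>2 * mertens_prod y * mertens_prod z / (\<alpha> * \<beta>) + \<eta>) * X + K"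
proof -
  define Z where "Z = max y z"
  define Pn where "Pn = \<Prod>(primes_le Z)"
  define P where "P = real Pn"
  have Pn0: "Pn > 0" and P0: "P > 0" using primorial_pos[of Z] by (simp_all add: P_def Pn_def del: of_nat_prod)
  define V where "V = mertens_prod y * mertens_prod z"
  have V: "0 \<le> V" "V \<le> 1" using mertens_prod_pos[of y] mertens_prod_pos[of z] mertens_prod_le_1[of y] mertens_prod_le_1[of z]
    by (auto simp: V_def mult_le_one)
  \<comment> \<open>\<open>g q\<close> is the coefficient of X that blocks of length q produce; its
    limit is V c^2 / (\<alpha> \<beta>).\<close>
  define g where "g = (\<lambda>q. V * ((c + P * \<beta> / q)\<^sup>2 / (\<alpha> * \<beta>) + 2 * (c + P * \<beta> / q) * P / (\<alpha> * q)))"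
  have "((\<lambda>q::nat. g (real q)) \<longlongrightarrow> V * ((c + 0)\<^sup>2 / (\<alpha> * \<beta>) + 0)) sequentially"
  proof -
    have l1: "((\<lambda>q::nat. P * \<beta> / real q) \<longlongrightarrow> 0) sequentially" by real_asymp
    have l2: "((\<lambda>q::nat. 1 / real q) \<longlongrightarrow> 0) sequentially" by real_asymp
    have "((\<lambda>q::nat. V * ((c + P * \<beta> / real q)\<^sup>2 / (\<alpha> * \<beta>) + 2 * (c + P * \<beta> / real q) * P / \<alpha> * (1 / real q)))
        \<longlongrightarrow> V * ((c + 0)\<^sup>2 / (\<alpha> * \<beta>) + 2 * (c + 0) * P / \<alpha> * 0)) sequentially"
      by (intro tendsto_intros l1 l2) (use pos in auto)
    then show ?thesis by (simp add: g_def)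
  qed
  then have "eventually (\<lambda>q::nat. g (real q) < V * ((c + 0)\<^sup>2 / (\<alpha> * \<beta>) + 0) + \<eta>) sequentially"
    using pos by (intro order_tendstoD) auto
  then obtain Q where Q: "\<And>q. q \<ge> Q \<Longrightarrow> g (real q) < V * (c\<^sup>2 / (\<alpha> * \<beta>)) + \<eta>"
    by (auto simp: eventually_sequentially)
  obtain q a where q: "q > Q" "coprime a (int q)" "\<bar>\<alpha> / \<beta> - real_of_int a / real q\<bar> < 1 / (real q)\<^sup>2"
    using good_approximation[OF irr] by blast
  have q0: "q > 0" using q by simp
  define b where "b = real q * (c + P * \<beta> / real q)\<^sup>2 / (P * \<beta>) + 2 * (c + P * \<beta> / real q)"
  have b0: "b \<ge> 0" using pos P0 by (simp add: b_def)
  define A where "A = residues y Z"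
  define B where "B = residues z Z"
  have cardAB: "real (card A) * real (card B) = P\<^sup>2 * V"
    using card_residues_eq[of y Z] card_residues_eq[of z Z]
    by (simp add: A_def B_def Z_def V_def P_def Pn_def power2_eq_square del: of_nat_prod)
  have "pair_sum c y z \<alpha> \<beta> X \<le> (c\<^sup>2 * mertens_prod y * mertens_prod z / (\<alpha> * \<beta>) + \<eta>) * X + P\<^sup>2 * V * (2 * b)" if X: "X \<ge> 0" for X
  proof -
    \<comment> \<open>Enough blocks of q values of k to cover all n up to X / \<alpha>; the rounding
      costs a bounded number of blocks and goes into the constant.\<close>
    define T where "T = Suc (nat \<lfloor>X / (\<alpha> * P * real q)\<rfloor>)"
    define L where "L = {l::nat. True \<and> real l * \<beta> \<le> X}"
    have finL: "finite L" unfolding L_def by (rule finite_bounded_multiples) (use pos in simp)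
    have inner: "(\<Sum>k\<in>{..<q * T}. \<Sum>l\<in>L. tent c (x + P * (real k * \<alpha> - real l * \<beta>))) \<le> real T * b" for x
    proof -
      have "(\<Sum>k\<in>{..<q * t}. \<Sum>l\<in>L. tent c (x + P * (real k * \<alpha> - real l * \<beta>))) \<le> real t * b" for t
      proof (induction t)
        case (Suc t)
        have "{..<q * Suc t} = {..<q * t} \<union> {q * t..<q * t + q}" by auto
        moreover have "{..<q * t} \<inter> {q * t..<q * t + q} = {}" by auto
        ultimately have "(\<Sum>k\<in>{..<q * Suc t}. \<Sum>l\<in>L. tent c (x + P * (real k * \<alpha> - real l * \<beta>)))
          = (\<Sum>k\<in>{..<q * t}. \<Sum>l\<in>L. tent c (x + P * (real k * \<alpha> - real l * \<beta>)))
          + (\<Sum>k\<in>{q * t..<q * t + q}. \<Sum>l\<in>L. tent c (x + P * (real k * \<alpha> - real l * \<beta>)))"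
          by (simp add: sum.union_disjoint)
        moreover have "(\<Sum>k\<in>{q * t..<q * t + q}. \<Sum>l\<in>L. tent c (x + P * (real k * \<alpha> - real l * \<beta>))) \<le> b"
          using irrational_block_le[OF q0 q(2,3) pos(2) P0 pos(3) finL, of x "q * t"] pos by (simp add: b_def)
        ultimately show ?case using Suc by (simp add: distrib_right)
      qed simp
      then show ?thesis .
    qed
    define Tp where "Tp = (\<lambda>n m. tent c (real n * \<alpha> - real m * \<beta>))"
    have "pair_sum c y z \<alpha> \<beta> X = (\<Sum>(n, m)\<in>{n. n \<in> rough y \<and> real n * \<alpha> \<le> X} \<times> {m. m \<in> rough z \<and> real m * \<beta> \<le> X}. Tp n m)"
      by (simp add: pair_sum_def Tp_def sum.cartesian_product)
    also have "\<dots> \<le> (\<Sum>(n, m)\<in>(\<lambda>((a, b), (k, l)). (a + Pn * k, b + Pn * l)) ` ((A \<times> B) \<times> ({..<q * T} \<times> L)). Tp n m)"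
    proof (rule sum_mono2)
      show "finite ((\<lambda>((a, b), k, l). (a + Pn * k, b + Pn * l)) ` ((A \<times> B) \<times> {..<q * T} \<times> L))"
        using finL by (auto simp: A_def B_def)
      show "{n. n \<in> rough y \<and> real n * \<alpha> \<le> X} \<times> {m. m \<in> rough z \<and> real m * \<beta> \<le> X}
        \<subseteq> (\<lambda>((a, b), k, l). (a + Pn * k, b + Pn * l)) ` ((A \<times> B) \<times> {..<q * T} \<times> L)"
      proof clarify
        fix n m assume n: "n \<in> rough y" "real n * \<alpha> \<le> X" and m: "m \<in> rough z" "real m * \<beta> \<le> X"
        have "n mod Pn \<in> A" "m mod Pn \<in> B"
          using n m rough_mod_iff[of y Z n] rough_mod_iff[of z Z m] Pn0
          by (auto simp: A_def B_def residues_def Pn_def Z_def rough_def)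
        moreover have "n div Pn \<in> {..<q * T}"
        proof -
          have "real (n div Pn) * P \<le> real n" unfolding P_def
            by (metis of_nat_le_iff of_nat_mult div_times_less_eq_dividend)
          then have "real (n div Pn) * P * \<alpha> \<le> X" using n pos mult_right_mono[of "real (n div Pn) * P" "real n" \<alpha>] by linarith
          then have "real (n div Pn) \<le> real q * (X / (\<alpha> * P * real q))"
            using pos P0 q0 by (simp add: field_simps)
          also have "\<dots> < real q * real T"
          proof (rule mult_strict_left_mono)
            show "X / (\<alpha> * P * real q) < real T" unfolding T_def by linarith
          qed (use q0 in simp)
          finally have "real (n div Pn) < real (q * T)" by simp
          then have "n div Pn < q * T" by (simp only: of_nat_less_iff)
          then show ?thesis by (simp only: lessThan_iff)
        qed
        moreover have "m div Pn \<in> L"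
        proof -
          have "real (m div Pn) * \<beta> \<le> real m * \<beta>" using pos by (intro mult_right_mono) auto
          then show ?thesis using m by (simp add: L_def)
        qed
        ultimately show "(n, m) \<in> (\<lambda>((a, b), k, l). (a + Pn * k, b + Pn * l)) ` ((A \<times> B) \<times> {..<q * T} \<times> L)"
          by (intro image_eqI[where x = "((n mod Pn, m mod Pn), (n div Pn, m div Pn))"]) auto
      qed
    qed (auto simp: Tp_def tent_nonneg)
    also have "\<dots> \<le> (\<Sum>((a, b), (k, l))\<in>(A \<times> B) \<times> ({..<q * T} \<times> L). Tp (a + Pn * k) (b + Pn * l))"
    proof -
      have "sum (\<lambda>(n, m). Tp n m) ((\<lambda>((a, b), (k, l)). (a + Pn * k, b + Pn * l)) ` ((A \<times> B) \<times> ({..<q * T} \<times> L)))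
        \<le> sum ((\<lambda>(n, m). Tp n m) \<circ> (\<lambda>((a, b), (k, l)). (a + Pn * k, b + Pn * l))) ((A \<times> B) \<times> ({..<q * T} \<times> L))"
        by (rule sum_image_le) (use finL in \<open>auto simp: A_def B_def Tp_def tent_nonneg\<close>)
      then show ?thesis by (simp add: case_prod_unfold o_def)
    qed
    also have "\<dots> = (\<Sum>(a, b)\<in>A \<times> B. \<Sum>(k, l)\<in>{..<q * T} \<times> L. Tp (a + Pn * k) (b + Pn * l))"
      by (simp add: sum.cartesian_product case_prod_unfold)
    also have "\<dots> \<le> (\<Sum>(a, b)\<in>A \<times> B. real T * b')" if "b' = b" for b'
    proof (rule sum_mono, clarify)
      fix a' b'' assume "a' \<in> A" "b'' \<in> B"
      have "(\<Sum>(k, l)\<in>{..<q * T} \<times> L. Tp (a' + Pn * k) (b'' + Pn * l))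
        = (\<Sum>k\<in>{..<q * T}. \<Sum>l\<in>L. tent c ((real a' * \<alpha> - real b'' * \<beta>) + P * (real k * \<alpha> - real l * \<beta>)))"
        unfolding sum.cartesian_product Tp_def P_def
        by (intro sum.cong refl) (auto simp: algebra_simps)
      also have "\<dots> \<le> real T * b" by (rule inner)
      finally show "(\<Sum>(k, l)\<in>{..<q * T} \<times> L. Tp (a' + Pn * k) (b'' + Pn * l)) \<le> real T * b'" using that by simp
    qed
    finally have "pair_sum c y z \<alpha> \<beta> X \<le> real (card A) * real (card B) * (real T * b)"
      by (simp add: case_prod_unfold card_cartesian_product)
    also have "\<dots> = P\<^sup>2 * V * (real T * b)" by (simp add: cardAB)
    also have "\<dots> \<le> P\<^sup>2 * V * ((X / (\<alpha> * P * real q) + 2) * b)"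
    proof (intro mult_left_mono mult_right_mono)
      have "X / (\<alpha> * P * real q) \<ge> 0" using X pos P0 by simp
      then show "real T \<le> X / (\<alpha> * P * real q) + 2" unfolding T_def by linarith
    qed (use b0 V in auto)
    also have "\<dots> = g (real q) * X + P\<^sup>2 * V * (2 * b)"
      using pos P0 q0 by (simp add: g_def b_def field_simps power2_eq_square)
    also have "g (real q) * X \<le> (V * (c\<^sup>2 / (\<alpha> * \<beta>)) + \<eta>) * X"
      using Q[of q] q X by (intro mult_right_mono) auto
    finally show ?thesis by (simp add: V_def mult_ac)
  qed
  then show ?thesis by (rule that)
qed

section \<open>Overlaps when the ratio is rational\<close>

text \<open>The proportion of pairs of residues modulo p that both sieves let pass if the two
  numbers are independent.\<close>

definition sieve_mean :: "nat \<Rightarrow> nat \<Rightarrow> nat \<Rightarrow> real" where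
  "sieve_mean y z p = (if p \<le> y then 1 - 1 / real p else 1) * (if p \<le> z then 1 - 1 / real p else 1)"

lemma sieve_mean_pos: "prime p \<Longrightarrow> sieve_mean y z p > 0"
  using prime_gt_1_nat[of p] by (auto simp: sieve_mean_def)

lemma prod_sieve_mean:
  assumes "y \<le> Z" "z \<le> Z"
  shows "(\<Prod>p\<in>primes_le Z. sieve_mean y z p) = mertens_prod y * mertens_prod z"
  using assms by (simp add: sieve_mean_def prod.distrib mertens_prod_extend)

locale bezout_pair =
  fixes a b :: nat and s t :: int
  assumes a0: "a > 0" and b0: "b > 0" and bezout: "s * int a - t * int b = 1"
begin

text \<open>The solutions of $n a - m b = h$ are $n = h s + b k$, $m = h t + a k$; \<open>dens y z p h\<close> is the proportion of
  those $k$ modulo \<open>p\<close> for which \<open>p\<close> sieves out neither $n$ nor $m$.\<close>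

definition dens :: "nat \<Rightarrow> nat \<Rightarrow> nat \<Rightarrow> int \<Rightarrow> real" where
  "dens y z p h = (\<Sum>k\<in>{0..<int p}. sieve y p (h * s + int b * k) * sieve z p (h * t + int a * k)) / real p"

definition full_dens :: "nat \<Rightarrow> nat \<Rightarrow> nat \<Rightarrow> int \<Rightarrow> real" where
  "full_dens y z Z h = (\<Prod>p\<in>primes_le Z. dens y z p h)"

lemma dens_nonneg: "dens y z p h \<ge> 0"
  by (auto simp: dens_def sieve_nonneg intro!: divide_nonneg_nonneg sum_nonneg mult_nonneg_nonneg)

lemma full_dens_nonneg: "full_dens y z Z h \<ge> 0"
  by (auto simp: full_dens_def dens_nonneg intro: prod_nonneg)

lemma periodic_dens: "periodic (int p) (dens y z p)"
proof -
  have "sieve w p ((h + int p) * s + x) = sieve w p (h * s + x)" for w h s x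
  proof -
    have "(h + int p) * s + x = x + s * (h + int p)" "h * s + x = x + s * h" by (simp_all add: algebra_simps)
    then show ?thesis using periodic_sieve_affine[of p w x s] unfolding periodic_def by metis
  qed
  then show ?thesis by (simp add: periodic_def dens_def)
qed

text \<open>The map sending (h, k) to (h s + b k, h t + a k) has determinant 1, hence permutes the
  pairs of residues modulo p; on average over h the two sieve conditions are therefore
  independent.\<close>

lemma sum_dens:
  assumes p: "prime p"
  shows "(\<Sum>h\<in>{0..<int p}. dens y z p h) = real p * sieve_mean y z p"
proof -
  have p0: "p > 0" using p prime_gt_0_nat by blast
  define I where "I = {0..<int p}"
  define f where "f = (\<lambda>(h, k). ((h * s + int b * k) mod int p, (h * t + int a * k) mod int p))"
  have inj: "inj_on f (I \<times> I)"
  proof (rule inj_onI)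
    fix x x' assume x: "x \<in> I \<times> I" "x' \<in> I \<times> I" "f x = f x'"
    obtain h k h' k' where xx: "x = (h, k)" "x' = (h', k')" by (cases x, cases x')
    have hk: "h \<in> I" "k \<in> I" "h' \<in> I" "k' \<in> I" using x xx by auto
    have "int p dvd (h * s + int b * k) - (h' * s + int b * k')" "int p dvd (h * t + int a * k) - (h' * t + int a * k')"
      using x by (simp_all add: f_def xx mod_eq_dvd_iff)
    then obtain u v where uv: "(h * s + int b * k) - (h' * s + int b * k') = int p * u"
        "(h * t + int a * k) - (h' * t + int a * k') = int p * v" by (auto elim!: dvdE)
    have "h - h' = (h - h') * (s * int a - t * int b)" by (simp add: bezout)
    also have "\<dots> = ((h * s + int b * k) - (h' * s + int b * k')) * int a - ((h * t + int a * k) - (h' * t + int a * k')) * int b"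
      by (simp add: algebra_simps)
    also have "\<dots> = int p * (u * int a - v * int b)" unfolding uv by (simp add: algebra_simps)
    finally have "int p dvd h - h'" by simp
    then have "h mod int p = h' mod int p" by (simp only: mod_eq_dvd_iff)
    then have "h = h'" using hk by (simp add: I_def)
    have "k - k' = (k - k') * (s * int a - t * int b)" by (simp add: bezout)
    also have "\<dots> = ((h * t + int a * k) - (h' * t + int a * k')) * s - ((h * s + int b * k) - (h' * s + int b * k')) * t"
      by (simp add: algebra_simps)
    also have "\<dots> = int p * (v * s - u * t)" unfolding uv by (simp add: algebra_simps)
    finally have "int p dvd k - k'" by simp
    then have "k mod int p = k' mod int p" by (simp only: mod_eq_dvd_iff)
    then have "k = k'" using hk by (simp add: I_def)
    with \<open>h = h'\<close> show "x = x'" by (simp add: xx)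
  qed
  have "f ` (I \<times> I) \<subseteq> I \<times> I" using p0 by (auto simp: f_def I_def)
  then have bij: "bij_betw f (I \<times> I) (I \<times> I)"
    unfolding bij_betw_def using inj by (simp add: I_def endo_inj_surj)
  have red: "sieve w p (x mod int p) = sieve w p x" for w x
    by (simp add: sieve_def dvd_mod_iff)
  have "(\<Sum>(n, m)\<in>I \<times> I. sieve y p n * sieve z p m) = (\<Sum>x\<in>I \<times> I. case f x of (n, m) \<Rightarrow> sieve y p n * sieve z p m)"
    by (rule sum.reindex_bij_betw[OF bij, symmetric])
  also have "\<dots> = (\<Sum>(h, k)\<in>I \<times> I. sieve y p (h * s + int b * k) * sieve z p (h * t + int a * k))"
    by (intro sum.cong refl) (auto simp: f_def red)
  finally have "(\<Sum>(h, k)\<in>I \<times> I. sieve y p (h * s + int b * k) * sieve z p (h * t + int a * k)) = (\<Sum>n\<in>I. sieve y p n) * (\<Sum>m\<in>I. sieve z p m)"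
    by (simp add: sum_product sum.cartesian_product)
  also have "\<dots> = (real p)\<^sup>2 * sieve_mean y z p"
    unfolding I_def sum_sieve_prime[OF p] by (simp add: sieve_mean_def power2_eq_square)
  finally have "(\<Sum>h\<in>I. \<Sum>k\<in>I. sieve y p (h * s + int b * k) * sieve z p (h * t + int a * k)) = (real p)\<^sup>2 * sieve_mean y z p"
    by (simp add: sum.cartesian_product)
  then show ?thesis unfolding dens_def using p0
    by (simp add: I_def power2_eq_square flip: sum_divide_distrib)
qed

lemma affine_zero:
  assumes p: "prime p" and "\<not> int p dvd c"
  obtains k where "k \<in> {0..<int p}" "int p dvd x + c * k"
proof -
  have "coprime c (int p)" using prime_imp_coprime[of "int p" c] assms by (simp add: coprime_commute)
  then obtain u v where uv: "u * c + v * int p = 1" using bezout_int[of c "int p"] by (metis coprime_iff_gcd_eq_1)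
  define k where "k = (- x * u) mod int p"
  have "k \<in> {0..<int p}" using prime_gt_0_nat[OF p] by (simp add: k_def)
  moreover have "int p dvd x + c * k"
  proof -
    have "x + c * (- x * u) = x * (1 - u * c)" by (simp add: algebra_simps)
    also have "1 - u * c = v * int p" using uv by simp
    finally have "x + c * (- x * u) = x * v * int p" by simp
    then have "(x + c * k) mod int p = 0" unfolding k_def by (metis mod_add_right_eq mod_mult_right_eq mod_mult_self2_is_0)
    then show ?thesis by (simp add: dvd_eq_mod_eq_0)
  qed
  ultimately show ?thesis by (rule that)
qed

lemma dens_le_card:
  assumes K: "K \<subseteq> {0..<int p}" "\<And>k. k \<in> K \<Longrightarrow> sieve y p (h * s + int b * k) * sieve z p (h * t + int a * k) = 0" and "p > 0"
  shows "dens y z p h \<le> 1 - real (card K) / real p"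
proof -
  have "(\<Sum>k\<in>{0..<int p}. sieve y p (h * s + int b * k) * sieve z p (h * t + int a * k))
    \<le> (\<Sum>k\<in>{0..<int p}. if k \<in> K then 0 else 1)"
  proof (intro sum_mono)
    fix k
    show "sieve y p (h * s + int b * k) * sieve z p (h * t + int a * k) \<le> (if k \<in> K then 0 else 1)"
    proof (cases "k \<in> K")
      case True
      have eq: "sieve y p (h * s + int b * k) * sieve z p (h * t + int a * k) = 0" by (rule K(2)[OF True])
      show ?thesis unfolding eq by simp
    qed (simp add: sieve_def)
  qed
  also have "\<dots> = real (card ({0..<int p} - K))"
    by (simp add: sum.If_cases Diff_eq)
  also have "\<dots> = real p - real (card K)"
    using K(1) card_mono[OF _ K(1)] by (simp add: card_Diff_subset finite_subset of_nat_diff)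
  finally show ?thesis using \<open>p > 0\<close> by (simp add: dens_def field_simps)
qed

lemma coprime_ab: "coprime a b"
proof -
  have "int (gcd a b) dvd s * int a - t * int b"
    by (intro dvd_diff dvd_mult) (simp_all add: int_dvd_int_iff)
  then show ?thesis unfolding bezout by (simp add: coprime_iff_gcd_eq_1)
qed

lemma dens_le_1: "p > 0 \<Longrightarrow> dens y z p h \<le> 1"
  using dens_le_card[of "{}" p y h z] by simp

text \<open>If both sieves act, p does not divide both a and b, so at least one residue k is
  removed: 1 - 1 / p in place of (1 - 1 / p)^2. This loss of one factor is accepted for the primes
  dividing a b or h.\<close>

lemma dens_le:
  assumes p: "prime p"
  shows "dens y z p h \<le> sieve_mean y z p / (1 - 1 / real p)"
proof -
  have p2: "real p \<ge> 2" using prime_ge_2_nat[OF p] by simp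
  then have p0: "p > 0" by auto
  show ?thesis
  proof (cases "p \<le> y \<and> p \<le> z")
    case True
    have "\<not> int p dvd int b \<or> \<not> int p dvd int a"
      using coprime_ab p by (metis coprime_common_divisor int_dvd_int_iff not_prime_unit)
    then obtain k where "k \<in> {0..<int p}" "int p dvd h * s + int b * k \<or> int p dvd h * t + int a * k"
      using affine_zero[OF p] by metis
    then have "dens y z p h \<le> 1 - real (card {k}) / real p"
      using True p0 by (intro dens_le_card) (auto simp: sieve_def)
    then show ?thesis using True p2 by (simp add: sieve_mean_def)
  next
    case False
    then have "1 \<le> sieve_mean y z p / (1 - 1 / real p)"
      using p2 by (auto simp: sieve_mean_def field_simps)
    then show ?thesis using dens_le_1[OF p0, of y z h] by linarith
  qed
qed

text \<open>Each acting sieve removes one residue, and the two residues differ because p does not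
  divide h; moreover 1 - 2 / p <= (1 - 1 / p)^2.\<close>

lemma dens_le_mean:
  assumes p: "prime p" and ndvd: "\<not> p dvd a * b" "\<not> int p dvd h"
  shows "dens y z p h \<le> sieve_mean y z p"
proof -
  have p2: "real p \<ge> 2" using prime_ge_2_nat[OF p] by simp
  then have p0: "p > 0" by auto
  have "\<not> int p dvd int b" "\<not> int p dvd int a" using ndvd by auto
  then obtain k1 k2 where k1: "k1 \<in> {0..<int p}" "int p dvd h * s + int b * k1"
    and k2: "k2 \<in> {0..<int p}" "int p dvd h * t + int a * k2"
    using affine_zero[OF p] by metis
  have ne: "k1 \<noteq> k2"
  proof
    assume eq: "k1 = k2"
    have "int p dvd (h * s + int b * k1) * int a - (h * t + int a * k2) * int b"
      using k1 k2 by (intro dvd_diff dvd_mult2)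
    also have "(h * s + int b * k1) * int a - (h * t + int a * k2) * int b = h * (s * int a - t * int b)"
      by (simp add: eq algebra_simps)
    finally show False using ndvd by (simp add: bezout)
  qed
  define K where "K = (if p \<le> y then {k1} else {}) \<union> (if p \<le> z then {k2} else {})"
  have "dens y z p h \<le> 1 - real (card K) / real p"
    by (rule dens_le_card) (use k1 k2 p0 in \<open>auto simp: K_def sieve_def split: if_splits\<close>)
  also have "\<dots> \<le> sieve_mean y z p"
    using p2 ne by (auto simp: K_def sieve_mean_def field_simps power2_eq_square)
  finally show ?thesis .
qed

lemma full_dens_0_le_1: "full_dens y z Z 0 \<le> 1"
  unfolding full_dens_def
  by (intro prod_le_1) (auto simp: dens_nonneg intro!: dens_le_1 dest: prime_gt_0_nat)

text \<open>For h = 0 the solutions are n = b k, m = a k, so a sieving prime dividing b,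
  respectively a, removes all of them.\<close>

lemma full_dens_0_eq_0:
  assumes "p \<in> primes_le Z" "p \<le> y \<and> p dvd b \<or> p \<le> z \<and> p dvd a"
  shows "full_dens y z Z 0 = 0"
proof -
  have "dens y z p 0 = 0" unfolding dens_def
    using assms(2) by (auto simp: sieve_def intro!: sum.neutral dvd_mult2)
  then show ?thesis unfolding full_dens_def using assms(1) by (intro prod_zero) auto
qed

text \<open>The solutions form a single progression in k, and surviving both sieves is a product of
  conditions on k modulo primes, whose proportion over a full period is the product of the local
  densities.\<close>

lemma card_solutions_le:
  assumes pos: "\<alpha> > 0" and X: "X \<ge> 0" and Z: "y \<le> Z" "z \<le> Z"
  shows "real (card {(n, m). n \<in> rough y \<and> m \<in> rough z \<and> real n * \<alpha> \<le> X \<and> int n * int a - int m * int b = h})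
    \<le> (X / (\<alpha> * real b) + 1 + real (\<Prod>(primes_le Z))) * full_dens y z Z h"
proof -
  define Sol where "Sol = {(n, m). n \<in> rough y \<and> m \<in> rough z \<and> real n * \<alpha> \<le> X \<and> int n * int a - int m * int b = h}"
  \<comment> \<open>The least k with h s + b k >= 0.\<close>
  define k0 where "k0 = - ((h * s) div int b)"
  define L where "L = \<lfloor>X / (\<alpha> * real b)\<rfloor> + 1"
  define w where "w = (\<lambda>k. \<Prod>p\<in>primes_le Z. sieve y p (h * s + int b * k) * sieve z p (h * t + int a * k))"
  define P where "P = \<Prod>(primes_le Z)"
  have P0: "P > 0" using primorial_pos by (simp add: P_def)
  define \<kappa> :: "nat \<times> nat \<Rightarrow> int" where "\<kappa> = (\<lambda>(n, m). (int n - h * s) div int b)"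
  have \<kappa>: "int n = h * s + int b * \<kappa> (n, m)" "int m = h * t + int a * \<kappa> (n, m)" if "(n, m) \<in> Sol" for n m
  proof -
    have eq: "int n * int a - int m * int b = h" using that by (simp add: Sol_def)
    have e: "(int n - h * s) * int a = (int m - h * t) * int b"
    proof -
      have "(int n - h * s) * int a - (int m - h * t) * int b = (int n * int a - int m * int b) - h * (s * int a - t * int b)"
        by (simp add: algebra_simps)
      then show ?thesis by (simp add: eq bezout)
    qed
    then have "int b dvd (int n - h * s) * int a" by simp
    then have "int b dvd int n - h * s" using coprime_ab by (simp add: coprime_dvd_mult_left_iff coprime_commute)
    then have k: "int n - h * s = int b * \<kappa> (n, m)" by (simp add: \<kappa>_def)
    then show "int n = h * s + int b * \<kappa> (n, m)" by simp
    have "(int m - h * t) * int b = (int a * \<kappa> (n, m)) * int b" using e k by (simp add: algebra_simps)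
    then show "int m = h * t + int a * \<kappa> (n, m)" using b0 by simp
  qed
  have inj: "inj_on \<kappa> Sol"
  proof (rule inj_onI)
    fix x x' assume "x \<in> Sol" "x' \<in> Sol" "\<kappa> x = \<kappa> x'"
    then show "x = x'" using \<kappa> by (cases x, cases x') (metis of_nat_eq_iff)
  qed
  have sub: "\<kappa> ` Sol \<subseteq> {k \<in> {k0..<k0 + L}. w k = 1}"
  proof
    fix k assume "k \<in> \<kappa> ` Sol"
    then obtain n m where nm: "(n, m) \<in> Sol" "k = \<kappa> (n, m)" by auto
    note eqs = \<kappa>[OF nm(1), folded nm(2)]
    have "k0 \<le> k"
    proof -
      have "0 \<le> h * s + int b * k" using eqs(1) by linarith
      then have "int b * (- k) \<le> h * s" by simp
      then have "(int b * (- k)) div int b \<le> (h * s) div int b" using b0 by (intro zdiv_mono1) auto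
      moreover have "(int b * (- k)) div int b = - k" by (rule nonzero_mult_div_cancel_left) (use b0 in simp)
      ultimately have "- k \<le> (h * s) div int b" by (simp only:)
      then show ?thesis by (simp add: k0_def)
    qed
    moreover have "k < k0 + L"
    proof -
      have "int b * (k - k0) \<le> int n"
      proof -
        have "int b * ((h * s) div int b) = h * s - (h * s) mod int b" by (rule minus_mod_eq_mult_div[symmetric])
        moreover have "(h * s) mod int b \<ge> 0" using b0 by simp
        moreover have "int b * (k - k0) = int b * k + int b * ((h * s) div int b)"
          by (simp only: k0_def diff_minus_eq_add distrib_left)
        ultimately show ?thesis using eqs(1) by linarith
      qed
      then have "real b * real_of_int (k - k0) \<le> real n"
        by (metis of_int_le_iff of_int_mult of_int_of_nat_eq)
      then have "real b * real_of_int (k - k0) * \<alpha> \<le> real n * \<alpha>" using pos by (intro mult_right_mono) auto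
      also have "\<dots> \<le> X" using nm by (simp add: Sol_def)
      finally have "real_of_int (k - k0) \<le> X / (\<alpha> * real b)" using pos b0 by (simp add: field_simps)
      then show ?thesis unfolding L_def by linarith
    qed
    moreover have "w k = 1"
    proof -
      have "sieve y p (int n) = 1" "sieve z p (int m) = 1" if "p \<in> primes_le Z" for p
        using nm(1) that by (auto simp: Sol_def rough_def sieve_def primes_le_def)
      then show ?thesis unfolding w_def eqs[symmetric] by simp
    qed
    ultimately show "k \<in> {k \<in> {k0..<k0 + L}. w k = 1}" by simp
  qed
  have w0: "w k \<ge> 0" for k unfolding w_def by (intro prod_nonneg) (auto simp: sieve_def)
  have perw: "periodic (int p) (\<lambda>k. sieve y p (h * s + int b * k) * sieve z p (h * t + int a * k))" for p
    by (intro periodic_mult_fun periodic_sieve_affine)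
  have "card Sol = card (\<kappa> ` Sol)" by (simp add: card_image inj)
  also have "\<dots> \<le> card {k \<in> {k0..<k0 + L}. w k = 1}"
    using sub by (intro card_mono finite_subset[of "{k \<in> {k0..<k0 + L}. w k = 1}" "{k0..<k0 + L}"]) auto
  finally have "card Sol \<le> card {k \<in> {k0..<k0 + L}. w k = 1}" .
  then have "real (card Sol) \<le> real (card {k \<in> {k0..<k0 + L}. w k = 1})" by (simp only: of_nat_le_iff)
  also have "\<dots> = (\<Sum>k\<in>{k \<in> {k0..<k0 + L}. w k = 1}. w k)" by simp
  also have "\<dots> \<le> (\<Sum>k\<in>{k0..<k0 + L}. w k)" by (rule sum_mono2) (auto simp: w0)
  also have "\<dots> \<le> (real_of_int L / real_of_int (int P) + 1) * (\<Sum>k\<in>{0..<int P}. w k)"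
  proof (rule sum_periodic_le)
    show "periodic (int P) w" unfolding w_def P_def
    proof -
      have "periodic (int (\<Prod>(primes_le Z))) (\<lambda>k. \<Prod>q\<in>int ` primes_le Z. (\<lambda>q k. sieve y (nat q) (h * s + int b * k) * sieve z (nat q) (h * t + int a * k)) q k)"
      proof (rule periodic_prod)
        fix q assume "q \<in> int ` primes_le Z"
        then obtain p where p: "q = int p" "p \<in> primes_le Z" by auto
        show "periodic q (\<lambda>k. sieve y (nat q) (h * s + int b * k) * sieve z (nat q) (h * t + int a * k))"
          using perw[of p] by (simp add: p)
        show "q dvd int (\<Prod>(primes_le Z))"
          unfolding p(1) int_dvd_int_iff using dvd_prodI[of "primes_le Z" p "\<lambda>x. x"] p by simp
      qed
      then show "periodic (int (\<Prod>(primes_le Z))) (\<lambda>k. \<Prod>p\<in>primes_le Z. sieve y p (h * s + int b * k) * sieve z p (h * t + int a * k))"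
        by (subst (asm) prod.reindex) (auto simp: inj_on_def o_def)
    qed
    show "0 \<le> L" using X pos by (simp add: L_def)
  qed (use P0 w0 in auto)
  also have "(\<Sum>k\<in>{0..<int P}. w k) = (\<Prod>p\<in>primes_le Z. \<Sum>k\<in>{0..<int p}. sieve y p (h * s + int b * k) * sieve z p (h * t + int a * k))"
    unfolding w_def P_def by (rule sum_prod_periodic) (use perw in auto)
  also have "\<dots> = (\<Prod>p\<in>primes_le Z. real p * dens y z p h)"
    by (intro prod.cong refl) (auto simp: dens_def dest: prime_gt_0_nat)
  also have "\<dots> = real P * full_dens y z Z h" by (simp add: prod.distrib full_dens_def P_def)
  also have "(real_of_int L / real_of_int (int P) + 1) * (real P * full_dens y z Z h) = (real_of_int L + real P) * full_dens y z Z h"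
    using P0 by (simp add: distrib_right)
  finally have "real (card Sol) \<le> (real_of_int L + real P) * full_dens y z Z h" .
  also have "\<dots> \<le> (X / (\<alpha> * real b) + 1 + real P) * full_dens y z Z h"
    by (intro mult_right_mono full_dens_nonneg) (simp add: L_def)
  finally show ?thesis by (simp add: Sol_def P_def)
qed

text \<open>Since n \<alpha> - m \<beta> = q h with h = n a - m b, the pairs are grouped by h;
  beyond |h| = N the tent vanishes.\<close>

lemma pair_sum_rational_le:
  assumes q: "q > 0" "c \<ge> 0" and N: "c \<le> q * real_of_int N" and Z: "y \<le> Z" "z \<le> Z"
  obtains K where "\<And>X. X \<ge> 0 \<Longrightarrow> pair_sum c y z (q * real a) (q * real b) X
    \<le> 1 / (q * real a * real b) * (\<Sum>h\<in>{-N..N}. tent c (q * real_of_int h) * full_dens y z Z h) * X + K"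
proof -
  define \<alpha> \<beta> where "\<alpha> = q * real a" and "\<beta> = q * real b"
  have pos: "\<alpha> > 0" "\<beta> > 0" using q a0 b0 by (auto simp: \<alpha>_def \<beta>_def)
  define C where "C = 1 + real (\<Prod>(primes_le Z))"
  define K where "K = (\<Sum>h\<in>{-N..N}. tent c (q * real_of_int h) * (C * full_dens y z Z h))"
  show ?thesis
  proof (rule that[of K])
    fix X :: real assume X: "X \<ge> 0"
    define A where "A = {n. n \<in> rough y \<and> real n * \<alpha> \<le> X}"
    define B where "B = {m. m \<in> rough z \<and> real m * \<beta> \<le> X}"
    define hh where "hh = (\<lambda>(n, m). int n * int a - int m * int b)"
    have fin: "finite A" "finite B" using pos by (auto simp: A_def B_def)
    have tent_eq: "tent c (real n * \<alpha> - real m * \<beta>) = tent c (q * real_of_int (hh (n, m)))" for n m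
      by (rule arg_cong[where f = "tent c"]) (simp add: hh_def \<alpha>_def \<beta>_def algebra_simps)
    have tent0: "tent c (q * real_of_int h) = 0" if "h \<notin> {-N..N}" for h
    proof -
      have "real_of_int N \<le> \<bar>real_of_int h\<bar>" using that by auto
      then have "q * real_of_int N \<le> q * \<bar>real_of_int h\<bar>" using q by (intro mult_left_mono) auto
      then have "c \<le> q * \<bar>real_of_int h\<bar>" using N by linarith
      then have "c \<le> \<bar>q * real_of_int h\<bar>" using q by (simp add: abs_mult)
      then show ?thesis by (simp add: tent_def)
    qed
    have "pair_sum c y z \<alpha> \<beta> X = (\<Sum>x\<in>A \<times> B. tent c (q * real_of_int (hh x)))"
      unfolding pair_sum_def sum.cartesian_product A_def[symmetric] B_def[symmetric]
      by (intro sum.cong refl) (auto simp: tent_eq)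
    also have "\<dots> = (\<Sum>x\<in>{x \<in> A \<times> B. hh x \<in> {-N..N}}. tent c (q * real_of_int (hh x)))"
      by (rule sum.mono_neutral_right) (use fin tent0 in auto)
    also have "\<dots> = (\<Sum>h\<in>{-N..N}. \<Sum>x\<in>{x \<in> {x \<in> A \<times> B. hh x \<in> {-N..N}}. hh x = h}. tent c (q * real_of_int (hh x)))"
      by (rule sum.group[symmetric]) (use fin in auto)
    also have "\<dots> \<le> (\<Sum>h\<in>{-N..N}. tent c (q * real_of_int h) * ((X / (\<alpha> * real b) + C) * full_dens y z Z h))"
    proof (rule sum_mono)
      fix h assume h: "h \<in> {-N..N}"
      define S where "S = {(n, m). n \<in> rough y \<and> m \<in> rough z \<and> real n * \<alpha> \<le> X \<and> int n * int a - int m * int b = h}"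
      have "{x \<in> {x \<in> A \<times> B. hh x \<in> {-N..N}}. hh x = h} \<subseteq> S"
        by (auto simp: S_def A_def B_def hh_def)
      moreover have "finite S"
      proof (rule finite_subset)
        show "S \<subseteq> (\<lambda>n. (n, nat ((int n * int a - h) div int b))) ` A"
        proof
          fix x assume "x \<in> S"
          then obtain n m where nm: "x = (n, m)" "n \<in> A" "int n * int a - int m * int b = h" by (auto simp: S_def A_def)
          then have "int n * int a - h = int m * int b" by simp
          then have "nat ((int n * int a - h) div int b) = m" using b0 by simp
          then show "x \<in> (\<lambda>n. (n, nat ((int n * int a - h) div int b))) ` A" using nm by auto
        qed
      qed (use fin in simp)
      ultimately have "card {x \<in> {x \<in> A \<times> B. hh x \<in> {-N..N}}. hh x = h} \<le> card S" by (simp add: card_mono)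
      also have "real (card S) \<le> (X / (\<alpha> * real b) + 1 + real (\<Prod>(primes_le Z))) * full_dens y z Z h"
        unfolding S_def by (rule card_solutions_le[OF pos(1) X Z])
      finally have "real (card {x \<in> {x \<in> A \<times> B. hh x \<in> {-N..N}}. hh x = h}) \<le> (X / (\<alpha> * real b) + C) * full_dens y z Z h"
        by (simp add: C_def add.assoc)
      then have "tent c (q * real_of_int h) * real (card {x \<in> {x \<in> A \<times> B. hh x \<in> {-N..N}}. hh x = h})
        \<le> tent c (q * real_of_int h) * ((X / (\<alpha> * real b) + C) * full_dens y z Z h)"
        by (rule mult_left_mono) (rule tent_nonneg)
      then show "(\<Sum>x\<in>{x \<in> {x \<in> A \<times> B. hh x \<in> {-N..N}}. hh x = h}. tent c (q * real_of_int (hh x)))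
        \<le> tent c (q * real_of_int h) * ((X / (\<alpha> * real b) + C) * full_dens y z Z h)"
        by (simp add: mult.commute)
    qed
    also have "\<dots> = (\<Sum>h\<in>{-N..N}. tent c (q * real_of_int h) * full_dens y z Z h) * (X / (\<alpha> * real b)) + K"
    proof -
      have "(\<Sum>h\<in>J. t h * ((u + C) * F h)) = (\<Sum>h\<in>J. t h * F h) * u + (\<Sum>h\<in>J. t h * (C * F h))"
        for J :: "int set" and t F u
        by (simp add: distrib_left distrib_right sum.distrib sum_distrib_left sum_distrib_right mult_ac)
      from this[where t = "\<lambda>h. tent c (q * real_of_int h)" and F = "full_dens y z Z"]
      show ?thesis unfolding K_def .
    qed
    finally show "pair_sum c y z (q * real a) (q * real b) X
      \<le> 1 / (q * real a * real b) * (\<Sum>h\<in>{-N..N}. tent c (q * real_of_int h) * full_dens y z Z h) * X + K"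
      by (simp add: \<alpha>_def \<beta>_def mult_ac)
  qed
qed

end

section \<open>From local densities to the overlap of a commensurable pair\<close>

definition ratio_tail :: "nat \<Rightarrow> nat \<Rightarrow> real" where
  "ratio_tail H n = (\<Sum>p | prime p \<and> H < p \<and> p dvd n. 1 / real p)"

lemma finite_prime_divisors: "n > 0 \<Longrightarrow> finite {p::nat. prime p \<and> H < p \<and> p dvd n}"
  by (rule finite_subset[of _ "{..n}"]) (auto intro: dvd_imp_le)

text \<open>A prime p > H has 1 / p <= ln p / (H ln H), and the ln p of the primes dividing n add up
  to at most ln n.\<close>

lemma ratio_tail_le:
  assumes n: "n > 0" "real n \<le> T" and H: "H \<ge> 2"
  shows "ratio_tail H n \<le> ln T / (real H * ln (real H))"
proof -
  have lnH: "ln (real H) > 0" using H by simp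
  have "ratio_tail H n \<le> (\<Sum>p | prime p \<and> H < p \<and> p dvd n. ln (real p) / (real H * ln (real H)))"
    unfolding ratio_tail_def
  proof (rule sum_mono)
    fix p assume "p \<in> {p. prime p \<and> H < p \<and> p dvd n}"
    then have p: "H < p" by simp
    have "1 * (real H * ln (real H)) \<le> ln (real p) * real p"
      using p H lnH by (simp add: mult.commute[of "ln (real p)"] mult_mono)
    then show "1 / real p \<le> ln (real p) / (real H * ln (real H))"
      using p H lnH by (simp add: field_simps)
  qed
  also have "\<dots> = (\<Sum>p | prime p \<and> H < p \<and> p dvd n. ln (real p)) / (real H * ln (real H))"
    by (simp add: sum_divide_distrib)
  also have "\<dots> \<le> (\<Sum>p | prime p \<and> p dvd n. ln (real p)) / (real H * ln (real H))"
  proof (intro divide_right_mono sum_mono2)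
    show "finite {p. prime p \<and> p dvd n}" using finite_prime_divisors[OF n(1), of 0] 
      by (rule rev_finite_subset) (auto dest: prime_gt_0_nat)
  qed (use lnH in \<open>auto dest: prime_ge_1_nat\<close>)
  also have "\<dots> \<le> ln (real n) / (real H * ln (real H))"
    using sum_ln_prime_divisors_le[OF n(1)] lnH by (intro divide_right_mono) auto
  also have "\<dots> \<le> ln T / (real H * ln (real H))"
    using n lnH by (intro divide_right_mono) auto
  finally show ?thesis .
qed

lemma inverse_le_exp:
  assumes "prime p"
  shows "1 / (1 - 1 / real p) \<le> exp (2 / real p)"
proof -
  have p: "real p \<ge> 2" using prime_ge_2_nat[OF assms] by simp
  have "- (1 / real p) - 2 * (1 / real p)\<^sup>2 \<le> ln (1 - 1 / real p)"
    by (rule ln_one_minus_pos_lower_bound) (use p in \<open>auto simp: field_simps\<close>)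
  moreover have "2 * (1 / real p)\<^sup>2 \<le> 1 / real p" using p by (simp add: power2_eq_square field_simps)
  ultimately have "- (2 / real p) \<le> ln (1 - 1 / real p)" by simp
  then have "exp (- (2 / real p)) \<le> exp (ln (1 - 1 / real p))" by (simp only: exp_le_cancel_iff)
  also have "\<dots> = 1 - 1 / real p" using p by (subst exp_ln) auto
  finally show ?thesis using p by (simp add: exp_minus field_simps)
qed

lemma mertens_prod_antimono:
  assumes "m \<le> n"
  shows "mertens_prod n \<le> mertens_prod m"
proof -
  have "mertens_prod n = mertens_prod m * (\<Prod>p\<in>primes_le n - primes_le m. 1 - 1 / real p)"
    unfolding mertens_prod_def using prod.subset_diff[OF primes_le_mono[OF assms]] by (simp add: mult.commute)
  also have "\<dots> \<le> mertens_prod m * 1"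
    by (intro mult_left_mono prod_le_1) (use mertens_prod_pos[of m] in \<open>auto dest!: prime_of_primes_le prime_gt_1_nat\<close>)
  finally show ?thesis by simp
qed

context bezout_pair
begin

text \<open>The share of the primes up to \<open>W\<close> in the density, as a function of h
  normalised to mean 1.\<close>

definition local_ratio :: "nat \<Rightarrow> nat \<Rightarrow> nat \<Rightarrow> int \<Rightarrow> real" where
  "local_ratio y z W h = (\<Prod>p\<in>primes_le W. dens y z p h / sieve_mean y z p)"

lemma local_ratio_nonneg: "local_ratio y z W h \<ge> 0"
  unfolding local_ratio_def
  by (intro prod_nonneg ballI divide_nonneg_pos) (auto simp: dens_nonneg intro: sieve_mean_pos)

text \<open>Primes above \<open>H\<close> are bounded one by one: only those dividing a b or h can
  exceed their mean, by a factor of at most 1 / (1 - 1 / p). Primes up to \<open>H\<close> are kept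
  exactly, because their product has a period of at most 4^H and can be averaged over h.\<close>

lemma full_dens_le:
  assumes Z: "y \<le> Z" "z \<le> Z" and h: "h \<noteq> 0"
  shows "full_dens y z Z h \<le> mertens_prod y * mertens_prod z
    * exp (2 * ratio_tail H (a * b) + 2 * ratio_tail H (nat \<bar>h\<bar>)) * local_ratio y z (min H Z) h"
proof -
  define W where "W = min H Z"
  define g where "g = (\<lambda>p. dens y z p h / sieve_mean y z p)"
  define e where "e = (\<lambda>n p. if p dvd n then 2 / real p else 0 :: real)"
  define n where "n = nat \<bar>h\<bar>"
  have n0: "n > 0" and hn: "int p dvd h \<longleftrightarrow> p dvd n" for p
    using h by (auto simp: n_def simp flip: int_dvd_int_iff)
  have D: "primes_le Z - primes_le W = {p \<in> primes_le Z. H < p}"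
    by (auto simp: primes_le_def W_def)
  have g0: "g p \<ge> 0" if "p \<in> primes_le Z" for p
    using that sieve_mean_pos[of p y z] dens_nonneg[of y z p h] by (auto simp: g_def intro!: divide_nonneg_pos)
  have gle: "g p \<le> exp (e (a * b) p + e n p)" if "p \<in> primes_le Z" for p
  proof -
    have p: "prime p" using that by auto
    have m: "sieve_mean y z p > 0" by (rule sieve_mean_pos[OF p])
    show ?thesis
    proof (cases "p dvd a * b \<or> p dvd n")
      case True
      have p1: "real p > 1" using prime_gt_1_nat[OF p] by simp
      have "g p \<le> 1 / (1 - 1 / real p)"
        using dens_le[OF p, of y z h] m p1 by (simp add: g_def field_simps)
      also have "\<dots> \<le> exp (2 / real p)" by (rule inverse_le_exp[OF p])
      also have "\<dots> \<le> exp (e (a * b) p + e n p)" using True by (auto simp: e_def)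
      finally show ?thesis .
    next
      case False
      then have "dens y z p h \<le> sieve_mean y z p" using dens_le_mean[OF p] hn by blast
      then show ?thesis using m False by (simp add: g_def e_def)
    qed
  qed
  have esum: "(\<Sum>p\<in>primes_le Z - primes_le W. e m p) \<le> 2 * ratio_tail H m" if "m > 0" for m
  proof -
    have "(\<Sum>p\<in>primes_le Z - primes_le W. e m p) = (\<Sum>p\<in>{p \<in> primes_le Z - primes_le W. p dvd m}. 2 / real p)"
      unfolding e_def by (rule sum.inter_filter[symmetric]) simp
    also have "\<dots> \<le> (\<Sum>p | prime p \<and> H < p \<and> p dvd m. 2 / real p)"
      unfolding D by (rule sum_mono2) (use finite_prime_divisors[OF that] in auto)
    also have "\<dots> = 2 * ratio_tail H m" by (simp add: ratio_tail_def sum_distrib_left)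
    finally show ?thesis .
  qed
  have WZ: "primes_le W \<subseteq> primes_le Z" by (rule primes_le_mono) (simp add: W_def)
  have "full_dens y z Z h = (\<Prod>p\<in>primes_le Z. sieve_mean y z p * g p)"
    unfolding full_dens_def
  proof (rule prod.cong[OF refl])
    fix p assume "p \<in> primes_le Z"
    then have "sieve_mean y z p > 0" using sieve_mean_pos by blast
    then show "dens y z p h = sieve_mean y z p * g p" by (simp add: g_def)
  qed
  also have "\<dots> = mertens_prod y * mertens_prod z * (\<Prod>p\<in>primes_le Z. g p)"
    by (simp add: prod.distrib prod_sieve_mean[OF Z])
  also have "(\<Prod>p\<in>primes_le Z. g p) = (\<Prod>p\<in>primes_le Z - primes_le W. g p) * (\<Prod>p\<in>primes_le W. g p)"
    by (rule prod.subset_diff[OF WZ]) simp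
  also have "\<dots> \<le> exp (2 * ratio_tail H (a * b) + 2 * ratio_tail H n) * (\<Prod>p\<in>primes_le W. g p)"
  proof (rule mult_right_mono)
    have "(\<Prod>p\<in>primes_le Z - primes_le W. g p) \<le> (\<Prod>p\<in>primes_le Z - primes_le W. exp (e (a * b) p + e n p))"
      by (intro prod_mono) (use g0 gle in auto)
    also have "\<dots> = exp (\<Sum>p\<in>primes_le Z - primes_le W. e (a * b) p + e n p)" by (simp add: exp_sum)
    also have "\<dots> \<le> exp (2 * ratio_tail H (a * b) + 2 * ratio_tail H n)"
      using esum[of "a * b"] esum[of n] a0 b0 n0 by (simp add: sum.distrib)
    finally show "(\<Prod>p\<in>primes_le Z - primes_le W. g p) \<le> exp (2 * ratio_tail H (a * b) + 2 * ratio_tail H n)" .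
    show "(\<Prod>p\<in>primes_le W. g p) \<ge> 0" by (intro prod_nonneg) (use g0 WZ in auto)
  qed
  finally show ?thesis
    using mertens_prod_pos[of y] mertens_prod_pos[of z]
    by (simp add: local_ratio_def g_def W_def n_def mult.assoc)
qed

lemma local_ratio_le: "local_ratio y z (min H Z) h \<le> 1 / mertens_prod H"
proof -
  have "local_ratio y z (min H Z) h \<le> (\<Prod>p\<in>primes_le (min H Z). 1 / (1 - 1 / real p))"
    unfolding local_ratio_def
  proof (intro prod_mono conjI)
    fix p assume "p \<in> primes_le (min H Z)"
    then have p: "prime p" by auto
    have m: "sieve_mean y z p > 0" by (rule sieve_mean_pos[OF p])
    have p1: "real p > 1" using prime_gt_1_nat[OF p] by simp
    show "dens y z p h / sieve_mean y z p \<ge> 0" using m dens_nonneg by (intro divide_nonneg_pos)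
    show "dens y z p h / sieve_mean y z p \<le> 1 / (1 - 1 / real p)"
      using dens_le[OF p, of y z h] m p1 by (simp add: field_simps)
  qed
  also have "\<dots> = 1 / mertens_prod (min H Z)" by (simp add: mertens_prod_def prod_dividef)
  also have "\<dots> \<le> 1 / mertens_prod H"
    using mertens_prod_pos[of H] mertens_prod_antimono[of "min H Z" H] by (simp add: frac_le)
  finally show ?thesis .
qed

lemma local_ratio_mean:
  "periodic (int (\<Prod>(primes_le W))) (local_ratio y z W)"
  "(\<Sum>h\<in>{0..<int (\<Prod>(primes_le W))}. local_ratio y z W h) = real (\<Prod>(primes_le W))"
proof -
  have per: "periodic (int p) (\<lambda>h. dens y z p h / sieve_mean y z p)" for p
    using periodic_dens[of p y z] by (simp add: periodic_def)
  show "periodic (int (\<Prod>(primes_le W))) (local_ratio y z W)"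
    unfolding periodic_def local_ratio_def
  proof (intro allI prod.cong refl)
    fix k p assume "p \<in> primes_le W"
    then have "p dvd \<Prod>(primes_le W)" using dvd_prodI[of "primes_le W" p "\<lambda>x. x"] by simp
    then obtain j where "\<Prod>(primes_le W) = p * j" by (rule dvdE)
    then have "k + int (\<Prod>(primes_le W)) = k + int p * int j" by simp
    then show "dens y z p (k + int (\<Prod>(primes_le W))) / sieve_mean y z p = dens y z p k / sieve_mean y z p"
      using periodic_add_mult[OF periodic_dens, of y z p k "int j"] by (simp only:)
  qed
  have "(\<Sum>h\<in>{0..<int (\<Prod>(primes_le W))}. local_ratio y z W h) = (\<Prod>p\<in>primes_le W. \<Sum>h\<in>{0..<int p}. dens y z p h / sieve_mean y z p)"
    unfolding local_ratio_def by (rule sum_prod_periodic) (use per in auto)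
  also have "\<dots> = (\<Prod>p\<in>primes_le W. real p)"
  proof (rule prod.cong[OF refl])
    fix p assume "p \<in> primes_le W"
    then have p: "prime p" by auto
    show "(\<Sum>h\<in>{0..<int p}. dens y z p h / sieve_mean y z p) = real p"
      using sum_dens[OF p, of y z] sieve_mean_pos[OF p, of y z] by (simp flip: sum_divide_distrib)
  qed
  finally show "(\<Sum>h\<in>{0..<int (\<Prod>(primes_le W))}. local_ratio y z W h) = real (\<Prod>(primes_le W))" by simp
qed

text \<open>Two estimates for the primes up to \<open>H\<close>. Averaging over the period has an
  error that is harmless when 4^H q is much smaller than c; the pointwise maximum 1 /
  \<open>mertens_prod H\<close> needs no such relation but loses a logarithm of
  \<open>H\<close>.\<close>

lemma sum_tent_dens_le:
  assumes Z: "y \<le> Z" "z \<le> Z" and q: "q > 0" "c > q" and H: "H \<ge> 2"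
  shows "(\<Sum>h\<in>{-N..N} - {0}. tent c (q * real_of_int h) * full_dens y z Z h)
    \<le> mertens_prod y * mertens_prod z * exp (2 * ratio_tail H (a * b) + 2 * (ln (c / q) / (real H * ln (real H))))
      * min (c\<^sup>2 / q + 2 * 4 ^ H * c) (3 * c\<^sup>2 / q / mertens_prod H)"
proof -
  define W where "W = min H Z"
  define E where "E = mertens_prod y * mertens_prod z * exp (2 * ratio_tail H (a * b) + 2 * (ln (c / q) / (real H * ln (real H))))"
  have E0: "E \<ge> 0" using mertens_prod_pos[of y] mertens_prod_pos[of z] by (simp add: E_def)
  have c0: "c > 0" using q by simp
  have lr: "local_ratio y z W h \<ge> 0" for h by (rule local_ratio_nonneg)
  have "(\<Sum>h\<in>{-N..N} - {0}. tent c (q * real_of_int h) * full_dens y z Z h)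
    \<le> (\<Sum>h\<in>{-N..N} - {0}. E * (tent c (q * real_of_int h) * local_ratio y z W h))"
  proof (rule sum_mono)
    fix h assume h: "h \<in> {-N..N} - {0}"
    show "tent c (q * real_of_int h) * full_dens y z Z h \<le> E * (tent c (q * real_of_int h) * local_ratio y z W h)"
    proof (cases "q * \<bar>real_of_int h\<bar> < c")
      case True
      have "full_dens y z Z h \<le> mertens_prod y * mertens_prod z
        * exp (2 * ratio_tail H (a * b) + 2 * ratio_tail H (nat \<bar>h\<bar>)) * local_ratio y z W h"
        unfolding W_def by (rule full_dens_le) (use Z h in auto)
      also have "\<dots> \<le> E * local_ratio y z W h"
      proof (intro mult_right_mono lr)
        have "real (nat \<bar>h\<bar>) \<le> c / q" using True q by (simp add: field_simps)
        then have "ratio_tail H (nat \<bar>h\<bar>) \<le> ln (c / q) / (real H * ln (real H))"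
          using h H by (intro ratio_tail_le) auto
        then show "mertens_prod y * mertens_prod z * exp (2 * ratio_tail H (a * b) + 2 * ratio_tail H (nat \<bar>h\<bar>)) \<le> E"
          unfolding E_def using mertens_prod_pos[of y] mertens_prod_pos[of z] by (intro mult_left_mono) auto
      qed
      finally have "tent c (q * real_of_int h) * full_dens y z Z h \<le> tent c (q * real_of_int h) * (E * local_ratio y z W h)"
        by (rule mult_left_mono) (rule tent_nonneg)
      then show ?thesis by (simp add: mult_ac)
    next
      case False
      then have "tent c (q * real_of_int h) = 0" using q by (simp add: tent_def abs_mult)
      then show ?thesis by simp
    qed
  qed
  also have "\<dots> = E * (\<Sum>h\<in>{-N..N} - {0}. tent c (q * real_of_int h) * local_ratio y z W h)"
    by (simp add: sum_distrib_left)
  also have "\<dots> \<le> E * min (c\<^sup>2 / q + 2 * 4 ^ H * c) (3 * c\<^sup>2 / q / mertens_prod H)"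
  proof (intro mult_left_mono min.boundedI E0)
    define R where "R = \<Prod>(primes_le W)"
    have R: "R > 0" "real R \<le> 4 ^ H"
    proof -
      show "R > 0" unfolding R_def by (rule primorial_pos)
      have "R \<le> 4 ^ W" unfolding R_def by (rule primorial_le)
      also have "(4::nat) ^ W \<le> 4 ^ H" by (rule power_increasing) (auto simp: W_def)
      finally show "real R \<le> 4 ^ H" by (metis of_nat_le_iff of_nat_numeral of_nat_power)
    qed
    have "(\<Sum>h\<in>{-N..N} - {0}. tent c (q * real_of_int h) * local_ratio y z W h) \<le> 1 * (c\<^sup>2 / q + 2 * real_of_int (int R) * c)"
      by (rule sum_tent_periodic_le) (use R local_ratio_mean[where W = W and y = y and z = z] lr c0 q in \<open>auto simp: R_def simp del: of_nat_prod\<close>)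
    also have "\<dots> \<le> c\<^sup>2 / q + 2 * 4 ^ H * c" using R c0 by simp
    finally show "(\<Sum>h\<in>{-N..N} - {0}. tent c (q * real_of_int h) * local_ratio y z W h) \<le> c\<^sup>2 / q + 2 * 4 ^ H * c" .
    have "(\<Sum>h\<in>{-N..N} - {0}. tent c (q * real_of_int h) * local_ratio y z W h)
      \<le> (\<Sum>h\<in>{-N..N} - {0}. 1 / mertens_prod H * (tent c (q * real_of_int h) * 1))"
    proof (rule sum_mono)
      fix h
      show "tent c (q * real_of_int h) * local_ratio y z W h \<le> 1 / mertens_prod H * (tent c (q * real_of_int h) * 1)"
        using mult_left_mono[OF local_ratio_le[of y z H Z h] tent_nonneg[of c "q * real_of_int h"]]
        by (simp add: W_def mult.commute)
    qed
    also have "\<dots> = 1 / mertens_prod H * (\<Sum>h\<in>{-N..N} - {0}. tent c (q * real_of_int h) * 1)"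
      by (simp only: sum_distrib_left)
    also have "\<dots> \<le> 1 / mertens_prod H * (1 * (c\<^sup>2 / q + 2 * real_of_int 1 * c))"
    proof (intro mult_left_mono sum_tent_periodic_le)
      show "periodic 1 (\<lambda>h. 1)" by (simp add: periodic_def)
    qed (use mertens_prod_pos[of H] c0 q in auto)
    also have "\<dots> \<le> 1 / mertens_prod H * (3 * c\<^sup>2 / q)"
    proof (intro mult_left_mono)
      have "c * q \<le> c * c" using q c0 by (intro mult_left_mono) auto
      then show "1 * (c\<^sup>2 / q + 2 * real_of_int 1 * c) \<le> 3 * c\<^sup>2 / q" using q by (simp add: field_simps power2_eq_square)
    qed (use mertens_prod_pos[of H] in auto)
    finally show "(\<Sum>h\<in>{-N..N} - {0}. tent c (q * real_of_int h) * local_ratio y z W h) \<le> 3 * c\<^sup>2 / q / mertens_prod H"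
      by (simp add: mult.commute)
  qed
  finally show ?thesis by (simp add: E_def)
qed

text \<open>The coincidences h = 0 are separated; for c <= q nothing else remains, because then the
  tent vanishes at q h for every h <> 0.\<close>

lemma pair_sum_le:
  assumes q: "q > 0" "c > 0" and H: "H \<ge> 2" and Z: "y \<le> Z" "z \<le> Z"
  obtains K where "\<And>X. X \<ge> 0 \<Longrightarrow> pair_sum c y z (q * real a) (q * real b) X
    \<le> (c * full_dens y z Z 0 / (q * real a * real b)
       + (if c \<le> q then 0 else mertens_prod y * mertens_prod z / ((q * real a) * (q * real b))
          * exp (2 * ratio_tail H (a * b) + 2 * (ln (c / q) / (real H * ln (real H))))
          * min (c\<^sup>2 + 2 * 4 ^ H * c * q) (3 * c\<^sup>2 / mertens_prod H))) * X + K"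
proof -
  define N where "N = \<lceil>c / q\<rceil>"
  have N: "c \<le> q * real_of_int N"
  proof -
    have "c / q \<le> real_of_int N" by (simp add: N_def)
    then show ?thesis using q by (simp add: field_simps)
  qed
  have N0: "N \<ge> 0" using ceiling_mono[of 0 "c / q"] q by (simp add: N_def)
  define S where "S = (\<Sum>h\<in>{-N..N} - {0}. tent c (q * real_of_int h) * full_dens y z Z h)"
  obtain K where K: "\<And>X. X \<ge> 0 \<Longrightarrow> pair_sum c y z (q * real a) (q * real b) X
    \<le> 1 / (q * real a * real b) * (\<Sum>h\<in>{-N..N}. tent c (q * real_of_int h) * full_dens y z Z h) * X + K"
    using pair_sum_rational_le[OF q(1) _ N Z] q by auto
  have sum_eq: "(\<Sum>h\<in>{-N..N}. tent c (q * real_of_int h) * full_dens y z Z h) = c * full_dens y z Z 0 + S"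
    unfolding S_def using N0 q by (subst sum.remove[of _ 0]) (auto simp: tent_def)
  define M where "M = mertens_prod y * mertens_prod z * exp (2 * ratio_tail H (a * b) + 2 * (ln (c / q) / (real H * ln (real H))))"
  have M0: "M \<ge> 0" using mertens_prod_pos[of y] mertens_prod_pos[of z] by (simp add: M_def)
  have S: "1 / (q * real a * real b) * S \<le> (if c \<le> q then 0 else M / ((q * real a) * (q * real b)) * min (c\<^sup>2 + 2 * 4 ^ H * c * q) (3 * c\<^sup>2 / mertens_prod H))"
  proof (cases "c \<le> q")
    case True
    have "tent c (q * real_of_int h) = 0" if "h \<noteq> 0" for h
    proof -
      have "1 \<le> \<bar>real_of_int h\<bar>" using that by linarith
      then have "q * 1 \<le> q * \<bar>real_of_int h\<bar>" using q by (intro mult_left_mono) auto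
      then have "c \<le> q * \<bar>real_of_int h\<bar>" using True by linarith
      then have "c \<le> \<bar>q * real_of_int h\<bar>" using q by (simp add: abs_mult)
      then show ?thesis by (simp add: tent_def)
    qed
    then have "S = 0" unfolding S_def by (intro sum.neutral) auto
    then show ?thesis using True by simp
  next
    case False
    have "S \<le> M * min (c\<^sup>2 / q + 2 * 4 ^ H * c) (3 * c\<^sup>2 / q / mertens_prod H)"
      unfolding S_def M_def by (rule sum_tent_dens_le) (use Z q False H in auto)
    also have "min (c\<^sup>2 / q + 2 * 4 ^ H * c) (3 * c\<^sup>2 / q / mertens_prod H)
      = min (c\<^sup>2 + 2 * 4 ^ H * c * q) (3 * c\<^sup>2 / mertens_prod H) / q"
      using q by (simp add: min_divide_distrib_right field_simps)
    finally have "1 / (q * real a * real b) * S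
      \<le> 1 / (q * real a * real b) * (M * (min (c\<^sup>2 + 2 * 4 ^ H * c * q) (3 * c\<^sup>2 / mertens_prod H) / q))"
      using q by (intro mult_left_mono) auto
    then show ?thesis using False by (simp add: field_simps)
  qed
  show ?thesis
  proof (rule that[of K])
    fix X :: real assume X: "X \<ge> 0"
    have "1 / (q * real a * real b) * (c * full_dens y z Z 0 + S)
      \<le> c * full_dens y z Z 0 / (q * real a * real b)
        + (if c \<le> q then 0 else M / ((q * real a) * (q * real b)) * min (c\<^sup>2 + 2 * 4 ^ H * c * q) (3 * c\<^sup>2 / mertens_prod H))"
      using S by (simp add: distrib_left)
    then have "1 / (q * real a * real b) * (c * full_dens y z Z 0 + S) * X
      \<le> (c * full_dens y z Z 0 / (q * real a * real b)
        + (if c \<le> q then 0 else M / ((q * real a) * (q * real b)) * min (c\<^sup>2 + 2 * 4 ^ H * c * q) (3 * c\<^sup>2 / mertens_prod H))) * X"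
      using X by (rule mult_right_mono)
    moreover have "(if c \<le> q then 0 else M / ((q * real a) * (q * real b)) * min (c\<^sup>2 + 2 * 4 ^ H * c * q) (3 * c\<^sup>2 / mertens_prod H))
      = (if c \<le> q then 0 else mertens_prod y * mertens_prod z / ((q * real a) * (q * real b))
          * exp (2 * ratio_tail H (a * b) + 2 * (ln (c / q) / (real H * ln (real H))))
          * min (c\<^sup>2 + 2 * 4 ^ H * c * q) (3 * c\<^sup>2 / mertens_prod H))"
      by (simp add: M_def)
    ultimately show "pair_sum c y z (q * real a) (q * real b) X
    \<le> (c * full_dens y z Z 0 / (q * real a * real b)
       + (if c \<le> q then 0 else mertens_prod y * mertens_prod z / ((q * real a) * (q * real b))
          * exp (2 * ratio_tail H (a * b) + 2 * (ln (c / q) / (real H * ln (real H))))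
          * min (c\<^sup>2 + 2 * 4 ^ H * c * q) (3 * c\<^sup>2 / mertens_prod H))) * X + K"
      using K[OF X] unfolding sum_eq by (simp only:)
  qed
qed

end

section \<open>Bad pairs\<close>

text \<open>\<alpha> / \<beta> as a reduced fraction a / b; then \<open>q\<close> is the largest
  common unit, a gcd of the two real numbers.\<close>

definition ratio_rep :: "real \<Rightarrow> real \<Rightarrow> real \<Rightarrow> nat \<Rightarrow> nat \<Rightarrow> bool" where
  "ratio_rep \<alpha> \<beta> q a b \<longleftrightarrow> q > 0 \<and> a > 0 \<and> b > 0 \<and> coprime a b \<and> \<alpha> = q * real a \<and> \<beta> = q * real b"

text \<open>The lower bound on \<open>q\<close> becomes a lower bound on a gcd of integers. Where a
  pair is charged as bad, c >= 64^(- H) and q > c / 64^(H + 1), so that q > 64^(- (2 H + 1)), which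
  the exponent 4 H covers.\<close>

definition bad_pair :: "real \<Rightarrow> nat \<Rightarrow> real \<Rightarrow> real \<Rightarrow> bool" where
  "bad_pair \<eta> H \<alpha> \<beta> \<longleftrightarrow> (\<exists>q a b. ratio_rep \<alpha> \<beta> q a b \<and> 1 / 64 ^ (4 * H) \<le> q \<and> ratio_tail H (a * b) > \<eta>)"

lemma ratio_rep_unique:
  assumes "ratio_rep \<alpha> \<beta> q a b" "ratio_rep \<alpha> \<beta> q' a' b'"
  shows "q = q'" "a = a'" "b = b'"
proof -
  have "q * real a * (q' * real b') = q' * real a' * (q * real b)"
    using assms by (simp add: ratio_rep_def)
  then have "q * q' * (real a * real b') = q * q' * (real a' * real b)" by (simp add: mult_ac)
  then have "real a * real b' = real a' * real b" using assms by (simp add: ratio_rep_def)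
  then have eq: "a * b' = a' * b" by (metis of_nat_eq_iff of_nat_mult)
  then have "a dvd a' * b" "a' dvd a * b'" by (metis dvd_triv_left)+
  then have "a dvd a'" "a' dvd a" using assms
    by (auto simp: ratio_rep_def coprime_dvd_mult_left_iff)
  then show aa: "a = a'" by (rule dvd_antisym)
  then show "q = q'" using assms by (auto simp: ratio_rep_def)
  show "b = b'" using eq aa assms by (auto simp: ratio_rep_def)
qed

lemma ratio_rep_multiples:
  assumes "\<theta> > 0" "n > 0" "m > 0"
  shows "ratio_rep (\<theta> * real n) (\<theta> * real m) (\<theta> * real (gcd n m)) (n div gcd n m) (m div gcd n m)"
proof -
  have g: "gcd n m > 0" using assms by simp
  have "real n = real (gcd n m) * real (n div gcd n m)" "real m = real (gcd n m) * real (m div gcd n m)"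
    by (metis dvd_mult_div_cancel gcd_dvd1 of_nat_mult, metis dvd_mult_div_cancel gcd_dvd2 of_nat_mult)
  moreover have "coprime (n div gcd n m) (m div gcd n m)" using assms by (intro div_gcd_coprime) auto
  moreover have "n div gcd n m > 0" "m div gcd n m > 0"
    using assms by (simp_all add: div_greater_zero_iff gcd_le1_nat gcd_le2_nat)
  ultimately show ?thesis using assms g by (simp add: ratio_rep_def)
qed

lemma ratio_rep_of_rational:
  assumes "\<alpha> > 0" "\<beta> > 0" "\<alpha> / \<beta> \<in> \<rat>"
  obtains q a b where "ratio_rep \<alpha> \<beta> q a b"
proof -
  obtain i j where ij: "\<alpha> / \<beta> = of_int i / of_int j" "j > 0" using assms(3) by (metis Rats_cases')
  then have i: "i > 0" using assms by (metis divide_pos_pos of_int_0_less_iff zero_less_divide_iff order.asym)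
  define n m where "n = nat i" and "m = nat j"
  have nm: "n > 0" "m > 0" "real n = of_int i" "real m = of_int j" using i ij by (auto simp: n_def m_def)
  have "\<alpha> = (\<beta> / real m) * real n" using ij nm assms by (simp add: field_simps)
  moreover have "\<beta> = (\<beta> / real m) * real m" using nm by simp
  ultimately show ?thesis
    using ratio_rep_multiples[of "\<beta> / real m" n m] nm assms that by (metis divide_pos_pos of_nat_0_less_iff)
qed

text \<open>Dividing out the gcd lowers both exponents equally, after which at most one of them is
  positive.\<close>

lemma prime_tail_eq_ratio_tail:
  assumes nm: "n > 0" "m > 0"
  shows "prime_tail H n m = ratio_tail H ((n div gcd n m) * (m div gcd n m))"
proof -
  define g a b where "g = gcd n m" and "a = n div g" and "b = m div g"
  have n: "n = g * a" and m: "m = g * b" by (simp_all add: g_def a_def b_def)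
  have pos: "g > 0" "a > 0" "b > 0" using nm n m by (auto intro: Nat.gr0I)
  have cop: "coprime a b" unfolding a_def b_def g_def using nm by (intro div_gcd_coprime) auto
  have "multiplicity p n \<noteq> multiplicity p m \<longleftrightarrow> p dvd a * b" if p: "prime p" for p
  proof -
    have pe: "prime_elem p" using p by simp
    have "multiplicity p n = multiplicity p g + multiplicity p a" "multiplicity p m = multiplicity p g + multiplicity p b"
      unfolding n m using pos pe by (simp_all add: prime_elem_multiplicity_mult_distrib)
    then have "multiplicity p n \<noteq> multiplicity p m \<longleftrightarrow> multiplicity p a \<noteq> multiplicity p b" by simp
    moreover have "\<not> (p dvd a \<and> p dvd b)" using cop p by (metis coprime_common_divisor not_prime_unit)
    moreover have "multiplicity p a > 0 \<longleftrightarrow> p dvd a" "multiplicity p b > 0 \<longleftrightarrow> p dvd b"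
      using pos p by (simp_all add: prime_multiplicity_gt_zero_iff)
    ultimately show ?thesis using p by (auto simp: prime_dvd_mult_iff)
  qed
  then have "{p. prime p \<and> H < p \<and> multiplicity p n \<noteq> multiplicity p m} = {p. prime p \<and> H < p \<and> p dvd a * b}" by blast
  then show ?thesis by (simp add: prime_tail_def ratio_tail_def a_def b_def g_def)
qed

text \<open>When x joins a set with unit \<theta>, the common unit of x and \<theta> serves the
  enlarged set. This carries statements on finite sets of integers over to finite sets of
  commensurable reals.\<close>

lemma common_unit:
  assumes "finite S" "\<And>x. x \<in> S \<Longrightarrow> x > 0 \<and> x / x0 \<in> \<rat>" "x0 > 0"
  obtains \<theta> :: real and f :: "real \<Rightarrow> nat" where "\<theta> > 0" "\<And>x. x \<in> S \<Longrightarrow> f x > 0 \<and> x = \<theta> * real (f x)"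
proof -
  have "\<exists>\<theta>>0. \<forall>x\<in>S. \<exists>n>0. x = \<theta> * real n"
    using assms(1,2)
  proof (induction S)
    case empty
    then show ?case by (intro exI[of _ 1]) auto
  next
    case (insert x S)
    then obtain \<theta> where \<theta>: "\<theta> > 0" "\<forall>y\<in>S. \<exists>n>0. y = \<theta> * real n" by auto
    show ?case
    proof (cases "S = {}")
      case True
      then show ?thesis using insert.prems[of x] by (intro exI[of _ x]) (auto intro!: exI[of _ "1::nat"])
    next
      case False
      then obtain y where y: "y \<in> S" by auto
      then obtain n where n: "n > 0" "y = \<theta> * real n" using \<theta> by auto
      have "x / \<theta> = (x / x0) / (y / x0) * real n" using n \<theta> insert.prems[of y] y assms(3) by (simp add: field_simps)
      moreover have "x / x0 \<in> \<rat>" "y / x0 \<in> \<rat>" using insert.prems[of x] insert.prems[of y] y by auto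
      then have "(x / x0) / (y / x0) * real n \<in> \<rat>" by (intro Rats_mult[OF Rats_divide Rats_of_nat])
      ultimately have "x / \<theta> \<in> \<rat>" by simp
      then obtain q a b where r: "ratio_rep x \<theta> q a b"
        using ratio_rep_of_rational[of x \<theta>] \<theta> insert.prems[of x] by auto
      show ?thesis
      proof (intro exI[of _ q] conjI ballI)
        show "q > 0" using r by (simp add: ratio_rep_def)
        fix u assume "u \<in> insert x S"
        then show "\<exists>n>0. u = q * real n"
        proof
          assume "u = x" then show ?thesis using r by (auto simp: ratio_rep_def)
        next
          assume "u \<in> S"
          then obtain n where "n > 0" "u = \<theta> * real n" using \<theta> by auto
          then show ?thesis using r by (intro exI[of _ "b * n"]) (auto simp: ratio_rep_def)
        qed
      qed
    qed
  qed
  then obtain \<theta> where \<theta>: "\<theta> > 0" "\<forall>x\<in>S. \<exists>n>0. x = \<theta> * real n" by blast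
  then obtain f where "\<forall>x\<in>S. f x > 0 \<and> x = \<theta> * real (f x)" by metis
  with \<theta> show ?thesis by (intro that[of \<theta> f]) auto
qed

text \<open>Bounds e i <= K^(1/4) (a i b i)^(3/4) add up over disjoint classes without loss: a
  quarter power of a i and of b i is replaced by that of the total, and Cauchy-Schwarz sums the
  remaining square roots.\<close>

lemma sum_three_quarter_powers:
  fixes a b e :: "'c \<Rightarrow> real"
  assumes "finite I" and nonneg: "\<And>i. i \<in> I \<Longrightarrow> a i \<ge> 0 \<and> b i \<ge> 0 \<and> e i \<ge> 0"
    and le: "\<And>i. i \<in> I \<Longrightarrow> e i ^ 4 \<le> K * (a i * b i) ^ 3" and K: "K \<ge> 0"
  shows "(\<Sum>i\<in>I. e i) ^ 4 \<le> K * ((\<Sum>i\<in>I. a i) * (\<Sum>i\<in>I. b i)) ^ 3"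
proof -
  define A B \<kappa> where "A = (\<lambda>i. root 4 (a i))" and "B = (\<lambda>i. root 4 (b i))" and "\<kappa> = root 4 K"
  define SA SB where "SA = root 4 (\<Sum>i\<in>I. a i)" and "SB = root 4 (\<Sum>i\<in>I. b i)"
  have p4: "A i ^ 4 = a i" "B i ^ 4 = b i" if "i \<in> I" for i using nonneg[OF that] by (auto simp: A_def B_def)
  have k4: "\<kappa> ^ 4 = K" using K by (simp add: \<kappa>_def)
  have S4: "SA ^ 4 = (\<Sum>i\<in>I. a i)" "SB ^ 4 = (\<Sum>i\<in>I. b i)"
    using nonneg by (auto simp: SA_def SB_def sum_nonneg)
  have n: "A i \<ge> 0" "B i \<ge> 0" if "i \<in> I" for i using nonneg[OF that] by (auto simp: A_def B_def)
  have n2: "\<kappa> \<ge> 0" "SA \<ge> 0" "SB \<ge> 0" using K nonneg by (auto simp: \<kappa>_def SA_def SB_def sum_nonneg)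
  have AS: "A i \<le> SA" "B i \<le> SB" if "i \<in> I" for i
    unfolding A_def SA_def B_def SB_def
    by (intro real_root_le_mono member_le_sum; use nonneg that assms(1) in auto)+
  have "e i \<le> \<kappa> * (SA * SB * ((A i)\<^sup>2 * (B i)\<^sup>2))" if i: "i \<in> I" for i
  proof -
    have "e i ^ 4 \<le> (\<kappa> * (A i * B i) ^ 3) ^ 4"
    proof -
      have "(\<kappa> * (A i * B i) ^ 3) ^ 4 = \<kappa> ^ 4 * (A i ^ 4 * B i ^ 4) ^ 3"
        by (simp add: power_mult_distrib flip: power_mult)
      then show ?thesis using le[OF i] by (simp add: p4[OF i] k4)
    qed
    then have "e i \<le> \<kappa> * (A i * B i) ^ 3"
      by (rule power_le_imp_le_base[of _ 3, simplified]) (use n[OF i] n2 in auto)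
    also have "(A i * B i) ^ 3 = (A i * B i) * ((A i)\<^sup>2 * (B i)\<^sup>2)" by (simp add: power3_eq_cube power2_eq_square)
    also have "\<kappa> * \<dots> \<le> \<kappa> * ((SA * SB) * ((A i)\<^sup>2 * (B i)\<^sup>2))"
      using n[OF i] n2 AS[OF i] by (intro mult_left_mono mult_right_mono mult_mono) auto
    finally show ?thesis .
  qed
  then have "(\<Sum>i\<in>I. e i) \<le> (\<Sum>i\<in>I. \<kappa> * (SA * SB * ((A i)\<^sup>2 * (B i)\<^sup>2)))" by (rule sum_mono)
  also have "\<dots> = \<kappa> * (SA * SB * (\<Sum>i\<in>I. (A i)\<^sup>2 * (B i)\<^sup>2))" by (simp add: sum_distrib_left)
  also have "\<dots> \<le> \<kappa> * (SA * SB * (SA\<^sup>2 * SB\<^sup>2))"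
  proof (intro mult_left_mono)
    have "(\<Sum>i\<in>I. (A i)\<^sup>2 * (B i)\<^sup>2)\<^sup>2 \<le> (\<Sum>i\<in>I. ((A i)\<^sup>2)\<^sup>2) * (\<Sum>i\<in>I. ((B i)\<^sup>2)\<^sup>2)"
      by (rule Cauchy_Schwarz_ineq_sum)
    also have "\<dots> = (\<Sum>i\<in>I. a i) * (\<Sum>i\<in>I. b i)" using p4 by (simp flip: power_mult)
    also have "\<dots> = (SA\<^sup>2 * SB\<^sup>2)\<^sup>2" by (simp add: power_mult_distrib S4[symmetric] flip: power_mult)
    finally show "(\<Sum>i\<in>I. (A i)\<^sup>2 * (B i)\<^sup>2) \<le> SA\<^sup>2 * SB\<^sup>2" by (rule power2_le_imp_le) simp
  qed (use n2 in auto)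
  finally have "(\<Sum>i\<in>I. e i) ^ 4 \<le> (\<kappa> * (SA * SB * (SA\<^sup>2 * SB\<^sup>2))) ^ 4"
    using nonneg by (intro power_mono sum_nonneg) auto
  also have "\<dots> = \<kappa> ^ 4 * (SA ^ 4 * SB ^ 4) ^ 3" by (simp add: power_mult_distrib flip: power_mult power_add) (simp add: eval_nat_numeral mult_ac)
  finally show ?thesis by (simp add: k4 S4)
qed

text \<open>Bad pairs are commensurable, so they split into classes of commensurable numbers. In
  each class a unit \<theta> reduces the question to integers; it cancels in M N / D^2, since sizes
  and gcd scale alike, and the classes are then added up.\<close>

theorem bad_pairs_block:
  fixes \<eta> \<Lambda> :: real
  assumes "\<eta> > 0"
  obtains H0 where "\<And>H A B M N. H \<ge> H0 \<Longrightarrow> finite A \<Longrightarrow> finite B \<Longrightarrow>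
      (\<And>x. x \<in> A \<Longrightarrow> 0 < x \<and> x \<le> M) \<Longrightarrow> (\<And>x. x \<in> B \<Longrightarrow> 0 < x \<and> x \<le> N) \<Longrightarrow> 0 < M \<Longrightarrow> 0 < N \<Longrightarrow>
      real (card {(\<alpha>, \<beta>) \<in> A \<times> B. bad_pair \<eta> H \<alpha> \<beta>}) ^ 4
        \<le> exp (- \<Lambda> * real H) * (M * N * 64 ^ (8 * H)) * (real (card A) * real (card B)) ^ 3"
proof -
  obtain H0 where H0: "\<And>H A B E M N D. H \<ge> H0 \<Longrightarrow> finite A \<Longrightarrow> finite B \<Longrightarrow> E \<subseteq> A \<times> B \<Longrightarrow> D > 0 \<Longrightarrow>
      (\<And>n. n \<in> A \<Longrightarrow> n > 0 \<and> real n \<le> M) \<Longrightarrow> (\<And>n. n \<in> B \<Longrightarrow> n > 0 \<and> real n \<le> N) \<Longrightarrow>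
      (\<And>n m. (n, m) \<in> E \<Longrightarrow> D \<le> real (gcd n m) \<and> prime_tail H n m > \<eta>) \<Longrightarrow>
      real (card E) ^ 4 * D\<^sup>2 \<le> exp (- \<Lambda> * real H) * (real (card A) * real (card B)) ^ 3 * (M * N)"
    using gcd_graph_bound[OF assms, of \<Lambda>] by blast
  show ?thesis
  proof (rule that[of H0])
    fix H and A B :: "real set" and M N :: real
    assume H: "H \<ge> H0" and fin: "finite A" "finite B" and A: "\<And>x. x \<in> A \<Longrightarrow> 0 < x \<and> x \<le> M"
      and B: "\<And>x. x \<in> B \<Longrightarrow> 0 < x \<and> x \<le> N" and MN: "0 < M" "0 < N"
    define E where "E = {(\<alpha>, \<beta>) \<in> A \<times> B. bad_pair \<eta> H \<alpha> \<beta>}"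
    define K where "K = exp (- \<Lambda> * real H) * (M * N * 64 ^ (8 * H))"
    have finE: "finite E" unfolding E_def by (rule finite_subset[of _ "A \<times> B"]) (use fin in auto)
    define cl where "cl = (\<lambda>x::real. {y. y > 0 \<and> y / x \<in> \<rat>})"
    have cl_eq: "cl x = cl y" if "x > 0" "y > 0" "x / y \<in> \<rat>" for x y
    proof -
      have "u / x \<in> \<rat> \<longleftrightarrow> u / y \<in> \<rat>" for u
      proof
        assume "u / x \<in> \<rat>"
        then have "u / x * (x / y) \<in> \<rat>" using that(3) by (rule Rats_mult)
        then show "u / y \<in> \<rat>" using that by simp
      next
        assume "u / y \<in> \<rat>"
        then have "u / y / (x / y) \<in> \<rat>" using that(3) by (rule Rats_divide)
        then show "u / x \<in> \<rat>" using that by simp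
      qed
      then show ?thesis by (simp add: cl_def)
    qed
    have cl_self: "x \<in> cl x" if "x > 0" for x using that by (simp add: cl_def)
    define I where "I = cl ` A"
    define a b e where "a = (\<lambda>C. {x \<in> A. cl x = C})" and "b = (\<lambda>C. {x \<in> B. cl x = C})"
      and "e = (\<lambda>C. {x \<in> E. cl (fst x) = C})"
    have finI: "finite I" using fin by (simp add: I_def)
    have same: "cl \<alpha> = cl \<beta>" if ab: "(\<alpha>, \<beta>) \<in> E" for \<alpha> \<beta>
    proof -
      obtain q m n where r: "ratio_rep \<alpha> \<beta> q m n" using ab by (auto simp: E_def bad_pair_def)
      then have "\<alpha> / \<beta> = real m / real n" by (auto simp: ratio_rep_def)
      then have "\<alpha> / \<beta> \<in> \<rat>" by simp
      then show ?thesis using r by (intro cl_eq) (auto simp: ratio_rep_def)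
    qed
    have class_bound: "real (card (e C)) ^ 4 \<le> K * (real (card (a C)) * real (card (b C))) ^ 3" if CI: "C \<in> I" for C
    proof -
      obtain x0 where x0: "x0 \<in> A" "C = cl x0" using CI by (auto simp: I_def)
      have x0p: "x0 > 0" using A x0 by auto
      have "finite (a C \<union> b C)" using fin by (simp add: a_def b_def)
      moreover have "x > 0 \<and> x / x0 \<in> \<rat>" if x: "x \<in> a C \<union> b C" for x
      proof -
        have xp: "x > 0" using x A B by (auto simp: a_def b_def)
        moreover have "cl x = cl x0" using x x0 by (auto simp: a_def b_def)
        then have "x \<in> cl x0" using cl_self[OF xp] by simp
        ultimately show ?thesis by (simp add: cl_def)
      qed
      ultimately obtain \<theta> f where \<theta>: "\<theta> > 0" and f: "\<And>x. x \<in> a C \<union> b C \<Longrightarrow> f x > 0 \<and> x = \<theta> * real (f x)"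
        using common_unit[of "a C \<union> b C" x0] x0p by blast
      have inj: "inj_on f (a C \<union> b C)" using f by (metis inj_onI)
      define A' B' E' where "A' = f ` a C" and "B' = f ` b C" and "E' = map_prod f f ` e C"
      have eC: "e C \<subseteq> a C \<times> b C" using same by (auto simp: e_def a_def b_def E_def)
      have cards: "card A' = card (a C)" "card B' = card (b C)" "card E' = card (e C)"
      proof -
        show "card A' = card (a C)" "card B' = card (b C)"
          unfolding A'_def B'_def by (intro card_image inj_on_subset[OF inj]; auto)+
        have "inj_on f (a C)" "inj_on f (b C)" by (rule inj_on_subset[OF inj]; auto)+
        then have "inj_on (map_prod f f) (e C)" by (rule inj_on_subset[OF map_prod_inj_on eC])
        then show "card E' = card (e C)" unfolding E'_def by (rule card_image)
      qed
      \<comment> \<open>In units of \<theta> the bound on q becomes gcd >= D.\<close>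
      define D where "D = 1 / 64 ^ (4 * H) / \<theta>"
      have "real (card E') ^ 4 * D\<^sup>2 \<le> exp (- \<Lambda> * real H) * (real (card A') * real (card B')) ^ 3 * (M / \<theta> * (N / \<theta>))"
      proof (rule H0[OF H])
        show "finite A'" "finite B'" using fin by (auto simp: A'_def B'_def a_def b_def)
        show "E' \<subseteq> A' \<times> B'" using eC by (auto simp: E'_def A'_def B'_def)
        show "D > 0" using \<theta> by (simp add: D_def)
        show "n > 0 \<and> real n \<le> M / \<theta>" if n: "n \<in> A'" for n
        proof -
          obtain x where x: "x \<in> a C" "n = f x" using n by (auto simp: A'_def)
          then have "x \<le> M" using A by (auto simp: a_def)
          moreover have "f x > 0" "x = \<theta> * real (f x)" using f x by auto
          ultimately show ?thesis using x \<theta> by (simp add: pos_le_divide_eq mult.commute)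
        qed
        show "n > 0 \<and> real n \<le> N / \<theta>" if n: "n \<in> B'" for n
        proof -
          obtain x where x: "x \<in> b C" "n = f x" using n by (auto simp: B'_def)
          then have "x \<le> N" using B by (auto simp: b_def)
          moreover have "f x > 0" "x = \<theta> * real (f x)" using f x by auto
          ultimately show ?thesis using x \<theta> by (simp add: pos_le_divide_eq mult.commute)
        qed
        fix n m assume "(n, m) \<in> E'"
        then obtain \<alpha> \<beta> where nm: "(\<alpha>, \<beta>) \<in> e C" "n = f \<alpha>" "m = f \<beta>" by (auto simp: E'_def)
        then have ab: "\<alpha> \<in> a C" "\<beta> \<in> b C" using eC by auto
        then have \<alpha>: "n > 0" "\<alpha> = \<theta> * real n" and \<beta>: "m > 0" "\<beta> = \<theta> * real m" using f nm by auto
        have "bad_pair \<eta> H \<alpha> \<beta>" using nm by (auto simp: e_def E_def)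
        then obtain q u v where r: "ratio_rep \<alpha> \<beta> q u v" "1 / 64 ^ (4 * H) \<le> q" "ratio_tail H (u * v) > \<eta>"
          by (auto simp: bad_pair_def)
        have r2: "ratio_rep \<alpha> \<beta> (\<theta> * real (gcd n m)) (n div gcd n m) (m div gcd n m)"
          unfolding \<alpha>(2) \<beta>(2) by (rule ratio_rep_multiples) (use \<theta> \<alpha> \<beta> in auto)
        note eqs = ratio_rep_unique[OF r(1) r2]
        have "D \<le> real (gcd n m)" using r(2) \<theta> unfolding D_def eqs(1) by (simp add: pos_divide_le_eq mult_ac)
        moreover have "prime_tail H n m > \<eta>"
          using r(3) unfolding prime_tail_eq_ratio_tail[OF \<alpha>(1) \<beta>(1)] eqs(2,3) .
        ultimately show "D \<le> real (gcd n m) \<and> prime_tail H n m > \<eta>" by simp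
      qed
      then have "real (card (e C)) ^ 4 * D\<^sup>2 * (\<theta>\<^sup>2 * 64 ^ (8 * H)) \<le>
        exp (- \<Lambda> * real H) * (real (card (a C)) * real (card (b C))) ^ 3 * (M / \<theta> * (N / \<theta>)) * (\<theta>\<^sup>2 * 64 ^ (8 * H))"
        unfolding cards using \<theta> by (intro mult_right_mono) auto
      then have le: "real (card (e C)) ^ 4 * (D\<^sup>2 * (\<theta>\<^sup>2 * 64 ^ (8 * H))) \<le>
        exp (- \<Lambda> * real H) * (real (card (a C)) * real (card (b C))) ^ 3 * ((M / \<theta> * (N / \<theta>)) * (\<theta>\<^sup>2 * 64 ^ (8 * H)))"
        by (simp only: mult.assoc)
      have one: "D\<^sup>2 * (\<theta>\<^sup>2 * 64 ^ (8 * H)) = 1"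
      proof -
        have "(64::real) ^ (8 * H) = (64 ^ (4 * H))\<^sup>2" by (simp flip: power_mult)
        then show ?thesis using \<theta> by (simp add: D_def power_divide power_mult_distrib mult.commute)
      qed
      have MN': "(M / \<theta> * (N / \<theta>)) * (\<theta>\<^sup>2 * 64 ^ (8 * H)) = M * N * 64 ^ (8 * H)"
        using \<theta> by (simp add: power2_eq_square)
      show ?thesis using le unfolding one MN' K_def by (simp add: mult_ac)
    qed
    have "(\<Sum>C\<in>I. real (card (e C))) ^ 4 \<le> K * ((\<Sum>C\<in>I. real (card (a C))) * (\<Sum>C\<in>I. real (card (b C)))) ^ 3"
      by (rule sum_three_quarter_powers) (use finI class_bound MN in \<open>auto simp: K_def\<close>)
    also have "\<dots> \<le> K * (real (card A) * real (card B)) ^ 3"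
    proof (intro mult_left_mono power_mono mult_mono)
      have sum_le: "(\<Sum>C\<in>I. real (card {x \<in> T. cl x = C})) \<le> real (card T)" if "finite T" for T
      proof -
        have "(\<Sum>C\<in>I. card {x \<in> T. cl x = C}) = card (\<Union>C\<in>I. {x \<in> T. cl x = C})"
          by (rule card_UN_disjoint[symmetric]) (use finI that in auto)
        also have "\<dots> \<le> card T" by (rule card_mono) (use that in auto)
        finally show ?thesis by (simp flip: of_nat_sum)
      qed
      show "(\<Sum>C\<in>I. real (card (a C))) \<le> real (card A)" "(\<Sum>C\<in>I. real (card (b C))) \<le> real (card B)"
        unfolding a_def b_def by (intro sum_le fin)+
    qed (use MN in \<open>auto simp: K_def intro!: sum_nonneg mult_nonneg_nonneg\<close>)
    also have "(\<Sum>C\<in>I. real (card (e C))) = real (card E)"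
    proof -
      have "(\<Sum>C\<in>I. card (e C)) = card (\<Union>C\<in>I. e C)"
        by (rule card_UN_disjoint[symmetric]) (use finI finE in \<open>auto simp: e_def\<close>)
      also have "(\<Union>C\<in>I. e C) = E" by (auto simp: e_def I_def E_def)
      finally show ?thesis by (simp flip: of_nat_sum)
    qed
    finally show "real (card {(\<alpha>, \<beta>) \<in> A \<times> B. bad_pair \<eta> H \<alpha> \<beta>}) ^ 4
        \<le> exp (- \<Lambda> * real H) * (M * N * 64 ^ (8 * H)) * (real (card A) * real (card B)) ^ 3"
      by (simp add: E_def K_def)
  qed
qed

section \<open>The second moment\<close>

text \<open>The integral of the square of (sum of the indicators) - \<kappa> (indicator of G),
  expanded. This is Cauchy-Schwarz with \<kappa> left free; it will be the expected number of
  intervals covering a point.\<close>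

lemma l2_inequality:
  fixes I :: "'i \<Rightarrow> real set" and G :: "real set"
  assumes "finite P" and I: "\<And>i. i \<in> P \<Longrightarrow> I i \<in> fmeasurable lborel" and G: "G \<in> fmeasurable lborel"
    and sub: "\<And>i. i \<in> P \<Longrightarrow> I i \<subseteq> G"
  shows "0 \<le> (\<Sum>i\<in>P. \<Sum>j\<in>P. measure lborel (I i \<inter> I j)) - 2 * \<kappa> * (\<Sum>i\<in>P. measure lborel (I i)) + \<kappa>\<^sup>2 * measure lborel G"
proof -
  have int: "integrable lborel (indicator S :: real \<Rightarrow> real)" "integral\<^sup>L lborel (indicator S :: real \<Rightarrow> real) = measure lborel S"
    if "S \<in> fmeasurable lborel" for S
    using that by (auto simp: fmeasurable_def integrable_indicator_iff)
  define f :: "real \<Rightarrow> real" where "f = (\<lambda>t. \<Sum>i\<in>P. indicator (I i) t)"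
  have eq: "(f t - \<kappa> * indicator G t)\<^sup>2 = (\<Sum>i\<in>P. \<Sum>j\<in>P. indicator (I i \<inter> I j) t) - 2 * \<kappa> * (\<Sum>i\<in>P. indicator (I i) t) + \<kappa>\<^sup>2 * indicator G t" for t
  proof -
    have "f t * f t = (\<Sum>i\<in>P. \<Sum>j\<in>P. indicator (I i \<inter> I j) t)"
      unfolding f_def sum_product by (simp add: indicator_inter_arith)
    moreover have "f t * indicator G t = f t"
    proof -
      have "f t * indicator G t = (\<Sum>i\<in>P. indicator (I i) t * indicator G t)" by (simp add: f_def sum_distrib_right)
      also have "\<dots> = f t" unfolding f_def
        by (rule sum.cong[OF refl]) (use sub in \<open>auto simp: indicator_def\<close>)
      finally show ?thesis .
    qed
    moreover have "indicator G t * indicator G t = (indicator G t :: real)" by (simp add: indicator_def)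
    moreover have "(f t - \<kappa> * indicator G t)\<^sup>2 = f t * f t - 2 * \<kappa> * (f t * indicator G t) + \<kappa>\<^sup>2 * (indicator G t * indicator G t)"
      by (simp add: power2_eq_square algebra_simps)
    ultimately show ?thesis by (simp only: f_def)
  qed
  have "0 \<le> integral\<^sup>L lborel (\<lambda>t. (f t - \<kappa> * indicator G t)\<^sup>2)" by (rule integral_nonneg_AE) simp
  also have "\<dots> = integral\<^sup>L lborel (\<lambda>t. (\<Sum>i\<in>P. \<Sum>j\<in>P. indicator (I i \<inter> I j) t) - 2 * \<kappa> * (\<Sum>i\<in>P. indicator (I i) t) + \<kappa>\<^sup>2 * indicator G t)"
    by (simp only: eq)
  also have "\<dots> = (\<Sum>i\<in>P. \<Sum>j\<in>P. measure lborel (I i \<inter> I j)) - 2 * \<kappa> * (\<Sum>i\<in>P. measure lborel (I i)) + \<kappa>\<^sup>2 * measure lborel G"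
  proof -
    have IJ: "I i \<inter> I j \<in> fmeasurable lborel" if "i \<in> P" "j \<in> P" for i j
      using I[OF that(1)] I[OF that(2)] by (intro fmeasurable.Int)
    have "integrable lborel (\<lambda>t. \<Sum>i\<in>P. \<Sum>j\<in>P. indicator (I i \<inter> I j) t :: real)"
      "integrable lborel (\<lambda>t. \<Sum>i\<in>P. indicator (I i) t :: real)"
      by (intro Bochner_Integration.integrable_sum int IJ I; assumption)+
    moreover have "integral\<^sup>L lborel (\<lambda>t. \<Sum>i\<in>P. \<Sum>j\<in>P. indicator (I i \<inter> I j) t :: real) = (\<Sum>i\<in>P. \<Sum>j\<in>P. measure lborel (I i \<inter> I j))"
    proof -
      have "integral\<^sup>L lborel (\<lambda>t. \<Sum>i\<in>P. \<Sum>j\<in>P. indicator (I i \<inter> I j) t :: real) = (\<Sum>i\<in>P. integral\<^sup>L lborel (\<lambda>t. \<Sum>j\<in>P. indicator (I i \<inter> I j) t :: real))"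
        by (rule Bochner_Integration.integral_sum) (intro Bochner_Integration.integrable_sum int IJ; assumption)
      also have "\<dots> = (\<Sum>i\<in>P. \<Sum>j\<in>P. integral\<^sup>L lborel (indicator (I i \<inter> I j) :: real \<Rightarrow> real))"
        by (intro sum.cong refl Bochner_Integration.integral_sum) (intro int IJ; assumption)
      also have "\<dots> = (\<Sum>i\<in>P. \<Sum>j\<in>P. measure lborel (I i \<inter> I j))"
        by (intro sum.cong refl int IJ)
      finally show ?thesis .
    qed
    moreover have "integral\<^sup>L lborel (\<lambda>t. \<Sum>i\<in>P. indicator (I i) t :: real) = (\<Sum>i\<in>P. measure lborel (I i))"
      using int I by (subst Bochner_Integration.integral_sum) auto
    ultimately show ?thesis using int[OF G] by simp
  qed
  finally show ?thesis .
qed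

section \<open>Sieved multiples, the diagonal, and bad pairs in logarithmic density\<close>

lemma count_rough:
  assumes "\<alpha> > 0"
  obtains K where "\<And>X. X \<ge> 0 \<Longrightarrow> \<bar>real (card {n. n \<in> rough z \<and> real n * \<alpha> \<le> X}) - mertens_prod z / \<alpha> * X\<bar> \<le> K"
proof (rule that[of "real (\<Prod>(primes_le z)) + 1"])
  fix X :: real assume X: "X \<ge> 0"
  define P where "P = \<Prod>(primes_le z)"
  have P: "P > 0" unfolding P_def by (rule primorial_pos)
  define v where "v = mertens_prod z"
  have v: "0 < v" "v \<le> 1" using mertens_prod_pos mertens_prod_le_1 by (auto simp: v_def)
  define f where "f = (\<lambda>k. \<Prod>p\<in>primes_le z. sieve z p k)"
  have f0: "f k \<ge> 0" for k unfolding f_def by (intro prod_nonneg) (auto simp: sieve_nonneg)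
  have f_eq: "f k = (if \<forall>p\<in>primes_le z. \<not> int p dvd k then 1 else 0)" for k
    unfolding f_def by (rule prod_sieve_eq) simp
  have sumf: "(\<Sum>k\<in>{0..<int P}. f k) = real P * v"
    unfolding f_def P_def v_def by (rule card_residues) simp
  have per: "periodic (int P) f"
  proof -
    have "int p dvd k + int P \<longleftrightarrow> int p dvd k" if "p \<in> primes_le z" for p k
    proof -
      have "int p dvd int P"
        unfolding int_dvd_int_iff P_def using dvd_prodI[of "primes_le z" p "\<lambda>x. x"] that by simp
      then show ?thesis by (rule dvd_add_left_iff)
    qed
    then show ?thesis unfolding periodic_def f_eq by simp
  qed
  define L where "L = \<lfloor>X / \<alpha>\<rfloor>"
  have L0: "L \<ge> 0" using X assms by (simp add: L_def)
  define S where "S = {n. n \<in> rough z \<and> real n * \<alpha> \<le> X}"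
  have iff: "real n * \<alpha> \<le> X \<longleftrightarrow> int n \<le> L" for n
    using assms by (simp add: L_def le_floor_iff pos_le_divide_eq)
  have "int ` S = {k \<in> {1..<1 + L}. \<forall>p\<in>primes_le z. \<not> int p dvd k}"
  proof
    show "{k \<in> {1..<1 + L}. \<forall>p\<in>primes_le z. \<not> int p dvd k} \<subseteq> int ` S"
    proof
      fix k assume k: "k \<in> {k \<in> {1..<1 + L}. \<forall>p\<in>primes_le z. \<not> int p dvd k}"
      then have kn: "k = int (nat k)" by simp
      have "int p dvd k \<longleftrightarrow> p dvd nat k" for p using k by (simp flip: int_dvd_int_iff)
      then have "nat k \<in> S" using k by (auto simp: S_def rough_def iff)
      then show "k \<in> int ` S" using kn by blast
    qed
  qed (auto simp: S_def rough_def iff)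
  then have "card S = card {k \<in> {1..<1 + L}. \<forall>p\<in>primes_le z. \<not> int p dvd k}"
    by (metis card_image inj_on_of_nat)
  also have "real \<dots> = (\<Sum>k\<in>{1..<1 + L}. f k)"
    unfolding f_eq by (simp add: sum.inter_filter[symmetric])
  finally have cS: "real (card S) = (\<Sum>k\<in>{1..<1 + L}. f k)" .
  have lo: "(real_of_int L / real P - 1) * (real P * v) \<le> real (card S)"
    and hi: "real (card S) \<le> (real_of_int L / real P + 1) * (real P * v)"
    using sum_periodic_ge[OF per _ f0 L0, of 1] sum_periodic_le[OF per _ f0 L0, of 1] P
    by (simp_all add: cS sumf)
  have e: "(real_of_int L / real P - 1) * (real P * v) = real_of_int L * v - real P * v"
    "(real_of_int L / real P + 1) * (real P * v) = real_of_int L * v + real P * v"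
    using P by (simp_all add: field_simps)
  have Lb: "real_of_int L \<le> X / \<alpha>" "X / \<alpha> - 1 \<le> real_of_int L" unfolding L_def by linarith+
  have "real_of_int L * v \<le> X / \<alpha> * v" "(X / \<alpha> - 1) * v \<le> real_of_int L * v"
    using Lb v by (intro mult_right_mono; simp)+
  moreover have "(X / \<alpha> - 1) * v = X / \<alpha> * v - v" by (simp add: algebra_simps)
  moreover have "real P * v \<le> real P" using v by (simp add: mult_left_le)
  moreover have "v / \<alpha> * X = X / \<alpha> * v" by simp
  ultimately show "\<bar>real (card {n. n \<in> rough z \<and> real n * \<alpha> \<le> X}) - mertens_prod z / \<alpha> * X\<bar> \<le> real (\<Prod>(primes_le z)) + 1"
    using lo hi v unfolding e S_def[symmetric] P_def[symmetric] v_def[symmetric] by linarith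
qed

text \<open>Distinct multiples of \<alpha> >= c are too far apart to overlap, so each interval meets
  only itself.\<close>

lemma pair_sum_diagonal:
  assumes "\<alpha> \<ge> c" "c \<ge> 0" "\<alpha> > 0"
  shows "pair_sum c z z \<alpha> \<alpha> X = c * real (card {n. n \<in> rough z \<and> real n * \<alpha> \<le> X})"
proof -
  have fin: "finite {m. m \<in> rough z \<and> real m * \<alpha> \<le> X}" using assms by simp
  have "(\<Sum>m | m \<in> rough z \<and> real m * \<alpha> \<le> X. tent c (real n * \<alpha> - real m * \<alpha>)) = c"
    if n: "n \<in> rough z \<and> real n * \<alpha> \<le> X" for n
  proof -
    have "tent c (real n * \<alpha> - real m * \<alpha>) = 0" if "m \<noteq> n" for m
    proof -
      have "1 \<le> \<bar>real n - real m\<bar>" using that by linarith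
      then have "1 * \<alpha> \<le> \<bar>real n - real m\<bar> * \<alpha>" using assms by (intro mult_right_mono) auto
      moreover have "\<bar>real n * \<alpha> - real m * \<alpha>\<bar> = \<bar>real n - real m\<bar> * \<alpha>"
        using assms by (simp add: abs_mult flip: left_diff_distrib)
      ultimately have "c \<le> \<bar>real n * \<alpha> - real m * \<alpha>\<bar>" using assms(1) by linarith
      then show ?thesis by (simp add: tent_def)
    qed
    then have "(\<Sum>m | m \<in> rough z \<and> real m * \<alpha> \<le> X. tent c (real n * \<alpha> - real m * \<alpha>)) = (\<Sum>m\<in>{n}. tent c (real n * \<alpha> - real m * \<alpha>))"
      using n fin by (intro sum.mono_neutral_right) auto
    then show ?thesis using assms by (simp add: tent_def)
  qed
  then show ?thesis unfolding pair_sum_def by simp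
qed

text \<open>Dyadic decomposition. Separation leaves at most 2^i elements in the block starting at
  2^i, so the number of bad pairs in two blocks has fourth power at most 4 exp (- 4 H) (2^i 2^j)^4.
  Each pair of blocks thus contributes at most 2 exp (- H), and the logarithms count the
  blocks.\<close>

lemma bad_pairs_log_sum:
  assumes "\<eta> > 0"
  obtains H0 where "\<And>H A B x x'. H \<ge> H0 \<Longrightarrow> finite A \<Longrightarrow> finite B \<Longrightarrow>
      A \<subseteq> {1..x} \<Longrightarrow> B \<subseteq> {1..x'} \<Longrightarrow> 1 \<le> x \<Longrightarrow> 1 \<le> x' \<Longrightarrow>
      (\<And>u v. u \<in> A \<Longrightarrow> v \<in> A \<Longrightarrow> u \<noteq> v \<Longrightarrow> \<bar>u - v\<bar> \<ge> 1) \<Longrightarrow> (\<And>u v. u \<in> B \<Longrightarrow> v \<in> B \<Longrightarrow> u \<noteq> v \<Longrightarrow> \<bar>u - v\<bar> \<ge> 1) \<Longrightarrow>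
      (\<Sum>(\<alpha>, \<beta>)\<in>{(\<alpha>, \<beta>) \<in> A \<times> B. bad_pair \<eta> H \<alpha> \<beta>}. 1 / (\<alpha> * \<beta>)) \<le> 2 * exp (- real H) * ((1 + log 2 x) * (1 + log 2 x'))"
proof -
  \<comment> \<open>8 ln 64 cancels the factor 64^(8 H), and the remaining 4 becomes exp (- H) after
    the fourth root.\<close>
  define \<Lambda> where "\<Lambda> = 4 + 8 * ln (64::real)"
  obtain H0 where H0: "\<And>H A B M N. H \<ge> H0 \<Longrightarrow> finite A \<Longrightarrow> finite B \<Longrightarrow>
      (\<And>x. x \<in> A \<Longrightarrow> 0 < x \<and> x \<le> M) \<Longrightarrow> (\<And>x. x \<in> B \<Longrightarrow> 0 < x \<and> x \<le> N) \<Longrightarrow> 0 < M \<Longrightarrow> 0 < N \<Longrightarrow>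
      real (card {(\<alpha>, \<beta>) \<in> A \<times> B. bad_pair \<eta> H \<alpha> \<beta>}) ^ 4
        \<le> exp (- \<Lambda> * real H) * (M * N * 64 ^ (8 * H)) * (real (card A) * real (card B)) ^ 3"
    using bad_pairs_block[OF assms, of \<Lambda>] by blast
  show ?thesis
  proof (rule that[of H0])
    fix H and A B :: "real set" and x x' :: real
    assume H: "H \<ge> H0" and fin: "finite A" "finite B" and sub: "A \<subseteq> {1..x}" "B \<subseteq> {1..x'}" and x: "1 \<le> x" "1 \<le> x'"
      and sepA: "\<And>u v. u \<in> A \<Longrightarrow> v \<in> A \<Longrightarrow> u \<noteq> v \<Longrightarrow> \<bar>u - v\<bar> \<ge> 1"
      and sepB: "\<And>u v. u \<in> B \<Longrightarrow> v \<in> B \<Longrightarrow> u \<noteq> v \<Longrightarrow> \<bar>u - v\<bar> \<ge> 1"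
    define k where "k = (\<lambda>u::real. nat \<lfloor>log 2 u\<rfloor>)"
    have k: "2 ^ k u \<le> u" "u < 2 ^ (k u + 1)" if "u \<ge> 1" for u
    proof -
      have "log 2 u \<ge> 0" using that by simp
      then have "real (k u) = real_of_int \<lfloor>log 2 u\<rfloor>" by (simp add: k_def)
      then have "real (k u) \<le> log 2 u" "log 2 u < real (k u + 1)" by linarith+
      then have "2 powr real (k u) \<le> 2 powr log 2 u" "2 powr log 2 u < 2 powr real (k u + 1)"
        by simp_all
      moreover have "2 powr log 2 u = u" using that by simp
      ultimately show "2 ^ k u \<le> u" "u < 2 ^ (k u + 1)" by (simp_all only: powr_realpow)
    qed
    have card_block: "real (card {u \<in> S. k u = i}) \<le> 2 ^ i"
      if S: "finite S" "\<And>u. u \<in> S \<Longrightarrow> u \<ge> 1" "\<And>u v. u \<in> S \<Longrightarrow> v \<in> S \<Longrightarrow> u \<noteq> v \<Longrightarrow> \<bar>u - v\<bar> \<ge> 1" for S i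
    proof -
      have inj: "inj_on (\<lambda>u. \<lfloor>u\<rfloor>) {u \<in> S. k u = i}"
      proof (rule inj_onI)
        fix u v assume uv: "u \<in> {u \<in> S. k u = i}" "v \<in> {u \<in> S. k u = i}" "\<lfloor>u\<rfloor> = \<lfloor>v\<rfloor>"
        then have "\<bar>u - v\<bar> < 1" by linarith
        then show "u = v" using S(3)[of u v] uv by force
      qed
      have "(\<lambda>u. \<lfloor>u\<rfloor>) ` {u \<in> S. k u = i} \<subseteq> {2 ^ i..<2 ^ (i + 1)}"
      proof (intro subsetI; elim imageE)
        fix w u assume u: "w = \<lfloor>u\<rfloor>" "u \<in> {u \<in> S. k u = i}"
        then have "2 ^ i \<le> u" "u < 2 ^ (i + 1)" using k[of u] S(2) by auto
        then show "w \<in> {2 ^ i..<2 ^ (i + 1)}" unfolding u(1) by (simp add: le_floor_iff floor_less_iff)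
      qed
      then have "card {u \<in> S. k u = i} \<le> card {2 ^ i..<(2::int) ^ (i + 1)}"
        by (intro card_inj_on_le[OF inj]) auto
      also have "\<dots> = 2 ^ i" by simp
      finally show ?thesis by (metis of_nat_le_iff of_nat_numeral of_nat_power)
    qed
    define m where "m = (\<lambda>x::real. Suc (nat \<lfloor>log 2 x\<rfloor>))"
    have m: "real (m x) \<le> 1 + log 2 x" if "x \<ge> 1" for x
    proof -
      have "log 2 x \<ge> 0" using that by simp
      then show ?thesis by (simp add: m_def)
    qed
    have km: "k u < m y" if "u \<in> {1..y}" for u y
    proof -
      have "log 2 u \<le> log 2 y" using that by simp
      then show ?thesis by (simp add: k_def m_def less_Suc_eq_le nat_mono floor_mono)
    qed
    define E where "E = {(\<alpha>, \<beta>) \<in> A \<times> B. bad_pair \<eta> H \<alpha> \<beta>}"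
    have finE: "finite E" unfolding E_def by (rule finite_subset[of _ "A \<times> B"]) (use fin in auto)
    define kk where "kk = (\<lambda>(\<alpha>, \<beta>). (k \<alpha>, k \<beta>))"
    have "(\<Sum>e\<in>E. case e of (\<alpha>, \<beta>) \<Rightarrow> 1 / (\<alpha> * \<beta>)) = (\<Sum>ij\<in>{..<m x} \<times> {..<m x'}. \<Sum>e\<in>{e \<in> E. kk e = ij}. case e of (\<alpha>, \<beta>) \<Rightarrow> 1 / (\<alpha> * \<beta>))"
      by (rule sum.group[symmetric]) (use finE sub km in \<open>auto simp: kk_def E_def subset_iff\<close>)
    also have "\<dots> \<le> (\<Sum>ij\<in>{..<m x} \<times> {..<m x'}. 2 * exp (- real H))"
    proof (rule sum_mono)
      fix ij :: "nat \<times> nat"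
      obtain i j where ij: "ij = (i, j)" by (cases ij)
      define Ai Bj where "Ai = {u \<in> A. k u = i}" and "Bj = {u \<in> B. k u = j}"
      have Eij: "{e \<in> E. kk e = ij} = {(\<alpha>, \<beta>) \<in> Ai \<times> Bj. bad_pair \<eta> H \<alpha> \<beta>}"
        by (auto simp: E_def kk_def ij Ai_def Bj_def)
      have cA: "real (card Ai) \<le> 2 ^ i" unfolding Ai_def by (rule card_block) (use fin sub sepA in auto)
      have cB: "real (card Bj) \<le> 2 ^ j" unfolding Bj_def by (rule card_block) (use fin sub sepB in auto)
      have rA: "2 ^ i \<le> u \<and> u < 2 ^ (i + 1)" if "u \<in> Ai" for u using that sub k[of u] by (auto simp: Ai_def)
      have rB: "2 ^ j \<le> u \<and> u < 2 ^ (j + 1)" if "u \<in> Bj" for u using that sub k[of u] by (auto simp: Bj_def)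
      have "real (card {e \<in> E. kk e = ij}) ^ 4 \<le> exp (- \<Lambda> * real H) * (2 ^ (i + 1) * 2 ^ (j + 1) * 64 ^ (8 * H)) * (real (card Ai) * real (card Bj)) ^ 3"
        unfolding Eij
      proof (rule H0[OF H])
        show "0 < u \<and> u \<le> 2 ^ (i + 1)" if "u \<in> Ai" for u using rA[OF that] by (smt (verit) zero_less_power)
        show "0 < u \<and> u \<le> 2 ^ (j + 1)" if "u \<in> Bj" for u using rB[OF that] by (smt (verit) zero_less_power)
      qed (use fin in \<open>auto simp: Ai_def Bj_def\<close>)
      also have "\<dots> \<le> exp (- \<Lambda> * real H) * (2 ^ (i + 1) * 2 ^ (j + 1) * 64 ^ (8 * H)) * (2 ^ i * 2 ^ j) ^ 3"
        by (intro mult_left_mono power_mono mult_mono cA cB) auto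
      also have "\<dots> = 4 * exp (- real H) ^ 4 * (2 ^ i * 2 ^ j) ^ 4"
      proof -
        have f1: "exp (- \<Lambda> * real H) * 64 ^ (8 * H) = exp (- real H) ^ 4"
        proof -
          have "(64::real) ^ (8 * H) = exp (ln 64) ^ (8 * H)" by simp
          also have "\<dots> = exp (real (8 * H) * ln 64)" by (rule exp_of_nat_mult[symmetric])
          finally have "(64::real) ^ (8 * H) = exp (real (8 * H) * ln 64)" .
          then have "exp (- \<Lambda> * real H) * 64 ^ (8 * H) = exp (- \<Lambda> * real H + real (8 * H) * ln 64)" by (simp only: exp_add)
          also have "- \<Lambda> * real H + real (8 * H) * ln 64 = real 4 * (- real H)" by (simp add: \<Lambda>_def algebra_simps)
          finally show ?thesis by (simp only: exp_of_nat_mult)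
        qed
        have f2: "exp (- \<Lambda> * real H) * (2 ^ (i + 1) * 2 ^ (j + 1) * 64 ^ (8 * H)) * (2 ^ i * 2 ^ j) ^ 3
          = (exp (- \<Lambda> * real H) * 64 ^ (8 * H)) * (2 ^ (i + 1) * 2 ^ (j + 1) * (2 ^ i * 2 ^ j) ^ 3)"
          by (simp only: mult_ac)
        have f3: "2 ^ (i + 1) * 2 ^ (j + 1) * (2 ^ i * 2 ^ j) ^ 3 = 4 * (2 ^ i * 2 ^ j :: real) ^ 4"
          by (simp add: eval_nat_numeral)
        show ?thesis unfolding f2 f1 f3 by (simp only: mult_ac)
      qed
      also have "\<dots> \<le> (2 * exp (- real H) * (2 ^ i * 2 ^ j)) ^ 4"
        by (simp add: power_mult_distrib)
      finally have "real (card {e \<in> E. kk e = ij}) ^ 4 \<le> (2 * exp (- real H) * (2 ^ i * 2 ^ j)) ^ 4" .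
      then have cE: "real (card {e \<in> E. kk e = ij}) \<le> 2 * exp (- real H) * (2 ^ i * 2 ^ j)"
        by (rule power_le_imp_le_base[of _ 3, simplified]) simp
      have "(\<Sum>e\<in>{e \<in> E. kk e = ij}. case e of (\<alpha>, \<beta>) \<Rightarrow> 1 / (\<alpha> * \<beta>)) \<le> (\<Sum>e\<in>{e \<in> E. kk e = ij}. 1 / (2 ^ i * 2 ^ j))"
      proof (rule sum_mono)
        fix e assume "e \<in> {e \<in> E. kk e = ij}"
        then obtain \<alpha> \<beta> where e: "e = (\<alpha>, \<beta>)" "\<alpha> \<in> Ai" "\<beta> \<in> Bj" unfolding Eij by auto
        have "(2::real) ^ i * 2 ^ j \<le> \<alpha> * \<beta>" using rA[OF e(2)] rB[OF e(3)]
          by (intro mult_mono) (auto intro: order_trans[OF zero_le_power])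
        then show "(case e of (\<alpha>, \<beta>) \<Rightarrow> 1 / (\<alpha> * \<beta>)) \<le> 1 / (2 ^ i * 2 ^ j)"
          unfolding e(1) by (simp add: frac_le)
      qed
      also have "\<dots> = real (card {e \<in> E. kk e = ij}) / (2 ^ i * 2 ^ j)" by simp
      also have "\<dots> \<le> 2 * exp (- real H)" using cE by (simp add: pos_divide_le_eq)
      finally show "(\<Sum>e\<in>{e \<in> E. kk e = ij}. case e of (\<alpha>, \<beta>) \<Rightarrow> 1 / (\<alpha> * \<beta>)) \<le> 2 * exp (- real H)" .
    qed
    also have "\<dots> = 2 * exp (- real H) * (real (m x) * real (m x'))" by (simp add: card_cartesian_product)
    also have "\<dots> \<le> 2 * exp (- real H) * ((1 + log 2 x) * (1 + log 2 x'))"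
      using x by (intro mult_left_mono mult_mono m) auto
    finally show "(\<Sum>(\<alpha>, \<beta>)\<in>{(\<alpha>, \<beta>) \<in> A \<times> B. bad_pair \<eta> H \<alpha> \<beta>}. 1 / (\<alpha> * \<beta>)) \<le> 2 * exp (- real H) * ((1 + log 2 x) * (1 + log 2 x'))"
      by (simp add: E_def)
  qed
qed

section \<open>The bound for a single pair\<close>

text \<open>The range in which q < c but c / q is too small for the averaging over h to be relied on
  at level \<open>y\<close>.\<close>

definition band_pair :: "real \<Rightarrow> nat \<Rightarrow> real \<Rightarrow> real \<Rightarrow> bool" where
  "band_pair c y \<alpha> \<beta> \<longleftrightarrow> (\<exists>q a b. ratio_rep \<alpha> \<beta> q a b \<and> c / 64 ^ y < q \<and> q < c)"

text \<open>An upper bound for the overlap relative to independent positions. The pair is charged at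
  every level at which it is bad, although one of these terms would pay for its excess; this way
  each level can be summed over all pairs separately. The cut-off \<open>N\<close> keeps the sum
  finite.\<close>

definition overlap_factor :: "real \<Rightarrow> real \<Rightarrow> real \<Rightarrow> nat \<Rightarrow> nat \<Rightarrow> real \<Rightarrow> real \<Rightarrow> real" where
  "overlap_factor C \<eta> c y N \<alpha> \<beta> = 1 + 14 * \<eta> + (if band_pair c y \<alpha> \<beta> then C * ln (real y) else 0)
     + (\<Sum>H\<in>{y..N}. if bad_pair \<eta> H \<alpha> \<beta> then C * ln (real (H + 1)) else 0)"

lemma overlap_factor_ge:
  assumes "C \<ge> 0" "\<eta> \<ge> 0" "y \<ge> 1"
  shows "overlap_factor C \<eta> c y N \<alpha> \<beta> \<ge> 1 + 14 * \<eta>"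
proof -
  have "(\<Sum>H\<in>{y..N}. if bad_pair \<eta> H \<alpha> \<beta> then C * ln (real (H + 1)) else 0) \<ge> 0"
    using assms by (intro sum_nonneg) auto
  then show ?thesis using assms by (simp add: overlap_factor_def)
qed

lemma ratio_tail_eq_0: "n > 0 \<Longrightarrow> n \<le> H \<Longrightarrow> ratio_tail H n = 0"
  unfolding ratio_tail_def by (rule sum.neutral) (auto dest!: dvd_imp_le)

lemma exp_le_one_plus_double:
  fixes x :: real
  assumes "0 \<le> x" "x \<le> 1"
  shows "exp x \<le> 1 + 2 * x"
proof -
  have "exp x \<le> 1 + x + x\<^sup>2" using exp_bound[OF assms] .
  also have "x\<^sup>2 \<le> x" using assms by (simp add: power2_eq_square mult_left_le)
  finally show ?thesis by simp
qed

text \<open>The level is H = max y n with 64^n <= c / q < 64^(n + 1). If the primes above H dividing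
  a b are negligible, then either n >= y and the averaged estimate is accurate, or the pair lies in
  the band and the crude estimate costs ln y. Otherwise H is raised to the least level at which they
  are negligible; the crude estimate costs the logarithm of that level, and the level just below it
  is bad and pays for it.\<close>

lemma pair_sum_bound:
  fixes \<alpha> \<beta> c \<eta> \<eta>' c1 :: real and y z z' :: nat
  assumes pos: "\<alpha> > 0" "\<beta> > 0" "c > 0" and \<eta>: "0 < \<eta>" "\<eta> \<le> 1 / 3" and \<eta>': "\<eta>' > 0"
    and y: "y \<ge> 2" "4 * ln 64 \<le> \<eta> * ln (real y)" "2 / 16 ^ y \<le> \<eta>" and cy: "1 / 64 ^ y \<le> c"
    and c1: "c1 > 0" "\<And>n. n \<ge> 2 \<Longrightarrow> mertens_prod n \<ge> c1 / ln (real n)"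
    and zero: "\<And>q a b. ratio_rep \<alpha> \<beta> q a b \<Longrightarrow>
        (\<exists>p. prime p \<and> (p \<le> z \<and> p dvd b \<or> p \<le> z' \<and> p dvd a)) \<or> q \<le> \<eta> * c * (mertens_prod z * mertens_prod z')"
  obtains N0 where "\<And>N. N \<ge> N0 \<Longrightarrow> \<exists>K. \<forall>X\<ge>0. pair_sum c z z' \<alpha> \<beta> X
    \<le> (c\<^sup>2 * (mertens_prod z / \<alpha>) * (mertens_prod z' / \<beta>) * overlap_factor (9 / c1) \<eta> c y N \<alpha> \<beta> + \<eta>') * X + K"
proof (cases "\<alpha> / \<beta> \<in> \<rat>")
  case False
  define M where "M = c\<^sup>2 * (mertens_prod z / \<alpha>) * (mertens_prod z' / \<beta>)"
  have M0: "M \<ge> 0" using pos mertens_prod_pos[of z] mertens_prod_pos[of z'] by (simp add: M_def)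
  obtain K where K: "\<And>X. X \<ge> 0 \<Longrightarrow> pair_sum c z z' \<alpha> \<beta> X
    \<le> (c\<^sup>2 * mertens_prod z * mertens_prod z' / (\<alpha> * \<beta>) + \<eta>') * X + K"
    using pair_sum_irrational_le[OF False pos(1,2) _ \<eta>', of c] pos by auto
  show ?thesis
  proof (rule that[of 0], rule exI[of _ K], intro allI impI)
    fix N :: nat and X :: real assume X: "X \<ge> 0"
    have "M * 1 \<le> M * overlap_factor (9 / c1) \<eta> c y N \<alpha> \<beta>"
      using overlap_factor_ge[of "9 / c1" \<eta> y c N \<alpha> \<beta>] c1 \<eta> y M0 by (intro mult_left_mono) auto
    then have "(M + \<eta>') * X \<le> (M * overlap_factor (9 / c1) \<eta> c y N \<alpha> \<beta> + \<eta>') * X"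
      using X by (intro mult_right_mono) auto
    moreover have "M = c\<^sup>2 * mertens_prod z * mertens_prod z' / (\<alpha> * \<beta>)" by (simp add: M_def)
    ultimately show "pair_sum c z z' \<alpha> \<beta> X
      \<le> (c\<^sup>2 * (mertens_prod z / \<alpha>) * (mertens_prod z' / \<beta>) * overlap_factor (9 / c1) \<eta> c y N \<alpha> \<beta> + \<eta>') * X + K"
      using K[OF X] by (simp add: M_def)
  qed
next
  case True
  obtain q a b where r: "ratio_rep \<alpha> \<beta> q a b" using ratio_rep_of_rational[OF pos(1,2) True] by blast
  have q: "q > 0" "a > 0" "b > 0" "coprime a b" and \<alpha>: "\<alpha> = q * real a" and \<beta>: "\<beta> = q * real b"
    using r by (auto simp: ratio_rep_def)
  obtain s t where st: "s * int a + t * int b = 1"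
    using bezout_int[of "int a" "int b"] q(4) by (auto simp: coprime_iff_gcd_eq_1)
  interpret bezout_pair a b s "- t" by unfold_locales (use q st in auto)
  define Z where "Z = max z z'"
  define v where "v = mertens_prod z * mertens_prod z'"
  have v0: "v > 0" using mertens_prod_pos[of z] mertens_prod_pos[of z'] by (simp add: v_def)
  define M where "M = c\<^sup>2 * (mertens_prod z / \<alpha>) * (mertens_prod z' / \<beta>)"
  have M: "M = c\<^sup>2 * v / (\<alpha> * \<beta>)" by (simp add: M_def v_def)
  then have M0: "M \<ge> 0" using v0 pos by simp
  have zero_term: "c * full_dens z z' Z 0 / (q * real a * real b) \<le> \<eta> * M"
    using zero[OF r]
  proof
    assume "\<exists>p. prime p \<and> (p \<le> z \<and> p dvd b \<or> p \<le> z' \<and> p dvd a)"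
    then obtain p where p: "prime p" "p \<le> z \<and> p dvd b \<or> p \<le> z' \<and> p dvd a" by blast
    then have "p \<in> primes_le Z" by (auto simp: primes_le_def Z_def)
    then have "full_dens z z' Z 0 = 0" using p(2) by (rule full_dens_0_eq_0)
    then show ?thesis using M0 \<eta> by simp
  next
    assume le: "q \<le> \<eta> * c * (mertens_prod z * mertens_prod z')"
    have "c * full_dens z z' Z 0 / (q * real a * real b) \<le> c * 1 / (q * real a * real b)"
      using pos q full_dens_0_le_1 by (intro divide_right_mono mult_left_mono) auto
    also have "\<dots> = c * q / (\<alpha> * \<beta>)" using q by (simp add: \<alpha> \<beta>)
    also have "\<dots> \<le> c * (\<eta> * c * v) / (\<alpha> * \<beta>)"
      using pos le by (intro divide_right_mono mult_left_mono) (auto simp: v_def)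
    also have "\<dots> = \<eta> * M" by (simp add: M power2_eq_square)
    finally show ?thesis .
  qed
  define D where "D = (\<lambda>H. exp (2 * ratio_tail H (a * b) + 2 * (ln (c / q) / (real H * ln (real H))))
          * min (c\<^sup>2 + 2 * 4 ^ H * c * q) (3 * c\<^sup>2 / mertens_prod H))"
  note result = that
  \<comment> \<open>For c > q it suffices to bound \<open>D H\<close> at one level \<open>H\<close>
    of choice; one \<eta> of the total is reserved for the coincidences h = 0.\<close>
  have finish: thesis
    if F: "c \<le> q \<or> (H \<ge> 2 \<and> (\<forall>N\<ge>N0. D H \<le> c\<^sup>2 * (overlap_factor (9 / c1) \<eta> c y N \<alpha> \<beta> - \<eta>)))" for H N0
  proof -
    define H' where "H' = (if c \<le> q then 2 else H)"
    have H2: "H' \<ge> 2" using F by (auto simp: H'_def)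
    obtain K where K: "\<And>X. X \<ge> 0 \<Longrightarrow> pair_sum c z z' (q * real a) (q * real b) X
      \<le> (c * full_dens z z' Z 0 / (q * real a * real b)
       + (if c \<le> q then 0 else mertens_prod z * mertens_prod z' / ((q * real a) * (q * real b))
          * exp (2 * ratio_tail H' (a * b) + 2 * (ln (c / q) / (real H' * ln (real H'))))
          * min (c\<^sup>2 + 2 * 4 ^ H' * c * q) (3 * c\<^sup>2 / mertens_prod H'))) * X + K"
      using pair_sum_le[OF q(1) pos(3) H2, of z Z z'] by (auto simp: Z_def)
    show thesis
    proof (rule result[of N0], rule exI[of _ K], intro allI impI)
      fix N :: nat and X :: real assume N: "N \<ge> N0" and X: "X \<ge> 0"
      define W where "W = overlap_factor (9 / c1) \<eta> c y N \<alpha> \<beta>"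
      have W1: "W \<ge> 1 + 14 * \<eta>" unfolding W_def by (rule overlap_factor_ge) (use c1 \<eta> y in auto)
      have "(if c \<le> q then 0 else mertens_prod z * mertens_prod z' / ((q * real a) * (q * real b))
          * exp (2 * ratio_tail H' (a * b) + 2 * (ln (c / q) / (real H' * ln (real H'))))
          * min (c\<^sup>2 + 2 * 4 ^ H' * c * q) (3 * c\<^sup>2 / mertens_prod H')) \<le> M * (W - \<eta>)"
      proof (cases "c \<le> q")
        case True
        then show ?thesis using M0 W1 \<eta> by simp
      next
        case False
        then have DH: "D H \<le> c\<^sup>2 * (W - \<eta>)" using F N by (auto simp: W_def)
        have "v / (\<alpha> * \<beta>) * D H \<le> v / (\<alpha> * \<beta>) * (c\<^sup>2 * (W - \<eta>))"
          by (rule mult_left_mono[OF DH]) (use v0 pos in auto)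
        then show ?thesis using False by (simp add: H'_def D_def M v_def \<alpha> \<beta> mult_ac)
      qed
      then have "c * full_dens z z' Z 0 / (q * real a * real b)
       + (if c \<le> q then 0 else mertens_prod z * mertens_prod z' / ((q * real a) * (q * real b))
          * exp (2 * ratio_tail H' (a * b) + 2 * (ln (c / q) / (real H' * ln (real H'))))
          * min (c\<^sup>2 + 2 * 4 ^ H' * c * q) (3 * c\<^sup>2 / mertens_prod H')) \<le> \<eta> * M + M * (W - \<eta>)"
        using zero_term by (intro add_mono)
      also have "\<dots> \<le> M * W + \<eta>'" using \<eta>' by (simp add: algebra_simps)
      finally have "(c * full_dens z z' Z 0 / (q * real a * real b)
       + (if c \<le> q then 0 else mertens_prod z * mertens_prod z' / ((q * real a) * (q * real b))
          * exp (2 * ratio_tail H' (a * b) + 2 * (ln (c / q) / (real H' * ln (real H'))))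
          * min (c\<^sup>2 + 2 * 4 ^ H' * c * q) (3 * c\<^sup>2 / mertens_prod H'))) * X \<le> (M * W + \<eta>') * X"
        using X by (rule mult_right_mono)
      then show "pair_sum c z z' \<alpha> \<beta> X
        \<le> (c\<^sup>2 * (mertens_prod z / \<alpha>) * (mertens_prod z' / \<beta>) * overlap_factor (9 / c1) \<eta> c y N \<alpha> \<beta> + \<eta>') * X + K"
        using K[OF X] unfolding \<alpha>[symmetric] \<beta>[symmetric] M_def[symmetric] W_def[symmetric] by linarith
    qed
  qed
  show ?thesis
  proof (cases "c \<le> q")
    case True
    then show ?thesis using finish by blast
  next
    case cq: False
    define T where "T = c / q"
    have T1: "T > 1" using cq q by (simp add: T_def)
    define n where "n = nat \<lfloor>log 64 T\<rfloor>"
    have n: "64 ^ n \<le> T" "T < 64 ^ (n + 1)"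
    proof -
      have "log 64 T \<ge> 0" using T1 by simp
      then have "real n = real_of_int \<lfloor>log 64 T\<rfloor>" by (simp add: n_def)
      then have "real n \<le> log 64 T" "log 64 T < real (n + 1)" by linarith+
      then have "64 powr real n \<le> 64 powr log 64 T" "64 powr log 64 T < 64 powr real (n + 1)"
        by simp_all
      moreover have "64 powr log 64 T = T" using T1 by simp
      ultimately show "64 ^ n \<le> T" "T < 64 ^ (n + 1)" by (simp_all only: powr_realpow)
    qed
    define H where "H = max y n"
    have H2: "H \<ge> 2" using y by (simp add: H_def)
    have ln64: "ln (64::real) > 0" by simp
    have lnT: "ln T \<le> 2 * real H' * ln 64" if "H' \<ge> H" for H'
    proof -
      have "ln T \<le> ln (64 ^ (n + 1))" using n T1 by (intro ln_mono) auto
      also have "\<dots> = real (n + 1) * ln 64" by (simp add: ln_realpow del: power_Suc)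
      also have "\<dots> \<le> 2 * real H' * ln 64" using that H2 ln64 by (intro mult_right_mono) (auto simp: H_def)
      finally show ?thesis .
    qed
    have lny: "ln (real y) > 0" using y by simp
    have expo: "exp (2 * ratio_tail H' (a * b) + 2 * (ln (c / q) / (real H' * ln (real H')))) \<le> exp (3 * \<eta>)"
      if H': "H' \<ge> H" "ratio_tail H' (a * b) \<le> \<eta>" for H'
    proof -
      have H'2: "H' \<ge> 2" "y \<le> H'" using H' H2 by (auto simp: H_def)
      have lnH': "ln (real H') \<ge> ln (real y)" using H'2 y by simp
      have "ln T / (real H' * ln (real H')) \<le> (2 * real H' * ln 64) / (real H' * ln (real H'))"
        using lnT[OF H'(1)] H'2 lny lnH' by (intro divide_right_mono) auto
      also have "\<dots> = 2 * ln 64 / ln (real H')" using H'2 by simp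
      also have "\<dots> \<le> 2 * ln 64 / ln (real y)" using lnH' lny ln64 by (intro divide_left_mono) auto
      also have "\<dots> \<le> \<eta> / 2" using y(2) lny by (simp add: pos_divide_le_eq)
      finally have "ln T / (real H' * ln (real H')) \<le> \<eta> / 2" .
      then have "2 * ratio_tail H' (a * b) + 2 * (ln T / (real H' * ln (real H'))) \<le> 3 * \<eta>" using H'(2) by linarith
      then show ?thesis unfolding T_def by (simp only: exp_le_cancel_iff)
    qed
    have e3: "exp (3 * \<eta>) \<le> 1 + 6 * \<eta>" using exp_le_one_plus_double[of "3 * \<eta>"] \<eta> by simp
    have e33: "exp (3 * \<eta>) \<le> 3" using e3 \<eta> by simp
    \<comment> \<open>9 / c1 comes from exp (3 \<eta>) <= 3, the 3 of the crude estimate, and the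
      constant in Mertens' bound.\<close>
    have crude: "D H' \<le> c\<^sup>2 * (9 / c1 * ln (real H'))"
      if H': "H' \<ge> H" "ratio_tail H' (a * b) \<le> \<eta>" for H'
    proof -
      have H'2: "H' \<ge> 2" using H' H2 by auto
      have lnH': "ln (real H') > 0" using H'2 by simp
      have "D H' \<le> exp (3 * \<eta>) * (3 * c\<^sup>2 / mertens_prod H')"
        unfolding D_def using expo[OF H'] mertens_prod_pos[of H'] pos q
        by (intro mult_mono) auto
      also have "\<dots> \<le> 3 * (3 * c\<^sup>2 / (c1 / ln (real H')))"
        using e33 c1(2)[OF H'2] c1(1) lnH' mertens_prod_pos[of H']
        by (intro mult_mono divide_left_mono) auto
      also have "\<dots> = c\<^sup>2 * (9 / c1 * ln (real H'))" using c1 lnH' by simp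
      finally show ?thesis .
    qed
    define S where "S = (\<lambda>N. \<Sum>H\<in>{y..N}. if bad_pair \<eta> H \<alpha> \<beta> then 9 / c1 * ln (real (H + 1)) else 0)"
    have S0: "S N \<ge> 0" for N unfolding S_def using c1 y by (intro sum_nonneg) auto
    have W: "overlap_factor (9 / c1) \<eta> c y N \<alpha> \<beta> = 1 + 14 * \<eta> + (if band_pair c y \<alpha> \<beta> then 9 / c1 * ln (real y) else 0) + S N" for N
      by (simp add: overlap_factor_def S_def)
    show ?thesis
    proof (cases "ratio_tail H (a * b) \<le> \<eta>")
      case good: True
      show ?thesis
      proof (cases "n \<ge> y")
        case True
        then have Hn: "H = n" by (simp add: H_def)
        \<comment> \<open>Here the base 64 = 4 * 16 pays off: 64^H q <= c turns the error 2 * 4^H c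
          q into at most 2 c^2 / 16^y.\<close>
        have "2 * 4 ^ H * c * q \<le> c\<^sup>2 * \<eta>"
        proof -
          have "64 ^ H * q \<le> c" using n(1) q by (simp add: Hn T_def pos_le_divide_eq)
          then have "(4 ^ H * q) * 16 ^ H \<le> c" by (simp add: mult_ac flip: power_mult_distrib)
          moreover have "(4 ^ H * q) * 16 ^ y \<le> (4 ^ H * q) * 16 ^ H"
            using q by (intro mult_left_mono power_increasing) (auto simp: H_def)
          ultimately have "(4 ^ H * q) * 16 ^ y \<le> c" by linarith
          then have "4 ^ H * q \<le> c / 16 ^ y" by (simp add: pos_le_divide_eq)
          then have "2 * c * (4 ^ H * q) \<le> 2 * c * (c / 16 ^ y)" using pos by (intro mult_left_mono) auto
          also have "\<dots> = c\<^sup>2 * (2 / 16 ^ y)" by (simp add: power2_eq_square)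
          also have "\<dots> \<le> c\<^sup>2 * \<eta>" by (rule mult_left_mono[OF y(3)]) simp
          finally show ?thesis by (simp add: mult_ac)
        qed
        then have "D H \<le> exp (3 * \<eta>) * (c\<^sup>2 * (1 + \<eta>))"
          unfolding D_def using expo[OF order_refl good] pos q mertens_prod_pos[of H]
          by (intro mult_mono) (auto simp: algebra_simps)
        also have "\<dots> \<le> (1 + 6 * \<eta>) * (c\<^sup>2 * (1 + \<eta>))"
          by (rule mult_right_mono[OF e3]) (use \<eta> in simp)
        also have "\<dots> = c\<^sup>2 * (1 + 7 * \<eta> + 6 * (\<eta> * \<eta>))" by (simp add: algebra_simps)
        also have "\<dots> \<le> c\<^sup>2 * (1 + 13 * \<eta>)"
        proof (intro mult_left_mono)
          have "\<eta> * \<eta> \<le> \<eta> * 1" using \<eta> by (intro mult_left_mono) auto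
          then show "1 + 7 * \<eta> + 6 * (\<eta> * \<eta>) \<le> 1 + 13 * \<eta>" by simp
        qed simp
        finally have DH: "D H \<le> c\<^sup>2 * (1 + 13 * \<eta>)" .
        show ?thesis
        proof (rule finish[of H 0], intro disjI2 conjI allI impI H2)
          fix N :: nat
          have "1 + 13 * \<eta> \<le> overlap_factor (9 / c1) \<eta> c y N \<alpha> \<beta> - \<eta>"
            using overlap_factor_ge[of "9 / c1" \<eta> y c N \<alpha> \<beta>] c1 \<eta> y by simp
          then have "c\<^sup>2 * (1 + 13 * \<eta>) \<le> c\<^sup>2 * (overlap_factor (9 / c1) \<eta> c y N \<alpha> \<beta> - \<eta>)"
            by (rule mult_left_mono) simp
          then show "D H \<le> c\<^sup>2 * (overlap_factor (9 / c1) \<eta> c y N \<alpha> \<beta> - \<eta>)" using DH by linarith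
        qed
      next
        case False
        then have Hy: "H = y" by (simp add: H_def)
        have "T < 64 ^ y"
        proof -
          have "(64::real) ^ (n + 1) \<le> 64 ^ y" using False by (intro power_increasing) auto
          then show ?thesis using n(2) by linarith
        qed
        then have "c < q * 64 ^ y" using q by (simp add: T_def pos_divide_less_eq mult.commute)
        then have "c / 64 ^ y < q" by (simp add: pos_divide_less_eq)
        then have band: "band_pair c y \<alpha> \<beta>"
          unfolding band_pair_def using r cq by (intro exI conjI) auto
        show ?thesis
        proof (rule finish[of H 0], intro disjI2 conjI allI impI H2)
          fix N :: nat
          have "9 / c1 * ln (real y) \<le> overlap_factor (9 / c1) \<eta> c y N \<alpha> \<beta> - \<eta>"
            unfolding W using band S0[of N] \<eta> by simp
          then have "c\<^sup>2 * (9 / c1 * ln (real y)) \<le> c\<^sup>2 * (overlap_factor (9 / c1) \<eta> c y N \<alpha> \<beta> - \<eta>)"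
            by (rule mult_left_mono) simp
          then show "D H \<le> c\<^sup>2 * (overlap_factor (9 / c1) \<eta> c y N \<alpha> \<beta> - \<eta>)"
            using crude[OF order_refl good] unfolding Hy by linarith
        qed
      qed
    next
      case bad: False
      define P where "P = (\<lambda>H'. H' \<ge> H \<and> ratio_tail H' (a * b) \<le> \<eta>)"
      \<comment> \<open>From a b onwards no larger prime divides a b, so an admissible level exists;
        this also determines how large \<open>N\<close> has to be for this pair.\<close>
      have Pmax: "P (max H (a * b))" using q \<eta> by (simp add: P_def ratio_tail_eq_0)
      define H' where "H' = (LEAST H'. P H')"
      have PH': "P H'" unfolding H'_def by (rule LeastI[of P, OF Pmax])
      have H'le: "H' \<le> max H (a * b)" unfolding H'_def by (rule Least_le[of P, OF Pmax])
      have H'gt: "H' > H" using PH' bad by (auto simp: P_def le_less)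
      define h where "h = H' - 1"
      have h: "H' = h + 1" "h \<ge> H" "h < H'" using H'gt by (auto simp: h_def)
      have "\<not> P h" using not_less_Least[of h P] h by (simp add: H'_def)
      then have tail: "ratio_tail h (a * b) > \<eta>" using h by (auto simp: P_def)
      \<comment> \<open>q > c / 64^(h + 1) together with c >= 64^(- y) >= 64^(- h) gives the lower
        bound on q demanded of a bad pair.\<close>
      have bad_h: "bad_pair \<eta> h \<alpha> \<beta>"
      proof -
        have "T < 64 ^ (h + 1)"
        proof -
          have "(64::real) ^ (n + 1) \<le> 64 ^ (h + 1)" using h by (intro power_increasing) (auto simp: H_def)
          then show ?thesis using n(2) by linarith
        qed
        then have "c < q * 64 ^ (h + 1)" using q by (simp add: T_def pos_divide_less_eq mult.commute)
        moreover have "1 / 64 ^ h \<le> c"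
        proof -
          have "1 / 64 ^ h \<le> (1 / 64 ^ y :: real)" using h by (intro divide_left_mono power_increasing) (auto simp: H_def)
          then show ?thesis using cy by linarith
        qed
        ultimately have "1 / 64 ^ h < q * 64 ^ (h + 1)" by linarith
        then have "1 < q * 64 ^ (h + 1) * 64 ^ h" by (simp add: pos_divide_less_eq)
        also have "\<dots> = q * 64 ^ (2 * h + 1)" by (simp add: mult.assoc flip: power_add)
        also have "\<dots> \<le> q * 64 ^ (4 * h)"
          using q h H2 by (intro mult_left_mono power_increasing) auto
        finally have "1 / 64 ^ (4 * h) \<le> q" by (simp add: pos_divide_le_eq)
        then show ?thesis unfolding bad_pair_def using r tail by (intro exI conjI) auto
      qed
      show ?thesis
      proof (rule finish[of H' "max H (a * b)"], intro disjI2 conjI allI impI)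
        show "2 \<le> H'" using H'gt H2 by simp
        fix N :: nat assume N: "max H (a * b) \<le> N"
        have "9 / c1 * ln (real H') \<le> S N"
        proof -
          have "h \<in> {y..N}" using h H'le N by (auto simp: H_def)
          then have "(if bad_pair \<eta> h \<alpha> \<beta> then 9 / c1 * ln (real (h + 1)) else 0) \<le> S N"
            unfolding S_def by (rule member_le_sum) (use c1 in auto)
          then show ?thesis using bad_h by (simp add: h(1))
        qed
        moreover have "0 \<le> (if band_pair c y \<alpha> \<beta> then 9 / c1 * ln (real y) else 0)" using c1(1) lny by simp
        ultimately have "9 / c1 * ln (real H') \<le> overlap_factor (9 / c1) \<eta> c y N \<alpha> \<beta> - \<eta>"
          unfolding W using \<eta>(1) by linarith
        then have "c\<^sup>2 * (9 / c1 * ln (real H')) \<le> c\<^sup>2 * (overlap_factor (9 / c1) \<eta> c y N \<alpha> \<beta> - \<eta>)"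
          by (rule mult_left_mono) simp
        moreover have "D H' \<le> c\<^sup>2 * (9 / c1 * ln (real H'))" by (rule crude) (use PH' in \<open>auto simp: P_def\<close>)
        ultimately show "D H' \<le> c\<^sup>2 * (overlap_factor (9 / c1) \<eta> c y N \<alpha> \<beta> - \<eta>)" by linarith
      qed
    qed
  qed
qed

section \<open>Selection of the finite set\<close>

text \<open>Abel summation over integer parts. Elements with integer part at most m are only known
  to lie below m + 1, and the first term 2 \<theta> + K of \<open>b\<close> makes its partial sums
  equal to \<theta> (m + 1) + K.\<close>

lemma sum_reciprocals_le:
  fixes T :: "real set"
  assumes fin: "\<And>x. finite (T \<inter> {1..x})" and cnt: "\<And>x. x \<ge> 1 \<Longrightarrow> real (card (T \<inter> {1..x})) \<le> \<theta> * x + K"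
    and "\<theta> \<ge> 0" "K \<ge> 0" and x: "x \<ge> 1"
  shows "(\<Sum>a\<in>T \<inter> {1..x}. 1 / a) \<le> \<theta> * ln x + (2 * \<theta> + K)"
proof -
  define n where "n = nat \<lfloor>x\<rfloor>"
  have n: "n \<ge> 1" "real n \<le> x" using x by (auto simp: n_def le_nat_floor)
  define f where "f = (\<lambda>a::real. nat \<lfloor>a\<rfloor>)"
  define a where "a = (\<lambda>k. real (card {u \<in> T \<inter> {1..x}. f u = k}))"
  define b where "b = (\<lambda>k::nat. if k = 1 then 2 * \<theta> + K else \<theta>)"
  have f1: "f u \<in> {1..n}" "real (f u) \<le> u" "u < real (f u) + 1" if "u \<in> {1..x}" for u
    using that x by (auto simp: f_def n_def nat_mono floor_mono le_nat_floor)
  have "(\<Sum>u\<in>T \<inter> {1..x}. 1 / u) = (\<Sum>k\<in>{1..n}. \<Sum>u\<in>{u \<in> T \<inter> {1..x}. f u = k}. 1 / u)"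
    by (rule sum.group[symmetric]) (use fin f1 in auto)
  also have "\<dots> \<le> (\<Sum>k\<in>{1..n}. a k * (1 / real k))"
  proof (rule sum_mono)
    fix k assume k: "k \<in> {1..n}"
    have "(\<Sum>u\<in>{u \<in> T \<inter> {1..x}. f u = k}. 1 / u) \<le> (\<Sum>u\<in>{u \<in> T \<inter> {1..x}. f u = k}. 1 / real k)"
    proof (rule sum_mono)
      fix u assume u: "u \<in> {u \<in> T \<inter> {1..x}. f u = k}"
      then have "real k \<le> u" using f1(2)[of u] by auto
      then show "1 / u \<le> 1 / real k" using k by (intro divide_left_mono) auto
    qed
    then show "(\<Sum>u\<in>{u \<in> T \<inter> {1..x}. f u = k}. 1 / u) \<le> a k * (1 / real k)" by (simp add: a_def)
  qed
  also have "\<dots> \<le> (\<Sum>k\<in>{1..n}. b k * (1 / real k))"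
  proof (rule weighted_sum_mono_of_partial_sums)
    fix m :: nat assume m: "1 \<le> m"
    have "(\<Sum>k\<in>{1..m}. a k) = real (card {u \<in> T \<inter> {1..x}. f u \<in> {1..m}})"
    proof -
      have "(\<Sum>k\<in>{1..m}. card {u \<in> T \<inter> {1..x}. f u = k}) = card (\<Union>k\<in>{1..m}. {u \<in> T \<inter> {1..x}. f u = k})"
      proof (rule card_UN_disjoint[symmetric])
        show "\<forall>k\<in>{1..m}. finite {u \<in> T \<inter> {1..x}. f u = k}"
          using fin[of x] by (intro ballI finite_subset[OF _ fin[of x]]) auto
      qed auto
      also have "(\<Union>k\<in>{1..m}. {u \<in> T \<inter> {1..x}. f u = k}) = {u \<in> T \<inter> {1..x}. f u \<in> {1..m}}" by auto
      finally show ?thesis by (simp add: a_def flip: of_nat_sum)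
    qed
    also have "\<dots> \<le> real (card (T \<inter> {1..real (m + 1)}))"
    proof -
      have "{u \<in> T \<inter> {1..x}. f u \<in> {1..m}} \<subseteq> T \<inter> {1..real (m + 1)}"
      proof
        fix u assume u: "u \<in> {u \<in> T \<inter> {1..x}. f u \<in> {1..m}}"
        then have "u < real (f u) + 1" "real (f u) \<le> real m" using f1(3)[of u] by auto
        then show "u \<in> T \<inter> {1..real (m + 1)}" using u by auto
      qed
      then show ?thesis using fin by (simp add: card_mono)
    qed
    also have "\<dots> \<le> \<theta> * real (m + 1) + K" by (rule cnt) simp
    also have "\<dots> = (\<Sum>k\<in>{1..m}. b k)"
      using m by (induction m rule: dec_induct) (simp_all add: b_def algebra_simps)
    finally show "(\<Sum>k\<in>{1..m}. a k) \<le> (\<Sum>k\<in>{1..m}. b k)" .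
  qed (use n in \<open>auto simp: field_simps\<close>)
  also have "\<dots> \<le> \<theta> * ln (real n) + (2 * \<theta> + K)"
    using n(1)
  proof (induction n rule: dec_induct)
    case (step m)
    have "ln (real m / real (Suc m)) \<le> real m / real (Suc m) - 1"
      by (rule ln_le_minus_one) (use step in simp)
    then have "ln (real m) - ln (real (Suc m)) \<le> real m / real (Suc m) - 1" using step by (simp add: ln_div)
    moreover have "real m / real (Suc m) - 1 = - (1 / real (Suc m))" by (simp add: field_simps)
    ultimately have "1 / real (Suc m) \<le> ln (real (Suc m)) - ln (real m)" by linarith
    then have "\<theta> * (1 / real (Suc m)) \<le> \<theta> * (ln (real (Suc m)) - ln (real m))" using assms(3) by (rule mult_left_mono)
    moreover have "b (Suc m) = \<theta>" using step by (simp add: b_def)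
    ultimately show ?case using step by (simp add: right_diff_distrib)
  qed (simp add: b_def)
  also have "\<theta> * ln (real n) \<le> \<theta> * ln x" using n assms(3) by (intro mult_left_mono ln_mono) auto
  finally show ?thesis by simp
qed

text \<open>The density of the sieved multiples of \<alpha> on the line.\<close>

definition weight :: "(real \<Rightarrow> nat) \<Rightarrow> real \<Rightarrow> real" where
  "weight z \<alpha> = mertens_prod (z \<alpha>) / \<alpha>"

text \<open>The blocks (x i, x (i + 1)] each carry reciprocals of total at least \<delta> / 2 ln (x
  (i + 1)). Sieving by the primes up to about x (i + 1)^2 costs a factor of order 1 / ln (x (i +
  1)), so every block keeps weight at least c1 \<delta> / 8 and any total is reachable. Coincidences
  are harmless because a = 1 would make \<beta> a multiple of \<alpha>, against the separation; so a
  has a prime factor, which is either sieved out or so large that q is tiny.\<close>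

lemma selection:
  fixes A :: "real set" and \<delta> \<eta> c0 c1 M :: real
  assumes sep: "\<And>\<alpha> \<beta> n. \<alpha> \<in> A \<Longrightarrow> \<beta> \<in> A \<Longrightarrow> \<alpha> \<noteq> \<beta> \<Longrightarrow> n > 0 \<Longrightarrow> \<bar>real n * \<alpha> - \<beta>\<bar> \<ge> 1"
    and fin: "\<And>x. finite (A \<inter> {..x})" and \<delta>: "\<delta> > 0"
    and dens: "\<And>x0. \<exists>x\<ge>x0. \<delta> * ln x \<le> (\<Sum>a\<in>A \<inter> {1..x}. 1 / a)"
    and c1: "c1 > 0" "\<And>n. n \<ge> 2 \<Longrightarrow> mertens_prod n \<ge> c1 / ln (real n)" and \<eta>: "\<eta> > 0" and c0: "c0 > 0"
    and badsum: "\<And>H A B x x'. H \<ge> H0 \<Longrightarrow> finite A \<Longrightarrow> finite B \<Longrightarrow>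
      A \<subseteq> {1..x} \<Longrightarrow> B \<subseteq> {1..x'} \<Longrightarrow> 1 \<le> x \<Longrightarrow> 1 \<le> x' \<Longrightarrow>
      (\<And>u v. u \<in> A \<Longrightarrow> v \<in> A \<Longrightarrow> u \<noteq> v \<Longrightarrow> \<bar>u - v\<bar> \<ge> 1) \<Longrightarrow> (\<And>u v. u \<in> B \<Longrightarrow> v \<in> B \<Longrightarrow> u \<noteq> v \<Longrightarrow> \<bar>u - v\<bar> \<ge> 1) \<Longrightarrow>
      (\<Sum>(\<alpha>, \<beta>)\<in>{(\<alpha>, \<beta>) \<in> A \<times> B. bad_pair \<eta> H \<alpha> \<beta>}. 1 / (\<alpha> * \<beta>)) \<le> 2 * exp (- real H) * ((1 + log 2 x) * (1 + log 2 x'))"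
  obtains S z where "finite S" "S \<subseteq> A" "S \<subseteq> {1..}" "(\<Sum>\<alpha>\<in>S. weight z \<alpha>) \<ge> M"
    "\<And>\<alpha> \<beta> q a b. \<alpha> \<in> S \<Longrightarrow> \<beta> \<in> S \<Longrightarrow> \<alpha> \<noteq> \<beta> \<Longrightarrow> ratio_rep \<alpha> \<beta> q a b \<Longrightarrow>
        (\<exists>p. prime p \<and> (p \<le> z \<alpha> \<and> p dvd b \<or> p \<le> z \<beta> \<and> p dvd a)) \<or> q \<le> \<eta> * c0 * (mertens_prod (z \<alpha>) * mertens_prod (z \<beta>))"
    "\<And>H. H \<ge> H0 \<Longrightarrow> (\<Sum>\<alpha>\<in>S. \<Sum>\<beta>\<in>S. if bad_pair \<eta> H \<alpha> \<beta> then weight z \<alpha> * weight z \<beta> else 0)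
        \<le> 72 / \<delta>\<^sup>2 * exp (- real H) * (\<Sum>\<alpha>\<in>S. weight z \<alpha>)\<^sup>2"
proof -
  have fin1: "finite (A \<inter> {u<..w})" "finite (A \<inter> {u..w})" for u w
    by (rule finite_subset[OF _ fin[of w]]; auto)+
  \<comment> \<open>The third condition compares 1 / w, an upper bound for q when a prime factor
    exceeds w^2, with the product of the two sieve densities; it holds for all large w because w
    outgrows (ln w)^2.\<close>
  define R where "R = (\<lambda>u w::real. w \<ge> u + 1 \<and> w \<ge> 3 \<and> 1 / w \<le> \<eta> * c0 * (c1 / (4 * ln w))\<^sup>2 \<and> \<delta> / 2 * ln w \<le> (\<Sum>a\<in>A \<inter> {u<..w}. 1 / a))"
  have ex: "\<exists>w. R u w" if u: "u \<ge> 1" for u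
  proof -
    define s where "s = (\<Sum>a\<in>A \<inter> {1..u}. 1 / a)"
    have "eventually (\<lambda>w::real. 1 / w \<le> \<eta> * c0 * (c1 / (4 * ln w))\<^sup>2) at_top"
      using \<eta> c0 c1(1) by real_asymp
    moreover have "eventually (\<lambda>w::real. s \<le> \<delta> / 2 * ln w) at_top"
      using \<delta> by real_asymp
    ultimately have "eventually (\<lambda>w::real. 1 / w \<le> \<eta> * c0 * (c1 / (4 * ln w))\<^sup>2 \<and> s \<le> \<delta> / 2 * ln w) at_top"
      by (rule eventually_conj)
    then obtain x0 where x0: "\<And>w. w \<ge> x0 \<Longrightarrow> 1 / w \<le> \<eta> * c0 * (c1 / (4 * ln w))\<^sup>2 \<and> s \<le> \<delta> / 2 * ln w"
      by (auto simp: eventually_at_top_linorder)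
    obtain w where w: "w \<ge> max x0 (max (u + 1) 3)" "\<delta> * ln w \<le> (\<Sum>a\<in>A \<inter> {1..w}. 1 / a)"
      using dens by blast
    have "A \<inter> {1..w} = (A \<inter> {1..u}) \<union> (A \<inter> {u<..w})" using u w by auto
    then have "(\<Sum>a\<in>A \<inter> {1..w}. 1 / a) = s + (\<Sum>a\<in>A \<inter> {u<..w}. 1 / a)"
      using fin1 by (simp add: s_def) (subst sum.union_disjoint, auto)
    then have "R u w" using w x0[of w] by (auto simp: R_def)
    then show ?thesis by blast
  qed
  obtain x :: "nat \<Rightarrow> real" where x: "x 0 = 1" "\<And>i. x i \<ge> 1 \<and> R (x i) (x (Suc i))"
  proof -
    have "\<exists>f. \<forall>n. (f n \<ge> (1::real) \<and> (n = 0 \<longrightarrow> f n = 1)) \<and> R (f n) (f (Suc n))"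
    proof (rule dependent_nat_choice)
      show "\<exists>x::real. x \<ge> 1 \<and> (0 = (0::nat) \<longrightarrow> x = 1)" by auto
      fix u :: real and n :: nat assume "u \<ge> 1 \<and> (n = 0 \<longrightarrow> u = 1)"
      then obtain w where "R u w" using ex by blast
      then show "\<exists>y. (y \<ge> 1 \<and> (Suc n = 0 \<longrightarrow> y = 1)) \<and> R u y" by (intro exI[of _ w]) (auto simp: R_def)
    qed
    then show ?thesis using that by auto
  qed
  have x1: "x (Suc i) \<ge> 3" "x (Suc i) \<ge> x i + 1" "1 / x (Suc i) \<le> \<eta> * c0 * (c1 / (4 * ln (x (Suc i))))\<^sup>2"
     "\<delta> / 2 * ln (x (Suc i)) \<le> (\<Sum>a\<in>A \<inter> {x i<..x (Suc i)}. 1 / a)" for i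
    using x(2)[of i] by (auto simp: R_def)
  have xmono: "i \<le> j \<Longrightarrow> x i \<le> x j" for i j
    by (rule lift_Suc_mono_le[of x]) (use x1(2) in \<open>smt (verit)\<close>)
  \<comment> \<open>With x = x (i + 1), the square makes any coefficient a > x^2 of an \<alpha> <= x
    force q = \<alpha> / a <= 1 / x. As \<open>zi i\<close> is at most x^4, Mertens' bound only
    loses a factor 4.\<close>
  define zi where "zi = (\<lambda>i. (nat \<lceil>x (Suc i)\<rceil>)\<^sup>2)"
  define idx where "idx = (\<lambda>\<alpha>. LEAST i. \<alpha> \<le> x (Suc i))"
  define z where "z = (\<lambda>\<alpha>. zi (idx \<alpha>))"
  define B where "B = (\<lambda>i. A \<inter> {x i<..x (Suc i)})"
  have finB: "finite (B i)" for i by (simp add: B_def fin1)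
  have idx: "idx \<alpha> = i" if "\<alpha> \<in> B i" for \<alpha> i
    unfolding idx_def
  proof (rule Least_equality)
    show "\<alpha> \<le> x (Suc i)" using that by (simp add: B_def)
    fix j assume j: "\<alpha> \<le> x (Suc j)"
    show "i \<le> j"
    proof (rule ccontr)
      assume "\<not> i \<le> j"
      then have "x (Suc j) \<le> x i" by (intro xmono) auto
      then show False using j that by (simp add: B_def)
    qed
  qed
  have B1: "\<alpha> \<in> {1..x (Suc i)}" "\<alpha> \<in> A" if "\<alpha> \<in> B i" for \<alpha> i
    using that x(2)[of i] by (auto simp: B_def)
  have zi_mono: "i \<le> j \<Longrightarrow> zi i \<le> zi j" for i j
    unfolding zi_def by (intro power_mono nat_mono ceiling_mono xmono) auto
  have zi_ge: "(x (Suc i))\<^sup>2 \<le> real (zi i)" for i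
  proof -
    have "x (Suc i) \<le> real (nat \<lceil>x (Suc i)\<rceil>)" by (rule real_nat_ceiling_ge)
    then have "(x (Suc i))\<^sup>2 \<le> (real (nat \<lceil>x (Suc i)\<rceil>))\<^sup>2" using x1(1)[of i] by (intro power_mono) auto
    then show ?thesis by (simp add: zi_def)
  qed
  have vi_ge: "mertens_prod (zi i) \<ge> c1 / (4 * ln (x (Suc i)))" for i
  proof -
    have x3: "x (Suc i) \<ge> 3" by (rule x1)
    have ge9: "9 \<le> real (zi i)"
    proof -
      have "(3::real)\<^sup>2 \<le> (x (Suc i))\<^sup>2" using x3 by (intro power_mono) auto
      then show ?thesis using zi_ge[of i] by simp
    qed
    have "real (nat \<lceil>x (Suc i)\<rceil>) \<le> x (Suc i) + 1" using x3 by linarith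
    also have "\<dots> \<le> (x (Suc i))\<^sup>2"
    proof -
      have "3 * x (Suc i) \<le> x (Suc i) * x (Suc i)" using x3 by (intro mult_right_mono) auto
      then show ?thesis using x3 unfolding power2_eq_square by linarith
    qed
    finally have "(real (nat \<lceil>x (Suc i)\<rceil>))\<^sup>2 \<le> ((x (Suc i))\<^sup>2)\<^sup>2" by (intro power_mono) auto
    then have "real (zi i) \<le> x (Suc i) ^ 4" by (simp add: zi_def flip: power_mult)
    then have "ln (real (zi i)) \<le> ln (x (Suc i) ^ 4)" using ge9 by (intro ln_mono) auto
    also have "\<dots> = 4 * ln (x (Suc i))" using x3 by (simp add: ln_realpow)
    finally have "c1 / (4 * ln (x (Suc i))) \<le> c1 / ln (real (zi i))"
      using c1(1) ge9 x3 by (intro divide_left_mono) auto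
    also have "\<dots> \<le> mertens_prod (zi i)" by (rule c1(2)) (use ge9 in linarith)
    finally show ?thesis .
  qed
  define m where "m = (\<lambda>i. \<Sum>\<alpha>\<in>B i. weight z \<alpha>)"
  have m_eq: "m i = mertens_prod (zi i) * (\<Sum>\<alpha>\<in>B i. 1 / \<alpha>)" for i
    unfolding m_def weight_def z_def by (simp add: idx sum_distrib_left)
  have m_ge: "mertens_prod (zi i) * (\<delta> / 2 * ln (x (Suc i))) \<le> m i" for i
    unfolding m_eq B_def by (intro mult_left_mono x1) (use mertens_prod_pos[of "zi i"] in auto)
  have m_ge': "c1 * \<delta> / 8 \<le> m i" for i
  proof -
    have l: "ln (x (Suc i)) > 0" using x1(1)[of i] by simp
    have "c1 * \<delta> / 8 = c1 / (4 * ln (x (Suc i))) * (\<delta> / 2 * ln (x (Suc i)))" using l by simp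
    also have "\<dots> \<le> mertens_prod (zi i) * (\<delta> / 2 * ln (x (Suc i)))"
      by (intro mult_right_mono vi_ge) (use l \<delta> in auto)
    also have "\<dots> \<le> m i" by (rule m_ge)
    finally show ?thesis .
  qed
  obtain J :: nat where J: "M \<le> real J * (c1 * \<delta> / 8)"
    using reals_Archimedean3[of "c1 * \<delta> / 8"] c1 \<delta> by (metis divide_pos_pos mult_pos_pos less_imp_le zero_less_numeral)
  define S where "S = (\<Union>i\<in>{..<J}. B i)"
  have disj: "B i \<inter> B j = {}" if "i \<noteq> j" for i j
  proof (rule ccontr)
    assume "B i \<inter> B j \<noteq> {}"
    then obtain \<alpha> where "\<alpha> \<in> B i" "\<alpha> \<in> B j" by blast
    then show False using idx[of \<alpha> i] idx[of \<alpha> j] that by simp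
  qed
  have sumS: "(\<Sum>\<alpha>\<in>S. f \<alpha>) = (\<Sum>i<J. \<Sum>\<alpha>\<in>B i. f \<alpha>)" for f :: "real \<Rightarrow> real"
    unfolding S_def by (rule sum.UNION_disjoint) (use finB disj in auto)
  show ?thesis
  proof (rule that[of S z])
    show "finite S" "S \<subseteq> A" "S \<subseteq> {1..}" using finB B1 by (auto simp: S_def)
    have "real J * (c1 * \<delta> / 8) = (\<Sum>i<J. c1 * \<delta> / 8)" by simp
    also have "\<dots> \<le> (\<Sum>i<J. m i)" by (intro sum_mono m_ge')
    finally show "(\<Sum>\<alpha>\<in>S. weight z \<alpha>) \<ge> M" using J by (simp add: sumS m_def)
  next
    fix \<alpha> \<beta> q a b assume ab: "\<alpha> \<in> S" "\<beta> \<in> S" "\<alpha> \<noteq> \<beta>" and r: "ratio_rep \<alpha> \<beta> q a b"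
    obtain i j where ij: "\<alpha> \<in> B i" "\<beta> \<in> B j" using ab by (auto simp: S_def)
    have zz: "z \<alpha> = zi i" "z \<beta> = zi j" using idx ij by (auto simp: z_def)
    have q: "q > 0" "a > 0" "b > 0" "\<alpha> = q * real a" "\<beta> = q * real b" using r by (auto simp: ratio_rep_def)
    have small: "q \<le> \<eta> * c0 * (mertens_prod (z \<alpha>) * mertens_prod (z \<beta>))"
      if l: "u = q * real n" "u \<le> x (Suc k)" "real n > real (zi k)" "i \<le> k" "j \<le> k" for u n k
    proof -
      define y where "y = x (Suc k)"
      have y3: "y \<ge> 3" using x1(1) by (simp add: y_def)
      have "q * (y * y) \<le> q * real n"
        using q(1) zi_ge[of k] l by (intro mult_left_mono) (auto simp: y_def power2_eq_square)
      also have "\<dots> \<le> y" using l by (simp add: y_def)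
      finally have "q \<le> 1 / y" using y3 by (simp add: field_simps)
      also have "\<dots> \<le> \<eta> * c0 * (c1 / (4 * ln y))\<^sup>2" using x1(3)[of k] by (simp add: y_def)
      also have "\<dots> \<le> \<eta> * c0 * (mertens_prod (zi k) * mertens_prod (zi k))"
        unfolding power2_eq_square using vi_ge[of k] \<eta> c0 c1 y3
        by (intro mult_left_mono mult_mono) (auto simp: y_def intro: less_imp_le[OF mertens_prod_pos])
      also have "\<dots> \<le> \<eta> * c0 * (mertens_prod (zi i) * mertens_prod (zi j))"
        using \<eta> c0 l by (intro mult_left_mono mult_mono mertens_prod_antimono zi_mono) (auto intro: less_imp_le[OF mertens_prod_pos])
      finally show ?thesis by (simp add: zz)
    qed
    show "(\<exists>p. prime p \<and> (p \<le> z \<alpha> \<and> p dvd b \<or> p \<le> z \<beta> \<and> p dvd a)) \<or> q \<le> \<eta> * c0 * (mertens_prod (z \<alpha>) * mertens_prod (z \<beta>))"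
    proof (rule disjCI)
      assume "\<not> q \<le> \<eta> * c0 * (mertens_prod (z \<alpha>) * mertens_prod (z \<beta>))"
      note big = this
      show "\<exists>p. prime p \<and> (p \<le> z \<alpha> \<and> p dvd b \<or> p \<le> z \<beta> \<and> p dvd a)"
      \<comment> \<open>The prime is taken from the coefficient of the element in the earlier block.
        That coefficient divides every multiplier of the other element in a coincidence, so the
        higher of the two sieve levels is the one that acts.\<close>
      proof (cases "i \<le> j")
        case True
        have "a \<noteq> 1"
        proof
          assume "a = 1"
          then have "real b * \<alpha> = \<beta>" using q by simp
          then show False using sep[of \<alpha> \<beta> b] B1 ij ab q by force
        qed
        then obtain p where p: "prime p" "p dvd a" using prime_factor_nat by blast
        have "p \<le> zi j"
        proof (rule ccontr)
          assume "\<not> p \<le> zi j"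
          moreover have "p \<le> a" using p q by (intro dvd_imp_le) auto
          ultimately have "real a > real (zi j)" by simp
          moreover have "\<alpha> \<le> x (Suc j)" using B1[OF ij(1)] xmono[of "Suc i" "Suc j"] True by auto
          ultimately show False using small[of \<alpha> a j] q True big by auto
        qed
        then show ?thesis using p zz by auto
      next
        case False
        have "b \<noteq> 1"
        proof
          assume "b = 1"
          then have "real a * \<beta> = \<alpha>" using q by simp
          then show False using sep[of \<beta> \<alpha> a] B1 ij ab q by force
        qed
        then obtain p where p: "prime p" "p dvd b" using prime_factor_nat by blast
        have "p \<le> zi i"
        proof (rule ccontr)
          assume "\<not> p \<le> zi i"
          moreover have "p \<le> b" using p q by (intro dvd_imp_le) auto
          ultimately have "real b > real (zi i)" by simp
          moreover have "\<beta> \<le> x (Suc i)" using B1[OF ij(2)] xmono[of "Suc j" "Suc i"] False by auto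
          ultimately show False using small[of \<beta> b i] q False big by auto
        qed
        then show ?thesis using p zz by auto
      qed
    qed
  next
    fix H assume H: "H \<ge> H0"
    have sepB: "\<bar>u - v\<bar> \<ge> 1" if "u \<in> B i" "v \<in> B i" "u \<noteq> v" for u v i
      using sep[of u v 1] B1 that by auto
    \<comment> \<open>The number of dyadic blocks is paid for by the weight of the block, since its
      reciprocals make up at least \<delta> / 2 of ln x; the 72 below is 2 * 6 * 6.\<close>
    have lg: "mertens_prod (zi i) * (1 + log 2 (x (Suc i))) \<le> 6 / \<delta> * m i" for i
    proof -
      have x3: "x (Suc i) \<ge> 3" by (rule x1)
      have "exp 1 \<le> (3::real)" using exp_le by simp
      then have "1 \<le> ln (x (Suc i))" using x3 by (subst ln_ge_iff) auto
      moreover have "log 2 (x (Suc i)) \<le> 2 * ln (x (Suc i))"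
      proof -
        have "(1::real) \<le> 2 * ln 2" using ln2_ge_two_thirds by simp
        then have "1 * ln (x (Suc i)) \<le> 2 * ln 2 * ln (x (Suc i))" using x3 by (intro mult_right_mono) auto
        then show ?thesis by (simp add: log_def field_simps)
      qed
      ultimately have "1 + log 2 (x (Suc i)) \<le> 3 * ln (x (Suc i))" by simp
      then have "mertens_prod (zi i) * (1 + log 2 (x (Suc i))) \<le> mertens_prod (zi i) * (3 * ln (x (Suc i)))"
        using mertens_prod_pos[of "zi i"] by (intro mult_left_mono) auto
      also have "\<dots> = 6 / \<delta> * (mertens_prod (zi i) * (\<delta> / 2 * ln (x (Suc i))))" using \<delta> by simp
      also have "\<dots> \<le> 6 / \<delta> * m i" using \<delta> by (intro mult_left_mono m_ge) auto
      finally show ?thesis .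
    qed
    have block: "(\<Sum>\<alpha>\<in>B i. \<Sum>\<beta>\<in>B j. if bad_pair \<eta> H \<alpha> \<beta> then weight z \<alpha> * weight z \<beta> else 0)
      \<le> 72 / \<delta>\<^sup>2 * exp (- real H) * (m i * m j)" for i j
    proof -
      define vv where "vv = mertens_prod (zi i) * mertens_prod (zi j)"
      have "(\<Sum>\<alpha>\<in>B i. \<Sum>\<beta>\<in>B j. if bad_pair \<eta> H \<alpha> \<beta> then weight z \<alpha> * weight z \<beta> else 0)
        = (\<Sum>e\<in>B i \<times> B j. if (case e of (\<alpha>, \<beta>) \<Rightarrow> bad_pair \<eta> H \<alpha> \<beta>) then vv * (case e of (\<alpha>, \<beta>) \<Rightarrow> 1 / (\<alpha> * \<beta>)) else 0)"
        unfolding sum.cartesian_product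
        by (intro sum.cong refl) (auto simp: weight_def z_def idx vv_def)
      also have "\<dots> = (\<Sum>e\<in>{e \<in> B i \<times> B j. case e of (\<alpha>, \<beta>) \<Rightarrow> bad_pair \<eta> H \<alpha> \<beta>}. vv * (case e of (\<alpha>, \<beta>) \<Rightarrow> 1 / (\<alpha> * \<beta>)))"
        by (rule sum.inter_filter[symmetric]) (use finB in auto)
      also have "\<dots> = vv * (\<Sum>(\<alpha>, \<beta>)\<in>{(\<alpha>, \<beta>) \<in> B i \<times> B j. bad_pair \<eta> H \<alpha> \<beta>}. 1 / (\<alpha> * \<beta>))"
        unfolding sum_distrib_left by (intro sum.cong) auto
      also have "\<dots> \<le> vv * (2 * exp (- real H) * ((1 + log 2 (x (Suc i))) * (1 + log 2 (x (Suc j)))))"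
      proof (intro mult_left_mono badsum[OF H])
        show "0 \<le> vv" using mertens_prod_pos[of "zi i"] mertens_prod_pos[of "zi j"] by (simp add: vv_def)
      qed (use finB B1 sepB x in auto)
      also have "\<dots> = 2 * exp (- real H) * ((mertens_prod (zi i) * (1 + log 2 (x (Suc i)))) * (mertens_prod (zi j) * (1 + log 2 (x (Suc j)))))"
        by (simp add: vv_def)
      also have "\<dots> \<le> 2 * exp (- real H) * ((6 / \<delta> * m i) * (6 / \<delta> * m j))"
      proof (rule mult_left_mono[OF mult_mono[OF lg lg]])
        have "log 2 (x (Suc j)) \<ge> 0" using x1(1)[of j] by simp
        then show "0 \<le> mertens_prod (zi j) * (1 + log 2 (x (Suc j)))"
          using mertens_prod_pos[of "zi j"] by simp
        have "m i \<ge> 0" using m_ge'[of i] c1 \<delta> by (smt (verit) divide_nonneg_nonneg mult_nonneg_nonneg)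
        then show "0 \<le> 6 / \<delta> * m i" using \<delta> by simp
      qed simp
      also have "\<dots> = 72 / \<delta>\<^sup>2 * exp (- real H) * (m i * m j)" by (simp add: power2_eq_square)
      finally show ?thesis .
    qed
    have "(\<Sum>\<alpha>\<in>S. \<Sum>\<beta>\<in>S. if bad_pair \<eta> H \<alpha> \<beta> then weight z \<alpha> * weight z \<beta> else 0)
      = (\<Sum>i<J. \<Sum>j<J. \<Sum>\<alpha>\<in>B i. \<Sum>\<beta>\<in>B j. if bad_pair \<eta> H \<alpha> \<beta> then weight z \<alpha> * weight z \<beta> else 0)"
      unfolding sumS by (intro sum.cong refl) (rule sum.swap)
    also have "\<dots> \<le> (\<Sum>i<J. \<Sum>j<J. 72 / \<delta>\<^sup>2 * exp (- real H) * (m i * m j))" by (intro sum_mono block)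
    also have "\<dots> = 72 / \<delta>\<^sup>2 * exp (- real H) * ((\<Sum>i<J. m i) * (\<Sum>j<J. m j))"
      unfolding sum_product by (simp only: sum_distrib_left)
    finally show "(\<Sum>\<alpha>\<in>S. \<Sum>\<beta>\<in>S. if bad_pair \<eta> H \<alpha> \<beta> then weight z \<alpha> * weight z \<beta> else 0)
        \<le> 72 / \<delta>\<^sup>2 * exp (- real H) * (\<Sum>\<alpha>\<in>S. weight z \<alpha>)\<^sup>2"
      by (simp add: sumS m_def power2_eq_square)
  qed
qed

section \<open>From overlaps to a counting bound\<close>

text \<open>An interval around n \<alpha> has half-length at most 1 / 4, and 1 / 4 + 1 / 2 < 1, so
  it avoids the unit intervals around the elements of A - S. In the second moment with \<kappa> = c
  \<mu> the terms linear in X combine to (c \<mu>)^2 (1 + \<theta> - 2 + 1) X, which leaves \<theta>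
  X for the count.\<close>

lemma count_bound_of_overlaps:
  fixes A S :: "real set" and z :: "real \<Rightarrow> nat" and c \<mu> \<theta> K1 :: real
  assumes sep: "\<And>\<alpha> \<beta> n. \<alpha> \<in> A \<Longrightarrow> \<beta> \<in> A \<Longrightarrow> \<alpha> \<noteq> \<beta> \<Longrightarrow> n > 0 \<Longrightarrow> \<bar>real n * \<alpha> - \<beta>\<bar> \<ge> 1"
    and fin: "\<And>x. finite (A \<inter> {..x})" and S: "finite S" "S \<subseteq> A" "S \<subseteq> {1..}"
    and c: "0 < c" "c \<le> 1 / 2" and \<mu>: "\<mu> = (\<Sum>\<alpha>\<in>S. weight z \<alpha>)" "\<mu> > 0"
    and overlap: "\<And>X. X \<ge> 0 \<Longrightarrow> (\<Sum>\<alpha>\<in>S. \<Sum>\<beta>\<in>S. pair_sum c (z \<alpha>) (z \<beta>) \<alpha> \<beta> X) \<le> (c * \<mu>)\<^sup>2 * (1 + \<theta>) * X + K1"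
  obtains K where "K \<ge> 0" "\<And>X. X \<ge> 1 \<Longrightarrow> real (card ((A - S) \<inter> {1..X})) \<le> \<theta> * X + K"
proof -
  have "\<exists>K. \<forall>X\<ge>0. \<bar>real (card {n. n \<in> rough (z \<alpha>) \<and> real n * \<alpha> \<le> X}) - weight z \<alpha> * X\<bar> \<le> K" if "\<alpha> \<in> S" for \<alpha>
  proof -
    have "\<alpha> > 0" using that S(3) by auto
    then obtain K where "\<And>X. X \<ge> 0 \<Longrightarrow> \<bar>real (card {n. n \<in> rough (z \<alpha>) \<and> real n * \<alpha> \<le> X}) - mertens_prod (z \<alpha>) / \<alpha> * X\<bar> \<le> K"
      using count_rough[of \<alpha> "z \<alpha>"] by blast
    then show ?thesis by (intro exI[of _ K]) (simp add: weight_def)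
  qed
  then have "\<forall>\<alpha>\<in>S. \<exists>K. \<forall>X\<ge>0. \<bar>real (card {n. n \<in> rough (z \<alpha>) \<and> real n * \<alpha> \<le> X}) - weight z \<alpha> * X\<bar> \<le> K" by blast
  from bchoice[OF this] obtain K2 where K2: "\<And>\<alpha> X. \<alpha> \<in> S \<Longrightarrow> X \<ge> 0 \<Longrightarrow> \<bar>real (card {n. n \<in> rough (z \<alpha>) \<and> real n * \<alpha> \<le> X}) - weight z \<alpha> * X\<bar> \<le> K2 \<alpha>"
    by blast
  define m where "m = c * \<mu>"
  have m0: "m > 0" using c \<mu> by (simp add: m_def)
  define K3 where "K3 = (\<Sum>\<alpha>\<in>S. K2 \<alpha>)"
  define K where "K = \<bar>1 + (K1 + 2 * m * c * K3) / m\<^sup>2\<bar>"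
  show ?thesis
  proof (rule that[of K])
    show "K \<ge> 0" by (simp add: K_def)
    fix X :: real assume X: "X \<ge> 1"
    define N where "N = (\<lambda>\<alpha>. {n. n \<in> rough (z \<alpha>) \<and> real n * \<alpha> \<le> X})"
    have a1: "\<alpha> \<ge> 1" "\<alpha> \<in> A" if "\<alpha> \<in> S" for \<alpha> using that S by auto
    have finN: "finite (N \<alpha>)" if "\<alpha> \<in> S" for \<alpha>
      unfolding N_def by (rule finite_bounded_multiples) (use a1[OF that] in auto)
    define P where "P = Sigma S N"
    have finP: "finite P" unfolding P_def using S(1) finN by auto
    define I where "I = (\<lambda>(\<alpha>, n). {real n * \<alpha> - c / 2..real n * \<alpha> + c / 2})"
    define B where "B = (A - S) \<inter> {1..X}"
    have finB: "finite B" unfolding B_def by (rule finite_subset[OF _ fin[of X]]) auto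
    define U where "U = (\<Union>\<beta>\<in>B. {\<beta> - 1 / 2<..<\<beta> + 1 / 2})"
    define G where "G = {0..X + 1} - U"
    have Usub: "U \<subseteq> {0..X + 1}" by (auto simp: U_def B_def)
    have fm: "{u..v} \<in> fmeasurable lborel" "{u<..<v} \<in> fmeasurable lborel" for u v :: real
      by (rule fmeasurableI; cases "u \<le> v"; simp)+
    have measI: "I x \<in> fmeasurable lborel" "measure lborel (I x) = c" for x
    proof -
      obtain \<alpha> n where x: "x = (\<alpha>, n)" by (cases x)
      show "I x \<in> fmeasurable lborel" unfolding I_def x by (simp only: prod.case fm)
      show "measure lborel (I x) = c" unfolding I_def x using c by simp
    qed
    have measU: "U \<in> fmeasurable lborel" "measure lborel U = real (card B)"
    proof -
      show "U \<in> fmeasurable lborel" unfolding U_def by (rule fmeasurable.finite_UN) (use finB fm in auto)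
      have "measure lborel U = (\<Sum>\<beta>\<in>B. measure lborel {\<beta> - 1 / 2<..<\<beta> + 1 / 2})"
        unfolding U_def
      proof (rule measure_finite_Union)
        show "disjoint_family_on (\<lambda>\<beta>. {\<beta> - 1 / 2<..<\<beta> + 1 / 2}) B"
          unfolding disjoint_family_on_def
        proof (intro ballI impI)
          fix u v assume uv: "u \<in> B" "v \<in> B" "u \<noteq> v"
          then have "1 \<le> \<bar>real 1 * u - v\<bar>" by (intro sep) (auto simp: B_def)
          then show "{u - 1 / 2<..<u + 1 / 2} \<inter> {v - 1 / 2<..<v + 1 / 2} = {}" by auto
        qed
      qed (use finB fm in auto)
      then show "measure lborel U = real (card B)" by simp
    qed
    have measG: "G \<in> fmeasurable lborel" "measure lborel G = X + 1 - real (card B)"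
    proof -
      show "G \<in> fmeasurable lborel" unfolding G_def by (intro fmeasurable.Diff) (use measU fm in auto)
      have "measure lborel G = measure lborel {0..X + 1} - measure lborel U"
        unfolding G_def by (rule measurable_measure_Diff) (use measU Usub fm in auto)
      then show "measure lborel G = X + 1 - real (card B)" using X measU by simp
    qed
    have subG: "I x \<subseteq> G" if "x \<in> P" for x
    proof
      fix t assume t: "t \<in> I x"
      obtain \<alpha> n where x: "x = (\<alpha>, n)" by (cases x)
      then have an: "\<alpha> \<in> S" "n > 0" "real n * \<alpha> \<le> X" using that by (auto simp: P_def N_def rough_def)
      have "real n * \<alpha> - c / 2 \<le> t" "t \<le> real n * \<alpha> + c / 2" using t by (auto simp: I_def x)
      then have t': "\<bar>t - real n * \<alpha>\<bar> \<le> 1 / 4" using c by linarith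
      have "1 * 1 \<le> real n * \<alpha>" using an a1[OF an(1)] by (intro mult_mono) auto
      then have "0 \<le> t" "t \<le> X + 1" using t' an(3) by linarith+
      then have "t \<in> {0..X + 1}" by simp
      moreover have "t \<notin> U"
      proof
        assume "t \<in> U"
        then obtain \<beta> where "\<beta> \<in> B" "\<beta> - 1 / 2 < t" "t < \<beta> + 1 / 2" by (auto simp: U_def)
        then have \<beta>: "\<beta> \<in> B" "\<bar>t - \<beta>\<bar> < 1 / 2" by linarith+
        have "1 \<le> \<bar>real n * \<alpha> - \<beta>\<bar>" by (rule sep) (use an a1 \<beta> in \<open>auto simp: B_def\<close>)
        then show False using t' \<beta>(2) by linarith
      qed
      ultimately show "t \<in> G" by (simp add: G_def)
    qed
    have ineq: "0 \<le> (\<Sum>x\<in>P. \<Sum>y\<in>P. measure lborel (I x \<inter> I y)) - 2 * m * (\<Sum>x\<in>P. measure lborel (I x)) + m\<^sup>2 * measure lborel G"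
      by (rule l2_inequality) (use finP measI measG subG in auto)
    have tentI: "measure lborel (I (\<alpha>, n) \<inter> I (\<beta>, k)) = tent c (real n * \<alpha> - real k * \<beta>)" for \<alpha> \<beta> n k
      by (auto simp: I_def tent_def max_def min_def)
    have pairs: "(\<Sum>x\<in>P. \<Sum>y\<in>P. measure lborel (I x \<inter> I y)) = (\<Sum>\<alpha>\<in>S. \<Sum>\<beta>\<in>S. pair_sum c (z \<alpha>) (z \<beta>) \<alpha> \<beta> X)"
    proof -
      have "(\<Sum>x\<in>P. \<Sum>y\<in>P. measure lborel (I x \<inter> I y)) = (\<Sum>\<alpha>\<in>S. \<Sum>n\<in>N \<alpha>. \<Sum>\<beta>\<in>S. \<Sum>k\<in>N \<beta>. measure lborel (I (\<alpha>, n) \<inter> I (\<beta>, k)))"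
      proof -
        have "(\<Sum>x\<in>P. f x) = (\<Sum>\<alpha>\<in>S. \<Sum>n\<in>N \<alpha>. f (\<alpha>, n))" for f :: "real \<times> nat \<Rightarrow> real"
          unfolding P_def using sum.Sigma[of S N "\<lambda>\<alpha> n. f (\<alpha>, n)"] S(1) finN by (simp add: split_def)
        then show ?thesis by simp
      qed
      also have "\<dots> = (\<Sum>\<alpha>\<in>S. \<Sum>\<beta>\<in>S. \<Sum>n\<in>N \<alpha>. \<Sum>k\<in>N \<beta>. measure lborel (I (\<alpha>, n) \<inter> I (\<beta>, k)))"
        by (intro sum.cong refl sum.swap)
      finally show ?thesis by (simp add: pair_sum_def N_def tentI)
    qed
    have singles: "(\<Sum>x\<in>P. measure lborel (I x)) \<ge> c * (\<mu> * X - K3)"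
    proof -
      have "\<mu> * X - K3 = (\<Sum>\<alpha>\<in>S. weight z \<alpha> * X - K2 \<alpha>)"
        by (simp add: \<mu>(1) K3_def sum_subtractf sum_distrib_right)
      also have "\<dots> \<le> (\<Sum>\<alpha>\<in>S. real (card (N \<alpha>)))"
      proof (rule sum_mono)
        fix \<alpha> assume "\<alpha> \<in> S"
        then show "weight z \<alpha> * X - K2 \<alpha> \<le> real (card (N \<alpha>))" using K2[of \<alpha> X] X unfolding N_def by linarith
      qed
      also have "\<dots> = real (card P)" unfolding P_def using S(1) finN by (simp add: card_SigmaI)
      finally have "c * (\<mu> * X - K3) \<le> c * real (card P)" using c by (intro mult_left_mono) auto
      then show ?thesis by (simp add: measI mult.commute)
    qed
    have "m\<^sup>2 * real (card B) \<le> m\<^sup>2 * (1 + \<theta>) * X + K1 - 2 * m * (c * (\<mu> * X - K3)) + m\<^sup>2 * (X + 1)"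
      using ineq overlap[of X] X mult_left_mono[OF singles, of "2 * m"] m0
      unfolding pairs measG m_def[symmetric] by (simp add: algebra_simps)
    also have "\<dots> = m\<^sup>2 * (\<theta> * X + (1 + (K1 + 2 * m * c * K3) / m\<^sup>2))"
    proof -
      have "2 * m * (c * (\<mu> * X - K3)) = 2 * m\<^sup>2 * X - 2 * m * c * K3"
        by (simp add: m_def algebra_simps power2_eq_square)
      moreover have "m\<^sup>2 * (\<theta> * X + (1 + Q / m\<^sup>2)) = m\<^sup>2 * \<theta> * X + m\<^sup>2 + Q" for Q
        using m0 by (simp add: distrib_left)
      ultimately show ?thesis by (simp only:) (simp add: algebra_simps)
    qed
    also have "\<dots> \<le> m\<^sup>2 * (\<theta> * X + K)"
      unfolding K_def by (intro mult_left_mono add_left_mono abs_ge_self) simp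
    finally have "real (card B) \<le> \<theta> * X + K" using m0 by (simp add: mult_le_cancel_left)
    then show "real (card ((A - S) \<inter> {1..X})) \<le> \<theta> * X + K" by (simp add: B_def)
  qed
qed

lemma harmonic_type_diverges:
  fixes u v M :: real
  assumes "u > 0" "v > 0"
  obtains K :: nat where "(\<Sum>k<K. 1 / (real k * u + v)) > M"
proof -
  define D where "D = u + v"
  have D: "D > 0" using assms by (simp add: D_def)
  have "\<not> summable (\<lambda>k. 1 / (real k * u + v))"
  proof
    assume "summable (\<lambda>k. 1 / (real k * u + v))"
    then have "summable (\<lambda>k. D * (1 / (real k * u + v)))" by (rule summable_mult)
    then have "summable (\<lambda>k. 1 / real (Suc k))"
    proof (rule summable_comparison_test')
      fix k :: nat assume "k \<ge> 0"
      have "real k * u + v \<le> real (Suc k) * D" using assms by (simp add: D_def algebra_simps)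
      then have "1 / real (Suc k) \<le> D * (1 / (real k * u + v))"
        using assms D by (simp add: field_simps add_pos_nonneg)
      then show "norm (1 / real (Suc k)) \<le> D * (1 / (real k * u + v))" by simp
    qed
    then have "summable (\<lambda>k. 1 / real k)" by (subst (asm) summable_Suc_iff)
    then show False using not_summable_harmonic[where 'a = real] by (simp add: inverse_eq_divide)
  qed
  moreover have "summable (\<lambda>k. 1 / (real k * u + v))" if "\<And>K. (\<Sum>k<K. 1 / (real k * u + v)) \<le> M"
    by (rule summableI_nonneg_bounded[where x = M]) (use that assms in auto)
  ultimately obtain K where "\<not> (\<Sum>k<K. 1 / (real k * u + v)) \<le> M" by blast
  then show ?thesis by (intro that[of K]) auto
qed

text \<open>The 18 is 14 from the single pairs, and 1 each for the bad pairs, the band pairs, the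
  diagonal with c \<mu> <= \<eta> (c \<mu>)^2, and the additive errors \<eta>' of all pairs
  together.\<close>

lemma overlap_sum_bound:
  fixes A S :: "real set" and z :: "real \<Rightarrow> nat" and c \<eta> c1 \<mu> :: real and y :: nat
  assumes S: "finite S" "S \<subseteq> {1..}" and c: "0 < c" "c \<le> 1 / 2" and \<eta>: "0 < \<eta>" "\<eta> \<le> 1 / 3"
    and y: "y \<ge> 2" "4 * ln 64 \<le> \<eta> * ln (real y)" "2 / 16 ^ y \<le> \<eta>" and cy: "1 / 64 ^ y \<le> c"
    and c1: "c1 > 0" "\<And>n. n \<ge> 2 \<Longrightarrow> mertens_prod n \<ge> c1 / ln (real n)"
    and \<mu>: "\<mu> = (\<Sum>\<alpha>\<in>S. weight z \<alpha>)" "\<mu> > 0" "1 \<le> \<eta> * (c * \<mu>)"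
    and zero: "\<And>\<alpha> \<beta> q a b. \<alpha> \<in> S \<Longrightarrow> \<beta> \<in> S \<Longrightarrow> \<alpha> \<noteq> \<beta> \<Longrightarrow> ratio_rep \<alpha> \<beta> q a b \<Longrightarrow>
        (\<exists>p. prime p \<and> (p \<le> z \<alpha> \<and> p dvd b \<or> p \<le> z \<beta> \<and> p dvd a)) \<or> q \<le> \<eta> * c * (mertens_prod (z \<alpha>) * mertens_prod (z \<beta>))"
    and bad: "\<And>N. (\<Sum>H\<in>{y..N}. 9 / c1 * ln (real (H + 1)) * (\<Sum>\<alpha>\<in>S. \<Sum>\<beta>\<in>S. if bad_pair \<eta> H \<alpha> \<beta> then weight z \<alpha> * weight z \<beta> else 0)) \<le> \<eta> * \<mu>\<^sup>2"
    and band: "9 / c1 * ln (real y) * (\<Sum>\<alpha>\<in>S. \<Sum>\<beta>\<in>S. if band_pair c y \<alpha> \<beta> then weight z \<alpha> * weight z \<beta> else 0) \<le> \<eta> * \<mu>\<^sup>2"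
  obtains K where "\<And>X. X \<ge> 0 \<Longrightarrow> (\<Sum>\<alpha>\<in>S. \<Sum>\<beta>\<in>S. pair_sum c (z \<alpha>) (z \<beta>) \<alpha> \<beta> X) \<le> (c * \<mu>)\<^sup>2 * (1 + 18 * \<eta>) * X + K"
proof -
  define w where "w = weight z"
  have a1: "\<alpha> \<ge> 1" if "\<alpha> \<in> S" for \<alpha> using that S by auto
  have w0: "w \<alpha> \<ge> 0" if "\<alpha> \<in> S" for \<alpha>
    using a1[OF that] mertens_prod_pos[of "z \<alpha>"] by (simp add: w_def weight_def)
  define \<eta>' where "\<eta>' = \<eta> * (c * \<mu>)\<^sup>2 / (real (card S) ^ 2 + 1)"
  have \<eta>': "\<eta>' > 0" using \<eta> c \<mu> by (auto simp: \<eta>'_def intro!: divide_pos_pos add_nonneg_pos)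
  define \<Psi> where "\<Psi> = (\<lambda>N \<alpha> \<beta>. overlap_factor (9 / c1) \<eta> c y N \<alpha> \<beta>)"
  have ex1: "\<exists>N0. \<forall>N\<ge>N0. \<exists>K. \<forall>X\<ge>0. pair_sum c (z \<alpha>) (z \<beta>) \<alpha> \<beta> X \<le> (c\<^sup>2 * w \<alpha> * w \<beta> * \<Psi> N \<alpha> \<beta> + \<eta>') * X + K"
    if ab: "\<alpha> \<in> S" "\<beta> \<in> S" "\<alpha> \<noteq> \<beta>" for \<alpha> \<beta>
  proof -
    have "\<alpha> > 0" "\<beta> > 0" using a1[OF ab(1)] a1[OF ab(2)] by auto
    obtain N0 where N0: "\<And>N. N \<ge> N0 \<Longrightarrow> \<exists>K. \<forall>X\<ge>0. pair_sum c (z \<alpha>) (z \<beta>) \<alpha> \<beta> X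
      \<le> (c\<^sup>2 * (mertens_prod (z \<alpha>) / \<alpha>) * (mertens_prod (z \<beta>) / \<beta>) * overlap_factor (9 / c1) \<eta> c y N \<alpha> \<beta> + \<eta>') * X + K"
      by (rule pair_sum_bound[OF \<open>\<alpha> > 0\<close> \<open>\<beta> > 0\<close> c(1) \<eta> \<eta>' y cy c1 zero[OF ab]]) blast+
    show ?thesis unfolding \<Psi>_def w_def weight_def by (rule exI[of _ N0]) (use N0 in blast)
  qed
  \<comment> \<open>The cut-off depends on the pair; as \<open>S\<close> is finite, one
    \<open>N\<close> serves all pairs.\<close>
  have "\<exists>N0. \<forall>x\<in>{(\<alpha>, \<beta>) \<in> S \<times> S. \<alpha> \<noteq> \<beta>}. \<forall>N\<ge>N0. \<exists>K. \<forall>X\<ge>0. pair_sum c (z (fst x)) (z (snd x)) (fst x) (snd x) X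
     \<le> (c\<^sup>2 * w (fst x) * w (snd x) * \<Psi> N (fst x) (snd x) + \<eta>') * X + K"
  proof -
    have "finite {(\<alpha>, \<beta>) \<in> S \<times> S. \<alpha> \<noteq> \<beta>}" by (rule finite_subset[of _ "S \<times> S"]) (use S in auto)
    moreover have "\<forall>x\<in>{(\<alpha>, \<beta>) \<in> S \<times> S. \<alpha> \<noteq> \<beta>}. \<exists>N0. \<forall>N\<ge>N0. \<exists>K. \<forall>X\<ge>0. pair_sum c (z (fst x)) (z (snd x)) (fst x) (snd x) X
     \<le> (c\<^sup>2 * w (fst x) * w (snd x) * \<Psi> N (fst x) (snd x) + \<eta>') * X + K"
      using ex1 by auto
    ultimately have "\<forall>\<^sub>F N in sequentially. \<forall>x\<in>{(\<alpha>, \<beta>) \<in> S \<times> S. \<alpha> \<noteq> \<beta>}. \<exists>K. \<forall>X\<ge>0. pair_sum c (z (fst x)) (z (snd x)) (fst x) (snd x) X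
     \<le> (c\<^sup>2 * w (fst x) * w (snd x) * \<Psi> N (fst x) (snd x) + \<eta>') * X + K"
      by (intro eventually_ball_finite) (auto simp: eventually_sequentially)
    then show ?thesis unfolding eventually_sequentially by blast
  qed
  then obtain N where N': "\<forall>x\<in>{(\<alpha>, \<beta>) \<in> S \<times> S. \<alpha> \<noteq> \<beta>}. \<exists>K. \<forall>X\<ge>0. pair_sum c (z (fst x)) (z (snd x)) (fst x) (snd x) X
     \<le> (c\<^sup>2 * w (fst x) * w (snd x) * \<Psi> N (fst x) (snd x) + \<eta>') * X + K" by blast
  have N: "\<exists>K. \<forall>X\<ge>0. pair_sum c (z \<alpha>) (z \<beta>) \<alpha> \<beta> X \<le> (c\<^sup>2 * w \<alpha> * w \<beta> * \<Psi> N \<alpha> \<beta> + \<eta>') * X + K"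
    if "\<alpha> \<in> S" "\<beta> \<in> S" "\<alpha> \<noteq> \<beta>" for \<alpha> \<beta>
    using bspec[OF N', of "(\<alpha>, \<beta>)"] that by simp
  \<comment> \<open>On the diagonal c w \<alpha> is the true coefficient; the off-diagonal
    expression is nonnegative and kept there too, so that all double sums run over the whole of S x
    S.\<close>
  define M where "M = (\<lambda>\<alpha> \<beta>. (if \<alpha> = \<beta> then c * w \<alpha> else 0) + (c\<^sup>2 * w \<alpha> * w \<beta> * \<Psi> N \<alpha> \<beta> + \<eta>'))"
  have Psi1: "\<Psi> N \<alpha> \<beta> \<ge> 0" for \<alpha> \<beta>
    using overlap_factor_ge[of "9 / c1" \<eta> y c N \<alpha> \<beta>] c1 \<eta> y by (simp add: \<Psi>_def)
  have "\<exists>K. \<forall>X\<ge>0. pair_sum c (z \<alpha>) (z \<beta>) \<alpha> \<beta> X \<le> M \<alpha> \<beta> * X + K" if ab: "\<alpha> \<in> S" "\<beta> \<in> S" for \<alpha> \<beta>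
  proof (cases "\<alpha> = \<beta>")
    case False
    then show ?thesis using N[OF ab False] by (simp add: M_def)
  next
    case True
    have ac: "c \<le> \<alpha>" "0 \<le> c" "\<alpha> > 0" using a1[OF ab(1)] c by auto
    obtain K where K: "\<And>X. X \<ge> 0 \<Longrightarrow> \<bar>real (card {n. n \<in> rough (z \<alpha>) \<and> real n * \<alpha> \<le> X}) - mertens_prod (z \<alpha>) / \<alpha> * X\<bar> \<le> K"
      using count_rough[OF ac(3)] by blast
    show ?thesis
    proof (rule exI[of _ "c * K"], intro allI impI)
      fix X :: real assume X: "X \<ge> 0"
      have "pair_sum c (z \<alpha>) (z \<beta>) \<alpha> \<beta> X = c * real (card {n. n \<in> rough (z \<alpha>) \<and> real n * \<alpha> \<le> X})"
        using pair_sum_diagonal[OF ac] True by simp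
      also have "\<dots> \<le> c * (w \<alpha> * X + K)"
      proof (rule mult_left_mono)
        show "real (card {n. n \<in> rough (z \<alpha>) \<and> real n * \<alpha> \<le> X}) \<le> w \<alpha> * X + K"
          using K[OF X] unfolding w_def weight_def by linarith
      qed (use c in simp)
      also have "\<dots> = c * w \<alpha> * X + c * K" by (simp add: algebra_simps)
      also have "\<dots> \<le> M \<alpha> \<beta> * X + c * K"
      proof -
        have "0 \<le> c\<^sup>2 * w \<alpha> * w \<beta> * \<Psi> N \<alpha> \<beta> + \<eta>'" using w0 ab Psi1 \<eta>' by simp
        then have "c * w \<alpha> \<le> M \<alpha> \<beta>" using True by (simp add: M_def)
        then show ?thesis using X by (intro add_right_mono mult_right_mono)
      qed
      finally show "pair_sum c (z \<alpha>) (z \<beta>) \<alpha> \<beta> X \<le> M \<alpha> \<beta> * X + c * K" .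
    qed
  qed
  then have "\<forall>x\<in>S \<times> S. \<exists>K. \<forall>X\<ge>0. pair_sum c (z (fst x)) (z (snd x)) (fst x) (snd x) X \<le> M (fst x) (snd x) * X + K" by auto
  from bchoice[OF this] obtain K' where K': "\<forall>x\<in>S \<times> S. \<forall>X\<ge>0. pair_sum c (z (fst x)) (z (snd x)) (fst x) (snd x) X \<le> M (fst x) (snd x) * X + K' x"
    by blast
  define K where "K = (\<lambda>\<alpha> \<beta>. K' (\<alpha>, \<beta>))"
  have K: "pair_sum c (z \<alpha>) (z \<beta>) \<alpha> \<beta> X \<le> M \<alpha> \<beta> * X + K \<alpha> \<beta>" if "\<alpha> \<in> S" "\<beta> \<in> S" "X \<ge> 0" for \<alpha> \<beta> X
    using bspec[OF K', of "(\<alpha>, \<beta>)"] that by (simp add: K_def)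
  have total: "(\<Sum>\<alpha>\<in>S. \<Sum>\<beta>\<in>S. M \<alpha> \<beta>) \<le> (c * \<mu>)\<^sup>2 * (1 + 18 * \<eta>)"
  proof -
    have ww: "(\<Sum>\<alpha>\<in>S. \<Sum>\<beta>\<in>S. w \<alpha> * w \<beta>) = \<mu>\<^sup>2" by (simp add: \<mu>(1) w_def power2_eq_square sum_product)
    have d: "(\<Sum>\<alpha>\<in>S. \<Sum>\<beta>\<in>S. if \<alpha> = \<beta> then c * w \<alpha> else 0) = c * \<mu>"
      using S(1) by (simp add: \<mu>(1) w_def sum_distrib_left)
    have e: "(\<Sum>\<alpha>\<in>S. \<Sum>\<beta>\<in>S. \<eta>') \<le> \<eta> * (c * \<mu>)\<^sup>2"
    proof -
      have "(\<Sum>\<alpha>\<in>S. \<Sum>\<beta>\<in>S. \<eta>') = \<eta>' * (real (card S))\<^sup>2" by (simp add: power2_eq_square)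
      also have "\<dots> \<le> \<eta>' * ((real (card S))\<^sup>2 + 1)" using \<eta>' by (intro mult_left_mono) auto
      also have "\<dots> = \<eta> * (c * \<mu>)\<^sup>2" unfolding \<eta>'_def by (simp add: add_nonneg_eq_0_iff)
      finally show ?thesis .
    qed
    define bd where "bd = (\<lambda>\<alpha> \<beta>. if band_pair c y \<alpha> \<beta> then w \<alpha> * w \<beta> else 0)"
    define bp where "bp = (\<lambda>H \<alpha> \<beta>. if bad_pair \<eta> H \<alpha> \<beta> then w \<alpha> * w \<beta> else 0)"
    have factor: "w \<alpha> * w \<beta> * \<Psi> N \<alpha> \<beta> = (1 + 14 * \<eta>) * (w \<alpha> * w \<beta>) + 9 / c1 * ln (real y) * bd \<alpha> \<beta>
        + (\<Sum>H\<in>{y..N}. 9 / c1 * ln (real (H + 1)) * bp H \<alpha> \<beta>)" for \<alpha> \<beta>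
    proof -
      have "(\<Sum>H\<in>{y..N}. 9 / c1 * ln (real (H + 1)) * bp H \<alpha> \<beta>)
          = w \<alpha> * w \<beta> * (\<Sum>H\<in>{y..N}. if bad_pair \<eta> H \<alpha> \<beta> then 9 / c1 * ln (real (H + 1)) else 0)"
        unfolding sum_distrib_left by (intro sum.cong refl) (simp add: bp_def)
      moreover have "9 / c1 * ln (real y) * bd \<alpha> \<beta> = w \<alpha> * w \<beta> * (if band_pair c y \<alpha> \<beta> then 9 / c1 * ln (real y) else 0)"
        by (simp add: bd_def)
      ultimately show ?thesis unfolding \<Psi>_def overlap_factor_def by (simp only: distrib_left mult.commute)
    qed
    have "(\<Sum>\<alpha>\<in>S. \<Sum>\<beta>\<in>S. w \<alpha> * w \<beta> * \<Psi> N \<alpha> \<beta>)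
      = (1 + 14 * \<eta>) * (\<Sum>\<alpha>\<in>S. \<Sum>\<beta>\<in>S. w \<alpha> * w \<beta>) + 9 / c1 * ln (real y) * (\<Sum>\<alpha>\<in>S. \<Sum>\<beta>\<in>S. bd \<alpha> \<beta>)
        + (\<Sum>\<alpha>\<in>S. \<Sum>\<beta>\<in>S. \<Sum>H\<in>{y..N}. 9 / c1 * ln (real (H + 1)) * bp H \<alpha> \<beta>)"
      unfolding factor sum.distrib sum_distrib_left ..
    also have "(\<Sum>\<alpha>\<in>S. \<Sum>\<beta>\<in>S. \<Sum>H\<in>{y..N}. 9 / c1 * ln (real (H + 1)) * bp H \<alpha> \<beta>)
      = (\<Sum>H\<in>{y..N}. 9 / c1 * ln (real (H + 1)) * (\<Sum>\<alpha>\<in>S. \<Sum>\<beta>\<in>S. bp H \<alpha> \<beta>))"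
    proof -
      have "(\<Sum>\<alpha>\<in>S. \<Sum>\<beta>\<in>S. \<Sum>H\<in>{y..N}. 9 / c1 * ln (real (H + 1)) * bp H \<alpha> \<beta>)
        = (\<Sum>\<alpha>\<in>S. \<Sum>H\<in>{y..N}. \<Sum>\<beta>\<in>S. 9 / c1 * ln (real (H + 1)) * bp H \<alpha> \<beta>)"
        by (intro sum.cong refl sum.swap)
      also have "\<dots> = (\<Sum>H\<in>{y..N}. \<Sum>\<alpha>\<in>S. \<Sum>\<beta>\<in>S. 9 / c1 * ln (real (H + 1)) * bp H \<alpha> \<beta>)" by (rule sum.swap)
      finally show ?thesis by (simp only: sum_distrib_left)
    qed
    finally have "(\<Sum>\<alpha>\<in>S. \<Sum>\<beta>\<in>S. w \<alpha> * w \<beta> * \<Psi> N \<alpha> \<beta>) \<le> (1 + 14 * \<eta>) * \<mu>\<^sup>2 + \<eta> * \<mu>\<^sup>2 + \<eta> * \<mu>\<^sup>2"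
      using bad[of N, folded w_def] band[folded w_def] unfolding ww bd_def bp_def by linarith
    then have "c\<^sup>2 * (\<Sum>\<alpha>\<in>S. \<Sum>\<beta>\<in>S. w \<alpha> * w \<beta> * \<Psi> N \<alpha> \<beta>) \<le> c\<^sup>2 * ((1 + 14 * \<eta>) * \<mu>\<^sup>2 + \<eta> * \<mu>\<^sup>2 + \<eta> * \<mu>\<^sup>2)"
      by (rule mult_left_mono) simp
    then have main: "c\<^sup>2 * (\<Sum>\<alpha>\<in>S. \<Sum>\<beta>\<in>S. w \<alpha> * w \<beta> * \<Psi> N \<alpha> \<beta>) \<le> (c * \<mu>)\<^sup>2 * (1 + 16 * \<eta>)"
      by (simp add: power_mult_distrib algebra_simps)
    have cm: "c * \<mu> \<le> \<eta> * (c * \<mu>)\<^sup>2"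
    proof -
      have "1 * (c * \<mu>) \<le> (\<eta> * (c * \<mu>)) * (c * \<mu>)" by (rule mult_right_mono[OF \<mu>(3)]) (use c \<mu> in simp)
      then show ?thesis by (simp add: power2_eq_square)
    qed
    have "(\<Sum>\<alpha>\<in>S. \<Sum>\<beta>\<in>S. M \<alpha> \<beta>) = c * \<mu> + (c\<^sup>2 * (\<Sum>\<alpha>\<in>S. \<Sum>\<beta>\<in>S. w \<alpha> * w \<beta> * \<Psi> N \<alpha> \<beta>) + (\<Sum>\<alpha>\<in>S. \<Sum>\<beta>\<in>S. \<eta>'))"
      unfolding M_def sum.distrib d sum_distrib_left by (simp only: mult.assoc)
    also have "\<dots> \<le> \<eta> * (c * \<mu>)\<^sup>2 + ((c * \<mu>)\<^sup>2 * (1 + 16 * \<eta>) + \<eta> * (c * \<mu>)\<^sup>2)"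
      using cm main e by (intro add_mono)
    also have "\<dots> = (c * \<mu>)\<^sup>2 * (1 + 18 * \<eta>)" by (simp add: algebra_simps)
    finally show ?thesis .
  qed
  show ?thesis
  proof (rule that[of "\<Sum>\<alpha>\<in>S. \<Sum>\<beta>\<in>S. K \<alpha> \<beta>"])
    fix X :: real assume X: "X \<ge> 0"
    have "(\<Sum>\<alpha>\<in>S. \<Sum>\<beta>\<in>S. pair_sum c (z \<alpha>) (z \<beta>) \<alpha> \<beta> X) \<le> (\<Sum>\<alpha>\<in>S. \<Sum>\<beta>\<in>S. M \<alpha> \<beta> * X + K \<alpha> \<beta>)"
      by (intro sum_mono K X)
    also have "\<dots> = (\<Sum>\<alpha>\<in>S. \<Sum>\<beta>\<in>S. M \<alpha> \<beta>) * X + (\<Sum>\<alpha>\<in>S. \<Sum>\<beta>\<in>S. K \<alpha> \<beta>)"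
      by (simp add: sum.distrib sum_distrib_right)
    also have "\<dots> \<le> (c * \<mu>)\<^sup>2 * (1 + 18 * \<eta>) * X + (\<Sum>\<alpha>\<in>S. \<Sum>\<beta>\<in>S. K \<alpha> \<beta>)"
      by (intro add_right_mono mult_right_mono total X)
    finally show "(\<Sum>\<alpha>\<in>S. \<Sum>\<beta>\<in>S. pair_sum c (z \<alpha>) (z \<beta>) \<alpha> \<beta> X) \<le> (c * \<mu>)\<^sup>2 * (1 + 18 * \<eta>) * X + (\<Sum>\<alpha>\<in>S. \<Sum>\<beta>\<in>S. K \<alpha> \<beta>)" .
  qed
qed

section \<open>Choice of the scale and conclusion\<close>

text \<open>The unit q of a pair is unique and the bands between c (k + 1) and c k are disjoint, so
  a pair lies in at most one of them and the masses of all bands add up to at most the square of the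
  total weight. As the shares a k add up to more than 1, some band stays within its share.\<close>

lemma sparse_band:
  fixes c a :: "nat \<Rightarrow> real" and y :: "nat \<Rightarrow> nat" and w :: "real \<Rightarrow> real"
  assumes S: "finite S" and w: "\<And>\<alpha>. \<alpha> \<in> S \<Longrightarrow> w \<alpha> \<ge> 0" "(\<Sum>\<alpha>\<in>S. w \<alpha>) > 0"
    and c: "\<And>k. c k > 0" "\<And>k. c (Suc k) = c k / 64 ^ y k" and a: "(\<Sum>k<K. a k) > 1"
  obtains k where "k < K" "(\<Sum>\<alpha>\<in>S. \<Sum>\<beta>\<in>S. if band_pair (c k) (y k) \<alpha> \<beta> then w \<alpha> * w \<beta> else 0) \<le> a k * (\<Sum>\<alpha>\<in>S. w \<alpha>)\<^sup>2"
proof (rule ccontr)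
  note result = that
  assume neg: "\<not> thesis"
  define b where "b = (\<lambda>k. \<Sum>\<alpha>\<in>S. \<Sum>\<beta>\<in>S. if band_pair (c k) (y k) \<alpha> \<beta> then w \<alpha> * w \<beta> else 0)"
  define \<mu> where "\<mu> = (\<Sum>\<alpha>\<in>S. w \<alpha>)"
  have gt: "a k * \<mu>\<^sup>2 \<le> b k" if "k < K" for k
    using neg result[OF that] unfolding b_def \<mu>_def by linarith
  have "1 * \<mu>\<^sup>2 < (\<Sum>k<K. a k) * \<mu>\<^sup>2" using a w(2) by (intro mult_strict_right_mono) (auto simp: \<mu>_def)
  also have "\<dots> \<le> (\<Sum>k<K. b k)" unfolding sum_distrib_right by (intro sum_mono gt) auto
  also have "\<dots> = (\<Sum>\<alpha>\<in>S. \<Sum>k<K. \<Sum>\<beta>\<in>S. if band_pair (c k) (y k) \<alpha> \<beta> then w \<alpha> * w \<beta> else 0)"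
    unfolding b_def by (rule sum.swap)
  also have "\<dots> = (\<Sum>\<alpha>\<in>S. \<Sum>\<beta>\<in>S. \<Sum>k<K. if band_pair (c k) (y k) \<alpha> \<beta> then w \<alpha> * w \<beta> else 0)"
    by (intro sum.cong refl sum.swap)
  also have "\<dots> \<le> (\<Sum>\<alpha>\<in>S. \<Sum>\<beta>\<in>S. w \<alpha> * w \<beta>)"
  proof (intro sum_mono)
    fix \<alpha> \<beta> assume "\<alpha> \<in> S" "\<beta> \<in> S"
    then have w0: "w \<alpha> * w \<beta> \<ge> 0" using w by simp
    have anti: "c l \<le> c k" if "k \<le> l" for k l
      using that
    proof (induction l rule: dec_induct)
      case (step l)
      have "c l / 64 ^ y l \<le> c l / 1" using c(1)[of l] by (intro divide_left_mono) auto
      then show ?case using step c(2)[of l] by simp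
    qed simp
    have uniq: False if kl: "k < l" "band_pair (c k) (y k) \<alpha> \<beta>" "band_pair (c l) (y l) \<alpha> \<beta>" for k l
    proof -
      obtain q a b where q: "ratio_rep \<alpha> \<beta> q a b" "c k / 64 ^ y k < q" using kl by (auto simp: band_pair_def)
      obtain q' a' b' where q': "ratio_rep \<alpha> \<beta> q' a' b'" "q' < c l" using kl by (auto simp: band_pair_def)
      have "c l \<le> c (Suc k)" using kl by (intro anti) auto
      then show False using q q' c(2)[of k] ratio_rep_unique(1)[OF q(1) q'(1)] by simp
    qed
    have "card {k \<in> {..<K}. band_pair (c k) (y k) \<alpha> \<beta>} \<le> Suc 0"
    proof (subst card_le_Suc0_iff_eq)
      have "k = l" if "band_pair (c k) (y k) \<alpha> \<beta>" "band_pair (c l) (y l) \<alpha> \<beta>" for k l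
        using uniq[of k l] uniq[of l k] that by (meson nat_neq_iff)
      then show "\<forall>k\<in>{k \<in> {..<K}. band_pair (c k) (y k) \<alpha> \<beta>}. \<forall>l\<in>{k \<in> {..<K}. band_pair (c k) (y k) \<alpha> \<beta>}. k = l" by blast
    qed simp
    then have "real (card {k \<in> {..<K}. band_pair (c k) (y k) \<alpha> \<beta>}) * (w \<alpha> * w \<beta>) \<le> 1 * (w \<alpha> * w \<beta>)"
      using w0 by (intro mult_right_mono) auto
    moreover have "(\<Sum>k<K. if band_pair (c k) (y k) \<alpha> \<beta> then w \<alpha> * w \<beta> else 0)
      = real (card {k \<in> {..<K}. band_pair (c k) (y k) \<alpha> \<beta>}) * (w \<alpha> * w \<beta>)"
      by (simp flip: sum.inter_filter)
    ultimately show "(\<Sum>k<K. if band_pair (c k) (y k) \<alpha> \<beta> then w \<alpha> * w \<beta> else 0) \<le> w \<alpha> * w \<beta>" by simp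
  qed
  also have "\<dots> = \<mu>\<^sup>2" by (simp add: \<mu>_def power2_eq_square sum_product)
  finally show False by simp
qed

text \<open>ln (H + 1) <= H <= 2 exp (H / 2) makes the series dominated by a geometric one.\<close>

lemma exp_tail_bound:
  fixes D \<eta> :: real
  assumes "D \<ge> 0" "\<eta> > 0"
  obtains n where "\<And>m N. m \<ge> n \<Longrightarrow> (\<Sum>H\<in>{m..N}. D * ln (real (H + 1)) * exp (- real H)) \<le> \<eta>"
proof -
  define g where "g = (\<lambda>H. 2 * D * exp (- 1 / 2 :: real) ^ H)"
  have "summable g" unfolding g_def by (intro summable_mult summable_geometric) simp
  then have "\<forall>\<^sub>F m in sequentially. \<forall>N. norm (sum g {m..<N}) < \<eta>"
    unfolding summable_Cauchy using assms(2) by (auto simp: eventually_sequentially)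
  then obtain n where n: "\<And>m N. m \<ge> n \<Longrightarrow> norm (sum g {m..<N}) < \<eta>"
    by (auto simp: eventually_sequentially)
  show ?thesis
  proof (rule that[of n])
    fix m N assume m: "m \<ge> n"
    have "(\<Sum>H\<in>{m..N}. D * ln (real (H + 1)) * exp (- real H)) \<le> (\<Sum>H\<in>{m..N}. g H)"
    proof (rule sum_mono)
      fix H :: nat
      have e: "exp (real H / 2) * exp (real H / 2) = exp (real H)" by (simp flip: exp_add)
      have "ln (real (H + 1)) \<le> real H" using ln_add_one_self_le_self[of "real H"] by (simp add: add.commute)
      also have "\<dots> \<le> 2 * exp (real H / 2)" using exp_ge_add_one_self[of "real H / 2"] by linarith
      finally have "D * ln (real (H + 1)) * exp (- real H) \<le> D * (2 * exp (real H / 2)) * exp (- real H)"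
        using assms(1) by (intro mult_right_mono mult_left_mono) auto
      also have "\<dots> = 2 * D * exp (- (real H / 2))" by (simp add: exp_minus field_simps flip: e)
      also have "\<dots> = g H" by (simp add: g_def flip: exp_of_nat_mult)
      finally show "D * ln (real (H + 1)) * exp (- real H) \<le> g H" .
    qed
    also have "\<dots> = sum g {m..<Suc N}" by (simp add: atLeastLessThanSuc_atLeastAtMost)
    also have "\<dots> \<le> \<eta>" using n[OF m, of "Suc N"] by simp
    finally show "(\<Sum>H\<in>{m..N}. D * ln (real (H + 1)) * exp (- real H)) \<le> \<eta>" .
  qed
qed

text \<open>The order of choices matters: \<eta>, then \<open>y0\<close>, then the number
  \<open>K\<close> of scales, then \<open>S\<close> with the smallest scale c K in view, and only
  then the scale k < K with few band pairs in this \<open>S\<close>. The properties of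
  \<open>S\<close> obtained for c K persist for the larger c k.\<close>

lemma separated_contradiction:
  fixes A :: "real set" and \<delta> :: real
  assumes sep: "\<And>\<alpha> \<beta> n. \<alpha> \<in> A \<Longrightarrow> \<beta> \<in> A \<Longrightarrow> \<alpha> \<noteq> \<beta> \<Longrightarrow> n > 0 \<Longrightarrow> \<bar>real n * \<alpha> - \<beta>\<bar> \<ge> 1"
    and fin: "\<And>x. finite (A \<inter> {..x})" and \<delta>: "0 < \<delta>" "\<delta> \<le> 1"
    and dens: "\<And>x0. \<exists>x\<ge>x0. \<delta> * ln x \<le> (\<Sum>a\<in>A \<inter> {1..x}. 1 / a)"
  shows False
proof -
  \<comment> \<open>The counting bound will have slope 18 \<eta> = \<delta> / 4, strictly below the
    logarithmic density \<delta>.\<close>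
  define \<eta> where "\<eta> = \<delta> / 72"
  have \<eta>: "0 < \<eta>" "\<eta> \<le> 1 / 3" using \<delta> by (auto simp: \<eta>_def)
  obtain c1 where c1: "c1 > 0" "\<And>n. n \<ge> 2 \<Longrightarrow> mertens_prod n \<ge> c1 / ln (real n)"
    using mertens_prod_ge by blast
  obtain H0 where H0: "\<And>H A B x x'. H \<ge> H0 \<Longrightarrow> finite A \<Longrightarrow> finite B \<Longrightarrow>
      A \<subseteq> {1..x} \<Longrightarrow> B \<subseteq> {1..x'} \<Longrightarrow> 1 \<le> x \<Longrightarrow> 1 \<le> x' \<Longrightarrow>
      (\<And>u v. u \<in> A \<Longrightarrow> v \<in> A \<Longrightarrow> u \<noteq> v \<Longrightarrow> \<bar>u - v\<bar> \<ge> 1) \<Longrightarrow> (\<And>u v. u \<in> B \<Longrightarrow> v \<in> B \<Longrightarrow> u \<noteq> v \<Longrightarrow> \<bar>u - v\<bar> \<ge> 1) \<Longrightarrow>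
      (\<Sum>(\<alpha>, \<beta>)\<in>{(\<alpha>, \<beta>) \<in> A \<times> B. bad_pair \<eta> H \<alpha> \<beta>}. 1 / (\<alpha> * \<beta>)) \<le> 2 * exp (- real H) * ((1 + log 2 x) * (1 + log 2 x'))"
    by (rule bad_pairs_log_sum[OF \<eta>(1)]) blast
  define D where "D = 9 / c1 * (72 / \<delta>\<^sup>2)"
  have "D \<ge> 0" using c1 by (simp add: D_def)
  then obtain n0 where n0: "\<And>m N. m \<ge> n0 \<Longrightarrow> (\<Sum>H\<in>{m..N}. D * ln (real (H + 1)) * exp (- real H)) \<le> \<eta>"
    using exp_tail_bound[OF _ \<eta>(1)] by blast
  obtain y0 :: nat where y0: "y0 \<ge> 2" "y0 \<ge> H0" "y0 \<ge> n0" "4 * ln 64 \<le> \<eta> * ln (real y0)" "2 / 16 ^ y0 \<le> \<eta>"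
  proof -
    have "eventually (\<lambda>y::nat. 4 * ln 64 \<le> \<eta> * ln (real y)) sequentially" using \<eta> by real_asymp
    moreover have "eventually (\<lambda>y::nat. 2 / 16 ^ y \<le> \<eta>) sequentially" using \<eta> by real_asymp
    moreover have "eventually (\<lambda>y::nat. y \<ge> 2 \<and> y \<ge> H0 \<and> y \<ge> n0) sequentially"
      using eventually_ge_at_top[of 2] eventually_ge_at_top[of H0] eventually_ge_at_top[of n0] by eventually_elim simp
    ultimately have "eventually (\<lambda>y::nat. 4 * ln 64 \<le> \<eta> * ln (real y) \<and> 2 / 16 ^ y \<le> \<eta> \<and> (y \<ge> 2 \<and> y \<ge> H0 \<and> y \<ge> n0)) sequentially"
      by eventually_elim simp
    then obtain y where "4 * ln 64 \<le> \<eta> * ln (real y) \<and> 2 / 16 ^ y \<le> \<eta> \<and> (y \<ge> 2 \<and> y \<ge> H0 \<and> y \<ge> n0)"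
      using eventually_happens'[OF sequentially_bot] by blast
    then show ?thesis using that by blast
  qed
  \<comment> \<open>Doubling meets two demands: the exponents spent before scale k add up to (2^k -
    1) y0 < y k, which gives 64^(- y k) <= c k, and ln (y k) still grows only linearly in k, so that
    the sum of its reciprocals diverges.\<close>
  define y where "y = (\<lambda>k::nat. 2 ^ k * y0)"
  define c where "c = (\<lambda>k::nat. 1 / (2 * 64 ^ ((2 ^ k - 1) * y0)) :: real)"
  have c0: "c k > 0" "c k \<le> 1 / 2" for k by (auto simp: c_def field_simps)
  have y_ge: "y0 \<le> y k" for k by (simp add: y_def)
  have y_eq: "(2 ^ Suc k - 1) * y0 = (2 ^ k - 1) * y0 + y k" for k
  proof -
    have "(2 ^ Suc k - 1 :: nat) = (2 ^ k - 1) + 2 ^ k" by simp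
    then show ?thesis by (simp only: y_def distrib_right)
  qed
  have cSuc: "c (Suc k) = c k / 64 ^ y k" for k
    unfolding c_def y_eq by (simp add: power_add)
  have anti: "c l \<le> c k" if "k \<le> l" for k l
    using that
  proof (induction l rule: dec_induct)
    case (step l)
    have "c l / 64 ^ y l \<le> c l / 1" using c0(1)[of l] by (intro divide_left_mono) auto
    then show ?case using step cSuc[of l] by simp
  qed simp
  have cy: "1 / 64 ^ y k \<le> c k" for k
  proof -
    have "y k = (2 ^ k - 1) * y0 + y0" by (simp add: y_def diff_mult_distrib)
    moreover have "(2::real) \<le> 64 ^ y0" using power_increasing[of 1 y0 "64::real"] y0(1) by simp
    ultimately have "2 * 64 ^ ((2 ^ k - 1) * y0) \<le> (64::real) ^ y k" by (simp add: power_add mult.commute)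
    then show ?thesis unfolding c_def by (intro divide_left_mono) auto
  qed
  have lny: "ln (real (y k)) = real k * ln 2 + ln (real y0)" for k
    using y0(1) by (simp add: y_def ln_mult ln_realpow)
  obtain K where K: "(\<Sum>k<K. 1 / (real k * ln 2 + ln (real y0))) > 9 / (c1 * \<eta>)"
    by (rule harmonic_type_diverges[of "ln 2" "ln (real y0)" "9 / (c1 * \<eta>)"]) (use y0 in auto)
  \<comment> \<open>The tolerable share of band pairs at scale k: the cost 9 / c1 * ln (y k) times a
    k is exactly \<eta>.\<close>
  define a where "a = (\<lambda>k. \<eta> * c1 / (9 * ln (real (y k))))"
  have a: "(\<Sum>k<K. a k) > 1"
  proof -
    have "1 = \<eta> * c1 / 9 * (9 / (c1 * \<eta>))" using \<eta> c1 by simp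
    also have "\<dots> < \<eta> * c1 / 9 * (\<Sum>k<K. 1 / (real k * ln 2 + ln (real y0)))"
      using K \<eta> c1 by (intro mult_strict_left_mono) auto
    also have "\<dots> = (\<Sum>k<K. a k)" by (simp add: sum_distrib_left a_def lny)
    finally show ?thesis .
  qed
  obtain S z where S: "finite S" "S \<subseteq> A" "S \<subseteq> {1..}" and big: "(\<Sum>\<alpha>\<in>S. weight z \<alpha>) \<ge> 1 / (\<eta> * c K)"
    and zero: "\<And>\<alpha> \<beta> q a b. \<alpha> \<in> S \<Longrightarrow> \<beta> \<in> S \<Longrightarrow> \<alpha> \<noteq> \<beta> \<Longrightarrow> ratio_rep \<alpha> \<beta> q a b \<Longrightarrow>
        (\<exists>p. prime p \<and> (p \<le> z \<alpha> \<and> p dvd b \<or> p \<le> z \<beta> \<and> p dvd a)) \<or> q \<le> \<eta> * c K * (mertens_prod (z \<alpha>) * mertens_prod (z \<beta>))"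
    and bad: "\<And>H. H \<ge> H0 \<Longrightarrow> (\<Sum>\<alpha>\<in>S. \<Sum>\<beta>\<in>S. if bad_pair \<eta> H \<alpha> \<beta> then weight z \<alpha> * weight z \<beta> else 0)
        \<le> 72 / \<delta>\<^sup>2 * exp (- real H) * (\<Sum>\<alpha>\<in>S. weight z \<alpha>)\<^sup>2"
    by (rule selection[OF sep fin \<delta>(1) dens c1 \<eta>(1) c0(1)[of K] H0, where M = "1 / (\<eta> * c K)"]) (assumption | blast)+
  define \<mu> where "\<mu> = (\<Sum>\<alpha>\<in>S. weight z \<alpha>)"
  have "0 < 1 / (\<eta> * c K)" using \<eta> c0 by simp
  then have \<mu>0: "\<mu> > 0" using big unfolding \<mu>_def by linarith
  have w0: "weight z \<alpha> \<ge> 0" if "\<alpha> \<in> S" for \<alpha>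
    using that S(3) mertens_prod_pos[of "z \<alpha>"] by (auto simp: weight_def intro!: divide_nonneg_nonneg less_imp_le)
  obtain k where k: "k < K" and bandk: "(\<Sum>\<alpha>\<in>S. \<Sum>\<beta>\<in>S. if band_pair (c k) (y k) \<alpha> \<beta> then weight z \<alpha> * weight z \<beta> else 0) \<le> a k * \<mu>\<^sup>2"
    by (rule sparse_band[where w = "weight z" and c = c and y = y and a = a, OF S(1) w0 \<mu>0[unfolded \<mu>_def] c0(1) cSuc a]) (auto simp: \<mu>_def)
  have ck: "c K \<le> c k" using k by (intro anti) simp
  have yk: "y k \<ge> 2" "y k \<ge> H0" "y k \<ge> n0" using y_ge[of k] y0 by auto
  have yk2: "4 * ln 64 \<le> \<eta> * ln (real (y k))" "2 / 16 ^ y k \<le> \<eta>"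
  proof -
    have "ln (real y0) \<le> ln (real (y k))" using y_ge[of k] y0 by (intro ln_mono) auto
    then have "\<eta> * ln (real y0) \<le> \<eta> * ln (real (y k))" using \<eta> by (intro mult_left_mono) auto
    then show "4 * ln 64 \<le> \<eta> * ln (real (y k))" using y0(4) by linarith
    have "2 / 16 ^ y k \<le> 2 / (16::real) ^ y0"
      using y_ge[of k] by (intro divide_left_mono power_increasing) auto
    then show "2 / 16 ^ y k \<le> \<eta>" using y0(5) by linarith
  qed
  have lnk: "ln (real (y k)) > 0" using yk(1) by simp
  have mu1: "1 \<le> \<eta> * (c k * \<mu>)"
  proof -
    have "1 = \<eta> * (c K * (1 / (\<eta> * c K)))" using \<eta> c0(1)[of K] by simp
    also have "\<dots> \<le> \<eta> * (c k * \<mu>)"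
      using \<eta> c0(1)[of k] c0(1)[of K] ck big by (intro mult_left_mono mult_mono) (auto simp: \<mu>_def)
    finally show ?thesis .
  qed
  have zero': "(\<exists>p. prime p \<and> (p \<le> z \<alpha> \<and> p dvd b \<or> p \<le> z \<beta> \<and> p dvd a)) \<or> q \<le> \<eta> * c k * (mertens_prod (z \<alpha>) * mertens_prod (z \<beta>))"
    if ab: "\<alpha> \<in> S" "\<beta> \<in> S" "\<alpha> \<noteq> \<beta>" "ratio_rep \<alpha> \<beta> q a b" for \<alpha> \<beta> q a b
  proof -
    have "\<eta> * c K * (mertens_prod (z \<alpha>) * mertens_prod (z \<beta>)) \<le> \<eta> * c k * (mertens_prod (z \<alpha>) * mertens_prod (z \<beta>))"
      using \<eta> ck mertens_prod_pos[of "z \<alpha>"] mertens_prod_pos[of "z \<beta>"] by (intro mult_right_mono mult_left_mono) auto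
    then show ?thesis using zero[OF ab] by (meson order_trans)
  qed
  have bad': "(\<Sum>H\<in>{y k..N}. 9 / c1 * ln (real (H + 1)) * (\<Sum>\<alpha>\<in>S. \<Sum>\<beta>\<in>S. if bad_pair \<eta> H \<alpha> \<beta> then weight z \<alpha> * weight z \<beta> else 0)) \<le> \<eta> * \<mu>\<^sup>2" for N
  proof -
    have "(\<Sum>H\<in>{y k..N}. 9 / c1 * ln (real (H + 1)) * (\<Sum>\<alpha>\<in>S. \<Sum>\<beta>\<in>S. if bad_pair \<eta> H \<alpha> \<beta> then weight z \<alpha> * weight z \<beta> else 0))
      \<le> (\<Sum>H\<in>{y k..N}. 9 / c1 * ln (real (H + 1)) * (72 / \<delta>\<^sup>2 * exp (- real H) * \<mu>\<^sup>2))"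
      unfolding \<mu>_def by (intro sum_mono mult_left_mono bad) (use yk c1 in auto)
    also have "\<dots> = (\<Sum>H\<in>{y k..N}. D * ln (real (H + 1)) * exp (- real H)) * \<mu>\<^sup>2"
      unfolding sum_distrib_right by (intro sum.cong refl) (simp add: D_def)
    also have "\<dots> \<le> \<eta> * \<mu>\<^sup>2" by (intro mult_right_mono n0 yk) simp
    finally show ?thesis .
  qed
  have band': "9 / c1 * ln (real (y k)) * (\<Sum>\<alpha>\<in>S. \<Sum>\<beta>\<in>S. if band_pair (c k) (y k) \<alpha> \<beta> then weight z \<alpha> * weight z \<beta> else 0) \<le> \<eta> * \<mu>\<^sup>2"
  proof -
    have "9 / c1 * ln (real (y k)) * (\<Sum>\<alpha>\<in>S. \<Sum>\<beta>\<in>S. if band_pair (c k) (y k) \<alpha> \<beta> then weight z \<alpha> * weight z \<beta> else 0)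
      \<le> 9 / c1 * ln (real (y k)) * (a k * \<mu>\<^sup>2)"
      by (intro mult_left_mono bandk) (use c1 lnk in auto)
    also have "\<dots> = \<eta> * \<mu>\<^sup>2" using c1 lnk by (simp add: a_def)
    finally show ?thesis .
  qed
  obtain K1 where K1: "\<And>X. X \<ge> 0 \<Longrightarrow> (\<Sum>\<alpha>\<in>S. \<Sum>\<beta>\<in>S. pair_sum (c k) (z \<alpha>) (z \<beta>) \<alpha> \<beta> X) \<le> (c k * \<mu>)\<^sup>2 * (1 + 18 * \<eta>) * X + K1"
    by (rule overlap_sum_bound[OF S(1,3) c0(1)[of k] c0(2)[of k] \<eta> yk(1) yk2 cy[of k] c1 \<mu>_def \<mu>0 mu1 zero' bad' band']) (assumption | blast)+
  obtain K2 where K2: "K2 \<ge> 0" "\<And>X. X \<ge> 1 \<Longrightarrow> real (card ((A - S) \<inter> {1..X})) \<le> 18 * \<eta> * X + K2"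
    by (rule count_bound_of_overlaps[OF sep fin S c0(1)[of k] c0(2)[of k] \<mu>_def \<mu>0 K1]) (assumption | blast)+
  define s where "s = (\<Sum>a\<in>S. 1 / a)"
  have upper: "(\<Sum>a\<in>A \<inter> {1..x}. 1 / a) \<le> s + (18 * \<eta> * ln x + (2 * (18 * \<eta>) + K2))" if x: "x \<ge> 1" for x
  proof -
    have fA: "finite (A \<inter> {1..u})" for u by (rule finite_subset[OF _ fin[of u]]) auto
    have fAS: "finite ((A - S) \<inter> {1..u})" for u by (rule finite_subset[OF _ fA[of u]]) auto
    have "(\<Sum>a\<in>A \<inter> {1..x}. 1 / a) \<le> (\<Sum>a\<in>S \<union> ((A - S) \<inter> {1..x}). 1 / a)"
    proof (rule sum_mono2)
      fix b assume "b \<in> S \<union> ((A - S) \<inter> {1..x}) - A \<inter> {1..x}"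
      then have "b \<in> S" by auto
      then show "0 \<le> 1 / b" using S(3) by auto
    qed (use S(1) fAS in auto)
    also have "\<dots> = s + (\<Sum>a\<in>(A - S) \<inter> {1..x}. 1 / a)"
      unfolding s_def by (rule sum.union_disjoint) (use S(1) fAS in auto)
    also have "(\<Sum>a\<in>(A - S) \<inter> {1..x}. 1 / a) \<le> 18 * \<eta> * ln x + (2 * (18 * \<eta>) + K2)"
      by (rule sum_reciprocals_le[OF fAS K2(2)]) (use K2 \<eta> x in auto)
    finally show ?thesis by simp
  qed
  define x0 where "x0 = max 1 (exp ((s + (2 * (18 * \<eta>) + K2) + 1) / (\<delta> / 2)))"
  obtain x where x: "x \<ge> x0" "\<delta> * ln x \<le> (\<Sum>a\<in>A \<inter> {1..x}. 1 / a)" using dens by blast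
  have x1: "x \<ge> 1" "x \<ge> exp ((s + (2 * (18 * \<eta>) + K2) + 1) / (\<delta> / 2))" using x by (auto simp: x0_def)
  have "ln x \<ge> (s + (2 * (18 * \<eta>) + K2) + 1) / (\<delta> / 2)" using x1 by (simp add: ln_ge_iff)
  then have "s + (2 * (18 * \<eta>) + K2) + 1 \<le> \<delta> / 2 * ln x" using \<delta> by (simp add: field_simps)
  moreover have "18 * \<eta> * ln x \<le> \<delta> / 2 * ln x" using x1(1) \<delta> by (intro mult_right_mono) (auto simp: \<eta>_def)
  moreover have "\<delta> / 2 * ln x + \<delta> / 2 * ln x = \<delta> * ln x" by simp
  ultimately show False using upper[OF x1(1)] x(2) by linarith
qed

theorem theorem1:
  fixes A :: "real set"
  assumes pos: "A \<subseteq> {0<..}"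
    and discrete: "\<forall>x::real. \<not> x islimpt A"
    and dens: "Limsup at_top (\<lambda>x::real. ereal ((1 / ln x) * (\<Sum>a\<in>A \<inter> {1..x}. 1 / a))) > 0"
  shows "\<forall>\<epsilon>>0. \<exists>\<alpha>\<in>A. \<exists>\<beta>\<in>A. \<alpha> \<noteq> \<beta> \<and> (\<exists>n::nat. n > 0 \<and> \<bar>real n * \<alpha> - \<beta>\<bar> < \<epsilon>)"
proof (rule ccontr)
  assume "\<not> (\<forall>\<epsilon>>0. \<exists>\<alpha>\<in>A. \<exists>\<beta>\<in>A. \<alpha> \<noteq> \<beta> \<and> (\<exists>n::nat. n > 0 \<and> \<bar>real n * \<alpha> - \<beta>\<bar> < \<epsilon>))"
  then obtain \<epsilon>' where \<epsilon>': "\<epsilon>' > 0" "\<And>\<alpha> \<beta> n. \<alpha> \<in> A \<Longrightarrow> \<beta> \<in> A \<Longrightarrow> \<alpha> \<noteq> \<beta> \<Longrightarrow> n > 0 \<Longrightarrow> \<epsilon>' \<le> \<bar>real n * \<alpha> - \<beta>\<bar>"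
    by (meson not_le)
  \<comment> \<open>With \<epsilon> <= 1 dividing by \<epsilon> moves points outwards, so that
    elements of A in [1, x] land in [1, x / \<epsilon>].\<close>
  define \<epsilon> where "\<epsilon> = min 1 \<epsilon>'"
  have \<epsilon>: "0 < \<epsilon>" "\<epsilon> \<le> 1" "\<And>\<alpha> \<beta> n. \<alpha> \<in> A \<Longrightarrow> \<beta> \<in> A \<Longrightarrow> \<alpha> \<noteq> \<beta> \<Longrightarrow> n > 0 \<Longrightarrow> \<epsilon> \<le> \<bar>real n * \<alpha> - \<beta>\<bar>"
    using \<epsilon>' by (auto simp: \<epsilon>_def min_le_iff_disj)
  have fin: "finite (A \<inter> {..x})" for x
  proof (rule ccontr)
    assume inf: "infinite (A \<inter> {..x})"
    have "bounded (A \<inter> {..x})" by (rule bounded_subset[of "{0..x}"]) (use pos in auto)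
    then obtain l where "l islimpt (A \<inter> {..x})" using bounded_infinite_imp_islimpt[OF _ _ inf] by blast
    then show False using discrete islimpt_subset by blast
  qed
  obtain \<delta>' where \<delta>': "\<delta>' > 0" "\<And>x0. \<exists>x\<ge>x0. \<delta>' * ln x \<le> (\<Sum>a\<in>A \<inter> {1..x}. 1 / a)"
  proof -
    define f where "f = (\<lambda>x::real. (1 / ln x) * (\<Sum>a\<in>A \<inter> {1..x}. 1 / a))"
    obtain r where r: "0 < ereal r" "ereal r < Limsup at_top (\<lambda>x. ereal (f x))"
      using ereal_dense2[OF dens] unfolding f_def by blast
    show ?thesis
    proof (rule that[of r])
      show "r > 0" using r by simp
      fix x0 :: real
      have "\<not> (\<forall>x\<ge>max x0 2. f x \<le> r)"
      proof
        assume "\<forall>x\<ge>max x0 2. f x \<le> r"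
        then have "Limsup at_top (\<lambda>x. ereal (f x)) \<le> ereal r"
          by (intro Limsup_bounded) (auto simp: eventually_at_top_linorder intro!: exI[of _ "max x0 2"])
        then show False using r by simp
      qed
      then obtain x where x: "x \<ge> x0" "x \<ge> 2" "r < f x" by (auto simp: not_le)
      then have "r * ln x \<le> f x * ln x" by (intro mult_right_mono) auto
      also have "\<dots> = (\<Sum>a\<in>A \<inter> {1..x}. 1 / a)" using x by (simp add: f_def)
      finally show "\<exists>x\<ge>x0. r * ln x \<le> (\<Sum>a\<in>A \<inter> {1..x}. 1 / a)" using x by blast
    qed
  qed
  define A' where "A' = (\<lambda>a. a / \<epsilon>) ` A"
  \<comment> \<open>Dividing the set by \<epsilon> multiplies the reciprocals by \<epsilon>, and ln
    (x / \<epsilon>) <= 2 ln x once x >= 1 / \<epsilon>; hence \<epsilon> \<delta>' / 2.\<close>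
  define \<delta> where "\<delta> = min 1 (\<epsilon> * \<delta>' / 2)"
  have \<delta>: "0 < \<delta>" "\<delta> \<le> 1" "\<delta> \<le> \<epsilon> * \<delta>' / 2" using \<epsilon> \<delta>' by (auto simp: \<delta>_def)
  have inj: "inj_on (\<lambda>a. a / \<epsilon>) B" for B using \<epsilon> by (auto intro!: inj_onI)
  have A'x: "A' \<inter> {..x} = (\<lambda>a. a / \<epsilon>) ` (A \<inter> {..\<epsilon> * x})" for x
    using \<epsilon> by (auto simp: A'_def field_simps)
  show False
  proof (rule separated_contradiction[of A' \<delta>])
    show "finite (A' \<inter> {..x})" for x unfolding A'x by (intro finite_imageI fin)
    fix u v :: real and n :: nat assume uv: "u \<in> A'" "v \<in> A'" "u \<noteq> v" "n > 0"
    then obtain \<alpha> \<beta> where ab: "\<alpha> \<in> A" "\<beta> \<in> A" "u = \<alpha> / \<epsilon>" "v = \<beta> / \<epsilon>" by (auto simp: A'_def)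
    have "\<epsilon> / \<epsilon> \<le> \<bar>real n * \<alpha> - \<beta>\<bar> / \<epsilon>" using \<epsilon>(3)[of \<alpha> \<beta> n] ab uv \<epsilon>(1) by (intro divide_right_mono) auto
    also have "\<dots> = \<bar>real n * u - v\<bar>" using \<epsilon>(1) by (simp add: ab flip: diff_divide_distrib)
    finally show "\<bar>real n * u - v\<bar> \<ge> 1" using \<epsilon>(1) by simp
  next
    fix x0 :: real
    obtain x where x: "x \<ge> max (max x0 1) (1 / \<epsilon>)" "\<delta>' * ln x \<le> (\<Sum>a\<in>A \<inter> {1..x}. 1 / a)"
      using \<delta>'(2) by blast
    have x1: "x \<ge> 1" "x \<ge> x0" "x \<ge> 1 / \<epsilon>" using x by auto
    show "\<exists>x\<ge>x0. \<delta> * ln x \<le> (\<Sum>a\<in>A' \<inter> {1..x}. 1 / a)"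
    proof (rule exI[of _ "x / \<epsilon>"], intro conjI)
      have "x * \<epsilon> \<le> x" using \<epsilon> x1 by (simp add: mult_le_cancel_left1)
      then have "x \<le> x / \<epsilon>" using \<epsilon> by (simp add: pos_le_divide_eq)
      then show "x0 \<le> x / \<epsilon>" using x1 by linarith
      have "0 < 1 / \<epsilon>" using \<epsilon> by simp
      have "x / \<epsilon> \<le> x * x" using mult_left_mono[OF x1(3), of x] x1 by simp
      then have "ln (x / \<epsilon>) \<le> ln (x * x)" using x1 \<epsilon> by (intro ln_mono) auto
      also have "\<dots> = 2 * ln x" using x1 by (simp add: ln_mult)
      finally have "\<delta> * ln (x / \<epsilon>) \<le> \<delta> * (2 * ln x)" using \<delta> by (intro mult_left_mono) auto
      also have "\<dots> \<le> \<epsilon> * \<delta>' / 2 * (2 * ln x)" using \<delta> x1 by (intro mult_right_mono) auto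
      also have "\<dots> = \<epsilon> * (\<delta>' * ln x)" by simp
      also have "\<dots> \<le> \<epsilon> * (\<Sum>a\<in>A \<inter> {1..x}. 1 / a)" using \<epsilon> x by (intro mult_left_mono) auto
      also have "\<dots> = (\<Sum>u\<in>(\<lambda>a. a / \<epsilon>) ` (A \<inter> {1..x}). 1 / u)"
        using inj by (simp add: sum.reindex sum_distrib_left)
      also have "\<dots> \<le> (\<Sum>u\<in>A' \<inter> {1..x / \<epsilon>}. 1 / u)"
      proof (rule sum_mono2)
        show "finite (A' \<inter> {1..x / \<epsilon>})"
        proof (rule finite_subset)
          show "finite (A' \<inter> {..x / \<epsilon>})" unfolding A'x by (intro finite_imageI fin)
        qed auto
        show "(\<lambda>a. a / \<epsilon>) ` (A \<inter> {1..x}) \<subseteq> A' \<inter> {1..x / \<epsilon>}"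
          using \<epsilon> by (auto simp: A'_def divide_right_mono pos_le_divide_eq)
      qed auto
      finally show "\<delta> * ln (x / \<epsilon>) \<le> (\<Sum>u\<in>A' \<inter> {1..x / \<epsilon>}. 1 / u)" .
    qed
  qed (use \<delta> in auto)
qed

end
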